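(* Let $X$ be a compact abelian group and let $T:X\to X$ be an affine linear map, $T(x)=Ax+b$, where $A$ is a (continuous) automorphism of $X$ and $b\in X$. Suppose the flow $(T,X)$ has zero (topological) entropy. Then the M\"obius function $\mu$ is linearly disjoint from $(T,X)$: for every $f\in C(X)$ and every $x\in X$, $$\frac{1}{N}\sum_{n\le N}\mu(n)f(T^n x)\to 0\quad\text{as }N\to\infty.$$
   Context: $\mu(n)$ is the M\"obius function: $\mu(n)=0$ if $n$ is not square-free and $\mu(n)=(-1)^t$ if $n$ is a product of $t$ distinct primes. A flow is a pair $(T,X)$ with $X$ a compact space and $T:X\to X$ continuous; a sequence $\xi(n)=f(T^nx)$ with $f\in C(X)$, $x\in X$ is called an observable of the flow, and $\mu$ is linearly disjoint from the flow if $\frac1N\sum_{n\le N}\mu(n)\xi(n)\to0$ for every observable $\xi$. *)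

theory Defs
  imports "HOL-Analysis.Analysis" "HOL-Computational_Algebra.Squarefree"
begin

section \<open>The Moebius function and linear disjointness\<close>

definition moebius_mu :: "nat \<Rightarrow> int" where
  "moebius_mu n = (if squarefree n then (- 1) ^ card (prime_factors n) else 0)"

text \<open>The phase space of a flow is the whole type; its observables come from complex-valued
  continuous functions.\<close>

definition observable :: "('a::topological_space \<Rightarrow> 'a) \<Rightarrow> (nat \<Rightarrow> complex) \<Rightarrow> bool" where
  "observable T \<xi> \<longleftrightarrow>
     (\<exists>f x. continuous_on UNIV f \<and> \<xi> = (\<lambda>n. f ((T ^^ n) x)))"

definition linearly_disjoint ::
    "(nat \<Rightarrow> complex) \<Rightarrow> ('a::topological_space \<Rightarrow> 'a) \<Rightarrow> bool" where
  "linearly_disjoint a T \<longleftrightarrow>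
     (\<forall>\<xi>. observable T \<xi> \<longrightarrow>
       (\<lambda>N. 1 / of_nat N * (\<Sum>n=1..N. a n * \<xi> n)) \<longlonglongrightarrow> 0)"

section \<open>Topological entropy via open covers (Adler, Konheim, McAndrew)\<close>

definition open_cover :: "'a::topological_space set set \<Rightarrow> bool" where
  "open_cover \<U> \<longleftrightarrow> (\<forall>U\<in>\<U>. open U) \<and> \<Union>\<U> = UNIV"

text \<open>On a compact space the set below is nonempty for every open cover, so the infimum of
  natural numbers is a minimum.\<close>

definition cover_number :: "'a set set \<Rightarrow> nat" where
  "cover_number \<U> = Inf {card \<V> |\<V>. \<V> \<subseteq> \<U> \<and> finite \<V> \<and> \<Union>\<V> = UNIV}"

text \<open>The common refinement of the covers \<open>T\<^sup>-\<^sup>i \<U>\<close> for \<open>i < n\<close>.\<close>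

definition iterated_join :: "('a \<Rightarrow> 'a) \<Rightarrow> 'a set set \<Rightarrow> nat \<Rightarrow> 'a set set" where
  "iterated_join T \<U> n = {(\<Inter>i<n. (T ^^ i) -` s i) |s. \<forall>i<n. s i \<in> \<U>}"

text \<open>For continuous \<open>T\<close> on a compact space, the sequence below converges by subadditivity
  of the logarithms, so the upper limit is the limit.\<close>

definition cover_entropy :: "('a \<Rightarrow> 'a) \<Rightarrow> 'a set set \<Rightarrow> ereal" where
  "cover_entropy T \<U> =
     limsup (\<lambda>n. ereal (ln (real (cover_number (iterated_join T \<U> n))) / real n))"

definition topological_entropy :: "('a::topological_space \<Rightarrow> 'a) \<Rightarrow> ereal" where
  "topological_entropy T = (SUP \<U>\<in>Collect open_cover. cover_entropy T \<U>)"

section \<open>Automorphisms of a compact group\<close>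

text \<open>Continuity of the inverse is automatic, since the group will be compact Hausdorff.\<close>

definition continuous_automorphism :: "('a::topological_ab_group_add \<Rightarrow> 'a) \<Rightarrow> bool" where
  "continuous_automorphism A \<longleftrightarrow> Modules.additive A \<and> bij A \<and> continuous_on UNIV A"

end

theory Submission
  imports Defs "HOL-Complex_Analysis.Complex_Analysis" "HOL-Computational_Algebra.Fundamental_Theorem_Algebra"
begin

text \<open>By Peter--Weyl and Stone--Weierstrass it suffices to treat \<open>f = \<kappa>\<close> a continuous character. If the
  characters \<open>\<kappa> \<circ> A\<^bsup>L j\<^esup>\<close>, \<open>j < m\<close>, satisfied no multiplicative relation with exponents in \<open>{-1, 0, 1}\<close> for
  any \<open>m\<close>, Riesz products would show that covers by preimages of short arcs have entropy at least
  \<open>ln (3/2) / L\<close>. So zero entropy gives such a relation for every \<open>L\<close>. These sparse relations force the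
  annihilator of \<open>\<kappa>\<close> in \<open>\<int>[X]\<close>, with \<open>X\<close> acting as \<open>A\<close>, to contain a polynomial \<open>(X\<^sup>N - 1)\<^sup>k\<close>. Hence
  \<open>\<kappa>(T\<^sup>n x)\<close> is a polynomial phase on each residue class modulo \<open>N\<close>, and Davenport's theorem applies: irrational
  phases are handled by the Katai criterion and Weyl's inequality, periodic ones by nonvanishing of
  Dirichlet \<open>L\<close>-functions on the line \<open>Re s = 1\<close> together with Newman's Tauberian argument.\<close>

text \<open>The entropy hypothesis enters only through \<open>signed_relation\<close>. One signed
  relation says little: it confines roots merely to the annulus 1/2 < |z| < 2. Relations along the
  multiples of every \<open>L\<close> apply the same bound to all powers of z. Torsion in the dual
  group is a further obstacle: an element of least degree in the annihilator may have nontrivial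
  content, or even be a constant, and then its roots do not decide membership.

  The Katai criterion fails for rational phases, since g(pn) times the conjugate of g(qn) is
  constant when p and q agree modulo the period of a unimodular g. That case has the strength of the
  prime number theorem in progressions and is the reason for the analytic part.

  Haar integration appears as an invariant mean of continuous functions, a uniform limit of averages
  over finite lists of translates. Peter-Weyl is then carried out on continuous functions: inner
  products come from the mean, compactness from the supremum norm.\<close>

no_notation Infinite_Set_Sum.abs_summable_on (infix "abs'_summable'_on" 50)
hide_fact (open) Infinite_Set_Sum.abs_summable_on_Sigma_iff Infinite_Set_Sum.abs_summable_on_comparison_test

section \<open>Sequences of mean zero and polynomial phases\<close>

definition null_mean :: "(nat \<Rightarrow> complex) \<Rightarrow> bool" where
  "null_mean u \<longleftrightarrow> (\<lambda>N. (\<Sum>n=1..N. u n) / of_nat N) \<longlonglongrightarrow> 0"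

lemma null_mean_iff:
  "null_mean u \<longleftrightarrow> (\<forall>\<epsilon>>0. \<forall>\<^sub>F N in sequentially. norm (\<Sum>n=1..N. u n) \<le> \<epsilon> * real N)"
proof
  assume L: "null_mean u"
  show "\<forall>\<epsilon>>0. \<forall>\<^sub>F N in sequentially. norm (\<Sum>n=1..N. u n) \<le> \<epsilon> * real N"
  proof (intro allI impI)
    fix \<epsilon> :: real assume "\<epsilon> > 0"
    with L have "\<forall>\<^sub>F N in sequentially. dist ((\<Sum>n=1..N. u n) / of_nat N) 0 < \<epsilon>"
      unfolding null_mean_def tendsto_iff by blast
    then show "\<forall>\<^sub>F N in sequentially. norm (\<Sum>n=1..N. u n) \<le> \<epsilon> * real N"
      using eventually_gt_at_top[of 0]
      by eventually_elim (simp add: norm_divide field_simps)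
  qed
next
  assume R: "\<forall>\<epsilon>>0. \<forall>\<^sub>F N in sequentially. norm (\<Sum>n=1..N. u n) \<le> \<epsilon> * real N"
  show "null_mean u"
    unfolding null_mean_def tendsto_iff
  proof (intro allI impI)
    fix \<epsilon> :: real assume \<epsilon>: "\<epsilon> > 0"
    then have "\<forall>\<^sub>F N in sequentially. norm (\<Sum>n=1..N. u n) \<le> \<epsilon> / 2 * real N"
      using R half_gt_zero by blast
    then show "\<forall>\<^sub>F N in sequentially. dist ((\<Sum>n=1..N. u n) / of_nat N) 0 < \<epsilon>"
      using eventually_gt_at_top[of 0]
    proof eventually_elim
      case (elim N)
      have "\<epsilon> / 2 * real N < \<epsilon> * real N" using \<epsilon> elim by simp
      then show ?case using elim by (simp add: norm_divide field_simps)
    qed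
  qed
qed

lemma null_meanI:
  assumes "\<And>\<epsilon>. \<epsilon> > 0 \<Longrightarrow> \<forall>\<^sub>F N in sequentially. norm (\<Sum>n=1..N. u n) \<le> \<epsilon> * real N"
  shows "null_mean u"
  using assms null_mean_iff by blast

lemma null_mean_zero [simp]: "null_mean (\<lambda>n. 0)"
  by (simp add: null_mean_def)

lemma null_mean_add: "null_mean u \<Longrightarrow> null_mean v \<Longrightarrow> null_mean (\<lambda>n. u n + v n)"
  unfolding null_mean_def
  by (drule (1) tendsto_add) (simp add: sum.distrib add_divide_distrib)

lemma null_mean_cmult: "null_mean u \<Longrightarrow> null_mean (\<lambda>n. c * u n)"
  unfolding null_mean_def
  by (drule tendsto_mult_left[where c = c]) (simp add: sum_distrib_left)

lemma null_mean_sum: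
  "(\<And>i. i \<in> I \<Longrightarrow> null_mean (u i)) \<Longrightarrow> null_mean (\<lambda>n. \<Sum>i\<in>I. u i n)"
  by (induction I rule: infinite_finite_induct) (auto intro: null_mean_add)

lemma null_mean_cnj: "null_mean u \<Longrightarrow> null_mean (\<lambda>n. cnj (u n))"
  unfolding null_mean_iff
  by (metis (mono_tags, lifting) cnj_sum complex_mod_cnj eventually_mono)

lemma null_mean_of_bounded_sums:
  assumes "\<And>N. norm (\<Sum>n=1..N. u n) \<le> B"
  shows "null_mean u"
proof (rule null_meanI)
  fix \<epsilon> :: real assume \<epsilon>: "\<epsilon> > 0"
  show "\<forall>\<^sub>F N in sequentially. norm (\<Sum>n=1..N. u n) \<le> \<epsilon> * real N"
    using eventually_ge_at_top[of "nat \<lceil>B / \<epsilon>\<rceil>"]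
  proof eventually_elim
    case (elim N)
    then have "B / \<epsilon> \<le> real N" by linarith
    then have "B \<le> \<epsilon> * real N" using \<epsilon> by (simp add: field_simps)
    then show ?case using assms[of N] by linarith
  qed
qed

text \<open>Each unit shift lets one term enter at the top and one leave at the bottom, at a cost of
  at most 2 \<open>C\<close>.\<close>

lemma sum_shift_diff:
  fixes u :: "nat \<Rightarrow> complex"
  assumes "\<And>n. norm (u n) \<le> C"
  shows "norm ((\<Sum>n=1..N. u (n + h)) - (\<Sum>n=1..N. u n)) \<le> 2 * C * real h"
proof (induction h)
  case 0
  then show ?case by simp
next
  case (Suc h)
  have "(\<Sum>n=1..N. u (n + Suc h)) - (\<Sum>n=1..N. u (n + h)) = u (Suc N + h) - u (Suc h)"
    by (induction N) (auto simp: algebra_simps)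
  moreover have "norm (u (Suc N + h) - u (Suc h)) \<le> 2 * C"
    using norm_triangle_ineq4[of "u (Suc N + h)" "u (Suc h)"] assms[of "Suc N + h"] assms[of "Suc h"]
    by linarith
  ultimately have "norm ((\<Sum>n=1..N. u (n + Suc h)) - (\<Sum>n=1..N. u (n + h))) \<le> 2 * C" by simp
  with Suc have "norm (((\<Sum>n=1..N. u (n + Suc h)) - (\<Sum>n=1..N. u (n + h)))
      + ((\<Sum>n=1..N. u (n + h)) - (\<Sum>n=1..N. u n))) \<le> 2 * C + 2 * C * real h"
    by (meson norm_triangle_mono)
  then show ?case by (simp add: algebra_simps)
qed

lemma null_mean_shift:
  assumes "null_mean u" "\<And>n. norm (u n) \<le> C"
  shows "null_mean (\<lambda>n. u (n + h))"
proof -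
  have "null_mean (\<lambda>n. u (n + h) - u n)"
    by (rule null_mean_of_bounded_sums[where B = "2 * C * real h"])
       (use sum_shift_diff[OF assms(2)] in \<open>simp add: sum_subtractf\<close>)
  from null_mean_add[OF this assms(1)] show ?thesis by simp
qed

text \<open>The shift by \<open>Q\<close> changes the sums by a bounded amount, yet it also
  multiplies them by \<open>\<omega>\<close>. Dividing by \<open>\<omega> - 1\<close> leaves a
  sequence with bounded sums.\<close>

lemma null_mean_quasi_periodic:
  assumes "\<And>n. u (n + Q) = \<omega> * u n" "\<omega> \<noteq> 1" "\<And>n. norm (u n) \<le> C"
  shows "null_mean u"
proof -
  have "null_mean (\<lambda>n. u (n + Q) - u n)"
    by (rule null_mean_of_bounded_sums[where B = "2 * C * real Q"])
       (use sum_shift_diff[OF assms(3)] in \<open>simp add: sum_subtractf\<close>)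
  then have "null_mean (\<lambda>n. (1 / (\<omega> - 1)) * (u (n + Q) - u n))"
    by (rule null_mean_cmult)
  moreover have "(1 / (\<omega> - 1)) * (u (n + Q) - u n) = u n" for n
    using assms(2) unfolding assms(1) by (simp add: field_simps)
  ultimately show ?thesis by simp
qed

lemma norm_mult_le_1:
  fixes a b :: complex
  shows "norm a \<le> 1 \<Longrightarrow> norm b \<le> 1 \<Longrightarrow> norm (a * b) \<le> 1"
  by (simp add: norm_mult mult_le_one)

lemma norm_sum_sq_le:
  fixes v :: "'i \<Rightarrow> complex"
  shows "(norm (\<Sum>n\<in>I. v n))\<^sup>2 \<le> real (card I) * (\<Sum>n\<in>I. (norm (v n))\<^sup>2)"
proof -
  have "(norm (\<Sum>n\<in>I. v n))\<^sup>2 \<le> (\<Sum>n\<in>I. 1 * norm (v n))\<^sup>2"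
    by (intro power_mono) (auto intro: norm_sum)
  also have "\<dots> \<le> (\<Sum>n\<in>I. 1\<^sup>2) * (\<Sum>n\<in>I. (norm (v n))\<^sup>2)"
    by (rule Cauchy_Schwarz_ineq_sum)
  finally show ?thesis by simp
qed

lemma norm_sum_sq_expand:
  fixes v :: "'i \<Rightarrow> complex"
  assumes "finite I"
  shows "complex_of_real ((norm (\<Sum>i\<in>I. v i))\<^sup>2)
    = of_real (\<Sum>i\<in>I. (norm (v i))\<^sup>2) + (\<Sum>i\<in>I. \<Sum>j\<in>I - {i}. v i * cnj (v j))"
proof -
  have "complex_of_real ((norm (\<Sum>i\<in>I. v i))\<^sup>2) = (\<Sum>i\<in>I. \<Sum>j\<in>I. v i * cnj (v j))"
    unfolding complex_norm_square by (simp add: sum_product)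
  also have "\<dots> = (\<Sum>i\<in>I. v i * cnj (v i) + (\<Sum>j\<in>I - {i}. v i * cnj (v j)))"
    using assms by (intro sum.cong refl) (simp add: sum.remove)
  finally show ?thesis
    by (simp add: sum.distrib complex_norm_square del: of_real_power)
qed

text \<open>Replacing \<open>u\<close> by its sum \<open>V\<close> over \<open>H\<close> consecutive
  shifts costs only boundary terms. After Cauchy-Schwarz the diagonal of |V|^2 contributes
  \<open>H\<close> per point, while the off-diagonal terms \<open>W\<close> have mean zero by
  \<open>corr\<close>.\<close>

lemma null_mean_van_der_Corput:
  assumes bd: "\<And>n. norm (u n) \<le> 1"
    and corr: "\<And>h. h \<ge> 1 \<Longrightarrow> null_mean (\<lambda>n. u (n + h) * cnj (u n))"
  shows "null_mean u"
proof (rule null_meanI)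
  fix \<epsilon> :: real assume \<epsilon>: "\<epsilon> > 0"
  \<comment> \<open>Cauchy-Schwarz bounds the sum of \<open>V\<close> by sqrt(2H) N. This is at most
    half of the target H \<open>\<epsilon>\<close> N as soon as H is at least 8 /
    \<open>\<epsilon>\<close>^2; the other half pays for the shifts.\<close>
  define H where "H = nat \<lceil>8 / \<epsilon>\<^sup>2\<rceil> + 1"
  have H: "real H \<ge> 8 / \<epsilon>\<^sup>2" "H \<ge> 1"
    unfolding H_def by linarith+
  define V where "V n = (\<Sum>h<H. u (n + h))" for n
  define W where "W n = (\<Sum>h<H. \<Sum>k\<in>{..<H} - {h}. u (n + h) * cnj (u (n + k)))" for n
  have b2: "norm (u (n + h) * cnj (u n)) \<le> 1" for n h
    using bd by (intro norm_mult_le_1) auto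
  have "null_mean (\<lambda>n. u (n + h) * cnj (u (n + k)))" if "h \<noteq> k" for h k
  proof (cases "k < h")
    case True
    from null_mean_shift[OF corr b2, of "h - k" k] True show ?thesis
      by (simp add: add.assoc)
  next
    case False
    from null_mean_cnj[OF null_mean_shift[OF corr b2, of "k - h" h]] False that show ?thesis
      by (simp add: add.assoc mult.commute)
  qed
  then have "null_mean W"
    unfolding W_def by (intro null_mean_sum) auto
  then have "\<forall>\<^sub>F N in sequentially. norm (\<Sum>n=1..N. W n) \<le> real H * real N"
    using H(2) unfolding null_mean_iff by force
  then show "\<forall>\<^sub>F N in sequentially. norm (\<Sum>n=1..N. u n) \<le> \<epsilon> * real N"
    using eventually_ge_at_top[of "nat \<lceil>4 * real H / \<epsilon>\<rceil>"]
  proof eventually_elim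
    case (elim N)
    have HN: "2 * real H \<le> \<epsilon> / 2 * real N"
    proof -
      have "4 * real H / \<epsilon> \<le> real N" using elim by linarith
      then show ?thesis using \<epsilon> by (simp add: field_simps)
    qed
    have "norm (complex_of_real (\<Sum>n=1..N. (norm (V n))\<^sup>2))
        = norm (of_real (\<Sum>n=1..N. \<Sum>h<H. (norm (u (n + h)))\<^sup>2) + (\<Sum>n=1..N. W n))"
      unfolding of_real_sum V_def W_def norm_sum_sq_expand[OF finite_lessThan] sum.distrib by simp
    also have "\<dots> \<le> norm (complex_of_real (\<Sum>n=1..N. \<Sum>h<H. (norm (u (n + h)))\<^sup>2)) + norm (\<Sum>n=1..N. W n)"
      by (rule norm_triangle_ineq)
    also have "norm (complex_of_real (\<Sum>n=1..N. \<Sum>h<H. (norm (u (n + h)))\<^sup>2)) \<le> (\<Sum>n=1..N. \<Sum>h<H. 1)"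
      unfolding norm_of_real
      by (subst abs_of_nonneg) (intro sum_nonneg zero_le_power2 sum_mono power_le_one norm_ge_zero bd)+
    finally have "(\<Sum>n=1..N. (norm (V n))\<^sup>2) \<le> real N * real H + norm (\<Sum>n=1..N. W n)"
      unfolding norm_of_real by (simp add: sum_nonneg)
    also have "\<dots> \<le> real N * real H + real H * real N" using elim by simp
    finally have V2: "(\<Sum>n=1..N. (norm (V n))\<^sup>2) \<le> 2 * real H * real N"
      by (simp add: mult_ac)
    have "(norm (\<Sum>n=1..N. V n))\<^sup>2 \<le> real N * (2 * real H * real N)"
      using norm_sum_sq_le[of V "{1..N}"] mult_left_mono[OF V2, of "real N"] by simp
    also have "\<dots> \<le> (real H * (\<epsilon> / 2) * real N)\<^sup>2"
    proof -
      have "8 \<le> real H * \<epsilon>\<^sup>2" using H \<epsilon> by (simp add: field_simps)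
      then have "8 * (real H * (real N)\<^sup>2) \<le> (real H * \<epsilon>\<^sup>2) * (real H * (real N)\<^sup>2)"
        by (intro mult_right_mono) auto
      then show ?thesis by (simp add: power2_eq_square algebra_simps)
    qed
    finally have V1: "norm (\<Sum>n=1..N. V n) \<le> real H * (\<epsilon> / 2) * real N"
      by (rule power2_le_imp_le) (use \<epsilon> in simp)
    have "norm ((\<Sum>n=1..N. V n) - of_nat H * (\<Sum>n=1..N. u n))
        = norm (\<Sum>h<H. (\<Sum>n=1..N. u (n + h)) - (\<Sum>n=1..N. u n))"
      unfolding V_def by (subst sum.swap) (simp add: sum_subtractf)
    also have "\<dots> \<le> (\<Sum>h<H. 2 * real H)"
    proof (rule sum_norm_le)
      fix h assume "h \<in> {..<H}"
      then have "2 * 1 * real h \<le> 2 * real H" by simp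
      with sum_shift_diff[where h = h and N = N, OF bd]
      show "norm ((\<Sum>n=1..N. u (n + h)) - (\<Sum>n=1..N. u n)) \<le> 2 * real H"
        by (rule order_trans)
    qed
    finally have "norm ((\<Sum>n=1..N. V n) - of_nat H * (\<Sum>n=1..N. u n)) \<le> real H * (2 * real H)"
      by simp
    then have "norm (of_nat H * (\<Sum>n=1..N. u n)) \<le> norm (\<Sum>n=1..N. V n) + real H * (2 * real H)"
      using norm_triangle_sub[of "of_nat H * (\<Sum>n=1..N. u n)" "\<Sum>n=1..N. V n"]
      by (simp add: norm_minus_commute)
    then have "real H * norm (\<Sum>n=1..N. u n) \<le> real H * (\<epsilon> / 2 * real N) + real H * (\<epsilon> / 2 * real N)"
      using V1 mult_left_mono[OF HN, of "real H"] by (simp add: norm_mult algebra_simps)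
    then have "real H * norm (\<Sum>n=1..N. u n) \<le> real H * (\<epsilon> * real N)"
      by (simp add: algebra_simps)
    then show ?case using H(2) by simp
  qed
qed

section \<open>Exponential phases and Weyl's theorem\<close>

definition expi :: "real \<Rightarrow> complex" where
  "expi x = cis (2 * pi * x)"

lemma norm_expi [simp]: "norm (expi x) = 1"
  by (simp add: expi_def)

lemma expi_add: "expi (x + y) = expi x * expi y"
  by (simp add: expi_def cis_mult distrib_left)

lemma expi_0 [simp]: "expi 0 = 1"
  by (simp add: expi_def)

lemma expi_uminus: "expi (- x) = cnj (expi x)"
  by (simp add: expi_def cis_cnj)

lemma expi_diff: "expi (x - y) = expi x * cnj (expi y)"
  using expi_add[of x "- y"] by (simp add: expi_uminus)

lemma expi_eq_1_iff: "expi x = 1 \<longleftrightarrow> x \<in> \<int>"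
proof
  assume "expi x = 1"
  then have "cos (2 * pi * x) = 1" by (simp add: expi_def complex_eq_iff)
  then obtain k :: int where "2 * pi * x = of_int k * (2 * pi)"
    using cos_one_2pi_int by auto
  then have "x = of_int k" by simp
  then show "x \<in> \<int>" by simp
next
  assume "x \<in> \<int>"
  then show "expi x = 1"
    by (auto elim!: Ints_cases simp: expi_def cis_multiple_2pi)
qed

lemma expi_power: "expi x ^ n = expi (real n * x)"
  unfolding expi_def Complex.DeMoivre by (simp add: mult_ac)

lemma ex_expi:
  assumes "norm z = 1"
  shows "\<exists>x. z = expi x"
proof
  show "z = expi (Arg z / (2 * pi))"
    using assms cis_Arg[of z] by (cases "z = 0") (auto simp add: expi_def sgn_div_norm)
qed

lemma common_denominator:
  fixes a :: "nat \<Rightarrow> real"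
  assumes "finite I" "\<And>i. i \<in> I \<Longrightarrow> a i \<in> \<rat>"
  shows "\<exists>q::nat. q > 0 \<and> (\<forall>i\<in>I. real q * a i \<in> \<int>)"
  using assms
proof (induction I rule: finite_induct)
  case empty
  then show ?case by (intro exI[of _ 1]) auto
next
  case (insert i I)
  then obtain q :: nat where q: "q > 0" "\<forall>i\<in>I. real q * a i \<in> \<int>" by auto
  have "a i \<in> \<rat>" using insert by auto
  then obtain b :: int and c :: int where c: "c > 0" "a i = of_int b / of_int c"
    by (metis Rats_cases')
  have 1: "real (q * nat c) * a k \<in> \<int>" if "k \<in> I" for k
  proof -
    have "real (q * nat c) * a k = of_int c * (real q * a k)" using c by simp
    then show ?thesis using q that by (metis Ints_mult Ints_of_int)
  qed
  have 2: "real (q * nat c) * a i = of_int (int q * b)" using c by simp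
  have "real (q * nat c) * a i \<in> \<int>" unfolding 2 by simp
  with 1 q c show ?case by (intro exI[of _ "q * nat c"]) auto
qed

lemma power_diff_Ints:
  assumes "real q * c \<in> \<int>"
  shows "c * (real (n + q) ^ i - real n ^ i) \<in> \<int>"
proof -
  have "real (n + q) ^ i - real n ^ i = real q * (\<Sum>k<i. real (n + q) ^ k * real n ^ (i - Suc k))"
    using power_diff_sumr2[of "real (n + q)" i "real n"] by (simp add: mult.commute)
  then have "c * (real (n + q) ^ i - real n ^ i)
      = (real q * c) * (\<Sum>k<i. real (n + q) ^ k * real n ^ (i - Suc k))"
    by simp
  also have "\<dots> \<in> \<int>"
    by (intro Ints_mult[OF assms] Ints_sum) auto
  finally show ?thesis .
qed

text \<open>The induction runs over the position \<open>j\<close> of the highest irrational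
  coefficient rather than over the degree. Differencing by \<open>h\<close> turns the coefficient at
  j into (j+1) h a(j+1) plus a rational number and keeps the higher ones rational, so
  \<open>j\<close> drops by one. For j = 1 a common denominator q of the coefficients from 2 on
  makes the shift by q multiply the sequence by the constant expi(q a(1)), which is not 1.\<close>

lemma weyl_null_mean:
  fixes a :: "nat \<Rightarrow> real"
  assumes "1 \<le> j" "j \<le> d" "a j \<notin> \<rat>" "\<And>i. j < i \<Longrightarrow> i \<le> d \<Longrightarrow> a i \<in> \<rat>"
  shows "null_mean (\<lambda>n. expi (\<Sum>i\<le>d. a i * real n ^ i))"
  using assms
proof (induction j arbitrary: a rule: dec_induct)
  case base
  have "\<exists>q::nat. q > 0 \<and> (\<forall>i\<in>{2..d}. real q * a i \<in> \<int>)"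
    by (rule common_denominator) (use base in auto)
  then obtain q :: nat where q: "q > 0" "\<And>i. i \<in> {2..d} \<Longrightarrow> real q * a i \<in> \<int>" by blast
  show ?case
  proof (rule null_mean_quasi_periodic[where Q = q and \<omega> = "expi (real q * a 1)" and C = 1])
    show "expi (real q * a 1) \<noteq> 1"
    proof
      assume "expi (real q * a 1) = 1"
      then have "real q * a 1 \<in> \<rat>" using expi_eq_1_iff Ints_subset_Rats by blast
      then have "(real q * a 1) / real q \<in> \<rat>" by (intro Rats_divide) auto
      then show False using base q by simp
    qed
  next
    fix n
    have "(\<Sum>i\<le>d. a i * real (n + q) ^ i) - (\<Sum>i\<le>d. a i * real n ^ i) - real q * a 1
        = (\<Sum>i\<le>d. a i * (real (n + q) ^ i - real n ^ i) - (if i = 1 then real q * a 1 else 0))"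
      using base by (simp add: sum_subtractf right_diff_distrib)
    also have "\<dots> \<in> \<int>"
    proof (rule Ints_sum)
      fix i assume i: "i \<in> {..d}"
      consider "i = 0" | "i = 1" | "i \<ge> 2" by linarith
      then show "a i * (real (n + q) ^ i - real n ^ i) - (if i = 1 then real q * a 1 else 0) \<in> \<int>"
      proof cases
        case 3
        then have "a i * (real (n + q) ^ i - real n ^ i) \<in> \<int>"
          using i by (intro power_diff_Ints q) auto
        then show ?thesis using 3 by simp
      qed (auto simp: algebra_simps)
    qed
    finally have "expi ((\<Sum>i\<le>d. a i * real (n + q) ^ i) - (\<Sum>i\<le>d. a i * real n ^ i) - real q * a 1) = 1"
      using expi_eq_1_iff by blast
    moreover have "(\<Sum>i\<le>d. a i * real (n + q) ^ i) = ((\<Sum>i\<le>d. a i * real (n + q) ^ i)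
      - (\<Sum>i\<le>d. a i * real n ^ i) - real q * a 1) + real q * a 1 + (\<Sum>i\<le>d. a i * real n ^ i)"
      by simp
    ultimately show "expi (\<Sum>i\<le>d. a i * real (n + q) ^ i) = expi (real q * a 1) * expi (\<Sum>i\<le>d. a i * real n ^ i)"
      using expi_add[of "(\<Sum>i\<le>d. a i * real (n + q) ^ i) - (\<Sum>i\<le>d. a i * real n ^ i) - real q * a 1"
          "real q * a 1 + (\<Sum>i\<le>d. a i * real n ^ i)"]
        expi_add[of "real q * a 1" "\<Sum>i\<le>d. a i * real n ^ i"]
      by (simp only: add.assoc mult_1)
  qed simp
next
  case (step j)
  show ?case
  proof (rule null_mean_van_der_Corput)
    fix h :: nat assume h: "h \<ge> 1"
    define b where "b k = (\<Sum>i\<in>{k<..d}. a i * real (i choose k) * real h ^ (i - k))" for k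
    have binom: "real (n + h) ^ i - real n ^ i = (\<Sum>k<i. real (i choose k) * real n ^ k * real h ^ (i - k))" for n i
      unfolding of_nat_add binomial_ring by (simp add: lessThan_Suc_atMost[symmetric])
    have "(\<Sum>i\<le>d. a i * real (n + h) ^ i) - (\<Sum>i\<le>d. a i * real n ^ i) = (\<Sum>k\<le>d. b k * real n ^ k)" for n
    proof -
      have "(\<Sum>i\<le>d. a i * real (n + h) ^ i) - (\<Sum>i\<le>d. a i * real n ^ i)
          = (\<Sum>i\<le>d. \<Sum>k<i. a i * (real (i choose k) * real n ^ k * real h ^ (i - k)))"
        by (simp add: sum_subtractf[symmetric] right_diff_distrib[symmetric] binom sum_distrib_left
            del: of_nat_add)
      also have "\<dots> = (\<Sum>(i,k)\<in>(SIGMA i:{..d}. {..<i}). a i * (real (i choose k) * real n ^ k * real h ^ (i - k)))"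
        by (simp add: sum.Sigma)
      also have "\<dots> = (\<Sum>(k,i)\<in>(SIGMA k:{..d}. {k<..d}). a i * (real (i choose k) * real n ^ k * real h ^ (i - k)))"
        by (rule sum.reindex_bij_witness[where i = prod.swap and j = prod.swap]) auto
      also have "\<dots> = (\<Sum>k\<le>d. b k * real n ^ k)"
        by (simp add: sum.Sigma[symmetric] b_def sum_distrib_right sum_distrib_left mult_ac)
      finally show ?thesis .
    qed
    moreover have "null_mean (\<lambda>n. expi (\<Sum>k\<le>d. b k * real n ^ k))"
    proof (rule step.IH)
      show "j \<le> d" using step by simp
      have eq: "{j<..d} = insert (Suc j) {Suc j<..d}" using step by auto
      have "b j = a (Suc j) * real (Suc j) * real h
            + (\<Sum>i\<in>{Suc j<..d}. a i * real (i choose j) * real h ^ (i - j))"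
        unfolding b_def eq by (simp del: of_nat_Suc)
      moreover have r: "(\<Sum>i\<in>{Suc j<..d}. a i * real (i choose j) * real h ^ (i - j)) \<in> \<rat>"
        using step by (intro Rats_sum Rats_mult) auto
      moreover have "a (Suc j) * real (Suc j) * real h \<notin> \<rat>"
      proof
        assume "a (Suc j) * real (Suc j) * real h \<in> \<rat>"
        then have "(a (Suc j) * real (Suc j) * real h) / (real (Suc j) * real h) \<in> \<rat>"
          by (intro Rats_divide) auto
        then show False using step h by simp
      qed
      ultimately show "b j \<notin> \<rat>"
        by (metis Rats_diff add_diff_cancel_right')
    next
      fix i assume "j < i" "i \<le> d"
      then show "b i \<in> \<rat>"
        unfolding b_def using step by (intro Rats_sum Rats_mult) auto
    qed
    ultimately show "null_mean (\<lambda>n. expi (\<Sum>i\<le>d. a i * real (n + h) ^ i) * cnj (expi (\<Sum>i\<le>d. a i * real n ^ i)))"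
      by (simp flip: expi_diff)
  qed simp
qed

section \<open>The criterion of Daboussi and Katai\<close>

lemma card_multiples_atMost:
  assumes "d > 0"
  shows "card {n\<in>{1..N}. d dvd n} = N div d"
proof -
  have "{n\<in>{1..N}. d dvd n} = (\<lambda>m. d * m) ` {1..N div d}"
  proof (intro set_eqI iffI)
    fix n assume "n \<in> {n\<in>{1..N}. d dvd n}"
    then obtain m where "n = d * m" "1 \<le> n" "n \<le> N" by auto
    moreover from this have "m \<in> {1..N div d}"
      using assms by (cases m) (auto simp: less_eq_div_iff_mult_less_eq mult.commute)
    ultimately show "n \<in> (\<lambda>m. d * m) ` {1..N div d}" by blast
  next
    fix n assume "n \<in> (\<lambda>m. d * m) ` {1..N div d}"
    then show "n \<in> {n\<in>{1..N}. d dvd n}"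
      using assms by (auto simp: less_eq_div_iff_mult_less_eq mult.commute)
  qed
  moreover have "inj_on (\<lambda>m. d * m) {1..N div d}" using assms by (auto simp: inj_on_def)
  ultimately show ?thesis by (simp add: card_image)
qed

lemma sum_multiples:
  fixes f :: "nat \<Rightarrow> 'b::comm_monoid_add"
  assumes "d > 0"
  shows "(\<Sum>n\<in>{n\<in>{1..N}. d dvd n}. f n) = (\<Sum>m=1..N div d. f (d * m))"
  by (rule sum.reindex_bij_witness[where i = "\<lambda>m. d * m" and j = "\<lambda>n. n div d"])
     (use assms in \<open>auto simp: less_eq_div_iff_mult_less_eq mult.commute dvd_div_mult_self
        div_le_mono Suc_le_eq intro!: div_greater_zero_iff[THEN iffD2] dest: dvd_imp_le\<close>)

text \<open>Erdos: if the primes outside a finite set \<open>Q\<close> had reciprocal sum below \<open>1/2\<close>, then at least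
  half of the numbers up to \<open>N\<close> would be \<open>s m\<^sup>2\<close> with \<open>s\<close> a product of distinct elements of \<open>Q\<close>.\<close>

lemma prime_reciprocals_unbounded:
  fixes B :: real
  shows "\<exists>P. finite P \<and> (\<forall>p\<in>P. prime (p::nat)) \<and> (\<Sum>p\<in>P. 1 / real p) > B"
proof (rule ccontr)
  assume "\<not> ?thesis"
  then have bd: "(\<Sum>p\<in>P. 1 / real p) \<le> B" if "finite P" "\<forall>p\<in>P. prime (p::nat)" for P
    using that not_less by blast
  define X where "X = {(\<Sum>p\<in>P. 1 / real p) |P. finite P \<and> (\<forall>p\<in>P. prime (p::nat))}"
  have ne: "X \<noteq> {}" unfolding X_def by (auto intro: exI[of _ "{}"])
  have bdd: "bdd_above X" unfolding X_def using bd by (auto intro!: bdd_aboveI[of _ B])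
  have "Sup X - 1/2 < Sup X" by simp
  then obtain x where "x \<in> X" "Sup X - 1/2 < x" using less_cSup_iff[OF ne bdd] by blast
  then obtain Q where Q: "finite Q" "\<forall>p\<in>Q. prime (p::nat)" "Sup X - 1/2 < (\<Sum>p\<in>Q. 1 / real p)"
    unfolding X_def by blast
  have half: "(\<Sum>p\<in>P. 1 / real p) < 1/2"
    if "finite P" "\<forall>p\<in>P. prime (p::nat)" "P \<inter> Q = {}" for P
  proof -
    have "(\<Sum>p\<in>P \<union> Q. 1 / real p) \<in> X" unfolding X_def using that Q by blast
    then have "(\<Sum>p\<in>P \<union> Q. 1 / real p) \<le> Sup X" using bdd by (rule cSup_upper)
    then show ?thesis using sum.union_disjoint[of P Q "\<lambda>p. 1 / real p"] that Q by simp
  qed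
  \<comment> \<open>With this N a square part is at most sqrt N = 2^(|Q|+1), and there are 2^|Q|
    candidates for the squarefree part. So \<open>S\<close> has at most N/2 elements, against the
    strict lower bound N/2.\<close>
  define N :: nat where "N = 4 ^ (card Q + 1)"
  define P where "P = {p\<in>{1..N}. prime p \<and> p \<notin> Q}"
  define S where "S = {n\<in>{1..N}. prime_factors n \<subseteq> Q}"
  define R where "R p = {n\<in>{1..N}. p dvd n}" for p
  have "{1..N} \<subseteq> S \<union> (\<Union>p\<in>P. R p)"
  proof
    fix n assume n: "n \<in> {1..N}"
    show "n \<in> S \<union> (\<Union>p\<in>P. R p)"
    proof (cases "prime_factors n \<subseteq> Q")
      case True
      then show ?thesis using n by (simp add: S_def)
    next
      case False
      then obtain p where p: "p \<in> prime_factors n" "p \<notin> Q" by blast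
      then have "prime p" "p dvd n" by auto
      moreover from this n have "p \<le> n" "p \<ge> 1"
        using dvd_imp_le[of p n] prime_ge_1_nat[of p] by auto
      ultimately have "p \<in> P" "n \<in> R p" using n p by (auto simp: P_def R_def)
      then show ?thesis by blast
    qed
  qed
  then have "card {1..N} \<le> card (S \<union> (\<Union>p\<in>P. R p))"
    by (intro card_mono) (auto simp: S_def P_def R_def)
  also have "\<dots> \<le> card S + (\<Sum>p\<in>P. card (R p))"
  proof -
    have "finite P" by (simp add: P_def)
    then show ?thesis
      using card_Un_le[of S "\<Union>(R ` P)"] card_UN_le[of P R] by linarith
  qed
  finally have "real (card {1..N}) \<le> real (card S + (\<Sum>p\<in>P. card (R p)))"
    unfolding of_nat_le_iff .
  then have "real N \<le> real (card S) + (\<Sum>p\<in>P. real (card (R p)))"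
    by simp
  also have "(\<Sum>p\<in>P. real (card (R p))) \<le> (\<Sum>p\<in>P. real N * (1 / real p))"
  proof (rule sum_mono)
    fix p assume "p \<in> P"
    then have "p > 0" by (auto simp: P_def)
    then show "real (card (R p)) \<le> real N * (1 / real p)"
      unfolding R_def card_multiples_atMost[OF \<open>p > 0\<close>]
      using of_nat_div_le_of_nat[where 'a = real, of N p] by simp
  qed
  also have "\<dots> = real N * (\<Sum>p\<in>P. 1 / real p)" by (simp add: sum_distrib_left)
  also have "\<dots> < real N * (1/2)"
  proof (rule mult_strict_left_mono)
    show "(\<Sum>p\<in>P. 1 / real p) < 1/2" by (rule half) (auto simp: P_def)
    show "real N > 0" by (simp add: N_def)
  qed
  finally have S1: "real N < 2 * real (card S)" by simp
  have "S \<subseteq> (\<lambda>(T, m). \<Prod>T * m\<^sup>2) ` (Pow Q \<times> {1..2 ^ (card Q + 1)})"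
  proof
    fix n assume "n \<in> S"
    then have n: "n \<ge> 1" "n \<le> N" "prime_factors n \<subseteq> Q" by (auto simp: S_def)
    let ?s = "squarefree_part n" and ?m = "square_part n"
    have dec: "n = ?s * ?m\<^sup>2" by (metis squarefree_decompose)
    have nz: "?s \<noteq> 0" "?m \<noteq> 0" using n dec by (metis mult_zero_left mult_zero_right not_one_le_zero zero_power2)+
    have sq: "squarefree ?s" using squarefree_squarefree_part n by auto
    have "prime_factors ?s \<subseteq> prime_factors n"
      using n dec by (intro dvd_prime_factors) (auto, metis dvd_triv_left)
    then have 1: "prime_factors ?s \<in> Pow Q" using n by auto
    have "?s = (\<Prod>p\<in>prime_factors ?s. p ^ multiplicity p ?s)"
      using prime_factorization_nat[of ?s] nz by simp
    also have "\<dots> = \<Prod>(prime_factors ?s)"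
      using squarefree_factorial_semiring'[OF nz(1)] sq by (intro prod.cong refl) simp
    finally have 2: "?s = \<Prod>(prime_factors ?s)" .
    have "?m\<^sup>2 \<le> n" using dec nz by (metis dvd_imp_le dvd_triv_right n(1) not_one_le_zero gr0I)
    also have "\<dots> \<le> (2 ^ (card Q + 1))\<^sup>2"
      using n(2) unfolding N_def by (simp add: power_mult[symmetric] mult.commute power_mult power2_eq_square power_mult_distrib[symmetric])
    finally have "?m \<le> 2 ^ (card Q + 1)" using power2_nat_le_eq_le by blast
    then have 3: "?m \<in> {1..2 ^ (card Q + 1)}" using nz by (simp del: square_part_0_iff add: Suc_le_eq)
    have "n = (\<lambda>(T, m). \<Prod>T * m\<^sup>2) (prime_factors ?s, ?m)" using dec 2 by simp
    with 1 3 show "n \<in> (\<lambda>(T, m). \<Prod>T * m\<^sup>2) ` (Pow Q \<times> {1..2 ^ (card Q + 1)})"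
      by blast
  qed
  then have "card S \<le> card (Pow Q \<times> {1..2 ^ (card Q + 1) :: nat})"
    using Q by (intro surj_card_le) auto
  also have "\<dots> = 2 ^ card Q * 2 ^ (card Q + 1)" using Q by (simp add: card_Pow card_cartesian_product)
  finally have "2 * card S \<le> 2 ^ (card Q + 1) * 2 ^ (card Q + 1)" by simp
  also have "\<dots> = N" unfolding N_def by (simp flip: power_mult_distrib)
  finally show False using S1 by linarith
qed

lemma sum_swap3:
  "(\<Sum>n\<in>A. \<Sum>p\<in>B. \<Sum>q\<in>C p. f n p q) = (\<Sum>p\<in>B. \<Sum>q\<in>C p. \<Sum>n\<in>A. f n p q)"
proof -
  have "(\<Sum>n\<in>A. \<Sum>p\<in>B. \<Sum>q\<in>C p. f n p q) = (\<Sum>p\<in>B. \<Sum>n\<in>A. \<Sum>q\<in>C p. f n p q)"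
    by (rule sum.swap)
  also have "\<dots> = (\<Sum>p\<in>B. \<Sum>q\<in>C p. \<Sum>n\<in>A. f n p q)"
    by (intro sum.cong refl sum.swap)
  finally show ?thesis .
qed

text \<open>Second moment computation. Distinct primes are coprime, so divisibility by both is
  divisibility by the product, and rounding down only helps in the upper bound for the squares.
  Rounding hurts in the lower bound for the linear term, where it costs 1 per prime; this produces
  the summand 2 A |P|.\<close>

lemma turan_kubilius:
  fixes P :: "nat set"
  assumes P: "finite P" "\<And>p. p \<in> P \<Longrightarrow> prime p"
  defines "A \<equiv> \<Sum>p\<in>P. 1 / real p"
  shows "(\<Sum>n=1..N. (real (card {p\<in>P. p dvd n}) - A)\<^sup>2) \<le> real N * A + 2 * A * real (card P)"
proof -
  define I where "I p n = (if p dvd n then 1 else 0 :: real)" for p n :: nat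
  have om: "real (card {p\<in>P. p dvd n}) = (\<Sum>p\<in>P. I p n)" for n
    unfolding I_def using P by (simp add: sum.If_cases Int_def conj_commute)
  have A0: "A \<ge> 0" unfolding A_def by (simp add: sum_nonneg)
  have cnt: "(\<Sum>n=1..N. I d n) = real (N div d)" if "d > 0" for d
    using card_multiples_atMost[OF that, of N] unfolding I_def
    by (simp add: sum.If_cases Int_def conj_commute)
  have pair: "(\<Sum>n=1..N. I p n * I q n) \<le> real N * (1 / real p) * (1 / real q) + (if p = q then real N * (1 / real p) else 0)"
    if "p \<in> P" "q \<in> P" for p q
  proof (cases "p = q")
    case True
    have "(\<Sum>n=1..N. I p n * I q n) = (\<Sum>n=1..N. I p n)" using True by (intro sum.cong) (auto simp: I_def)
    also have "\<dots> \<le> real N * (1 / real p)"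
      using cnt[of p] of_nat_div_le_of_nat[where 'a = real, of N p] P(2)[OF that(1)] by (simp add: prime_gt_0_nat)
    also have "\<dots> \<le> real N * (1 / real p) * (1 / real q) + real N * (1 / real p)" by simp
    finally show ?thesis by (simp only: True refl if_True)
  next
    case False
    have "coprime p q" using False P that primes_coprime by blast
    then have "I p n * I q n = I (p * q) n" for n
      unfolding I_def by (auto intro: divides_mult dest: dvd_mult_left dvd_mult_right)
    then have "(\<Sum>n=1..N. I p n * I q n) = real (N div (p * q))"
      using cnt[of "p * q"] P(2)[OF that(1)] P(2)[OF that(2)] by (simp add: prime_gt_0_nat)
    also have "\<dots> \<le> real N / real (p * q)" using of_nat_div_le_of_nat by blast
    finally show ?thesis using False by simp
  qed
  have sq: "(\<Sum>n=1..N. (\<Sum>p\<in>P. I p n)\<^sup>2) \<le> real N * A\<^sup>2 + real N * A"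
  proof -
    have "(\<Sum>n=1..N. (\<Sum>p\<in>P. I p n)\<^sup>2) = (\<Sum>n=1..N. \<Sum>p\<in>P. \<Sum>q\<in>P. I p n * I q n)"
      by (simp add: power2_eq_square sum_product)
    also have "\<dots> = (\<Sum>p\<in>P. \<Sum>q\<in>P. \<Sum>n=1..N. I p n * I q n)"
      by (rule sum_swap3)
    also have "\<dots> \<le> (\<Sum>p\<in>P. \<Sum>q\<in>P. real N * (1 / real p) * (1 / real q) + (if p = q then real N * (1 / real p) else 0))"
      by (intro sum_mono pair)
    also have "\<dots> = real N * A\<^sup>2 + real N * A"
      unfolding A_def using P by (simp add: sum.distrib power2_eq_square sum_product sum_distrib_left mult_ac)
    finally show ?thesis .
  qed
  have lin: "(\<Sum>n=1..N. \<Sum>p\<in>P. I p n) \<ge> real N * A - real (card P)"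
  proof -
    have "real N * A - real (card P) = (\<Sum>p\<in>P. real N * (1 / real p) - 1)"
      unfolding A_def by (simp add: sum_subtractf sum_distrib_left)
    also have "\<dots> \<le> (\<Sum>p\<in>P. \<Sum>n=1..N. I p n)"
    proof (rule sum_mono)
      fix p assume "p \<in> P"
      then have p: "p > 0" using P prime_gt_0_nat by blast
      have "real (N mod p) / real p \<le> 1" using p by (simp add: less_imp_le)
      then have "real N / real p - real (N div p) \<le> 1"
        using of_nat_of_nat_div_aux[where 'a = real, of N p] by linarith
      then show "real N * (1 / real p) - 1 \<le> (\<Sum>n=1..N. I p n)" using cnt[OF p] by simp
    qed
    also have "\<dots> = (\<Sum>n=1..N. \<Sum>p\<in>P. I p n)" by (rule sum.swap)
    finally show ?thesis .
  qed
  have "(\<Sum>n=1..N. (real (card {p\<in>P. p dvd n}) - A)\<^sup>2)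
      = (\<Sum>n=1..N. (\<Sum>p\<in>P. I p n)\<^sup>2) - 2 * A * (\<Sum>n=1..N. \<Sum>p\<in>P. I p n) + real N * A\<^sup>2"
    unfolding om power2_diff by (simp add: sum.distrib sum_subtractf sum_distrib_left mult_ac)
  also have "\<dots> \<le> (real N * A\<^sup>2 + real N * A) - 2 * A * (real N * A - real (card P)) + real N * A\<^sup>2"
    using sq mult_left_mono[OF lin, of "2 * A"] A0 by linarith
  also have "\<dots> = real N * A + 2 * A * real (card P)" by (simp add: power2_eq_square algebra_simps)
  finally show ?thesis .
qed

text \<open>The bound is uniform in \<open>P\<close>. In \<open>katai_criterion\<close> it keeps the
  defect of complete multiplicativity bounded while the sum of reciprocals is made large.\<close>

lemma sum_prime_reciprocal_squares_bounded:
  obtains K :: real where "K > 0" "\<And>P. finite P \<Longrightarrow> (\<Sum>p\<in>P. 1 / real p ^ 2) \<le> K"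
proof
  have s: "summable (\<lambda>n. 1 / real n ^ 2)"
    using inverse_power_summable[of 2, where 'a = real] by (simp add: inverse_eq_divide)
  show "suminf (\<lambda>n. 1 / real n ^ 2) + 1 > 0"
    by (intro add_nonneg_pos suminf_nonneg s) auto
  show "(\<Sum>p\<in>P. 1 / real p ^ 2) \<le> suminf (\<lambda>n. 1 / real n ^ 2) + 1" if "finite P" for P
  proof -
    have "(\<Sum>p\<in>P. 1 / real p ^ 2) \<le> suminf (\<lambda>n. 1 / real n ^ 2)"
      by (rule sum_le_suminf[OF s that]) simp
    then show ?thesis by linarith
  qed
qed

text \<open>The sum is weighted by the number \<open>\<omega>\<close> n of prime divisors in
  \<open>P\<close>, which is close to the constant \<open>A\<close> on average. Writing n = p m
  splits f n into f p and f m up to a bounded error; Cauchy-Schwarz over m then discards f m and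
  leaves the correlations of g. Every error is O(N sqrt A), whereas the weight gained is A.\<close>

theorem katai_criterion:
  fixes f g :: "nat \<Rightarrow> complex"
  assumes mult: "\<And>m n. coprime m n \<Longrightarrow> f (m * n) = f m * f n"
    and f1: "\<And>n. norm (f n) \<le> 1" and g1: "\<And>n. norm (g n) \<le> 1"
    and corr: "\<And>p q. prime p \<Longrightarrow> prime q \<Longrightarrow> p \<noteq> q \<Longrightarrow> null_mean (\<lambda>n. g (p * n) * cnj (g (q * n)))"
  shows "null_mean (\<lambda>n. f n * g n)"
proof (rule null_meanI)
  fix \<epsilon> :: real assume \<epsilon>: "\<epsilon> > 0"
  obtain K :: real where K: "K > 0" "\<And>P. finite P \<Longrightarrow> (\<Sum>p\<in>P. 1 / real p ^ 2) \<le> K"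
    using sum_prime_reciprocal_squares_bounded by blast
  \<comment> \<open>The three errors add up to N (2 sqrt(2A) + 2K). Since A > 1 this is at most N (2
    sqrt 2 + 2K) sqrt A, and the lower bound on A makes that at most \<open>\<epsilon>\<close> A
    N.\<close>
  obtain P where P: "finite P" "\<And>p. p \<in> P \<Longrightarrow> prime (p::nat)"
      and big: "(\<Sum>p\<in>P. 1 / real p) > max 1 (((2 * sqrt 2 + 2 * K) / \<epsilon>)\<^sup>2)"
    using prime_reciprocals_unbounded[of "max 1 (((2 * sqrt 2 + 2 * K) / \<epsilon>)\<^sup>2)"] by blast
  define A where "A = (\<Sum>p\<in>P. 1 / real p)"
  have A: "A > 1" "A > ((2 * sqrt 2 + 2 * K) / \<epsilon>)\<^sup>2" using big by (auto simp: A_def)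
  have p0: "p > 0" if "p \<in> P" for p using P(2)[OF that] prime_gt_0_nat by blast
  \<comment> \<open>There are fewer than |P|^2 off-diagonal pairs, so this tolerance makes them
    contribute at most A N together, as much as the diagonal.\<close>
  have ev1: "\<forall>\<^sub>F N in sequentially. \<forall>p\<in>P. \<forall>q\<in>P - {p}.
      norm (\<Sum>m=1..N div max p q. g (p * m) * cnj (g (q * m))) \<le> A / real (card P) ^ 2 * real (N div max p q)"
  proof (intro eventually_ball_finite ballI)
    fix p q assume pq: "p \<in> P" "q \<in> P - {p}"
    have "null_mean (\<lambda>n. g (p * n) * cnj (g (q * n)))" using corr P pq by auto
    moreover have "card P > 0" using P pq by (auto simp: card_gt_0_iff)
    then have "A / real (card P) ^ 2 > 0" using A by simp
    ultimately have "\<forall>\<^sub>F N in sequentially. norm (\<Sum>m=1..N. g (p * m) * cnj (g (q * m))) \<le> A / real (card P) ^ 2 * real N"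
      unfolding null_mean_iff by blast
    moreover have "filterlim (\<lambda>N. N div max p q) at_top sequentially"
      using p0 pq by (intro filterlim_at_top_div_const_nat) (auto simp: max_def)
    ultimately show "\<forall>\<^sub>F N in sequentially.
      norm (\<Sum>m=1..N div max p q. g (p * m) * cnj (g (q * m))) \<le> A / real (card P) ^ 2 * real (N div max p q)"
      by (rule eventually_compose_filterlim)
  qed (use P in auto)
  show "\<forall>\<^sub>F N in sequentially. norm (\<Sum>n=1..N. f n * g n) \<le> \<epsilon> * real N"
    using ev1 eventually_ge_at_top[of "2 * card P"]
  proof eventually_elim
    case (elim N)
    define \<omega> where "\<omega> n = real (card {p\<in>P. p dvd n})" for n
    define S where "S = (\<Sum>n=1..N. f n * g n)"
    define D1 where "D1 = (\<Sum>n=1..N. f n * g n * of_real (\<omega> n))"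
    define D where "D = (\<Sum>m=1..N. f m * (\<Sum>p\<in>{p\<in>P. p * m \<le> N}. f p * g (p * m)))"
    have fg: "norm (f n * g n') \<le> 1" for n n'
      using f1 g1 by (intro norm_mult_le_1) auto
    have step1: "norm (D1 - of_real A * S) \<le> real N * sqrt (2 * A)"
    proof -
      have "norm (D1 - of_real A * S) = norm (\<Sum>n=1..N. f n * g n * of_real (\<omega> n - A))"
        unfolding D1_def S_def by (simp add: sum_distrib_left sum_subtractf algebra_simps)
      also have "\<dots> \<le> sqrt (real N * (real N * (2 * A)))"
      proof (rule real_le_rsqrt)
        have "(norm (\<Sum>n=1..N. f n * g n * of_real (\<omega> n - A)))\<^sup>2
            \<le> real (card {1..N}) * (\<Sum>n=1..N. (norm (f n * g n * of_real (\<omega> n - A)))\<^sup>2)"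
          by (rule norm_sum_sq_le)
        also have "\<dots> \<le> real (card {1..N}) * (\<Sum>n=1..N. (\<omega> n - A)\<^sup>2)"
        proof (intro mult_left_mono sum_mono)
          fix n
          have "norm (f n * g n * of_real (\<omega> n - A)) \<le> 1 * \<bar>\<omega> n - A\<bar>"
            unfolding norm_mult[of "f n * g n"] norm_of_real using fg by (intro mult_right_mono) auto
          then have "(norm (f n * g n * of_real (\<omega> n - A)))\<^sup>2 \<le> (\<bar>\<omega> n - A\<bar>)\<^sup>2"
            by (intro power_mono) auto
          then show "(norm (f n * g n * of_real (\<omega> n - A)))\<^sup>2 \<le> (\<omega> n - A)\<^sup>2" by simp
        qed simp
        also have "\<dots> \<le> real N * (real N * A + 2 * A * real (card P))"
          using turan_kubilius[OF P, of N] unfolding \<omega>_def A_def by (simp add: mult_left_mono)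
        also have "\<dots> \<le> real N * (real N * (2 * A))"
        proof (rule mult_left_mono)
          have "2 * real (card P) * A \<le> real N * A" using elim A by (intro mult_right_mono) auto
          then show "real N * A + 2 * A * real (card P) \<le> real N * (2 * A)" by (simp add: algebra_simps)
        qed simp
        finally show "(norm (\<Sum>n=1..N. f n * g n * of_real (\<omega> n - A)))\<^sup>2 \<le> real N * (real N * (2 * A))" .
      qed
      also have "\<dots> = real N * sqrt (2 * A)" by (simp add: real_sqrt_mult)
      finally show ?thesis .
    qed
    \<comment> \<open>The two sums differ only at pairs with p dividing m, where f (p m) need not be
      f p f m. For each p there are at most N / p^2 such m, each costing at most 2.\<close>
    have step2: "norm (D1 - D) \<le> 2 * K * real N"
    proof -
      have "D1 = (\<Sum>n=1..N. \<Sum>p\<in>P. if p dvd n then f n * g n else 0)"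
        unfolding D1_def \<omega>_def using P
        by (intro sum.cong refl) (simp add: sum.If_cases Int_def conj_commute mult.commute)
      also have "\<dots> = (\<Sum>p\<in>P. \<Sum>n\<in>{n\<in>{1..N}. p dvd n}. f n * g n)"
        by (subst sum.swap) (rule sum.cong[OF refl], rule sum.inter_filter[symmetric], simp)
      also have "\<dots> = (\<Sum>p\<in>P. \<Sum>m=1..N div p. f (p * m) * g (p * m))"
        by (rule sum.cong[OF refl], rule sum_multiples, rule p0)
      finally have D1': "D1 = (\<Sum>p\<in>P. \<Sum>m=1..N div p. f (p * m) * g (p * m))" .
      have "D = (\<Sum>m=1..N. \<Sum>p\<in>P. if p * m \<le> N then f m * (f p * g (p * m)) else 0)"
        unfolding D_def sum.inter_filter[OF P(1)] sum_distrib_left by (intro sum.cong refl) simp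
      also have "\<dots> = (\<Sum>p\<in>P. \<Sum>m\<in>{m\<in>{1..N}. p * m \<le> N}. f m * (f p * g (p * m)))"
        by (subst sum.swap) (rule sum.cong[OF refl], rule sum.inter_filter[symmetric], simp)
      also have "\<dots> = (\<Sum>p\<in>P. \<Sum>m=1..N div p. f m * (f p * g (p * m)))"
      proof (intro sum.cong refl)
        fix p assume "p \<in> P"
        from p0[OF this] show "{m\<in>{1..N}. p * m \<le> N} = {1..N div p}"
          by (auto simp: less_eq_div_iff_mult_less_eq mult.commute intro: order_trans[rotated])
      qed
      finally have D': "D = (\<Sum>p\<in>P. \<Sum>m=1..N div p. f m * (f p * g (p * m)))" .
      have "norm (D1 - D) = norm (\<Sum>p\<in>P. \<Sum>m=1..N div p. (f (p * m) - f p * f m) * g (p * m))"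
        unfolding D1' D' by (simp add: sum_subtractf algebra_simps)
      also have "\<dots> \<le> (\<Sum>p\<in>P. 2 * real N * (1 / real p ^ 2))"
      proof (rule sum_norm_le)
        fix p assume p: "p \<in> P"
        have "norm (\<Sum>m=1..N div p. (f (p * m) - f p * f m) * g (p * m))
            \<le> (\<Sum>m=1..N div p. if p dvd m then 2 else 0)"
        proof (rule sum_norm_le)
          fix m
          show "norm ((f (p * m) - f p * f m) * g (p * m)) \<le> (if p dvd m then 2 else 0)"
          proof (cases "p dvd m")
            case True
            have "norm (f (p * m) - f p * f m) \<le> 1 + 1"
              using norm_triangle_ineq4[of "f (p * m)" "f p * f m"] f1[of "p * m"]
                norm_mult_le_1[OF f1 f1, of p m] by linarith
            then have "norm (f (p * m) - f p * f m) * norm (g (p * m)) \<le> (1 + 1) * 1"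
              using g1 by (intro mult_mono) auto
            then show ?thesis using True by (simp add: norm_mult)
          next
            case False
            then have "coprime p m" using P(2)[OF p] prime_imp_coprime by blast
            then show ?thesis using False mult by simp
          qed
        qed
        also have "\<dots> = 2 * real (N div p div p)"
          using card_multiples_atMost[OF p0[OF p], of "N div p"]
          by (simp add: sum.If_cases Int_def conj_commute)
        also have "\<dots> \<le> 2 * (real N / real (p * p))"
          using of_nat_div_le_of_nat[where 'a = real, of N "p * p"] by (simp add: div_mult2_eq)
        finally show "norm (\<Sum>m=1..N div p. (f (p * m) - f p * f m) * g (p * m)) \<le> 2 * real N * (1 / real p ^ 2)"
          by (simp add: power2_eq_square)
      qed
      also have "\<dots> = 2 * real N * (\<Sum>p\<in>P. 1 / real p ^ 2)" by (simp add: sum_distrib_left)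
      also have "\<dots> \<le> 2 * real N * K" using K P by (intro mult_left_mono) auto
      finally show ?thesis by (simp add: mult_ac)
    qed
    have step3: "norm D \<le> real N * sqrt (2 * A)"
    proof -
      define h where "h m = (\<Sum>p\<in>P. if p * m \<le> N then f p * g (p * m) else 0)" for m
      have h: "(\<Sum>p\<in>{p\<in>P. p * m \<le> N}. f p * g (p * m)) = h m" for m
        unfolding h_def by (rule sum.inter_filter[OF P(1)])
      have in_sum: "(\<Sum>m=1..N. (if p * m \<le> N then f p * g (p * m) else 0) * cnj (if q * m \<le> N then f q * g (q * m) else 0))
          = f p * cnj (f q) * (\<Sum>m=1..N div max p q. g (p * m) * cnj (g (q * m)))" if "p \<in> P" "q \<in> P" for p q
      proof -
        have "(\<Sum>m=1..N. (if p * m \<le> N then f p * g (p * m) else 0) * cnj (if q * m \<le> N then f q * g (q * m) else 0))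
          = (\<Sum>m=1..N. if max p q * m \<le> N then f p * cnj (f q) * (g (p * m) * cnj (g (q * m))) else 0)"
        proof (intro sum.cong refl)
          fix m
          have "max p q * m = max (p * m) (q * m)" by (simp add: max_def)
          then show "(if p * m \<le> N then f p * g (p * m) else 0) * cnj (if q * m \<le> N then f q * g (q * m) else 0)
            = (if max p q * m \<le> N then f p * cnj (f q) * (g (p * m) * cnj (g (q * m))) else 0)"
            by (simp add: mult_ac)
        qed
        also have "\<dots> = (\<Sum>m\<in>{m\<in>{1..N}. max p q * m \<le> N}. f p * cnj (f q) * (g (p * m) * cnj (g (q * m))))"
          by (rule sum.inter_filter[symmetric]) simp
        also have "{m\<in>{1..N}. max p q * m \<le> N} = {1..N div max p q}"
        proof -
          have "max p q > 0" using p0 that by (simp add: less_max_iff_disj)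
          then show ?thesis
            by (auto simp: less_eq_div_iff_mult_less_eq mult.commute intro: order_trans[rotated])
        qed
        finally show ?thesis by (simp add: sum_distrib_left)
      qed
      have expand: "complex_of_real (\<Sum>m=1..N. (norm (h m))\<^sup>2)
          = of_real (\<Sum>m=1..N. \<Sum>p\<in>P. (norm (if p * m \<le> N then f p * g (p * m) else 0))\<^sup>2)
            + (\<Sum>p\<in>P. \<Sum>q\<in>P - {p}. f p * cnj (f q) * (\<Sum>m=1..N div max p q. g (p * m) * cnj (g (q * m))))"
      proof -
        have "complex_of_real (\<Sum>m=1..N. (norm (h m))\<^sup>2)
          = of_real (\<Sum>m=1..N. \<Sum>p\<in>P. (norm (if p * m \<le> N then f p * g (p * m) else 0))\<^sup>2)
            + (\<Sum>m=1..N. \<Sum>p\<in>P. \<Sum>q\<in>P - {p}. (if p * m \<le> N then f p * g (p * m) else 0) * cnj (if q * m \<le> N then f q * g (q * m) else 0))"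
          unfolding of_real_sum h_def norm_sum_sq_expand[OF P(1)] sum.distrib by simp
        also have "(\<Sum>m=1..N. \<Sum>p\<in>P. \<Sum>q\<in>P - {p}. (if p * m \<le> N then f p * g (p * m) else 0) * cnj (if q * m \<le> N then f q * g (q * m) else 0))
          = (\<Sum>p\<in>P. \<Sum>q\<in>P - {p}. \<Sum>m=1..N. (if p * m \<le> N then f p * g (p * m) else 0) * cnj (if q * m \<le> N then f q * g (q * m) else 0))"
          by (rule sum_swap3)
        also have "\<dots> = (\<Sum>p\<in>P. \<Sum>q\<in>P - {p}. f p * cnj (f q) * (\<Sum>m=1..N div max p q. g (p * m) * cnj (g (q * m))))"
          by (intro sum.cong refl in_sum) auto
        finally show ?thesis .
      qed
      have "norm (complex_of_real (\<Sum>m=1..N. (norm (h m))\<^sup>2))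
          \<le> norm (complex_of_real (\<Sum>m=1..N. \<Sum>p\<in>P. (norm (if p * m \<le> N then f p * g (p * m) else 0))\<^sup>2))
            + norm (\<Sum>p\<in>P. \<Sum>q\<in>P - {p}. f p * cnj (f q) * (\<Sum>m=1..N div max p q. g (p * m) * cnj (g (q * m))))"
        unfolding expand by (rule norm_triangle_ineq)
      also have "norm (complex_of_real (\<Sum>m=1..N. \<Sum>p\<in>P. (norm (if p * m \<le> N then f p * g (p * m) else 0))\<^sup>2))
          \<le> real N * A"
      proof -
        have "(\<Sum>m=1..N. \<Sum>p\<in>P. (norm (if p * m \<le> N then f p * g (p * m) else 0))\<^sup>2)
            = (\<Sum>p\<in>P. \<Sum>m=1..N. (norm (if p * m \<le> N then f p * g (p * m) else 0))\<^sup>2)"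
          by (rule sum.swap)
        also have "\<dots> \<le> (\<Sum>p\<in>P. real N * (1 / real p))"
        proof (rule sum_mono)
          fix p assume p: "p \<in> P"
          have "(\<Sum>m=1..N. (norm (if p * m \<le> N then f p * g (p * m) else 0))\<^sup>2) \<le> (\<Sum>m=1..N. if p * m \<le> N then 1 else 0)"
            using fg by (intro sum_mono) (auto simp: power_le_one)
          also have "\<dots> = real (card {m\<in>{1..N}. p * m \<le> N})"
            by (simp add: sum.If_cases Int_def conj_commute)
          also have "{m\<in>{1..N}. p * m \<le> N} = {1..N div p}"
            using p0[OF p] by (auto simp: less_eq_div_iff_mult_less_eq mult.commute intro: order_trans[rotated])
          also have "real (card {1..N div p}) \<le> real N * (1 / real p)"
            using of_nat_div_le_of_nat[where 'a = real, of N p] by simp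
          finally show "(\<Sum>m=1..N. (norm (if p * m \<le> N then f p * g (p * m) else 0))\<^sup>2) \<le> real N * (1 / real p)" .
        qed
        also have "\<dots> = real N * A" by (simp add: A_def sum_distrib_left)
        finally show ?thesis unfolding norm_of_real by (simp add: sum_nonneg)
      qed
      also have "norm (\<Sum>p\<in>P. \<Sum>q\<in>P - {p}. f p * cnj (f q) * (\<Sum>m=1..N div max p q. g (p * m) * cnj (g (q * m))))
          \<le> (\<Sum>p\<in>P. \<Sum>q\<in>P. A / real (card P) ^ 2 * real N)"
      proof (rule sum_norm_le)
        fix p assume p: "p \<in> P"
        have "norm (\<Sum>q\<in>P - {p}. f p * cnj (f q) * (\<Sum>m=1..N div max p q. g (p * m) * cnj (g (q * m))))
            \<le> (\<Sum>q\<in>P - {p}. A / real (card P) ^ 2 * real N)"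
        proof (rule sum_norm_le)
          fix q assume q: "q \<in> P - {p}"
          have "norm (f p * cnj (f q)) \<le> 1"
            using f1 by (intro norm_mult_le_1) auto
          then have "norm (f p * cnj (f q) * (\<Sum>m=1..N div max p q. g (p * m) * cnj (g (q * m))))
              \<le> 1 * (A / real (card P) ^ 2 * real (N div max p q))"
            unfolding norm_mult[of "f p * cnj (f q)"] using elim p q by (intro mult_mono) auto
          also have "\<dots> \<le> A / real (card P) ^ 2 * real N"
            using A unfolding mult_1 by (intro mult_left_mono) (auto intro!: divide_nonneg_nonneg)
          finally show "norm (f p * cnj (f q) * (\<Sum>m=1..N div max p q. g (p * m) * cnj (g (q * m))))
              \<le> A / real (card P) ^ 2 * real N" .
        qed
        also have "\<dots> \<le> (\<Sum>q\<in>P. A / real (card P) ^ 2 * real N)"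
          using P A by (intro sum_mono2) auto
        finally show "norm (\<Sum>q\<in>P - {p}. f p * cnj (f q) * (\<Sum>m=1..N div max p q. g (p * m) * cnj (g (q * m))))
            \<le> (\<Sum>q\<in>P. A / real (card P) ^ 2 * real N)" .
      qed
      also have "(\<Sum>p\<in>P. \<Sum>q\<in>P. A / real (card P) ^ 2 * real N) = A * real N"
      proof -
        have "card P \<noteq> 0" using A P by (auto simp: A_def)
        then show ?thesis by (simp add: power2_eq_square)
      qed
      finally have hsq: "(\<Sum>m=1..N. (norm (h m))\<^sup>2) \<le> 2 * A * real N"
        unfolding norm_of_real by (simp add: sum_nonneg algebra_simps)
      have "(norm D)\<^sup>2 \<le> real (card {1..N}) * (\<Sum>m=1..N. (norm (f m * h m))\<^sup>2)"
        unfolding D_def h by (rule norm_sum_sq_le)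
      also have "\<dots> \<le> real (card {1..N}) * (\<Sum>m=1..N. (norm (h m))\<^sup>2)"
        using f1 by (intro mult_left_mono sum_mono power_mono) (auto simp: norm_mult mult_left_le_one_le)
      also have "\<dots> \<le> real N * (2 * A * real N)" using hsq by (simp add: mult_left_mono)
      finally have "norm D \<le> sqrt (real N * (2 * A * real N))" by (rule real_le_rsqrt)
      also have "\<dots> = real N * sqrt (2 * A)" by (simp add: real_sqrt_mult mult_ac)
      finally show ?thesis .
    qed
    have "A * norm S = norm (of_real A * S)" using A by (simp add: norm_mult)
    also have "\<dots> \<le> norm (D1 - of_real A * S) + norm (D1 - D) + norm D"
      by norm
    also have "\<dots> \<le> real N * (2 * sqrt (2 * A) + 2 * K)"
      using step1 step2 step3 by (simp add: algebra_simps)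
    also have "\<dots> \<le> real N * ((2 * sqrt 2 + 2 * K) * sqrt A)"
    proof (rule mult_left_mono)
      have "1 \<le> sqrt A" using A by simp
      then have "2 * K * 1 \<le> 2 * K * sqrt A" using K by (intro mult_left_mono) auto
      then show "2 * sqrt (2 * A) + 2 * K \<le> (2 * sqrt 2 + 2 * K) * sqrt A"
        by (simp add: real_sqrt_mult algebra_simps)
    qed simp
    also have "\<dots> \<le> real N * (\<epsilon> * A)"
    proof (rule mult_left_mono)
      have "(2 * sqrt 2 + 2 * K) / \<epsilon> \<le> sqrt A" using A by (intro real_le_rsqrt) simp
      then have "2 * sqrt 2 + 2 * K \<le> \<epsilon> * sqrt A" using \<epsilon> by (simp add: field_simps)
      then have "(2 * sqrt 2 + 2 * K) * sqrt A \<le> \<epsilon> * sqrt A * sqrt A"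
        using A by (intro mult_right_mono) auto
      then show "(2 * sqrt 2 + 2 * K) * sqrt A \<le> \<epsilon> * A" using A by (simp add: mult.assoc)
    qed simp
    finally have "A * norm S \<le> A * (\<epsilon> * real N)" by (simp add: mult_ac)
    then show ?case using A unfolding S_def by simp
  qed
qed

section \<open>Dirichlet series\<close>

text \<open>The power n^(-s). The convention 0 powr z = 0 gives \<open>nps 0 s = 0\<close>, so
  multiplicativity holds for all naturals.\<close>

definition nps :: "nat \<Rightarrow> complex \<Rightarrow> complex" where
  "nps n s = of_nat n powr (- s)"

lemma nps_0 [simp]: "nps 0 s = 0" and nps_1 [simp]: "nps 1 s = 1" and nps_Suc_0 [simp]: "nps (Suc 0) s = 1"
  by (simp_all add: nps_def)

lemma nps_mult: "nps (m * n) s = nps m s * nps n s"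
  unfolding nps_def of_nat_mult by (rule powr_times_real) auto

lemma nps_add: "nps n (s + t) = nps n s * nps n t"
  by (cases "n = 0") (auto simp: nps_def powr_add minus_add_distrib simp flip: powr_add)

lemma norm_nps: "norm (nps n s) = real n powr (- Re s)"
  unfolding nps_def by (subst norm_powr_real_powr) auto

lemma nps_of_real: "nps n (of_real x) = of_real (real n powr (- x))"
  using powr_of_real[of "real n" "- x"] by (simp add: nps_def)

lemma holomorphic_nps [holomorphic_intros]: "f holomorphic_on A \<Longrightarrow> (\<lambda>s. nps n (f s)) holomorphic_on A"
  unfolding nps_def by (intro holomorphic_intros)

text \<open>Absolute convergence is part of the notion because products of series are rearranged in
  \<open>has_dsum_dconv\<close>.\<close>

definition has_dsum :: "(nat \<Rightarrow> complex) \<Rightarrow> complex \<Rightarrow> complex \<Rightarrow> bool" where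
  "has_dsum a s S \<longleftrightarrow> (\<lambda>n. a n * nps n s) abs_summable_on {1..} \<and> ((\<lambda>n. a n * nps n s) has_sum S) {1..}"

definition dconv :: "(nat \<Rightarrow> complex) \<Rightarrow> (nat \<Rightarrow> complex) \<Rightarrow> nat \<Rightarrow> complex" where
  "dconv a b n = (\<Sum>d\<in>{d. d dvd n}. a d * b (n div d))"

lemma has_dsum_unique: "has_dsum a s S \<Longrightarrow> has_dsum a s T \<Longrightarrow> S = T"
  unfolding has_dsum_def using has_sum_unique by blast

lemma bounded_has_dsum:
  assumes "\<And>n. norm (a n) \<le> C" "Re s > 1"
  shows "\<exists>S. has_dsum a s S"
proof -
  have "summable (\<lambda>n. C * real n powr (- Re s))"
    using assms(2) by (intro summable_mult) (simp add: summable_real_powr_iff)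
  moreover have C: "C \<ge> 0" using assms(1)[of 0] norm_ge_zero order_trans by blast
  ultimately have "(\<lambda>n. C * real n powr (- Re s)) summable_on UNIV"
    by (intro summable_nonneg_imp_summable_on) auto
  then have "(\<lambda>n. C * real n powr (- Re s)) summable_on {1..}"
    by (rule summable_on_subset_banach) auto
  then have "(\<lambda>n. a n * nps n s) abs_summable_on {1..}"
    by (rule summable_on_comparison_test)
       (auto simp: norm_mult norm_nps intro!: mult_right_mono assms)
  moreover from this have "((\<lambda>n. a n * nps n s) has_sum infsum (\<lambda>n. a n * nps n s) {1..}) {1..}"
    by (rule has_sum_infsum[OF abs_summable_summable])
  ultimately have "has_dsum a s (infsum (\<lambda>n. a n * nps n s) {1..})"
    unfolding has_dsum_def by (rule conjI)
  then show ?thesis ..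
qed

text \<open>The product is an absolutely convergent double sum over pairs (d, e). The bijection from
  (n, d) with d dividing n to (d, n/d) regroups it by n = d e, and absolute convergence travels
  along the bijection.\<close>

lemma has_dsum_dconv:
  assumes "has_dsum a s S" "has_dsum b s T"
  shows "has_dsum (dconv a b) s (S * T)"
proof -
  let ?f = "\<lambda>n. a n * nps n s" and ?g = "\<lambda>n. b n * nps n s"
  define F where "F = (\<lambda>(d, e). ?f d * ?g e)"
  define H where "H = (\<lambda>(n, d). a d * b (n div d) * nps n s)"
  let ?D = "SIGMA n:{1::nat..}. {d::nat. d dvd n}"
  have f: "?f abs_summable_on {1..}" "(?f has_sum S) {1..}"
    and g: "?g abs_summable_on {1..}" "(?g has_sum T) {1..}"
    using assms by (auto simp: has_dsum_def)
  have F_abs: "F abs_summable_on {1..} \<times> {1..}"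
    unfolding Infinite_Sum.abs_summable_on_Sigma_iff
  proof (intro conjI ballI)
    fix d assume "d \<in> {1::nat..}"
    show "(\<lambda>e. F (d, e)) abs_summable_on {1..}"
      unfolding F_def prod.case norm_mult using g(1) by (intro summable_on_cmult_right) (simp add: norm_mult)
  next
    have "(\<lambda>d. norm (?f d) * infsum (\<lambda>e. norm (?g e)) {1..}) summable_on {1..}"
      using f(1) by (rule summable_on_cmult_left)
    moreover have "infsum (\<lambda>e. norm (F (d, e))) {1..} = norm (?f d) * infsum (\<lambda>e. norm (?g e)) {1..}" for d
      unfolding F_def prod.case norm_mult[of "a d * nps d s"]
      by (rule infsum_cmult_right) (use g(1) in auto)
    ultimately show "(\<lambda>d. infsum (\<lambda>e. norm (F (d, e))) {1..}) abs_summable_on {1..}"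
      by (simp add: abs_mult infsum_nonneg)
  qed
  have F_sum: "(F has_sum (S * T)) ({1..} \<times> {1..})"
  proof (rule has_sum_SigmaI)
    show "((\<lambda>e. F (d, e)) has_sum (?f d * T)) {1..}" for d
      unfolding F_def prod.case by (rule has_sum_cmult_right[OF g(2)])
    show "((\<lambda>d. ?f d * T) has_sum (S * T)) {1..}"
      by (rule has_sum_cmult_left[OF f(2)])
    show "F summable_on {1..} \<times> {1..}" by (rule abs_summable_summable[OF F_abs])
  qed
  have FH: "F (snd x, fst x div snd x) = H x" if "x \<in> ?D" for x
  proof -
    obtain n d where "x = (n, d)" by (cases x)
    with that have x: "x = (n, d)" "n \<ge> 1" "d dvd n" by simp_all
    have "nps n s = nps d s * nps (n div d) s" using x by (simp flip: nps_mult)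
    then show ?thesis by (simp add: F_def H_def x mult_ac)
  qed
  have bij: "bij_betw (\<lambda>x. (snd x, fst x div snd x)) ?D ({1..} \<times> {1..})"
  proof (rule bij_betwI[where g = "\<lambda>(d, e). (d * e, d)"])
    show "(\<lambda>x. (snd x, fst x div snd x)) \<in> ?D \<rightarrow> {1..} \<times> {1..}"
    proof
      fix x assume "x \<in> ?D"
      then obtain n d where x: "x = (n, d)" "n \<ge> 1" "d dvd n" by auto
      then have "d \<noteq> 0" "n div d \<noteq> 0" by (auto simp: dvd_div_eq_0_iff intro: Nat.gr0I)
      then show "(snd x, fst x div snd x) \<in> {1..} \<times> {1..}" using x by (simp add: Suc_le_eq)
    qed
  qed (auto simp: Suc_le_eq)
  have H_abs: "H abs_summable_on ?D"
  proof -
    have "(\<lambda>x. norm (F (snd x, fst x div snd x))) summable_on ?D"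
      using summable_on_reindex_bij_betw[OF bij, of "\<lambda>x. norm (F x)"] F_abs by simp
    then show ?thesis using FH by (subst (asm) summable_on_cong) auto
  qed
  have H_sum: "(H has_sum (S * T)) ?D"
  proof -
    have "((\<lambda>x. F (snd x, fst x div snd x)) has_sum (S * T)) ?D"
      using has_sum_reindex_bij_betw[OF bij, of F "S * T"] F_sum by simp
    then show ?thesis using FH by (subst (asm) has_sum_cong) auto
  qed
  have fin: "finite {d. d dvd n}" if "n \<in> {1..}" for n :: nat
    using that by (intro finite_divisors_nat) auto
  have inner: "(\<Sum>d\<in>{d. d dvd n}. H (n, d)) = dconv a b n * nps n s" for n
    by (simp add: H_def dconv_def sum_distrib_right)
  have "((\<lambda>n. \<Sum>d\<in>{d. d dvd n}. H (n, d)) has_sum (S * T)) {1..}"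
    by (rule has_sum_SigmaD[OF H_sum]) (intro has_sum_finite fin)
  moreover have "(\<lambda>n. \<Sum>d\<in>{d. d dvd n}. H (n, d)) abs_summable_on {1..}"
  proof (rule summable_on_comparison_test)
    have "(\<lambda>n. infsum (\<lambda>d. norm (H (n, d))) {d. d dvd n}) abs_summable_on {1..}"
      using H_abs unfolding Infinite_Sum.abs_summable_on_Sigma_iff by blast
    then show "(\<lambda>n. infsum (\<lambda>d. norm (H (n, d))) {d. d dvd n}) summable_on {1..}"
      by (rule abs_summable_summable)
    show "norm (\<Sum>d\<in>{d. d dvd n}. H (n, d)) \<le> infsum (\<lambda>d. norm (H (n, d))) {d. d dvd n}"
      if "n \<in> {1..}" for n
      using fin[OF that] by (simp add: norm_sum)
  qed auto
  ultimately show ?thesis unfolding has_dsum_def inner by blast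
qed

section \<open>Multiplicative functions and Moebius inversion\<close>

definition mult_fun :: "(nat \<Rightarrow> complex) \<Rightarrow> bool" where
  "mult_fun f \<longleftrightarrow> f 1 = 1 \<and> (\<forall>m n. coprime m n \<longrightarrow> f (m * n) = f m * f n)"

text \<open>For coprime m and n each divisor of m n is uniquely d e with d dividing m and e dividing
  n; gcd with m and with n recovers the factors.\<close>

lemma mult_fun_dconv:
  assumes a: "mult_fun a" and b: "mult_fun b"
  shows "mult_fun (dconv a b)"
  unfolding mult_fun_def
proof (intro conjI allI impI)
  show "dconv a b 1 = 1" using a b by (simp add: dconv_def mult_fun_def)
  fix m n :: nat assume mn: "coprime m n"
  show "dconv a b (m * n) = dconv a b m * dconv a b n"
  proof (cases "m = 0 \<or> n = 0")
    case True
    then show ?thesis by (auto simp: dconv_def)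
  next
    case False
    have gcd_de: "gcd (d * e) m = d" "gcd (d * e) n = e" if "d dvd m" "e dvd n" for d e
    proof -
      have cop: "coprime d n" "coprime e m"
        using that mn by (meson coprime_divisors coprime_commute dvd_refl)+
      have "gcd (d * e) m = gcd d m" using cop
        by (simp add: gcd_mult_right_right_cancel coprime_commute gcd_mult_left_right_cancel)
      moreover have "gcd (e * d) n = gcd e n" using cop
        by (simp add: gcd_mult_right_right_cancel coprime_commute gcd_mult_left_right_cancel)
      ultimately show "gcd (d * e) m = d" "gcd (d * e) n = e"
        using that by (simp_all add: gcd_nat.absorb1 mult.commute)
    qed
    have "dconv a b m * dconv a b n
        = (\<Sum>(d, e)\<in>{d. d dvd m} \<times> {e. e dvd n}. (a d * b (m div d)) * (a e * b (n div e)))"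
      by (simp add: dconv_def sum_product sum.cartesian_product)
    also have "\<dots> = (\<Sum>x\<in>{x. x dvd m * n}. a x * b (m * n div x))"
    proof (rule sum.reindex_bij_witness[where i = "\<lambda>x. (gcd x m, gcd x n)" and j = "\<lambda>(d, e). d * e"])
      fix x assume "x \<in> {d. d dvd m} \<times> {e. e dvd n}"
      then obtain d e where x: "x = (d, e)" "d dvd m" "e dvd n" by auto
      show "(gcd (case x of (d, e) \<Rightarrow> d * e) m, gcd (case x of (d, e) \<Rightarrow> d * e) n) = x"
        using x gcd_de by simp
      show "(case x of (d, e) \<Rightarrow> d * e) \<in> {x. x dvd m * n}" using x by (simp add: mult_dvd_mono)
      have c1: "coprime d e" using x mn by (meson coprime_divisors)
      have "m div d dvd m" "n div e dvd n"
        using x by (metis dvd_div_mult_self dvd_triv_left)+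
      then have c2: "coprime (m div d) (n div e)" using mn by (meson coprime_divisors)
      have "m * n div (d * e) = (m div d) * (n div e)" using x by (simp add: div_mult_div_if_dvd)
      then show "a (case x of (d, e) \<Rightarrow> d * e) * b (m * n div (case x of (d, e) \<Rightarrow> d * e))
          = (case x of (d, e) \<Rightarrow> a d * b (m div d) * (a e * b (n div e)))"
        using x c1 c2 a b by (simp add: mult_fun_def)
    next
      fix x assume "x \<in> {x. x dvd m * n}"
      then obtain d e where "x = d * e" "d dvd m" "e dvd n" using division_decomp by blast
      then show "(case (gcd x m, gcd x n) of (d, e) \<Rightarrow> d * e) = x" using gcd_de by simp
    qed auto
    finally show ?thesis by (simp add: dconv_def)
  qed
qed

lemma dconv_prime_power:
  assumes "prime p"
  shows "dconv a b (p ^ k) = (\<Sum>i\<le>k. a (p ^ i) * b (p ^ (k - i)))"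
proof -
  have "{d. d dvd p ^ k} = (\<lambda>i. p ^ i) ` {..k}"
    using assms divides_primepow_nat by auto
  moreover have "inj_on (\<lambda>i. p ^ i) {..k}"
    using assms prime_gt_1_nat[of p] by (auto simp: inj_on_def power_inject_exp)
  ultimately have "dconv a b (p ^ k) = (\<Sum>i\<le>k. a (p ^ i) * b (p ^ k div p ^ i))"
    unfolding dconv_def by (simp add: sum.reindex)
  also have "\<dots> = (\<Sum>i\<le>k. a (p ^ i) * b (p ^ (k - i)))"
    using assms prime_gt_0_nat[of p] by (intro sum.cong refl) (simp add: power_diff)
  finally show ?thesis .
qed

text \<open>Splitting off the full power of one prime at a time reduces claims on multiplicative
  functions to prime powers.\<close>

lemma prime_power_induct [consumes 1, case_names 1 step]:
  fixes n :: nat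
  assumes "n > 0" "P 1"
    and "\<And>p k m. prime p \<Longrightarrow> m > 0 \<Longrightarrow> \<not> p dvd m \<Longrightarrow> P m \<Longrightarrow> P (p ^ k * m)"
  shows "P n"
  using assms(1)
proof (induction n rule: less_induct)
  case (less n)
  show ?case
  proof (cases "n = 1")
    case False
    then obtain p where p: "prime p" "p dvd n" using prime_factor_nat by blast
    define k where "k = multiplicity p n"
    obtain m where m: "n = p ^ k * m" "\<not> p dvd m"
      using multiplicity_decompose'[of n p] less.prems p unfolding k_def
      by (metis not_prime_unit less_irrefl)
    have "k \<noteq> 0" using p m by (metis mult_1 power_0)
    then have "p ^ k > 1" using one_less_power[OF prime_gt_1_nat[OF p(1)], of k] by simp
    moreover have "m > 0" using less.prems m by (auto intro: Nat.gr0I)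
    ultimately have "m < n" using m by simp
    then show ?thesis using assms(3)[OF p(1) \<open>m > 0\<close> m(2) less.IH[of m]] \<open>m > 0\<close> m(1) by simp
  qed (use assms(2) in simp)
qed

lemma mult_fun_prime_power:
  assumes "mult_fun f" "prime p" "\<not> p dvd m"
  shows "f (p ^ k * m) = f (p ^ k) * f m"
  using assms unfolding mult_fun_def
  by (metis coprime_power_left_iff prime_imp_coprime)

lemma mult_fun_moebius: "mult_fun (\<lambda>n. of_int (moebius_mu n))"
  unfolding mult_fun_def
proof (intro conjI allI impI)
  show "of_int (moebius_mu 1) = (1 :: complex)" by (simp add: moebius_mu_def)
  fix m n :: nat assume mn: "coprime m n"
  show "(of_int (moebius_mu (m * n)) :: complex) = of_int (moebius_mu m) * of_int (moebius_mu n)"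
  proof (cases "squarefree (m * n)")
    case True
    then have sq: "squarefree m" "squarefree n" using squarefree_multD by blast+
    then have nz: "m \<noteq> 0" "n \<noteq> 0" by (metis not_squarefree_0)+
    have "prime_factors m \<inter> prime_factors n = {}"
      using mn by (auto simp: in_prime_factors_iff) (meson coprime_common_divisor_nat not_prime_1 coprime_common_divisor not_prime_unit)
    then have "card (prime_factors (m * n)) = card (prime_factors m) + card (prime_factors n)"
      using nz by (simp add: prime_factors_product card_Un_disjoint)
    then show ?thesis using True sq by (simp add: moebius_mu_def power_add)
  next
    case False
    then have "\<not> squarefree m \<or> \<not> squarefree n"
      using squarefree_mult_coprime[OF mn] by blast
    then show ?thesis using False by (auto simp: moebius_mu_def)
  qed
qed

lemma moebius_prime_power:
  assumes "prime p"
  shows "moebius_mu (p ^ k) = (if k = 0 then 1 else if k = 1 then -1 else 0)"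
proof -
  have "\<not> squarefree (p ^ k)" if "k \<ge> 2"
    using that prime_gt_1_nat[OF assms] by (simp add: squarefree_power_iff)
  moreover have "squarefree p" using assms squarefree_prime by blast
  ultimately show ?thesis using assms
    by (auto simp: moebius_mu_def prime_prime_factors)
qed

lemma norm_moebius_le: "norm (of_int (moebius_mu n) :: complex) \<le> 1"
  by (simp add: moebius_mu_def norm_power)

text \<open>Both sides are multiplicative, and at a prime power p^k with k > 0 the only nonzero
  terms are 1 and -1.\<close>

lemma dconv_moebius_1:
  assumes "n > 0"
  shows "dconv (\<lambda>n. of_int (moebius_mu n)) (\<lambda>_. 1) n = (if n = 1 then 1 else 0)"
proof -
  have M: "mult_fun (dconv (\<lambda>n. of_int (moebius_mu n)) (\<lambda>_. 1))"
    by (intro mult_fun_dconv mult_fun_moebius) (simp add: mult_fun_def)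
  have pp: "dconv (\<lambda>n. of_int (moebius_mu n)) (\<lambda>_. 1) (p ^ k) = (if k = 0 then 1 else 0)" if "prime p" for p k
  proof -
    have "(\<Sum>i\<le>k. (if i = 0 then 1 else if i = 1 then -1 else 0 :: complex)) = (if k = 0 then 1 else 0)"
      by (induction k) auto
    then show ?thesis unfolding dconv_prime_power[OF that] moebius_prime_power[OF that]
      by (simp add: if_distrib[of of_int] cong: if_cong)
  qed
  show ?thesis using assms
  proof (induction n rule: prime_power_induct)
    case 1
    then show ?case using M by (simp add: mult_fun_def)
  next
    case (step p k m)
    have "p ^ k * m = 1 \<longleftrightarrow> k = 0 \<and> m = 1" using prime_gt_1_nat[OF step(1)] by auto
    then show ?case using step mult_fun_prime_power[OF M step(1,3)] pp[OF step(1)] by auto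
  qed
qed

lemma has_dsum_one: "has_dsum (\<lambda>n. if n = 1 then c else 0) s c"
proof -
  have eq: "(if n = 1 then c else 0) * nps n s = (if n = 1 then c else 0)" for n by simp
  have "((\<lambda>n. if n = 1 then c else 0) has_sum c) {1::nat..}"
    by (rule has_sum_finite_neutralI[where B = "{1::nat}"]) auto
  moreover have "((\<lambda>n. norm (if n = 1 then c else 0)) has_sum norm c) {1::nat..}"
    by (rule has_sum_finite_neutralI[where B = "{1::nat}"]) auto
  ultimately show ?thesis
    unfolding has_dsum_def eq using summable_on_def by blast
qed

lemma has_dsum_cong:
  assumes "\<And>n. n \<ge> 1 \<Longrightarrow> a n = b n"
  shows "has_dsum a s S \<longleftrightarrow> has_dsum b s S"
proof -
  have "(\<lambda>n. a n * nps n s) abs_summable_on {1..} \<longleftrightarrow> (\<lambda>n. b n * nps n s) abs_summable_on {1..}"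
    by (rule summable_on_cong) (simp add: assms)
  moreover have "((\<lambda>n. a n * nps n s) has_sum S) {1..} \<longleftrightarrow> ((\<lambda>n. b n * nps n s) has_sum S) {1..}"
    by (rule has_sum_cong) (simp add: assms)
  ultimately show ?thesis by (simp add: has_dsum_def)
qed

lemma has_dsum_add:
  assumes "has_dsum a s S" "has_dsum b s T"
  shows "has_dsum (\<lambda>n. a n + b n) s (S + T)"
proof -
  have "(\<lambda>n. norm (a n * nps n s) + norm (b n * nps n s)) summable_on {1..}"
    using assms by (intro summable_on_add) (auto simp: has_dsum_def)
  then have "(\<lambda>n. a n * nps n s + b n * nps n s) abs_summable_on {1..}"
    by (rule summable_on_comparison_test) (auto intro: norm_triangle_ineq)
  then show ?thesis
    using assms has_sum_add by (fastforce simp: has_dsum_def distrib_right)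
qed

lemma has_dsum_cmult:
  assumes "has_dsum a s S"
  shows "has_dsum (\<lambda>n. c * a n) s (c * S)"
  using assms has_sum_cmult_right[where f = "\<lambda>n. a n * nps n s" and A = "{1..}" and c = c]
    summable_on_cmult_right[where f = "\<lambda>n. norm (a n * nps n s)" and A = "{1..}" and c = "norm c"]
  by (simp add: has_dsum_def norm_mult mult.assoc)

lemma has_dsum_imp_sums:
  assumes "has_dsum a s S"
  shows "(\<lambda>n. a (Suc n) * nps (Suc n) s) sums S"
proof -
  have "((\<lambda>n. a (Suc n) * nps (Suc n) s) has_sum S) UNIV
      \<longleftrightarrow> ((\<lambda>n. a n * nps n s) has_sum S) {1..}"
    by (rule has_sum_reindex_bij_witness[where i = "\<lambda>n. n - 1" and j = Suc]) auto
  then show ?thesis using assms has_sum_imp_sums by (auto simp: has_dsum_def)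
qed

lemma dsum_shift:
  "has_dsum a (s + t) S \<longleftrightarrow> has_dsum (\<lambda>n. a n * nps n t) s S"
  by (simp add: has_dsum_def nps_add mult_ac)

lemma has_dsum_cnj:
  assumes "has_dsum a s S"
  shows "has_dsum (\<lambda>n. cnj (a n)) (cnj s) (cnj S)"
proof -
  have "cnj (nps n s) = nps n (cnj s)" for n
    by (cases "n = 0") (simp_all add: nps_def cnj_powr)
  then have eq: "cnj (a n) * nps n (cnj s) = cnj (a n * nps n s)" for n by simp
  show ?thesis
    using assms unfolding has_dsum_def eq complex_mod_cnj has_sum_cnj_iff .
qed

section \<open>Continuation of Dirichlet series to the half plane Re s > 0\<close>

lemma in_real_segmentE:
  assumes "z \<in> closed_segment (complex_of_real a) (of_real x)" "a \<le> x"
  obtains u where "z = of_real u" "a \<le> u" "u \<le> x"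
  using assms by (auto simp: closed_segment_of_real closed_segment_eq_real_ivl)

lemma powr_diff_bound:
  assumes "0 < a" "a \<le> x" "Re s > -1"
  shows "norm (complex_of_real x powr (- s) - of_real a powr (- s)) \<le> norm s * a powr (- Re s - 1) * (x - a)"
proof -
  let ?S = "closed_segment (complex_of_real a) (of_real x)"
  have "norm (complex_of_real x powr (- s) - of_real a powr (- s))
      \<le> (norm s * a powr (- Re s - 1)) * norm (complex_of_real x - of_real a)"
  proof (rule field_differentiable_bound[where S = ?S and f' = "\<lambda>z. (- s) * z powr (- s - 1)"])
    fix z assume "z \<in> ?S"
    then obtain u where u: "z = of_real u" "a \<le> u" "u \<le> x" using assms(2) by (rule in_real_segmentE)
    then have "z \<notin> \<real>\<^sub>\<le>\<^sub>0" using assms(1) by (simp add: complex_nonpos_Reals_iff)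
    then show "((\<lambda>z. z powr (- s)) has_field_derivative (- s) * z powr (- s - 1)) (at z within ?S)"
      by (rule has_field_derivative_at_within[OF has_field_derivative_powr])
    have "norm (z powr (- s - 1)) = u powr (- Re s - 1)"
      using u assms(1) by (subst norm_powr_real_powr) auto
    also have "\<dots> \<le> a powr (- Re s - 1)"
      using u assms by (intro powr_mono2') auto
    finally show "norm ((- s) * z powr (- s - 1)) \<le> norm s * a powr (- Re s - 1)"
      by (simp add: norm_mult mult_left_mono)
  qed auto
  then show ?thesis using assms(2) by (simp flip: of_real_diff)
qed

lemma nps_diff_bound:
  assumes "n \<ge> 1" "Re s > 0"
  shows "norm (nps n s - nps (Suc n) s) \<le> norm s * real n powr (- Re s - 1)"
  using powr_diff_bound[of "real n" "real (Suc n)" s] assms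
  by (simp add: nps_def norm_minus_commute)

text \<open>The expression is (s - 1) times the difference between n^(-s) and the integral of u^(-s)
  over [n, n+1]. Comparing sum and integral gains one power of n, enough for convergence whenever Re
  s > 0. In the proof the integral is replaced by a mean value bound for an explicit
  primitive.\<close>

lemma zeta_term_bound:
  assumes "n \<ge> 1" "Re s > 0"
  shows "norm ((s - 1) * nps n s + nps (Suc n) (s - 1) - nps n (s - 1))
    \<le> norm (s - 1) * norm s * real n powr (- Re s - 1)"
proof -
  let ?S = "closed_segment (complex_of_real (real n)) (of_real (real (Suc n)))"
  let ?v = "\<lambda>z. (s - 1) * (z - of_nat n) * of_nat n powr (- s) + z powr (- (s - 1))"
  have "norm (?v (of_real (real (Suc n))) - ?v (of_real (real n)))
     \<le> (norm (s - 1) * norm s * real n powr (- Re s - 1)) * norm (complex_of_real (real (Suc n)) - of_real (real n))"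
  proof (rule field_differentiable_bound[where S = ?S
        and f' = "\<lambda>z. (s - 1) * (of_nat n powr (- s) - z powr (- s))"])
    fix z assume "z \<in> ?S"
    then obtain u where u: "z = of_real u" "real n \<le> u" "u \<le> real (Suc n)"
      by (rule in_real_segmentE) simp_all
    then have z: "z \<notin> \<real>\<^sub>\<le>\<^sub>0" using assms(1) by (simp add: complex_nonpos_Reals_iff)
    have "(?v has_field_derivative ((s - 1) * of_nat n powr (- s) + (- (s - 1)) * z powr (- (s - 1) - 1))) (at z)"
      by (rule derivative_eq_intros has_field_derivative_powr z refl | simp)+
    moreover have "(s - 1) * of_nat n powr (- s) + (- (s - 1)) * z powr (- (s - 1) - 1)
        = (s - 1) * (of_nat n powr (- s) - z powr (- s))"
      by (simp add: algebra_simps)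
    ultimately have "(?v has_field_derivative (s - 1) * (of_nat n powr (- s) - z powr (- s))) (at z)"
      by (simp only:)
    then show "(?v has_field_derivative (s - 1) * (of_nat n powr (- s) - z powr (- s))) (at z within ?S)"
      by (rule has_field_derivative_at_within)
    have "norm (of_nat n powr (- s) - z powr (- s)) \<le> norm s * real n powr (- Re s - 1) * (u - real n)"
      using powr_diff_bound[of "real n" u s] assms u by (simp add: norm_minus_commute)
    also have "\<dots> \<le> norm s * real n powr (- Re s - 1) * 1"
      using u by (intro mult_left_mono) auto
    finally show "norm ((s - 1) * (of_nat n powr (- s) - z powr (- s))) \<le> norm (s - 1) * norm s * real n powr (- Re s - 1)"
      unfolding norm_mult mult.assoc by (intro mult_left_mono) auto
  qed auto
  then show ?thesis by (simp add: nps_def add.commute add_diff_eq)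
qed

text \<open>Weierstrass test shared by both continuations below. On the ball of radius Re s / 2
  about s the real part stays above Re s / 2, so a single convergent majorant serves the whole ball;
  the polynomial factor in |s| is harmless there.\<close>

lemma half_plane_series:
  assumes hol: "\<And>n. f n holomorphic_on {s. Re s > 0}"
    and bd: "\<And>n s. Re s > 0 \<Longrightarrow> norm (f n s) \<le> C * (norm s + 1)\<^sup>2 * real (Suc n) powr (- Re s - 1)"
  obtains g where "g holomorphic_on {s. Re s > 0}" "\<And>s. Re s > 0 \<Longrightarrow> (\<lambda>n. f n s) sums g s"
proof -
  have op: "open {s. Re s > 0}" by (rule open_halfspace_Re_gt)
  have C: "C \<ge> 0" using bd[of 1 0] by (auto dest: order_trans[OF norm_ge_zero] simp: zero_le_mult_iff)
  obtain g where g: "\<forall>s\<in>{s. Re s > 0}. ((\<lambda>n. f n s) sums g s) \<and> g field_differentiable (at s)"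
  proof (rule series_differentiable_comparison_complex[OF op, where f = f])
    fix n and s :: complex assume "s \<in> {s. Re s > 0}"
    then show "f n field_differentiable (at s)" using hol op holomorphic_on_imp_differentiable_at by blast
  next
    fix s :: complex assume s: "s \<in> {s. Re s > 0}"
    define d where "d = Re s / 2"
    define h where "h n = complex_of_real (C * (norm s + d + 1)\<^sup>2 * real (Suc n) powr (- d - 1))" for n
    have d: "d > 0" using s by (simp add: d_def)
    have "summable (\<lambda>n. real (Suc n) powr (- d - 1))"
      using d by (subst summable_Suc_iff) (simp add: summable_real_powr_iff)
    then have "summable h" unfolding h_def by (intro summable_of_real summable_mult)
    moreover have "range h \<subseteq> \<real>\<^sub>\<ge>\<^sub>0" using C by (auto simp: h_def simp del: of_real_mult of_real_power of_real_add)
    moreover have "norm (f n y) \<le> norm (h n)" if y: "y \<in> ball s d \<inter> {s. Re s > 0}" for n y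
    proof -
      have ds: "norm (s - y) < d" using y by (simp add: dist_norm)
      then have "\<bar>Re s - Re y\<bar> < d" using abs_Re_le_cmod[of "s - y"] by simp
      then have Re: "Re y \<ge> d" unfolding d_def by linarith
      have ny: "norm y \<le> norm s + d" using ds norm_triangle_ineq2[of y s] by (simp add: norm_minus_commute)
      have "norm (f n y) \<le> C * (norm y + 1)\<^sup>2 * real (Suc n) powr (- Re y - 1)" using bd y by simp
      also have "\<dots> \<le> C * (norm s + d + 1)\<^sup>2 * real (Suc n) powr (- d - 1)"
        using ny Re C d by (intro mult_mono power_mono powr_mono) auto
      also have "\<dots> = norm (h n)" unfolding h_def norm_of_real using C by (simp add: abs_mult)
      finally show ?thesis .
    qed
    ultimately show "\<exists>d h. 0 < d \<and> summable h \<and> range h \<subseteq> \<real>\<^sub>\<ge>\<^sub>0 \<and>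
        (\<forall>\<^sub>F n in sequentially. \<forall>y\<in>ball s d \<inter> {s. Re s > 0}. cmod (f n y) \<le> cmod (h n))"
      using d by (intro exI[of _ d] exI[of _ h] conjI always_eventually allI ballI) auto
  qed
  show ?thesis
  proof (rule that[of g])
    show "g holomorphic_on {s. Re s > 0}"
      using g by (auto simp: holomorphic_on_def intro: field_differentiable_at_within)
  qed (use g in auto)
qed

lemma nps_tendsto_0:
  assumes "Re s > 0"
  shows "(\<lambda>n. nps (Suc n) s) \<longlonglongrightarrow> 0"
proof (rule tendsto_norm_zero_cancel)
  have "filterlim (\<lambda>n. real (Suc n)) at_top sequentially"
    by (rule filterlim_compose[OF filterlim_real_sequentially filterlim_Suc])
  then have "(\<lambda>n. real (Suc n) powr (- Re s)) \<longlonglongrightarrow> 0"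
    using assms by (intro tendsto_neg_powr) auto
  then show "(\<lambda>n. norm (nps (Suc n) s)) \<longlonglongrightarrow> 0" by (simp add: norm_nps)
qed

text \<open>\<open>Z\<close> is (s - 1) times the zeta function, so the pole is absorbed and
  \<open>Z 1 = 1\<close> records its residue. The summand 1 in \<open>1 + g s\<close> compensates
  the telescoping sum of (n+1)^(1-s) - n^(1-s), which is -1.\<close>

lemma zeta_continuation:
  obtains Z where "Z holomorphic_on {s. Re s > 0}" "Z 1 = 1"
    "\<And>s. Re s > 1 \<Longrightarrow> has_dsum (\<lambda>_. 1) s (Z s / (s - 1))"
proof -
  define w where "w n s = (s - 1) * nps (Suc n) s + nps (Suc (Suc n)) (s - 1) - nps (Suc n) (s - 1)" for n s
  obtain g where g: "g holomorphic_on {s. Re s > 0}" "\<And>s. Re s > 0 \<Longrightarrow> (\<lambda>n. w n s) sums g s"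
  proof (rule half_plane_series[where f = w and C = 1])
    show "w n holomorphic_on {s. Re s > 0}" for n unfolding w_def by (intro holomorphic_intros)
    fix n s assume s: "Re s > 0"
    have "norm (w n s) \<le> norm (s - 1) * norm s * real (Suc n) powr (- Re s - 1)"
      unfolding w_def using zeta_term_bound[of "Suc n" s] s by simp
    also have "\<dots> \<le> (norm s + 1) * (norm s + 1) * real (Suc n) powr (- Re s - 1)"
      using norm_triangle_ineq4[of s 1] by (intro mult_right_mono mult_mono) auto
    finally show "norm (w n s) \<le> 1 * (norm s + 1)\<^sup>2 * real (Suc n) powr (- Re s - 1)"
      by (simp add: power2_eq_square)
  qed blast
  show ?thesis
  proof (rule that[of "\<lambda>s. 1 + g s"])
    show "(\<lambda>s. 1 + g s) holomorphic_on {s. Re s > 0}" by (intro holomorphic_intros g)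
    have "w n 1 = 0" for n by (simp add: w_def nps_def del: of_nat_Suc)
    then have "(\<lambda>n. 0) sums g 1" using g(2)[of 1] by simp
    then show "1 + g 1 = 1" using sums_unique2[OF sums_zero] by simp
    fix s :: complex assume s: "Re s > 1"
    obtain S where S: "has_dsum (\<lambda>_. 1) s S" using bounded_has_dsum[of "\<lambda>_. 1" 1 s] s by auto
    have "(\<lambda>n. (s - 1) * nps (Suc n) s) sums ((s - 1) * S)"
      using has_dsum_imp_sums[OF S] by (intro sums_mult) simp
    moreover have "(\<lambda>n. nps (Suc (Suc n)) (s - 1) - nps (Suc n) (s - 1)) sums (0 - nps (Suc 0) (s - 1))"
      by (rule telescope_sums[where f = "\<lambda>n. nps (Suc n) (s - 1)"]) (use s in \<open>auto intro: nps_tendsto_0\<close>)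
    ultimately have "(\<lambda>n. (s - 1) * nps (Suc n) s + (nps (Suc (Suc n)) (s - 1) - nps (Suc n) (s - 1))) sums ((s - 1) * S + (0 - nps (Suc 0) (s - 1)))"
      by (rule sums_add)
    then have "(\<lambda>n. w n s) sums ((s - 1) * S - 1)" by (simp add: w_def add_diff_eq)
    then have "g s = (s - 1) * S - 1" using g(2)[of s] s sums_unique2 by fastforce
    moreover have "s \<noteq> 1" using s by auto
    ultimately have "S = (1 + g s) / (s - 1)" by (simp add: field_simps)
    then show "has_dsum (\<lambda>_. 1) s ((1 + g s) / (s - 1))" using S by simp
  qed
qed

text \<open>Summation by parts: the partial sums are bounded and n^(-s) - (n+1)^(-s) is of order
  n^(-Re s - 1).\<close>

lemma bounded_sums_continuation:
  assumes bd: "\<And>n. norm (\<Sum>k=1..n. \<psi> k) \<le> C"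
  obtains g where "g holomorphic_on {s. Re s > 0}" "\<And>s. Re s > 1 \<Longrightarrow> has_dsum \<psi> s (g s)"
proof -
  define A where "A n = (\<Sum>k=1..n. \<psi> k)" for n
  define w where "w n s = A (Suc n) * (nps (Suc n) s - nps (Suc (Suc n)) s)" for n s
  have C: "C \<ge> 0" using bd[of 0] by simp
  obtain g where g: "g holomorphic_on {s. Re s > 0}" "\<And>s. Re s > 0 \<Longrightarrow> (\<lambda>n. w n s) sums g s"
  proof (rule half_plane_series[where f = w and C = C])
    show "w n holomorphic_on {s. Re s > 0}" for n unfolding w_def by (intro holomorphic_intros)
    fix n s assume s: "Re s > 0"
    have "norm (w n s) \<le> C * (norm s * real (Suc n) powr (- Re s - 1))"
      unfolding w_def norm_mult A_def using s C
      by (intro mult_mono bd nps_diff_bound) auto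
    also have "\<dots> \<le> C * ((norm s + 1)\<^sup>2 * real (Suc n) powr (- Re s - 1))"
      using C by (intro mult_left_mono mult_right_mono) (auto simp: power2_eq_square algebra_simps add_increasing)
    finally show "norm (w n s) \<le> C * (norm s + 1)\<^sup>2 * real (Suc n) powr (- Re s - 1)" by (simp add: mult.assoc)
  qed blast
  show ?thesis
  proof (rule that[OF g(1)])
    fix s :: complex assume s: "Re s > 1"
    have b\<psi>: "norm (\<psi> n) \<le> max (norm (\<psi> 0)) (2 * C)" for n
    proof (cases n)
      case (Suc m)
      have "\<psi> n = A n - A m" by (simp add: A_def Suc)
      moreover have "norm (A n - A m) \<le> C + C"
        using norm_triangle_ineq4[of "A n" "A m"] bd[of n, folded A_def] bd[of m, folded A_def] by linarith
      ultimately show ?thesis by simp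
    qed simp
    obtain S where S: "has_dsum \<psi> s S" using bounded_has_dsum[of \<psi>, OF b\<psi> s] by blast
    have part: "(\<Sum>k<N. \<psi> (Suc k) * nps (Suc k) s) = (\<Sum>k<N. w k s) + A N * nps (Suc N) s" for N
      by (induction N) (simp_all add: w_def A_def algebra_simps)
    have "(\<lambda>N. A N * nps (Suc N) s) \<longlonglongrightarrow> 0"
    proof (rule Lim_null_comparison)
      show "\<forall>\<^sub>F N in sequentially. norm (A N * nps (Suc N) s) \<le> C * norm (nps (Suc N) s)"
        using bd by (intro always_eventually allI) (simp add: norm_mult A_def mult_right_mono)
      show "(\<lambda>N. C * norm (nps (Suc N) s)) \<longlonglongrightarrow> 0"
        using s by (intro tendsto_mult_right_zero tendsto_norm_zero nps_tendsto_0) simp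
    qed
    moreover have "(\<lambda>N. \<Sum>k<N. w k s) \<longlonglongrightarrow> g s" using g(2)[of s] s by (simp add: sums_def)
    ultimately have "(\<lambda>N. \<Sum>k<N. \<psi> (Suc k) * nps (Suc k) s) \<longlonglongrightarrow> g s + 0"
      unfolding part by (intro tendsto_add)
    moreover have "(\<lambda>N. \<Sum>k<N. \<psi> (Suc k) * nps (Suc k) s) \<longlonglongrightarrow> S"
      using has_dsum_imp_sums[OF S] by (simp add: sums_def)
    ultimately have "S = g s" using LIMSEQ_unique by fastforce
    then show "has_dsum \<psi> s (g s)" using S by simp
  qed
qed

lemma periodic_sums_bounded:
  fixes \<psi> :: "nat \<Rightarrow> complex"
  assumes q: "q > 0" and per: "\<And>n. \<psi> (n + q) = \<psi> n" and zero: "(\<Sum>k=1..q. \<psi> k) = 0"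
  shows "\<exists>C. \<forall>n. norm (\<Sum>k=1..n. \<psi> k) \<le> C"
proof -
  define A where "A n = (\<Sum>k=1..n. \<psi> k)" for n
  have Aq: "A (n + q) = A n" for n
  proof (induction n)
    case (Suc n)
    then show ?case using per[of "Suc n"] by (simp add: A_def)
  qed (use zero in \<open>simp add: A_def\<close>)
  have "A (r + q * j) = A r" for r j
  proof (induction j)
    case (Suc j)
    have "r + q * Suc j = (r + q * j) + q" by simp
    then show ?case using Aq Suc by metis
  qed simp
  then have "A n = A (n mod q)" for n by (metis mod_mult_div_eq)
  then have "norm (A n) \<le> (\<Sum>r<q. norm (A r))" for n
    using q member_le_sum[of "n mod q" "{..<q}" "\<lambda>r. norm (A r)"] by simp
  then show ?thesis unfolding A_def by blast
qed

text \<open>Subtracting the mean over a period leaves coefficients with bounded partial sums; the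
  mean itself contributes a multiple of zeta, which carries the only possible pole.\<close>

lemma periodic_continuation:
  fixes \<psi> :: "nat \<Rightarrow> complex"
  assumes q: "q > 0" and per: "\<And>n. \<psi> (n + q) = \<psi> n"
  obtains Z L m where "Z holomorphic_on {s. Re s > 0}" "Z 1 = 1" "L holomorphic_on {s. Re s > 0}"
    "\<And>s. Re s > 1 \<Longrightarrow> has_dsum \<psi> s (m * (Z s / (s - 1)) + L s)"
proof -
  obtain Z where Z: "Z holomorphic_on {s. Re s > 0}" "Z 1 = 1"
    "\<And>s. Re s > 1 \<Longrightarrow> has_dsum (\<lambda>_. 1) s (Z s / (s - 1))" using zeta_continuation by blast
  define m where "m = (\<Sum>k=1..q. \<psi> k) / of_nat q"
  have "(\<Sum>k=1..q. \<psi> k - m) = 0" using q by (simp add: m_def sum_subtractf)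
  then obtain C where C: "\<And>n. norm (\<Sum>k=1..n. \<psi> k - m) \<le> C"
    using periodic_sums_bounded[of q "\<lambda>n. \<psi> n - m"] q per by auto
  obtain L where L: "L holomorphic_on {s. Re s > 0}" "\<And>s. Re s > 1 \<Longrightarrow> has_dsum (\<lambda>n. \<psi> n - m) s (L s)"
    using bounded_sums_continuation[OF C] by blast
  show ?thesis
  proof (rule that[OF Z(1,2) L(1)])
    fix s :: complex assume s: "Re s > 1"
    show "has_dsum \<psi> s (m * (Z s / (s - 1)) + L s)"
      using has_dsum_add[OF has_dsum_cmult[OF Z(3)[OF s], of m] L(2)[OF s]] by simp
  qed
qed

section \<open>Landau's theorem on nonnegative coefficients\<close>

text \<open>The zeros accumulate at 0, but only from one side, and nothing is given at 0.
  Multiplying by w shifts the coefficients and makes the function vanish at 0, which is the form in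
  which isolation of zeros is applied.\<close>

lemma real_powser_unique:
  fixes a :: "nat \<Rightarrow> real"
  assumes "\<epsilon> > 0" and z: "\<And>w. 0 < w \<Longrightarrow> w < \<epsilon> \<Longrightarrow> (\<lambda>k. a k * w ^ k) sums 0"
  shows "a k = 0"
proof (rule ccontr)
  assume nz: "a k \<noteq> 0"
  define b where "b n = (case n of 0 \<Rightarrow> 0 | Suc j \<Rightarrow> a j)" for n
  have shift: "(\<lambda>n. b n * w ^ n) sums 0" if "0 < w" "w < \<epsilon>" for w
  proof -
    have "(\<lambda>n. w * (a n * w ^ n)) sums (w * 0)" using z that by (intro sums_mult)
    then have "(\<lambda>n. b (Suc n) * w ^ Suc n) sums 0" by (simp add: b_def mult_ac)
    then show ?thesis using sums_Suc_iff[of "\<lambda>n. b n * w ^ n" 0] by (simp add: b_def)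
  qed
  define f where "f x = suminf (\<lambda>n. b n * x ^ n)" for x
  have f0: "f 0 = 0" by (simp add: f_def powser_zero b_def)
  obtain s where s: "s > 0" "\<And>x. x \<in> cball 0 s - {0} \<Longrightarrow> f x \<noteq> 0"
  proof (rule powser_0_nonzero[where a = b and \<xi> = 0 and r = \<epsilon> and f = f and m = "Suc k"])
    fix x :: real assume "norm (x - 0) < \<epsilon>"
    then obtain K where K: "\<bar>x\<bar> < K" "K < \<epsilon>" using dense by auto
    then have "summable (\<lambda>n. b n * K ^ n)" using shift[of K] by (auto simp: sums_iff)
    then have "summable (\<lambda>n. b n * x ^ n)" by (rule powser_inside) (use K in simp)
    then show "(\<lambda>n. b n * (x - 0) ^ n) sums f x" by (simp add: f_def summable_sums)
  qed (use nz f0 assms(1) in \<open>auto simp: b_def\<close>)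
  define w where "w = min s (\<epsilon> / 2)"
  have w: "0 < w" "w < \<epsilon>" "w \<le> s" using s(1) assms(1) by (auto simp: w_def)
  then have "f w = 0" using shift[of w] by (simp add: f_def sums_iff)
  then show False using s(2)[of w] w by simp
qed

lemma exp_has_sum:
  fixes x :: real
  assumes "x \<ge> 0"
  shows "((\<lambda>k. x ^ k / fact k) has_sum exp x) UNIV"
  using exp_converges[of x] assms
  by (intro sums_nonneg_imp_has_sum) (simp_all add: divide_inverse_commute)

text \<open>Expanding n^w = exp(w ln n) gives a double series \<open>t n k\<close> w^k with
  nonnegative terms, so the order of summation is free. Summing over n first yields a power series
  that agrees with D on (c - \<open>\<epsilon>\<close>, c), hence has the Taylor coefficients of D
  at c and converges for all w < R. Swapping back gives the Dirichlet series at c - w.\<close>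

lemma landau_step:
  fixes b :: "nat \<Rightarrow> real"
  assumes nn: "\<And>n. n \<ge> 1 \<Longrightarrow> b n \<ge> 0"
    and D: "D holomorphic_on ball (of_real c) R" and \<epsilon>: "0 < \<epsilon>" "\<epsilon> \<le> R"
    and P: "\<And>x. c - \<epsilon> < x \<Longrightarrow> x < c \<Longrightarrow> ((\<lambda>n. b n * real n powr (- x)) has_sum Re (D (of_real x))) {1..}"
    and w: "0 < w" "w < R"
  shows "((\<lambda>n. b n * real n powr (- (c - w))) has_sum Re (D (of_real (c - w)))) {1..}"
proof -
  define h where "h z = D (of_real c - z)" for z
  define d where "d k = Re ((deriv ^^ k) h 0 / fact k)" for k
  define t where "t n k = b n * real n powr (- c) * ln (real n) ^ k / fact k" for n k
  have t0: "t n k \<ge> 0" if "n \<ge> 1" for n k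
    using nn[OF that] that by (simp add: t_def)
  have h: "h holomorphic_on ball 0 R"
    unfolding h_def by (rule holomorphic_on_compose_gen[OF _ D, unfolded o_def])
      (auto intro!: holomorphic_intros simp: dist_norm)
  have dsum: "(\<lambda>k. d k * v ^ k) sums Re (D (of_real (c - v)))" if "\<bar>v\<bar> < R" for v
  proof -
    have "(\<lambda>k. (deriv ^^ k) h 0 / fact k * (of_real v - 0) ^ k) sums h (of_real v)"
      by (rule holomorphic_power_series[OF h]) (use that in simp)
    then have "(\<lambda>k. Re ((deriv ^^ k) h 0 / fact k * (of_real v - 0) ^ k)) sums Re (h (of_real v))"
      by (rule sums_Re)
    moreover have "Re (z * (of_real v - 0) ^ k) = Re z * v ^ k" for z k
      by (simp flip: of_real_power)
    ultimately show ?thesis by (simp only: d_def h_def of_real_diff)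
  qed
  have inner: "((\<lambda>k. t n k * v ^ k) has_sum (b n * real n powr (- (c - v)))) UNIV" if "n \<ge> 1" "v > 0" for n v
  proof -
    have "((\<lambda>k. b n * real n powr (- c) * ((v * ln (real n)) ^ k / fact k)) has_sum
        (b n * real n powr (- c) * exp (v * ln (real n)))) UNIV"
      using that by (intro has_sum_cmult_right exp_has_sum) auto
    moreover have "exp (v * ln (real n)) = real n powr v" using that by (simp add: powr_def)
    moreover have "real n powr (- c) * real n powr v = real n powr (- (c - v))"
      by (simp flip: powr_add)
    ultimately show ?thesis by (simp add: t_def power_mult_distrib mult_ac)
  qed
  have swap: "((\<lambda>(k, n). t n k * v ^ k) has_sum V) (UNIV \<times> {1..}) \<longleftrightarrow> ((\<lambda>(n, k). t n k * v ^ k) has_sum V) ({1..} \<times> UNIV)" for v V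
    by (rule has_sum_reindex_bij_witness[where i = prod.swap and j = prod.swap]) auto
  define e where "e k = infsum (\<lambda>n. t n k) {1..}" for k
  have fwd: "(\<lambda>k. e k * v ^ k) sums Re (D (of_real (c - v)))" "\<And>k. (\<lambda>n. t n k) summable_on {1..}"
    if v: "0 < v" "v < \<epsilon>" for v
  proof -
    have P': "((\<lambda>n. b n * real n powr (- (c - v))) has_sum Re (D (of_real (c - v)))) {1..}"
      using v by (intro P) auto
    have "(\<lambda>(n, k). t n k * v ^ k) summable_on {1..} \<times> UNIV"
      by (rule summable_on_SigmaI[where g = "\<lambda>n. b n * real n powr (- (c - v))"])
         (use inner v t0 P' in \<open>auto intro: has_sum_imp_summable\<close>)
    then have "((\<lambda>(n, k). t n k * v ^ k) has_sum Re (D (of_real (c - v)))) ({1..} \<times> UNIV)"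
      by (intro has_sum_SigmaI[where g = "\<lambda>n. b n * real n powr (- (c - v))"])
         (use inner v P' in auto)
    then have sw: "((\<lambda>(k, n). t n k * v ^ k) has_sum Re (D (of_real (c - v)))) (UNIV \<times> {1..})"
      using swap by blast
    have sm: "(\<lambda>n. t n k) summable_on {1..}" for k
    proof -
      have "(\<lambda>n. t n k * v ^ k) summable_on {1..}"
        using summable_on_SigmaD1[where f = "\<lambda>k n. t n k * v ^ k" and A = UNIV and x = k] sw
        by (auto intro: has_sum_imp_summable)
      then have "(\<lambda>n. (t n k * v ^ k) * (1 / v ^ k)) summable_on {1..}" by (rule summable_on_cmult_left)
      then show ?thesis using v by simp
    qed
    then show "(\<lambda>n. t n k) summable_on {1..}" for k .
    have "((\<lambda>k. e k * v ^ k) has_sum Re (D (of_real (c - v)))) UNIV"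
      by (rule has_sum_SigmaD[OF sw]) (use sm in \<open>auto simp: e_def intro!: has_sum_cmult_left has_sum_infsum\<close>)
    then show "(\<lambda>k. e k * v ^ k) sums Re (D (of_real (c - v)))" by (rule has_sum_imp_sums)
  qed
  have ed: "e k = d k" for k
  proof -
    have "e k - d k = 0"
    proof (rule real_powser_unique[OF \<epsilon>(1)])
      fix v assume v: "0 < v" "v < \<epsilon>"
      have "(\<lambda>k. e k * v ^ k - d k * v ^ k) sums (Re (D (of_real (c - v))) - Re (D (of_real (c - v))))"
        using fwd(1)[OF v] dsum[of v] v \<epsilon> by (intro sums_diff) auto
      then show "(\<lambda>k. (e k - d k) * v ^ k) sums 0" by (simp add: left_diff_distrib)
    qed
    then show ?thesis by simp
  qed
  have e0: "e k \<ge> 0" for k unfolding e_def using t0 by (intro infsum_nonneg) auto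
  have es: "((\<lambda>k. e k * w ^ k) has_sum Re (D (of_real (c - w)))) UNIV"
    using dsum[of w] w e0 by (intro sums_nonneg_imp_has_sum) (auto simp: ed)
  have tk: "((\<lambda>n. t n k * w ^ k) has_sum (e k * w ^ k)) {1..}" for k
    using fwd(2)[of "\<epsilon> / 2" k] \<epsilon> unfolding e_def by (intro has_sum_cmult_left has_sum_infsum) auto
  have "(\<lambda>(k, n). t n k * w ^ k) summable_on UNIV \<times> {1..}"
    by (rule summable_on_SigmaI[where g = "\<lambda>k. e k * w ^ k"])
       (use tk es t0 w in \<open>auto intro: has_sum_imp_summable\<close>)
  then have "((\<lambda>(k, n). t n k * w ^ k) has_sum Re (D (of_real (c - w)))) (UNIV \<times> {1..})"
    by (intro has_sum_SigmaI[where g = "\<lambda>k. e k * w ^ k"]) (use tk es in auto)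
  then have "((\<lambda>(n, k). t n k * w ^ k) has_sum Re (D (of_real (c - w)))) ({1..} \<times> UNIV)"
    using swap by blast
  then show ?thesis by (rule has_sum_SigmaD) (use inner w in auto)
qed

text \<open>If the infimum of the abscissas of convergence were positive, D would be regular around
  it, and one Landau step from a centre slightly to its right would reach points to its
  left.\<close>

lemma landau_singularity:
  fixes b :: "nat \<Rightarrow> real"
  assumes nn: "\<And>n. n \<ge> 1 \<Longrightarrow> b n \<ge> 0"
    and D: "D holomorphic_on U" "open U" "\<And>x. x > 0 \<Longrightarrow> of_real x \<in> U"
    and P1: "\<And>x. x > 1 \<Longrightarrow> ((\<lambda>n. b n * real n powr (- x)) has_sum Re (D (of_real x))) {1..}"
    and x: "x > 0"
  shows "((\<lambda>n. b n * real n powr (- x)) has_sum Re (D (of_real x))) {1..}"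
proof -
  define P where "P x \<longleftrightarrow> ((\<lambda>n. b n * real n powr (- x)) has_sum Re (D (of_real x))) {1..}" for x
  define S where "S = {x. 0 < x \<and> (\<forall>y>x. P y)}"
  have S1: "1 \<in> S" using P1 by (auto simp: S_def P_def)
  have bdd: "bdd_below S" by (auto simp: S_def intro!: bdd_belowI[of _ 0])
  have above: "P y" if "y > Inf S" for y
  proof -
    have "S \<noteq> {}" using S1 by auto
    from cInf_lessD[OF this that] obtain x where "x \<in> S" "x < y" ..
    then show ?thesis by (simp add: S_def)
  qed
  have "Inf S \<le> 0"
  proof (rule ccontr)
    assume "\<not> Inf S \<le> 0"
    then have pos: "Inf S > 0" by simp
    then obtain r where r: "r > 0" "ball (of_real (Inf S)) r \<subseteq> U"
      using D(2,3) open_contains_ball by blast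
    \<comment> \<open>With centre Inf S + \<open>\<epsilon>\<close> and radius 3
      \<open>\<epsilon>\<close> the disc stays within distance 4 \<open>\<epsilon>\<close> of Inf S,
      hence inside U, and it reaches down to Inf S - 2 \<open>\<epsilon>\<close>, which is still
      positive.\<close>
    define \<epsilon> where "\<epsilon> = min (r / 4) (Inf S / 4)"
    have \<epsilon>: "\<epsilon> > 0" "4 * \<epsilon> \<le> r" "4 * \<epsilon> \<le> Inf S" using r pos by (auto simp: \<epsilon>_def)
    define c where "c = Inf S + \<epsilon>"
    have "ball (complex_of_real c) (3 * \<epsilon>) \<subseteq> ball (of_real (Inf S)) r"
    proof
      fix z assume "z \<in> ball (complex_of_real c) (3 * \<epsilon>)"
      then have "norm (of_real c - z) < 3 * \<epsilon>" by (simp add: dist_norm)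
      moreover have "norm (complex_of_real (Inf S) - of_real c) = \<epsilon>"
        using \<epsilon> by (simp add: c_def)
      moreover have "norm (of_real (Inf S) - z) \<le> norm (complex_of_real (Inf S) - of_real c) + norm (of_real c - z)"
        using norm_triangle_ineq[of "complex_of_real (Inf S) - of_real c" "of_real c - z"] by simp
      ultimately show "z \<in> ball (of_real (Inf S)) r" using \<epsilon> by (simp add: dist_norm)
    qed
    then have hol: "D holomorphic_on ball (of_real c) (3 * \<epsilon>)"
      using D(1) r holomorphic_on_subset by blast
    have "P y" if "y > Inf S - 2 * \<epsilon>" for y
    proof (cases "y \<ge> c")
      case True
      then show ?thesis using above[of y] \<epsilon> by (simp add: c_def)
    next
      case False
      have "P (c - (c - y))"
        unfolding P_def
      proof (rule landau_step[OF nn hol, where \<epsilon> = \<epsilon>])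
        fix x assume "c - \<epsilon> < x" "x < c"
        then show "((\<lambda>n. b n * real n powr (- x)) has_sum Re (D (of_real x))) {1..}"
          using above[of x] by (simp add: c_def P_def)
      qed (use \<epsilon> False that in \<open>auto simp: c_def\<close>)
      then show ?thesis by simp
    qed
    then have "Inf S - 2 * \<epsilon> \<in> S" using \<epsilon> by (auto simp: S_def)
    then have "Inf S \<le> Inf S - 2 * \<epsilon>" using bdd cInf_lower by blast
    then show False using \<epsilon> by simp
  qed
  then show ?thesis using above[of x] x by (simp add: P_def)
qed

section \<open>Ingham's nonvanishing theorem\<close>

text \<open>These are the coefficients of 1 / ((1-x)^2 (1 - \<open>\<gamma>\<close> x) (1 - cnj
  \<open>\<gamma>\<close> x)), the local factor at a prime in \<open>ingham_nonvanishing\<close>.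
  For unimodular \<open>\<gamma>\<close> they satisfy \<open>\<beta> (k+2)\<close> =
  \<open>\<beta> k\<close> + |S (k+2)|^2, so positivity spreads from k = 0 and k = 1, and the even
  ones stay above \<open>\<beta> 0\<close> = 1.\<close>

lemma geometric_convolution:
  fixes \<gamma> :: complex
  assumes "\<gamma> = 0 \<or> norm \<gamma> = 1"
  defines "S \<equiv> \<lambda>i. \<Sum>j\<le>i. \<gamma> ^ j"
  defines "\<beta> \<equiv> \<lambda>k. \<Sum>i\<le>k. S i * cnj (S (k - i))"
  shows "\<beta> k \<in> \<real>\<^sub>\<ge>\<^sub>0" "even k \<Longrightarrow> 1 \<le> Re (\<beta> k)"
proof -
  have "\<beta> k \<in> \<real>\<^sub>\<ge>\<^sub>0 \<and> (even k \<longrightarrow> 1 \<le> Re (\<beta> k))"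
  proof (cases "\<gamma> = 0")
    case True
    have "S i = 1" for i unfolding S_def True by (induction i) auto
    then show ?thesis by (simp add: \<beta>_def complex_nonneg_Reals_iff)
  next
    case False
    then have "norm \<gamma> = 1" using assms(1) by simp
    then have g: "\<gamma> * cnj \<gamma> = 1" by (simp flip: complex_norm_square)
    have S0: "S 0 = 1" by (simp add: S_def)
    have SS: "S (Suc i) = 1 + \<gamma> * S i" for i
      unfolding S_def by (subst sum.atMost_Suc_shift) (simp add: sum_distrib_left)
    have prod: "S (Suc i) * cnj (S (Suc j)) = S (Suc i) + cnj (S (Suc j)) - 1 + S i * cnj (S j)" for i j
    proof -
      have "S (Suc i) * cnj (S (Suc j)) = 1 + \<gamma> * S i + cnj \<gamma> * cnj (S j) + (\<gamma> * cnj \<gamma>) * (S i * cnj (S j))"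
        by (simp add: SS algebra_simps)
      then show ?thesis by (simp add: g SS)
    qed
    have sq: "S n * cnj (S n) = 1 + (\<Sum>i<n. S (Suc i) + cnj (S (Suc i)) - 1)" for n
      by (induction n) (simp_all add: S0 prod)
    have rec: "\<beta> (Suc (Suc k)) = \<beta> k + S (Suc (Suc k)) * cnj (S (Suc (Suc k)))" for k
    proof -
      have "\<beta> (Suc (Suc k)) = S 0 * cnj (S (Suc (Suc k))) + S (Suc (Suc k)) * cnj (S 0)
          + (\<Sum>i\<le>k. S (Suc i) * cnj (S (Suc k - i)))"
        unfolding \<beta>_def by (subst sum.atMost_Suc_shift) simp
      also have "(\<Sum>i\<le>k. S (Suc i) * cnj (S (Suc k - i))) = (\<Sum>i\<le>k. (S (Suc i) - 1) + cnj (S (Suc (k - i))) + S i * cnj (S (k - i)))"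
        by (intro sum.cong refl) (simp add: Suc_diff_le prod)
      also have "\<dots> = (\<Sum>i\<le>k. S (Suc i) - 1) + (\<Sum>i\<le>k. cnj (S (Suc (k - i)))) + \<beta> k"
        by (simp add: sum.distrib \<beta>_def)
      also have "(\<Sum>i\<le>k. cnj (S (Suc (k - i)))) = (\<Sum>i\<le>k. cnj (S (Suc i)))"
        by (rule sum.nat_diff_reindex[where g = "\<lambda>i. cnj (S (Suc i))" and n = "Suc k", simplified lessThan_Suc_atMost, simplified])
      finally have "\<beta> (Suc (Suc k)) = cnj (S (Suc (Suc k))) + S (Suc (Suc k))
          + ((\<Sum>i\<le>k. S (Suc i) - 1) + (\<Sum>i\<le>k. cnj (S (Suc i))) + \<beta> k)" by (simp add: S0)
      moreover have "S (Suc (Suc k)) * cnj (S (Suc (Suc k))) = S (Suc (Suc k)) + cnj (S (Suc (Suc k)))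
          + ((\<Sum>i\<le>k. S (Suc i) - 1) + (\<Sum>i\<le>k. cnj (S (Suc i))))"
        unfolding sq by (simp add: lessThan_Suc_atMost sum.distrib sum_subtractf)
      ultimately show ?thesis by simp
    qed
    have pos: "S n * cnj (S n) \<in> \<real>\<^sub>\<ge>\<^sub>0" "Re (S n * cnj (S n)) \<ge> 0" for n
      unfolding complex_norm_square[symmetric] by (simp_all flip: of_real_power)
    show ?thesis
    proof (induction k rule: nat_induct2)
      case 0
      then show ?case by (simp add: \<beta>_def S0)
    next
      case 1
      have "\<beta> 1 = S 1 * cnj (S 1)" by (simp add: \<beta>_def S0 SS algebra_simps g)
      then show ?case using pos[of 1] by simp
    next
      case (step k)
      define X where "X = S (Suc (Suc k)) * cnj (S (Suc (Suc k)))"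
      have "X \<in> \<real>\<^sub>\<ge>\<^sub>0" "Re X \<ge> 0" unfolding X_def by (rule pos)+
      moreover have "\<beta> (k + 2) = \<beta> k + X" by (simp add: rec X_def)
      ultimately show ?case using step by (auto intro: nonneg_Reals_add_I)
    qed
  qed
  then show "\<beta> k \<in> \<real>\<^sub>\<ge>\<^sub>0" "even k \<Longrightarrow> 1 \<le> Re (\<beta> k)" by auto
qed

text \<open>Ingham: if \<open>f 1 = 0\<close>, then \<open>\<zeta>\<^sup>2 f (cnj \<circ> f \<circ> cnj)\<close> is regular on the positive axis. Its
  coefficients are nonnegative and at least \<open>1\<close> on squares, so its Dirichlet series diverges at
  \<open>1/2\<close>, contradicting Landau's theorem.\<close>

lemma ingham_nonvanishing:
  assumes g: "\<And>m n. g (m * n) = g m * g n" "g 1 = 1" "\<And>n. n > 0 \<Longrightarrow> g n = 0 \<or> norm (g n) = 1"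
    and f: "f holomorphic_on U" and U: "open U" "\<And>x. x > 0 \<Longrightarrow> of_real x \<in> U" "cnj ` U = U" "U \<subseteq> {s. Re s > 0}"
    and fg: "\<And>s. s \<in> U \<Longrightarrow> Re s > 1 \<Longrightarrow> has_dsum g s (f s)"
  shows "f 1 \<noteq> 0"
proof
  assume f1: "f 1 = 0"
  obtain Z where Z: "Z holomorphic_on {s. Re s > 0}"
    "\<And>s. Re s > 1 \<Longrightarrow> has_dsum (\<lambda>_. 1) s (Z s / (s - 1))" using zeta_continuation by blast
  define fc where "fc = cnj \<circ> f \<circ> cnj"
  \<comment> \<open>For a function vanishing at 1 this is h z / (z - 1) with the removable
    singularity filled in. The two zeros, of \<open>f\<close> and of \<open>fc\<close>, absorb the
    double pole of zeta squared.\<close>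
  define q where "q h z = (if z = 1 then deriv h 1 else (h z - h 1) / (z - 1))" for h :: "complex \<Rightarrow> complex" and z
  define D where "D s = Z s ^ 2 * (q f s * q fc s)" for s
  define r where "r = dconv (\<lambda>_. 1) g"
  define rc where "rc = dconv (\<lambda>_. 1) (\<lambda>n. cnj (g n))"
  define B where "B = dconv r rc"
  have fc: "fc holomorphic_on U" "fc 1 = 0"
    using holomorphic_on_compose_cnj_cnj[of f U] f U f1 by (auto simp: fc_def)
  have D: "D holomorphic_on U"
    unfolding D_def q_def
    using Z(1) U(4) holomorphic_on_subset pole_lemma_open[OF f U(1), of 1] pole_lemma_open[OF fc(1) U(1), of 1]
    by (intro holomorphic_intros) auto
  have DB: "has_dsum B (of_real x) (D (of_real x))" if x: "x > 1" for x
  proof -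
    have xU: "of_real x \<in> U" and x1: "complex_of_real x \<noteq> 1" using U(2)[of x] x by auto
    have h1: "has_dsum (\<lambda>_. 1) (of_real x) (Z (of_real x) / (of_real x - 1))" using Z(2) x by simp
    have h2: "has_dsum g (of_real x) (f (of_real x))" using fg[OF xU] x by simp
    have h3: "has_dsum (\<lambda>n. cnj (g n)) (of_real x) (fc (of_real x))"
      using has_dsum_cnj[OF h2] by (simp add: fc_def)
    have "has_dsum B (of_real x) ((Z (of_real x) / (of_real x - 1) * f (of_real x)) * (Z (of_real x) / (of_real x - 1) * fc (of_real x)))"
      unfolding B_def r_def rc_def by (intro has_dsum_dconv h1 h2 h3)
    then show ?thesis using x1 by (simp add: D_def q_def f1 fc power2_eq_square mult_ac)
  qed
  have mg: "mult_fun g" "mult_fun (\<lambda>n. cnj (g n))" using g by (auto simp: mult_fun_def)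
  have m1: "mult_fun (\<lambda>_. 1)" by (simp add: mult_fun_def)
  have mB: "mult_fun B" unfolding B_def r_def rc_def by (intro mult_fun_dconv mg m1)
  have gp: "g (p ^ i) = g p ^ i" for p i
    by (induction i) (use g in auto)
  have rp: "r (p ^ i) = (\<Sum>j\<le>i. g p ^ j)" and rcp: "rc (p ^ i) = cnj (\<Sum>j\<le>i. g p ^ j)" if "prime p" for p i
  proof -
    have "(\<Sum>j\<le>i. c ^ (i - j)) = (\<Sum>j\<le>i. c ^ j)" for c :: complex
      by (rule sum.nat_diff_reindex[where g = "\<lambda>j. c ^ j" and n = "Suc i", simplified lessThan_Suc_atMost, simplified])
    then show "r (p ^ i) = (\<Sum>j\<le>i. g p ^ j)" "rc (p ^ i) = cnj (\<Sum>j\<le>i. g p ^ j)"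
      unfolding r_def rc_def dconv_prime_power[OF that] gp by simp_all
  qed
  have Bp: "B (p ^ k) \<in> \<real>\<^sub>\<ge>\<^sub>0" "even k \<Longrightarrow> 1 \<le> Re (B (p ^ k))" if "prime p" for p k
  proof -
    have "g p = 0 \<or> norm (g p) = 1" using g(3)[of p] prime_gt_0_nat[OF that] by simp
    from geometric_convolution[OF this, of k]
    show "B (p ^ k) \<in> \<real>\<^sub>\<ge>\<^sub>0" "even k \<Longrightarrow> 1 \<le> Re (B (p ^ k))"
      unfolding B_def dconv_prime_power[OF that] rp[OF that] rcp[OF that] by auto
  qed
  have Bn: "B n \<in> \<real>\<^sub>\<ge>\<^sub>0" if "n > 0" for n
    using that
  proof (induction n rule: prime_power_induct)
    case 1
    then show ?case using mB by (simp add: mult_fun_def)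
  next
    case (step p k m)
    then show ?case using mult_fun_prime_power[OF mB step(1,3)] Bp by (simp add: nonneg_Reals_mult_I)
  qed
  have Bsq: "Re (B (n ^ 2)) \<ge> 1" if "n > 0" for n
    using that
  proof (induction n rule: prime_power_induct)
    case 1
    then show ?case using mB by (simp add: mult_fun_def)
  next
    case (step p k m)
    have "(p ^ k * m) ^ 2 = p ^ (2 * k) * m ^ 2" by (simp add: power_mult_distrib power_mult[symmetric] mult.commute)
    moreover have "\<not> p dvd m ^ 2" using step prime_dvd_power by blast
    ultimately have "B ((p ^ k * m) ^ 2) = B (p ^ (2 * k)) * B (m ^ 2)"
      using mult_fun_prime_power[OF mB step(1)] by simp
    moreover have "Im (B (p ^ (2 * k))) = 0" using Bp(1)[OF step(1)] by (simp add: complex_nonneg_Reals_iff)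
    moreover have "1 * 1 \<le> Re (B (p ^ (2 * k))) * Re (B (m ^ 2))"
      using Bp(2)[OF step(1), of "2 * k"] step by (intro mult_mono) auto
    ultimately show ?case by simp
  qed
  have conv: "((\<lambda>n. Re (B n) * real n powr (- x)) has_sum Re (D (of_real x))) {1..}" if "x > 0" for x
  proof (rule landau_singularity[OF _ D U(1,2) _ that])
    show "Re (B n) \<ge> 0" if "n \<ge> 1" for n using Bn[of n] that by (simp add: complex_nonneg_Reals_iff)
    fix x :: real assume "x > 1"
    have "((\<lambda>n. Re (B n * nps n (of_real x))) has_sum Re (D (of_real x))) {1..}"
      using DB[OF \<open>x > 1\<close>] by (intro has_sum_Re) (simp add: has_dsum_def)
    then show "((\<lambda>n. Re (B n) * real n powr (- x)) has_sum Re (D (of_real x))) {1..}"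
      by (simp add: nps_of_real)
  qed
  have "(\<lambda>n. Re (B n) * real n powr (- (1/2))) summable_on {1..}"
    using conv[of "1/2"] has_sum_imp_summable by fastforce
  then have "(\<lambda>n. Re (B n) * real n powr (- (1/2))) summable_on (\<lambda>m. m ^ 2) ` {1..}"
    by (rule summable_on_subset_banach) auto
  then have "(\<lambda>m. Re (B (m ^ 2)) * real (m ^ 2) powr (- (1/2))) summable_on {1..}"
    by (subst (asm) summable_on_reindex) (auto simp: inj_on_def o_def)
  then have "(\<lambda>m. 1 / real m) summable_on {1..}"
  proof (rule summable_on_comparison_test)
    fix m :: nat assume "m \<in> {1..}"
    then have m: "m > 0" by simp
    have "real (m ^ 2) powr (- (1/2)) = 1 / real m"
      using m by (simp add: powr_minus powr_half_sqrt real_sqrt_abs inverse_eq_divide)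
    moreover have "1 * (1 / real m) \<le> Re (B (m ^ 2)) * (1 / real m)"
      using Bsq[OF m] by (intro mult_right_mono) auto
    ultimately show "1 / real m \<le> Re (B (m ^ 2)) * real (m ^ 2) powr (- (1/2))" by simp
  qed auto
  then have "(\<lambda>m. 1 / real (Suc m)) summable_on UNIV"
    using summable_on_reindex_bij_witness[where S = UNIV and T = "{1..}" and i = "\<lambda>n. n - 1" and j = Suc
        and g = "\<lambda>m. 1 / real (Suc m)" and h = "\<lambda>m. 1 / real m"] by auto
  then have "summable (\<lambda>m. 1 / real (Suc m))"
    using has_sum_imp_sums summable_on_def sums_summable by metis
  then show False
    using not_summable_harmonic[where 'a = real] summable_Suc_iff[of "\<lambda>m. 1 / real m"]
    by (simp add: inverse_eq_divide)
qed

section \<open>The Moebius function in residue classes\<close>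

lemma powr_mvt:
  fixes a b y :: real
  assumes "0 < a" "a < b"
  obtains \<xi> where "a < \<xi>" "\<xi> < b" "b powr y - a powr y = y * \<xi> powr (y - 1) * (b - a)"
proof -
  have "\<exists>\<xi>. a < \<xi> \<and> \<xi> < b \<and> b powr y - a powr y = (b - a) * (y * \<xi> powr (y - 1))"
  proof (rule MVT2[OF assms(2)])
    fix x assume "a \<le> x" "x \<le> b"
    then have "x > 0" using assms by simp
    then show "((\<lambda>x. x powr y) has_real_derivative y * x powr (y - 1)) (at x)"
      by (rule has_real_derivative_powr)
  qed
  then show ?thesis using that by (auto simp: mult_ac)
qed

lemma sum_powr_tail:
  assumes "x > 0" "N \<ge> 1" "M \<ge> N"
  shows "(\<Sum>n\<in>{N<..M}. real n powr (- 1 - x)) \<le> (real N powr (- x) - real M powr (- x)) / x"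
  using assms(3)
proof (induction M rule: dec_induct)
  case (step M)
  obtain \<xi> where \<xi>: "real M < \<xi>" "\<xi> < real (Suc M)"
      "real (Suc M) powr (- x) - real M powr (- x) = (- x) * \<xi> powr (- x - 1) * (real (Suc M) - real M)"
    using powr_mvt[of "real M" "real (Suc M)" "- x"] step assms by auto
  have "real (Suc M) powr (- 1 - x) \<le> \<xi> powr (- x - 1)"
  proof -
    have "real (Suc M) powr (- x - 1) \<le> \<xi> powr (- x - 1)"
      using \<xi> step assms by (intro powr_mono2') auto
    moreover have "- 1 - x = - x - 1" by simp
    ultimately show ?thesis by (simp only:)
  qed
  then have "x * real (Suc M) powr (- 1 - x) \<le> x * \<xi> powr (- x - 1)"
    by (rule mult_left_mono) (use assms in simp)
  moreover have "real (Suc M) powr (- x) - real M powr (- x) = - (x * \<xi> powr (- x - 1))"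
    using \<xi>(3) by simp
  ultimately have "x * real (Suc M) powr (- 1 - x) \<le> real M powr (- x) - real (Suc M) powr (- x)"
    by linarith
  then have "real (Suc M) powr (- 1 - x) \<le> (real M powr (- x) - real (Suc M) powr (- x)) / x"
    using assms by (simp add: field_simps)
  moreover have "{N<..Suc M} = insert (Suc M) {N<..M}" using step by auto
  ultimately show ?case using step by (simp add: diff_divide_distrib)
qed simp

text \<open>Comparison with the integral of u^(x-1), whose integrand decreases for x at most 1 and
  increases otherwise. In the increasing case the last term is left over, which explains the second
  summand.\<close>

lemma sum_powr_initial:
  assumes "x > 0" "N \<ge> 1"
  shows "(\<Sum>n=1..N. real n powr (x - 1)) \<le> real N powr x / x + real N powr (x - 1)"
proof (cases "x \<le> 1")
  case True
  have "(\<Sum>n=1..N. real n powr (x - 1)) \<le> real N powr x / x"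
    using assms(2)
  proof (induction N rule: dec_induct)
    case base
    then show ?case using True assms by (simp add: field_simps)
  next
    case (step N)
    obtain \<xi> where \<xi>: "real N < \<xi>" "\<xi> < real (Suc N)"
        "real (Suc N) powr x - real N powr x = x * \<xi> powr (x - 1) * (real (Suc N) - real N)"
      using powr_mvt[of "real N" "real (Suc N)" x] step by auto
    have "real (Suc N) powr (x - 1) \<le> \<xi> powr (x - 1)"
      using \<xi> step True by (intro powr_mono2') auto
    then have "x * real (Suc N) powr (x - 1) \<le> real (Suc N) powr x - real N powr x"
      using \<xi>(3) assms mult_left_mono[of _ _ x] by simp
    then have "real (Suc N) powr (x - 1) \<le> (real (Suc N) powr x - real N powr x) / x"
      using assms by (simp add: field_simps)
    then show ?case using step by (simp add: diff_divide_distrib)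
  qed
  then show ?thesis by (simp add: add_increasing2)
next
  case False
  have "(\<Sum>n=1..N. real n powr (x - 1)) \<le> (real N powr x - 1) / x + real N powr (x - 1)"
    using assms(2)
  proof (induction N rule: dec_induct)
    case (step N)
    obtain \<xi> where \<xi>: "real N < \<xi>" "\<xi> < real (Suc N)"
        "real (Suc N) powr x - real N powr x = x * \<xi> powr (x - 1) * (real (Suc N) - real N)"
      using powr_mvt[of "real N" "real (Suc N)" x] step by auto
    have "real N powr (x - 1) \<le> \<xi> powr (x - 1)"
      using \<xi> step False by (intro powr_mono2) auto
    then have "x * real N powr (x - 1) \<le> real (Suc N) powr x - real N powr x"
      using \<xi>(3) assms mult_left_mono[of _ _ x] by simp
    then have "real N powr (x - 1) \<le> (real (Suc N) powr x - real N powr x) / x"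
      using assms by (simp add: field_simps)
    then show ?case using step by (simp add: diff_divide_distrib)
  qed simp
  also have "\<dots> \<le> real N powr x / x + real N powr (x - 1)"
    using assms by (simp add: divide_right_mono)
  finally show ?thesis .
qed

lemma cesaro_null:
  fixes b :: "nat \<Rightarrow> complex"
  assumes "b \<longlonglongrightarrow> 0"
  shows "(\<lambda>N. (\<Sum>n<N. b n) / of_nat N) \<longlonglongrightarrow> 0"
proof -
  have "null_mean (\<lambda>n. b (n - 1))"
  proof (rule null_meanI)
    fix \<epsilon> :: real assume \<epsilon>: "\<epsilon> > 0"
    then obtain n0 where n0: "\<And>n. n \<ge> n0 \<Longrightarrow> norm (b n) < \<epsilon> / 2"
      using assms LIMSEQ_iff[of b 0] half_gt_zero by (metis diff_zero)
    define B where "B = (\<Sum>n<n0. norm (b n))"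
    show "\<forall>\<^sub>F N in sequentially. norm (\<Sum>n=1..N. b (n - 1)) \<le> \<epsilon> * real N"
      using eventually_ge_at_top[of n0] eventually_ge_at_top[of "nat \<lceil>2 * B / \<epsilon>\<rceil>"]
    proof eventually_elim
      case (elim N)
      have "2 * B / \<epsilon> \<le> real N" using elim by linarith
      then have B: "B \<le> \<epsilon> / 2 * real N" using \<epsilon> by (simp add: field_simps)
      have "(\<Sum>n=1..N. b (n - 1)) = (\<Sum>n<N. b n)"
        by (rule sum.reindex_bij_witness[where i = Suc and j = "\<lambda>n. n - 1"]) auto
      also have "norm \<dots> \<le> (\<Sum>n<N. norm (b n))" by (rule norm_sum)
      also have "\<dots> = B + (\<Sum>n\<in>{n0..<N}. norm (b n))"
        unfolding B_def using elim by (simp add: sum.atLeastLessThan_concat lessThan_atLeast0)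
      also have "(\<Sum>n\<in>{n0..<N}. norm (b n)) \<le> (\<Sum>n\<in>{n0..<N}. \<epsilon> / 2)"
        using n0 by (intro sum_mono) (auto intro: less_imp_le)
      also have "\<dots> \<le> \<epsilon> / 2 * real N" using \<epsilon> by (simp add: mult.commute mult_left_mono)
      finally show ?case using B by simp
    qed
  qed
  moreover have "(\<Sum>n=1..N. b (n - 1)) = (\<Sum>n<N. b n)" for N
    by (rule sum.reindex_bij_witness[where i = Suc and j = "\<lambda>n. n - 1"]) auto
  ultimately show ?thesis by (simp add: null_mean_def)
qed

text \<open>Abel summation writes the sum of a n as N (s N - L) minus the sum of s n - L over n < N;
  divided by N, both parts vanish in the limit.\<close>

lemma kronecker_lemma:
  fixes a :: "nat \<Rightarrow> complex"
  assumes "(\<lambda>N. \<Sum>n=1..N. a n / of_nat n) \<longlonglongrightarrow> L"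
  shows "null_mean a"
proof -
  define s where "s N = (\<Sum>n=1..N. a n / of_nat n)" for N
  have sum_eq: "(\<Sum>n=1..N. a n) = of_nat N * (s N - L) - (\<Sum>n<N. s n - L)" for N
  proof (induction N)
    case (Suc N)
    have "of_nat (Suc N) * (s (Suc N) - L) = of_nat (Suc N) * (s N - L) + a (Suc N)"
      by (simp add: s_def distrib_left right_diff_distrib del: of_nat_Suc)
    then show ?case using Suc by (simp add: algebra_simps)
  qed simp
  have s: "(\<lambda>N. s N - L) \<longlonglongrightarrow> 0"
    using assms by (simp add: s_def LIM_zero)
  have "(\<lambda>N. (s N - L) - (\<Sum>n<N. s n - L) / of_nat N) \<longlonglongrightarrow> 0 - 0"
    by (intro tendsto_diff s cesaro_null)
  moreover have "\<forall>\<^sub>F N in sequentially. (s N - L) - (\<Sum>n<N. s n - L) / of_nat N = (\<Sum>n=1..N. a n) / of_nat N"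
    using eventually_gt_at_top[of 0]
  proof eventually_elim
    case (elim N)
    then show ?case unfolding sum_eq by (simp add: diff_divide_distrib)
  qed
  ultimately show ?thesis
    unfolding null_mean_def using tendsto_cong by fastforce
qed

text \<open>The free starting angle \<open>\<alpha>\<close> allows the circle to be cut at -pi/2
  into a right and a left half. It is obtained by rotating h before applying the Cauchy
  formula.\<close>

lemma circle_mean_value:
  assumes "h holomorphic_on cball 0 R" "R > 0"
  shows "((\<lambda>t. h (of_real R * cis t)) has_integral (of_real (2 * pi) * h 0)) {\<alpha>..\<alpha> + 2 * pi}"
proof -
  have "((\<lambda>u. h (cis \<alpha> * u) / (u - 0)) has_contour_integral (2 * of_real pi * \<i> * h (cis \<alpha> * 0))) (circlepath 0 R)"
  proof (rule Cauchy_integral_circlepath_simple)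
    show "(\<lambda>u. h (cis \<alpha> * u)) holomorphic_on cball 0 R"
      by (rule holomorphic_on_compose_gen[OF _ assms(1), unfolded o_def])
         (auto intro!: holomorphic_intros simp: norm_mult)
  qed (use assms in auto)
  then have "((\<lambda>t. h (cis \<alpha> * (0 + of_real R * cis t)) / (0 + of_real R * cis t - 0) * of_real R * \<i> * cis t)
      has_integral (2 * of_real pi * \<i> * h (cis \<alpha> * 0))) {0..2 * pi}"
    unfolding circlepath_def by (subst (asm) has_contour_integral_part_circlepath_iff) auto
  then have "((\<lambda>t. \<i> * h (of_real R * cis (t + \<alpha>))) has_integral (2 * of_real pi * \<i> * h 0)) {0..2 * pi}"
    using assms(2) by (simp add: cis_mult[symmetric] mult_ac)
  then have int: "((\<lambda>t. - \<i> * (\<i> * h (of_real R * cis (t + \<alpha>)))) has_integral (- \<i> * (2 * of_real pi * \<i> * h 0))) {0..2 * pi}"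
    by (rule has_integral_mult_right)
  have "- \<i> * (2 * of_real pi * \<i> * h 0) = of_real (2 * pi) * h 0" by (simp add: complex_eq_iff)
  moreover have "- \<i> * (\<i> * w) = w" for w by simp
  ultimately have "((\<lambda>t. h (of_real R * cis (t + \<alpha>))) has_integral (of_real (2 * pi) * h 0)) {0..2 * pi}"
    using int by (simp only:)
  then show ?thesis
    using has_integral_affinity'[of "\<lambda>t. h (of_real R * cis t)" "of_real (2 * pi) * h 0" \<alpha> "\<alpha> + 2 * pi" 1 \<alpha>]
      has_integral_affinity'[of "\<lambda>t. h (of_real R * cis (t + \<alpha>))" "of_real (2 * pi) * h 0" 0 "2 * pi" 1 "- \<alpha>"]
    by (simp add: add.commute)
qed

lemma has_integral_norm_le:
  fixes f :: "real \<Rightarrow> complex"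
  assumes "(f has_integral i) {a..b}" "a \<le> b" "0 \<le> B" "\<And>x. x \<in> {a..b} \<Longrightarrow> norm (f x) \<le> B"
  shows "norm i \<le> B * (b - a)"
  using has_integral_bound_real[OF assms(3) finite.emptyI assms(1)] assms by simp

text \<open>Newman's contour argument. On \<open>|z| = R\<close> the kernel \<open>N\<^sup>z (1 + z\<^sup>2/R\<^sup>2)\<close> has absolute value
  \<open>2 N\<^sup>x |x| / R\<close>, which compensates both the tail of the Dirichlet series on the right half and
  its partial sum on the left half of the circle.\<close>

definition newman_kernel :: "real \<Rightarrow> nat \<Rightarrow> complex \<Rightarrow> complex" where
  "newman_kernel R N z = of_nat N powr z * (1 + z\<^sup>2 / of_real (R\<^sup>2))"

lemma norm_newman_kernel:
  assumes "R > 0"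
  shows "norm (newman_kernel R N (of_real R * cis t)) = real N powr (R * cos t) * (2 * \<bar>cos t\<bar>)"
proof -
  have "1 + (of_real R * cis t)\<^sup>2 / of_real (R\<^sup>2) = 1 + cis t * cis t"
    using assms by (simp add: power_mult_distrib power2_eq_square)
  also have "\<dots> = cis t * (cis t + cis (- t))" by (simp add: distrib_left cis_mult)
  also have "cis t + cis (- t) = of_real (2 * cos t)" by (simp add: complex_eq_iff)
  finally have "norm (1 + (of_real R * cis t)\<^sup>2 / of_real (R\<^sup>2)) = 2 * \<bar>cos t\<bar>"
    by (simp add: norm_mult abs_mult)
  moreover have "norm (of_nat N powr (of_real R * cis t)) = real N powr (R * cos t)"
    by (subst norm_powr_real_powr) auto
  ultimately show ?thesis by (simp add: newman_kernel_def norm_mult)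
qed

lemma newman_tail_bound:
  assumes C: "\<And>n. norm (a n) \<le> C" and N: "N \<ge> 1" and x: "Re z > 0"
    and f: "has_dsum a (1 + z) F"
  shows "norm (F - (\<Sum>n=1..N. a n * nps n (1 + z))) \<le> C * real N powr (- Re z) / Re z"
proof -
  define S where "S M = (\<Sum>n=1..M. a n * nps n (1 + z))" for M
  have C0: "C \<ge> 0" using C[of 0] norm_ge_zero order_trans by blast
  have SF: "S \<longlonglongrightarrow> F"
  proof -
    have "S = (\<lambda>M. \<Sum>k<M. a (Suc k) * nps (Suc k) (1 + z))"
      unfolding S_def by (intro ext sum.reindex_bij_witness[where i = Suc and j = "\<lambda>n. n - 1"]) auto
    then show ?thesis using has_dsum_imp_sums[OF f] by (simp add: sums_def)
  qed
  have bd: "norm (S M - S N) \<le> C * real N powr (- Re z) / Re z" if "M \<ge> N" for M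
  proof -
    have "S M = S N + (\<Sum>n\<in>{N<..M}. a n * nps n (1 + z))"
    proof -
      have "{1..M} = {1..N} \<union> {N<..M}" using that N by auto
      show ?thesis unfolding S_def \<open>{1..M} = {1..N} \<union> {N<..M}\<close>
        by (rule sum.union_disjoint) auto
    qed
    then have "norm (S M - S N) = norm (\<Sum>n\<in>{N<..M}. a n * nps n (1 + z))" by simp
    also have "\<dots> \<le> (\<Sum>n\<in>{N<..M}. C * real n powr (- 1 - Re z))"
      using C by (intro sum_norm_le) (simp add: norm_mult norm_nps mult_right_mono)
    also have "\<dots> = C * (\<Sum>n\<in>{N<..M}. real n powr (- 1 - Re z))" by (simp add: sum_distrib_left)
    also have "\<dots> \<le> C * ((real N powr (- Re z) - real M powr (- Re z)) / Re z)"
      using sum_powr_tail[OF x N that] C0 by (intro mult_left_mono) auto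
    also have "\<dots> \<le> C * (real N powr (- Re z) / Re z)"
      using x C0 by (intro mult_left_mono divide_right_mono) auto
    finally show ?thesis by simp
  qed
  have "(\<lambda>M. norm (S M - S N)) \<longlonglongrightarrow> norm (F - S N)"
    by (intro tendsto_intros SF)
  then have "norm (F - S N) \<le> C * real N powr (- Re z) / Re z"
    by (rule LIMSEQ_le_const2) (use bd in blast)
  then show ?thesis by (simp add: S_def)
qed

text \<open>Counterpart of \<open>newman_tail_bound\<close> on the left half plane: there the
  partial sum itself has the size N^(-Re z) / |Re z|, up to an additional term with factor
  1/N.\<close>

lemma newman_initial_bound:
  assumes C: "\<And>n. norm (a n) \<le> C" and N: "N \<ge> 1" and x: "Re z < 0"
  shows "norm (\<Sum>n=1..N. a n * nps n (1 + z)) \<le> C * real N powr (- Re z) * (1 / \<bar>Re z\<bar> + 1 / real N)"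
proof -
  have C0: "C \<ge> 0" using C[of 0] norm_ge_zero order_trans by blast
  have e: "- Re z - 1 = - Re (1 + z)" by simp
  have "norm (\<Sum>n=1..N. a n * nps n (1 + z)) \<le> (\<Sum>n=1..N. C * real n powr (- Re z - 1))"
    unfolding e using C by (intro sum_norm_le) (auto simp: norm_mult norm_nps intro!: mult_right_mono)
  also have "\<dots> = C * (\<Sum>n=1..N. real n powr (- Re z - 1))" by (simp add: sum_distrib_left)
  also have "\<dots> \<le> C * (real N powr (- Re z) / (- Re z) + real N powr (- Re z - 1))"
    using sum_powr_initial[of "- Re z" N] x N C0 by (intro mult_left_mono) auto
  also have "real N powr (- Re z - 1) = real N powr (- Re z) * (1 / real N)"
    using N by (simp add: powr_diff)
  finally show ?thesis using x by (simp add: algebra_simps)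
qed

text \<open>Riemann-Lebesgue effect: on the imaginary axis N^z has modulus 1 and is the derivative
  of N^z / ln N, so integration by parts gains a factor 1 / ln N.\<close>

lemma newman_segment_null:
  assumes H: "H holomorphic_on V" "open V" "\<And>z. Re z \<ge> 0 \<Longrightarrow> z \<in> V" and R: "R > 0"
  shows "(\<lambda>N. contour_integral (linepath (- \<i> * of_real R) (\<i> * of_real R)) (\<lambda>z. H z * of_nat N powr z)) \<longlonglongrightarrow> 0"
proof -
  define S where "S = closed_segment (- \<i> * of_real R) (\<i> * of_real R)"
  have ReS: "Re z = 0" if "z \<in> S" for z using that by (auto simp: S_def in_segment)
  have SV: "S \<subseteq> V" using ReS H(3) by auto
  have cont: "continuous_on S H" "continuous_on S (deriv H)"
    using H SV holomorphic_deriv holomorphic_on_imp_continuous_on continuous_on_subset by metis+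
  have "compact S" by (simp add: S_def)
  have "bounded (H ` S)" "bounded (deriv H ` S)"
    using cont \<open>compact S\<close> by (auto intro!: compact_imp_bounded compact_continuous_image)
  then obtain B1 B2 where B: "\<And>z. z \<in> S \<Longrightarrow> norm (H z) \<le> B1" "\<And>z. z \<in> S \<Longrightarrow> norm (deriv H z) \<le> B2"
    unfolding bounded_iff by (metis imageI)
  have endp: "- \<i> * of_real R \<in> S" "\<i> * of_real R \<in> S" by (auto simp: S_def)
  have B0: "B1 \<ge> 0" "B2 \<ge> 0" using B endp norm_ge_zero order_trans by metis+
  have nN: "norm (of_nat N powr z :: complex) = 1" if "z \<in> S" "N \<ge> 1" for N :: nat and z
    using that ReS by (subst norm_powr_real_powr) auto
  define Q where "Q = 2 * B1 + B2 * (2 * R)"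
  have bd: "norm (contour_integral (linepath (- \<i> * of_real R) (\<i> * of_real R)) (\<lambda>z. H z * of_nat N powr z)) \<le> Q / ln (real N)"
    if N: "N \<ge> 2" for N :: nat
  proof -
    let ?\<gamma> = "linepath (- \<i> * of_real R) (\<i> * of_real R)"
    let ?E = "\<lambda>z. of_nat N powr z :: complex"
    have N0: "(of_nat N :: complex) \<noteq> 0" using N by simp
    have "((\<lambda>z. deriv H z * ?E z + H z * (Ln (of_nat N) * ?E z)) has_contour_integral
        (H (pathfinish ?\<gamma>) * ?E (pathfinish ?\<gamma>) - H (pathstart ?\<gamma>) * ?E (pathstart ?\<gamma>))) ?\<gamma>"
    proof (rule contour_integral_primitive[where S = V and f = "\<lambda>z. H z * ?E z"])
      fix z assume "z \<in> V"
      then have "(H has_field_derivative deriv H z) (at z)" using H holomorphic_derivI by blast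
      then have "((\<lambda>z. H z * ?E z) has_field_derivative (deriv H z * ?E z + (Ln (of_nat N) * ?E z) * H z)) (at z)"
        by (intro DERIV_mult has_field_derivative_powr_right N0)
      then show "((\<lambda>z. H z * ?E z) has_field_derivative (deriv H z * ?E z + H z * (Ln (of_nat N) * ?E z))) (at z within V)"
        by (simp add: mult.commute has_field_derivative_at_within)
    qed (use SV in \<open>auto simp: S_def\<close>)
    then have I1: "((\<lambda>z. deriv H z * ?E z + H z * (Ln (of_nat N) * ?E z)) has_contour_integral
        (H (\<i> * of_real R) * ?E (\<i> * of_real R) - H (- \<i> * of_real R) * ?E (- \<i> * of_real R))) ?\<gamma>"
      by simp
    have cE: "continuous_on S ?E" unfolding powr_def using N0 by (auto intro!: continuous_intros)
    have "(\<lambda>z. deriv H z * ?E z) contour_integrable_on ?\<gamma>"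
      by (rule contour_integrable_continuous_linepath) (use cont cE in \<open>auto simp: S_def intro!: continuous_intros\<close>)
    then obtain I2 where I2: "((\<lambda>z. deriv H z * ?E z) has_contour_integral I2) ?\<gamma>"
      by (auto simp: contour_integrable_on_def)
    have "norm I2 \<le> B2 * norm (\<i> * of_real R - (- \<i> * of_real R))"
    proof (rule has_contour_integral_bound_linepath[OF I2 B0(2)])
      fix z assume "z \<in> closed_segment (- \<i> * of_real R) (\<i> * of_real R)"
      then show "norm (deriv H z * ?E z) \<le> B2" using B nN[of z N] N by (simp add: S_def norm_mult)
    qed
    moreover have "norm (\<i> * of_real R - (- \<i> * of_real R)) = 2 * R"
      using R by (simp add: norm_mult flip: mult_2)
    ultimately have nI2: "norm I2 \<le> B2 * (2 * R)" by simp
    define lN where "lN = complex_of_real (ln (real N))"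
    have lN: "Ln (of_nat N) = lN" using N Ln_of_real[of "real N"] by (simp add: lN_def)
    have lN0: "lN \<noteq> 0" "norm lN = ln (real N)" using N by (auto simp: lN_def)
    define E1 where "E1 = H (\<i> * of_real R) * ?E (\<i> * of_real R) - H (- \<i> * of_real R) * ?E (- \<i> * of_real R)"
    have "((\<lambda>z. (1 / lN) * (deriv H z * ?E z + H z * (lN * ?E z) - deriv H z * ?E z)) has_contour_integral
        ((1 / lN) * (E1 - I2))) ?\<gamma>"
      using I1 I2 unfolding lN E1_def by (intro has_contour_integral_lmul has_contour_integral_diff)
    then have "((\<lambda>z. H z * ?E z) has_contour_integral ((1 / lN) * (E1 - I2))) ?\<gamma>"
      using lN0 by simp
    then have "contour_integral ?\<gamma> (\<lambda>z. H z * ?E z) = (1 / lN) * (E1 - I2)"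
      by (rule contour_integral_unique)
    moreover have "norm E1 \<le> B1 + B1"
      unfolding E1_def using B(1) nN endp N
      by (intro order_trans[OF norm_triangle_ineq4] add_mono) (simp_all add: norm_mult)
    then have "norm (E1 - I2) \<le> Q"
      using nI2 norm_triangle_ineq4[of E1 I2] by (simp add: Q_def)
    ultimately show ?thesis
      using lN0 N by (simp add: norm_mult norm_divide divide_right_mono)
  qed
  show ?thesis
  proof (rule Lim_null_comparison)
    show "\<forall>\<^sub>F N in sequentially. norm (contour_integral (linepath (- \<i> * of_real R) (\<i> * of_real R)) (\<lambda>z. H z * of_nat N powr z)) \<le> Q / ln (real N)"
      using eventually_ge_at_top[of 2] by eventually_elim (rule bd)
    show "(\<lambda>N. Q / ln (real N)) \<longlonglongrightarrow> 0"
      by (intro tendsto_divide_0[OF tendsto_const] filterlim_at_top_imp_at_infinity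
          filterlim_compose[OF ln_at_top] filterlim_real_sequentially)
  qed
qed

text \<open>Because F 1 = 0, the quotient f z / z with f z = F (1 + z) is regular at 0, and Cauchy's
  theorem moves its integral over the right half circle onto the imaginary segment, where it tends
  to 0. The mean value over the full circle of the entire function S N times the kernel gives 2 pi S
  N 0. On the right half S N is compared with f, on the left half it is estimated directly.\<close>

lemma newman_normalized:
  assumes C: "\<And>n. norm (a n) \<le> C" and F: "F holomorphic_on U" "open U" "\<And>s. Re s \<ge> 1 \<Longrightarrow> s \<in> U"
    and FD: "\<And>s. Re s > 1 \<Longrightarrow> has_dsum a s (F s)" and F1: "F 1 = 0"
  shows "(\<lambda>N. \<Sum>n=1..N. a n / of_nat n) \<longlonglongrightarrow> 0"
  unfolding tendsto_iff
proof (intro allI impI)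
  fix \<epsilon> :: real assume \<epsilon>: "\<epsilon> > 0"
  have C0: "C \<ge> 0" using C[of 0] norm_ge_zero order_trans by blast
  \<comment> \<open>Chosen so that 2C/R is at most \<open>\<epsilon>\<close>/4. The segment then
    costs \<open>\<epsilon>\<close> and the two half circles at most 3 pi
    \<open>\<epsilon>\<close>/4 together, which stays below 2 pi \<open>\<epsilon>\<close>.\<close>
  define R where "R = max 1 (8 * C / \<epsilon>)"
  have R: "R > 0" "8 * C / \<epsilon> \<le> R" by (auto simp: R_def)
  have RC: "2 * C / R \<le> \<epsilon> / 4"
    using R \<epsilon> by (simp add: field_simps)
  define f where "f z = F (1 + z)" for z
  define S where "S N z = (\<Sum>n=1..N. a n * nps n (1 + z))" for N z
  define V where "V = (\<lambda>z. 1 + z) -` U"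
  define q where "q z = (if z = 0 then deriv f 0 else (f z - f 0) / (z - 0))" for z
  define H where "H z = q z * (1 + z\<^sup>2 / of_real (R\<^sup>2))" for z
  have V: "open V" "\<And>z. Re z \<ge> 0 \<Longrightarrow> z \<in> V"
    using F(2,3) by (auto simp: V_def intro!: open_vimage continuous_intros)
  have f: "f holomorphic_on V" "f 0 = 0"
    unfolding f_def V_def using F1
    by (auto intro!: holomorphic_on_compose_gen[OF _ F(1), unfolded o_def] holomorphic_intros)
  have q: "q holomorphic_on V" unfolding q_def by (rule pole_lemma_open[OF f(1) V(1)])
  have H: "H holomorphic_on V" unfolding H_def using R by (intro holomorphic_intros q) auto
  define J where "J N = contour_integral (linepath (- \<i> * of_real R) (\<i> * of_real R)) (\<lambda>z. H z * of_nat N powr z)" for N :: nat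
  have "J \<longlonglongrightarrow> 0" unfolding J_def by (rule newman_segment_null[OF H V R(1)])
  then have "\<forall>\<^sub>F N in sequentially. norm (J N) < \<epsilon>"
    using \<epsilon> by (auto simp: tendsto_iff)
  then show "\<forall>\<^sub>F N in sequentially. dist (\<Sum>n=1..N. a n / of_nat n) 0 < \<epsilon>"
    using eventually_ge_at_top[of 1] eventually_ge_at_top[of "nat \<lceil>8 * C / \<epsilon>\<rceil>"]
  proof eventually_elim
    case (elim N)
    have N: "N \<ge> 1" using elim by simp
    have NC: "2 * C / real N \<le> \<epsilon> / 4"
    proof -
      have "8 * C / \<epsilon> \<le> real N" using elim by linarith
      then show ?thesis using \<epsilon> N by (simp add: field_simps)
    qed
    define z where "z t = of_real R * cis t" for t
    let ?K = "\<lambda>t. newman_kernel R N (z t)"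
    have nK: "norm (?K t) = real N powr (R * cos t) * (2 * \<bar>cos t\<bar>)" for t
      unfolding z_def by (rule norm_newman_kernel[OF R(1)])
    have Rez: "Re (z t) = R * cos t" for t by (simp add: z_def)
    have hS: "(\<lambda>z. S N z * newman_kernel R N z) holomorphic_on cball 0 R"
      unfolding S_def newman_kernel_def using R by (intro holomorphic_intros) auto
    have K0: "newman_kernel R N 0 = 1" using N by (simp add: newman_kernel_def)
    have "((\<lambda>t. S N (z t) * ?K t) has_integral (of_real (2 * pi) * S N 0)) {-(pi/2)..-(pi/2) + 2 * pi}"
      using circle_mean_value[OF hS R(1), of "-(pi/2)"] K0 by (simp add: z_def)
    then have whole: "((\<lambda>t. S N (z t) * ?K t) has_integral (of_real (2 * pi) * S N 0)) {-(pi/2)..3 * pi / 2}"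
      by (simp add: field_simps)
    then have intg: "(\<lambda>t. S N (z t) * ?K t) integrable_on {-(pi/2)..3 * pi / 2}" by blast
    have intR: "(\<lambda>t. S N (z t) * ?K t) integrable_on {-(pi/2)..pi/2}"
      and intL: "(\<lambda>t. S N (z t) * ?K t) integrable_on {pi/2..3 * pi / 2}"
      by (rule integrable_subinterval_real[OF intg]; simp)+
    define IR where "IR = integral {-(pi/2)..pi/2} (\<lambda>t. S N (z t) * ?K t)"
    define IL where "IL = integral {pi/2..3 * pi / 2} (\<lambda>t. S N (z t) * ?K t)"
    have split: "of_real (2 * pi) * S N 0 = IR + IL"
    proof -
      have "IR + IL = integral {-(pi/2)..3 * pi / 2} (\<lambda>t. S N (z t) * ?K t)"
        unfolding IR_def IL_def by (rule Henstock_Kurzweil_Integration.integral_combine[OF _ _ intg]) auto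
      then show ?thesis using whole by (simp add: integral_unique)
    qed
    have intf: "((\<lambda>t. f (z t) * ?K t) has_integral (- \<i> * J N)) {-(pi/2)..pi/2}"
    proof -
      define D where "D = cball (0::complex) R \<inter> {z. Re z \<ge> 0}"
      let ?A = "part_circlepath 0 R (-(pi/2)) (pi/2)" and ?L = "linepath (\<i> * of_real R) (- \<i> * of_real R)"
      let ?G = "\<lambda>z. H z * of_nat N powr z"
      have G: "?G holomorphic_on V" using H N by (intro holomorphic_intros) auto
      have DV: "D \<subseteq> V" using V(2) by (auto simp: D_def)
      have cvD: "convex D" unfolding D_def by (intro convex_Int convex_cball convex_halfspace_Re_ge)
      have pA: "path_image ?A \<subseteq> D"
        using R by (auto simp: D_def path_image_part_circlepath' norm_mult closed_segment_eq_real_ivl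
            intro!: mult_nonneg_nonneg cos_ge_zero)
      have e: "exp (\<i> * of_real (pi/2)) = \<i>" "exp (\<i> * of_real (-(pi/2))) = - \<i>"
        by (simp_all add: exp_eq_polar complex_eq_iff)
      have pL: "path_image ?L \<subseteq> D"
        unfolding path_image_linepath
        by (rule closed_segment_subset[OF _ _ cvD]) (use R in \<open>auto simp: D_def norm_mult\<close>)
      have "(?G has_contour_integral 0) (?A +++ ?L)"
      proof (rule Cauchy_theorem_convex_simple[OF holomorphic_on_subset[OF G DV] cvD])
        show "valid_path (?A +++ ?L)" using e by (intro valid_path_join) (auto simp: mult_ac)
        show "path_image (?A +++ ?L) \<subseteq> D" using pA pL by (intro subset_path_image_join)
        show "pathfinish (?A +++ ?L) = pathstart (?A +++ ?L)" using e by (simp add: mult_ac)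
      qed
      moreover have GL: "(?G has_contour_integral (J N)) (linepath (- \<i> * of_real R) (\<i> * of_real R))"
        unfolding J_def
      proof (rule has_contour_integral_integral, rule contour_integrable_continuous_linepath)
        have "closed_segment (- \<i> * of_real R) (\<i> * of_real R) \<subseteq> V"
          using pL DV by (simp add: closed_segment_commute)
        then show "continuous_on (closed_segment (- \<i> * of_real R) (\<i> * of_real R)) ?G"
          using G holomorphic_on_imp_continuous_on continuous_on_subset by blast
      qed
      then have GL': "(?G has_contour_integral (- J N)) ?L"
        using has_contour_integral_reversepath[of "linepath (- \<i> * of_real R) (\<i> * of_real R)"] by simp
      moreover have "?G contour_integrable_on ?A"
        by (rule contour_integrable_continuous_part_circlepath)
           (use G pA DV holomorphic_on_imp_continuous_on continuous_on_subset in blast)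
      then obtain IA where IA: "(?G has_contour_integral IA) ?A" by (auto simp: contour_integrable_on_def)
      moreover have "(?G has_contour_integral (IA + - J N)) (?A +++ ?L)"
        by (rule has_contour_integral_join[OF IA GL']) auto
      ultimately have "IA = J N" using has_contour_integral_unique by fastforce
      with IA have "((\<lambda>t. ?G (0 + of_real R * cis t) * of_real R * \<i> * cis t) has_integral J N) {-(pi/2)..pi/2}"
        by (subst (asm) has_contour_integral_part_circlepath_iff) auto
      then have "((\<lambda>t. - \<i> * (?G (0 + of_real R * cis t) * of_real R * \<i> * cis t)) has_integral (- \<i> * J N)) {-(pi/2)..pi/2}"
        by (rule has_integral_mult_right)
      moreover have "- \<i> * (?G (0 + of_real R * cis t) * of_real R * \<i> * cis t) = f (z t) * ?K t" for t
      proof -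
        have nz: "z t \<noteq> 0" using R by (simp add: z_def)
        have "- \<i> * (?G (0 + of_real R * cis t) * of_real R * \<i> * cis t) = (q (z t) * z t) * ?K t"
          by (simp add: H_def newman_kernel_def z_def mult_ac)
        also have "q (z t) * z t = f (z t)" using nz f(2) by (simp add: q_def)
        finally show ?thesis .
      qed
      ultimately show ?thesis by simp
    qed
    have bR: "norm (- \<i> * J N - IR) \<le> 2 * C / R * (pi/2 - (-(pi/2)))"
    proof (rule has_integral_norm_le[where f = "\<lambda>t. f (z t) * ?K t - S N (z t) * ?K t"])
      show "((\<lambda>t. f (z t) * ?K t - S N (z t) * ?K t) has_integral (- \<i> * J N - IR)) {-(pi/2)..pi/2}"
        unfolding IR_def by (intro has_integral_diff intf integrable_integral intR)
      fix t assume t: "t \<in> {-(pi/2)..pi/2}"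
      then have ct: "cos t \<ge> 0" by (intro cos_ge_zero) auto
      show "norm (f (z t) * ?K t - S N (z t) * ?K t) \<le> 2 * C / R"
      proof (cases "cos t = 0")
        case True
        then have "?K t = 0" using nK[of t] by simp
        then show ?thesis using C0 R by simp
      next
        case False
        then have x: "Re (z t) > 0" using ct R by (simp add: Rez)
        have "norm (f (z t) - S N (z t)) \<le> C * real N powr (- Re (z t)) / Re (z t)"
          unfolding f_def S_def by (rule newman_tail_bound[OF C N x FD]) (use x in simp)
        then have "norm ((f (z t) - S N (z t)) * ?K t) \<le> (C * real N powr (- Re (z t)) / Re (z t)) * (real N powr (R * cos t) * (2 * \<bar>cos t\<bar>))"
          unfolding norm_mult nK by (intro mult_right_mono) auto
        also have "\<dots> = (real N powr (- (R * cos t)) * real N powr (R * cos t)) * (2 * C / R)"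
          using False R ct by (simp add: Rez field_simps)
        also have "real N powr (- (R * cos t)) * real N powr (R * cos t) = 1"
          using N by (simp flip: powr_add)
        finally show ?thesis by (simp add: left_diff_distrib)
      qed
    qed (use C0 R in auto)
    have bL: "norm IL \<le> (2 * C / R + 2 * C / real N) * (3 * pi / 2 - pi/2)"
    proof (rule has_integral_norm_le[where f = "\<lambda>t. S N (z t) * ?K t"])
      show "((\<lambda>t. S N (z t) * ?K t) has_integral IL) {pi/2..3 * pi / 2}"
        unfolding IL_def by (rule integrable_integral[OF intL])
      fix t assume t: "t \<in> {pi/2..3 * pi / 2}"
      have "cos (t - pi) \<ge> 0" using t by (intro cos_ge_zero) auto
      then have ct: "cos t \<le> 0" by simp
      show "norm (S N (z t) * ?K t) \<le> 2 * C / R + 2 * C / real N"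
      proof (cases "cos t = 0")
        case True
        then have "?K t = 0" using nK[of t] by simp
        then show ?thesis using C0 R by simp
      next
        case False
        then have x: "Re (z t) < 0" using ct R by (simp add: Rez mult_less_0_iff)
        have "norm (S N (z t)) \<le> C * real N powr (- Re (z t)) * (1 / \<bar>Re (z t)\<bar> + 1 / real N)"
          unfolding S_def by (rule newman_initial_bound[OF C N x])
        then have "norm (S N (z t) * ?K t) \<le> (C * real N powr (- Re (z t)) * (1 / \<bar>Re (z t)\<bar> + 1 / real N)) * (real N powr (R * cos t) * (2 * \<bar>cos t\<bar>))"
          unfolding norm_mult nK by (intro mult_right_mono) auto
        also have "\<dots> = (real N powr (- (R * cos t)) * real N powr (R * cos t)) * (C * (2 * \<bar>cos t\<bar> * (1 / (R * \<bar>cos t\<bar>)) + 2 * \<bar>cos t\<bar> / real N))"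
          using R by (simp add: Rez abs_mult algebra_simps)
        also have "real N powr (- (R * cos t)) * real N powr (R * cos t) = 1"
          using N by (simp flip: powr_add)
        also have "1 * (C * (2 * \<bar>cos t\<bar> * (1 / (R * \<bar>cos t\<bar>)) + 2 * \<bar>cos t\<bar> / real N)) = 2 * C / R + 2 * C * \<bar>cos t\<bar> / real N"
          using False R by (simp add: field_simps)
        also have "\<dots> \<le> 2 * C / R + 2 * C * 1 / real N"
          using C0 by (intro add_left_mono divide_right_mono mult_left_mono) auto
        finally show ?thesis by simp
      qed
    qed (use C0 R in auto)
    have "norm (of_real (2 * pi) * S N 0) \<le> norm (J N) + norm (- \<i> * J N - IR) + norm IL"
    proof -
      have "of_real (2 * pi) * S N 0 = - \<i> * J N - (- \<i> * J N - IR) + IL" unfolding split by simp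
      also have "norm \<dots> \<le> norm (- \<i> * J N - (- \<i> * J N - IR)) + norm IL" by (rule norm_triangle_ineq)
      also have "norm (- \<i> * J N - (- \<i> * J N - IR)) \<le> norm (- \<i> * J N) + norm (- \<i> * J N - IR)"
        by (rule norm_triangle_ineq4)
      finally show ?thesis by (simp add: norm_mult)
    qed
    also have "\<dots> < \<epsilon> + \<epsilon> / 4 * pi + (\<epsilon> / 4 + \<epsilon> / 4) * pi"
    proof -
      have "2 * C / R * pi \<le> \<epsilon> / 4 * pi" using RC by (intro mult_right_mono) auto
      moreover have "(2 * C / R + 2 * C / real N) * pi \<le> (\<epsilon> / 4 + \<epsilon> / 4) * pi"
        using RC NC by (intro mult_right_mono add_mono) auto
      moreover have "pi/2 - (-(pi/2)) = pi" "3 * pi / 2 - pi/2 = pi" by simp_all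
      note bR[unfolded this(1)] bL[unfolded this(2)]
      ultimately show ?thesis using elim(1) by linarith
    qed
    also have "\<dots> \<le> 2 * pi * \<epsilon>"
    proof -
      have "\<epsilon> * 1 \<le> \<epsilon> * pi" using \<epsilon> pi_gt3 by (intro mult_left_mono) auto
      then show ?thesis using \<epsilon> by (simp add: field_simps)
    qed
    finally have "2 * pi * norm (S N 0) < 2 * pi * \<epsilon>" by (simp add: norm_mult)
    then have "norm (S N 0) < \<epsilon>" by simp
    moreover have "S N 0 = (\<Sum>n=1..N. a n / of_nat n)"
      unfolding S_def by (intro sum.cong refl) (simp add: nps_def powr_minus divide_inverse)
    ultimately show ?case by simp
  qed
qed

text \<open>Changing only the first coefficient by -F 1 subtracts the constant F 1 from the
  function, which achieves the normalization and leaves the mean unchanged.\<close>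

theorem newman_tauberian:
  assumes C: "\<And>n. norm (a n) \<le> C" and F: "F holomorphic_on U" "open U" "\<And>s. Re s \<ge> 1 \<Longrightarrow> s \<in> U"
    and FD: "\<And>s. Re s > 1 \<Longrightarrow> has_dsum a s (F s)"
  shows "null_mean a"
proof -
  define e where "e n = (if n = 1 then - F 1 else 0)" for n :: nat
  have "(\<lambda>N. \<Sum>n=1..N. (a n + e n) / of_nat n) \<longlonglongrightarrow> 0"
  proof (rule newman_normalized[where C = "C + norm (F 1)" and F = "\<lambda>s. F s - F 1" and U = U])
    show "norm (a n + e n) \<le> C + norm (F 1)" for n
      using norm_triangle_ineq[of "a n" "e n"] C[of n] by (auto simp: e_def intro: order_trans)
    show "(\<lambda>s. F s - F 1) holomorphic_on U" by (intro holomorphic_intros F)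
    show "has_dsum (\<lambda>n. a n + e n) s (F s - F 1)" if "Re s > 1" for s
      using has_dsum_add[OF FD[OF that] has_dsum_one[of "- F 1"]] by (simp add: e_def)
  qed (use F in auto)
  then have "null_mean (\<lambda>n. a n + e n)" by (rule kronecker_lemma)
  moreover have "null_mean (\<lambda>n. - e n)"
  proof (rule null_mean_of_bounded_sums[where B = "norm (F 1)"])
    fix N
    have "(\<Sum>n=1..N. - e n) = (if N \<ge> 1 then F 1 else 0)"
      by (simp add: e_def sum.delta if_distrib cong: if_cong)
    then show "norm (\<Sum>n=1..N. - e n) \<le> norm (F 1)" by simp
  qed
  ultimately have "null_mean (\<lambda>n. (a n + e n) + - e n)" by (rule null_mean_add)
  then show ?thesis by simp
qed

section \<open>The Moebius function against periodic sequences\<close>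

text \<open>Complete multiplicativity pulls the factor \<open>\<kappa> n\<close> out of the
  convolution, leaving plain Moebius inversion.\<close>

lemma dconv_moebius_character:
  assumes mult: "\<And>m n. \<kappa> (m * n) = \<kappa> m * \<kappa> n" and one: "\<kappa> 1 = 1" and n: "n > 0"
  shows "dconv (\<lambda>n. of_int (moebius_mu n) * \<kappa> n) \<kappa> n = (if n = 1 then 1 else 0)"
proof -
  have "dconv (\<lambda>n. of_int (moebius_mu n) * \<kappa> n) \<kappa> n = (\<Sum>d\<in>{d. d dvd n}. of_int (moebius_mu d) * 1 * \<kappa> n)"
    unfolding dconv_def
  proof (intro sum.cong refl)
    fix d assume "d \<in> {d. d dvd n}"
    then have "\<kappa> n = \<kappa> d * \<kappa> (n div d)" by (simp flip: mult)
    then show "of_int (moebius_mu d) * \<kappa> d * \<kappa> (n div d) = of_int (moebius_mu d) * 1 * \<kappa> n" by simp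
  qed
  also have "\<dots> = dconv (\<lambda>n. of_int (moebius_mu n)) (\<lambda>_. 1) n * \<kappa> n"
    by (simp add: dconv_def sum_distrib_right)
  finally show ?thesis using dconv_moebius_1[OF n] one by simp
qed

text \<open>The coefficients \<open>a\<close> have the reciprocal of the L-function as their
  Dirichlet series, so the Tauberian theorem needs that L-function to be zero-free for Re s at least
  1. Right of the line this follows from the product being 1; on the line, Ingham's theorem is
  applied to the twist of \<open>\<kappa>\<close> by n^(-it). If \<open>m\<close> is nonzero there
  is a pole at 1, which multiplication by s - 1 removes.\<close>

lemma moebius_character_null_mean:
  assumes mult: "\<And>m n. \<kappa> (m * n) = \<kappa> m * \<kappa> n" and one: "\<kappa> 1 = 1"
    and norm: "\<And>n. \<kappa> n = 0 \<or> norm (\<kappa> n) = 1"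
    and q: "q > 0" and per: "\<And>n. \<kappa> (n + q) = \<kappa> n"
  shows "null_mean (\<lambda>n. of_int (moebius_mu n) * \<kappa> n)"
proof -
  obtain Z L m where Z: "Z holomorphic_on {s. Re s > 0}" "Z 1 = 1" and L: "L holomorphic_on {s. Re s > 0}"
    and D: "\<And>s. Re s > 1 \<Longrightarrow> has_dsum \<kappa> s (m * (Z s / (s - 1)) + L s)"
    using periodic_continuation[of q \<kappa>, OF q per] by blast
  define a where "a n = of_int (moebius_mu n) * \<kappa> n" for n
  have a1: "norm (a n) \<le> 1" for n
    unfolding a_def by (rule norm_mult_le_1[OF norm_moebius_le]) (use norm[of n] in auto)
  have inv: "\<exists>A. has_dsum a s A \<and> A * (m * (Z s / (s - 1)) + L s) = 1" if s: "Re s > 1" for s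
  proof -
    obtain A where A: "has_dsum a s A" using bounded_has_dsum[of a 1, OF a1 s] by blast
    have "has_dsum (dconv a \<kappa>) s (A * (m * (Z s / (s - 1)) + L s))"
      by (rule has_dsum_dconv[OF A D[OF s]])
    then have "has_dsum (\<lambda>n. if n = 1 then 1 else 0) s (A * (m * (Z s / (s - 1)) + L s))"
      using has_dsum_cong[of "dconv a \<kappa>" "\<lambda>n. if n = 1 then 1 else 0"] dconv_moebius_character[of \<kappa>, OF mult one]
      unfolding a_def by auto
    then show ?thesis using A has_dsum_unique[OF has_dsum_one[of 1]] by metis
  qed
  have twist: "f 1 \<noteq> 0"
    if "f holomorphic_on U" "open U" "\<And>x. x > 0 \<Longrightarrow> of_real x \<in> U" "cnj ` U = U" "U \<subseteq> {s. Re s > 0}"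
      and f: "\<And>s. s \<in> U \<Longrightarrow> Re s > 1 \<Longrightarrow> f s = m * (Z (s + \<i> * of_real t) / (s + \<i> * of_real t - 1)) + L (s + \<i> * of_real t)"
    for f U and t :: real
  proof (rule ingham_nonvanishing[where g = "\<lambda>n. \<kappa> n * nps n (\<i> * of_real t)" and U = U])
    show "has_dsum (\<lambda>n. \<kappa> n * nps n (\<i> * of_real t)) s (f s)" if "s \<in> U" "Re s > 1" for s
      unfolding f[OF that] dsum_shift[symmetric] by (rule D) (use that in simp)
    show "\<kappa> n * nps n (\<i> * of_real t) = 0 \<or> norm (\<kappa> n * nps n (\<i> * of_real t)) = 1" if "n > 0" for n
    proof -
      have "norm (nps n (\<i> * of_real t)) = 1" using that by (simp add: norm_nps)
      then show ?thesis using norm[of n] by (auto simp: norm_mult)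
    qed
  qed (use that one in \<open>auto simp: mult nps_mult\<close>)
  have op: "open {s. Re s > 0}" by (rule open_halfspace_Re_gt)
  show ?thesis unfolding a_def[symmetric]
  proof (cases "m = 0")
    case True
    have nz: "L s \<noteq> 0" if "Re s \<ge> 1" for s
    proof (cases "Re s = 1")
      case True
      have "L (1 + \<i> * of_real (Im s)) \<noteq> 0"
      proof (rule twist[where f = "\<lambda>s'. L (s' + \<i> * of_real (Im s))" and U = "{s. Re s > 0}" and t = "Im s"])
        show "(\<lambda>s'. L (s' + \<i> * of_real (Im s))) holomorphic_on {s. Re s > 0}"
          by (rule holomorphic_on_compose_gen[OF _ L, unfolded o_def]) (auto intro!: holomorphic_intros)
        show "cnj ` {s. Re s > 0} = {s. Re s > 0}"
          by (auto intro!: image_eqI[where x = "cnj _"])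
      qed (use op \<open>m = 0\<close> in auto)
      moreover have "s = 1 + \<i> * of_real (Im s)" using True by (simp add: complex_eq_iff)
      ultimately show ?thesis by simp
    next
      case False
      then show ?thesis using inv[of s] that \<open>m = 0\<close> by auto
    qed
    show "null_mean a"
    proof (rule newman_tauberian[where C = 1 and F = "\<lambda>s. 1 / L s" and U = "{s\<in>{s. Re s > 0}. L s \<in> - {0}}"])
      show "(\<lambda>s. 1 / L s) holomorphic_on {s\<in>{s. Re s > 0}. L s \<in> - {0}}"
        by (intro holomorphic_intros holomorphic_on_subset[OF L]) auto
      show "open {s\<in>{s. Re s > 0}. L s \<in> - {0}}"
        using continuous_open_preimage[OF holomorphic_on_imp_continuous_on[OF L] op, of "- {0}"]
        by (simp add: Int_def vimage_def open_Compl)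
      show "has_dsum a s (1 / L s)" if s: "Re s > 1" for s
      proof -
        obtain A where "has_dsum a s A" "A * L s = 1" using inv[OF s] True by auto
        moreover from this have "A = 1 / L s" by (metis eq_divide_eq mult_zero_right zero_neq_one)
        ultimately show ?thesis by simp
      qed
    qed (use a1 nz in auto)
  next
    case False
    define G where "G s = m * Z s + (s - 1) * L s" for s
    have G: "G holomorphic_on {s. Re s > 0}" unfolding G_def by (intro holomorphic_intros Z L)
    have GD: "m * (Z s / (s - 1)) + L s = G s / (s - 1)" if "s \<noteq> 1" for s
      using that by (simp add: G_def field_simps)
    have nz: "G s \<noteq> 0" if "Re s \<ge> 1" for s
    proof (cases "s = 1")
      case True
      then show ?thesis using False Z by (simp add: G_def)
    next
      case s1: False
      show ?thesis
      proof (cases "Re s = 1")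
        case True
        define t where "t = Im s"
        have t: "s = 1 + \<i> * of_real t" "t \<noteq> 0" using True s1 by (auto simp: complex_eq_iff t_def)
        \<comment> \<open>After translation by it the pole sits at 1 - it. Its conjugate is removed
          as well, since Ingham's theorem asks for a domain symmetric under conjugation; t being
          nonzero keeps the positive axis inside.\<close>
        define U where "U = {s. Re s > 0} - {1 - \<i> * of_real t, 1 + \<i> * of_real t}"
        have "G (1 + \<i> * of_real t) / (1 + \<i> * of_real t - 1) \<noteq> 0"
        proof (rule twist[where f = "\<lambda>s'. G (s' + \<i> * of_real t) / (s' + \<i> * of_real t - 1)" and U = U and t = t])
          have "(\<lambda>s'. G (s' + \<i> * of_real t)) holomorphic_on U"
            by (rule holomorphic_on_compose_gen[OF _ G, unfolded o_def]) (auto intro!: holomorphic_intros simp: U_def)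
          then show "(\<lambda>s'. G (s' + \<i> * of_real t) / (s' + \<i> * of_real t - 1)) holomorphic_on U"
            by (intro holomorphic_intros) (auto simp: U_def complex_eq_iff)
          show "open U" unfolding U_def using op by (intro open_Diff) auto
          show "of_real x \<in> U" if "x > 0" for x using that t by (auto simp: U_def complex_eq_iff)
          show "cnj ` U = U"
          proof -
            have "cnj z \<in> U" if "z \<in> U" for z using that by (auto simp: U_def complex_eq_iff)
            then show ?thesis by (metis complex_cnj_cnj image_eqI image_subsetI subsetI subset_antisym)
          qed
          show "U \<subseteq> {s. Re s > 0}" by (auto simp: U_def)
          fix s' assume "s' \<in> U"
          then have "s' + \<i> * of_real t \<noteq> 1" by (auto simp: U_def complex_eq_iff)
          then show "G (s' + \<i> * of_real t) / (s' + \<i> * of_real t - 1)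
              = m * (Z (s' + \<i> * of_real t) / (s' + \<i> * of_real t - 1)) + L (s' + \<i> * of_real t)"
            using GD by simp
        qed
        then show ?thesis using t by auto
      next
        case False
        then show ?thesis using inv[of s] GD[OF s1] that by auto
      qed
    qed
    show "null_mean a"
    proof (rule newman_tauberian[where C = 1 and F = "\<lambda>s. (s - 1) / G s" and U = "{s\<in>{s. Re s > 0}. G s \<in> - {0}}"])
      show "(\<lambda>s. (s - 1) / G s) holomorphic_on {s\<in>{s. Re s > 0}. G s \<in> - {0}}"
        by (intro holomorphic_intros holomorphic_on_subset[OF G]) auto
      show "open {s\<in>{s. Re s > 0}. G s \<in> - {0}}"
        using continuous_open_preimage[OF holomorphic_on_imp_continuous_on[OF G] op, of "- {0}"]
        by (simp add: Int_def vimage_def open_Compl)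
      show "has_dsum a s ((s - 1) / G s)" if s: "Re s > 1" for s
      proof -
        have s1: "s \<noteq> 1" using s by auto
        obtain A where "has_dsum a s A" "A * (G s / (s - 1)) = 1" using inv[OF s] GD[OF s1] by auto
        moreover from this have "A = (s - 1) / G s" using s1 nz[of s] s by (simp add: field_simps)
        ultimately show ?thesis by simp
      qed
    qed (use a1 nz in auto)
  qed
qed

text \<open>Pigeonhole on the residues of powers. The form \<open>1 mod q\<close> covers q =
  1.\<close>

lemma coprime_power_mod:
  fixes a q :: nat
  assumes "q > 0" "coprime a q"
  shows "\<exists>k>0. a ^ k mod q = 1 mod q"
proof -
  have "(\<lambda>i. a ^ i mod q) ` {..q} \<subseteq> {..<q}" using assms by auto
  then have "card ((\<lambda>i. a ^ i mod q) ` {..q}) \<le> card {..<q}" by (intro card_mono) auto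
  then have "\<not> inj_on (\<lambda>i. a ^ i mod q) {..q}" using card_image by fastforce
  then obtain i j where ij: "i < j" "a ^ i mod q = a ^ j mod q"
    unfolding inj_on_def by (metis linorder_neqE_nat)
  show ?thesis
  proof (cases "a = 0")
    case True
    then have "q = 1" using assms by simp
    then show ?thesis by auto
  next
    case False
    have eq: "a ^ j - a ^ i = a ^ i * (a ^ (j - i) - 1)"
      using ij(1) by (simp add: diff_mult_distrib2 flip: power_add)
    have "a ^ i \<le> a ^ j" using ij False by (intro power_increasing) auto
    then have "q dvd a ^ i * (a ^ (j - i) - 1)"
      using ij(2) mod_eq_dvd_iff_nat[of "a ^ i" "a ^ j" q] unfolding eq by simp
    moreover have "coprime q (a ^ i)" using assms by (simp add: coprime_commute)
    ultimately have "q dvd a ^ (j - i) - 1" by (simp add: coprime_dvd_mult_right_iff)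
    moreover have "1 \<le> a ^ (j - i)" using False by simp
    ultimately have "a ^ (j - i) mod q = 1 mod q" using mod_eq_dvd_iff_nat[of 1 "a ^ (j - i)" q] by simp
    then show ?thesis using ij(1) by (intro exI[of _ "j - i"]) auto
  qed
qed

text \<open>Functions on the residue classes prime to \<open>q\<close> decompose into characters: one residue \<open>a\<close> after
  the other, \<open>\<psi>\<close> is split into eigenfunctions of the shift \<open>\<psi> \<mapsto> \<psi>(a \<cdot>)\<close>, which has finite order.\<close>

lemma moebius_coprime_null_mean:
  fixes \<psi> :: "nat \<Rightarrow> complex"
  assumes q: "q > 0" and per: "\<And>n. \<psi> (n + q) = \<psi> n" and supp: "\<And>n. \<not> coprime n q \<Longrightarrow> \<psi> n = 0"
  shows "null_mean (\<lambda>n. of_int (moebius_mu n) * \<psi> n)"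
proof -
  define V where "V = {\<psi> :: nat \<Rightarrow> complex. (\<forall>n. \<psi> (n + q) = \<psi> n) \<and> (\<forall>n. \<not> coprime n q \<longrightarrow> \<psi> n = 0)}"
  define E where "E a \<psi> \<longleftrightarrow> (\<exists>c. \<forall>n. \<psi> (a * n) = c * \<psi> n)" for a and \<psi> :: "nat \<Rightarrow> complex"
  define R where "R = {a. a < q \<and> coprime a q}"
  have mod: "\<psi> n = \<psi> (n mod q)" if "\<psi> \<in> V" for \<psi> n
  proof -
    have "\<psi> (r + q * j) = \<psi> r" for r j
    proof (induction j)
      case (Suc j)
      have "r + q * Suc j = (r + q * j) + q" by simp
      then show ?case using that Suc unfolding V_def by (metis (mono_tags, lifting) mem_Collect_eq)
    qed simp
    then show ?thesis by (metis mod_mult_div_eq)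
  qed
  have cong: "\<psi> m = \<psi> n" if "\<psi> \<in> V" "m mod q = n mod q" for \<psi> m n
    using mod[OF that(1)] that(2) by metis
  \<comment> \<open>\<open>B\<close> collects the residues for which the eigenfunction property may
    still fail. For empty \<open>B\<close>, either \<open>\<psi>\<close> vanishes identically or
    \<open>\<psi>\<close> divided by its value at 1 is completely multiplicative.\<close>
  have main: "null_mean (\<lambda>n. of_int (moebius_mu n) * \<psi> n)"
    if "finite B" "B \<subseteq> R" "\<psi> \<in> V" "\<forall>a\<in>R - B. E a \<psi>" for B \<psi>
    using that
  proof (induction B arbitrary: \<psi> rule: finite_induct)
    case empty
    have E: "E a \<psi>" if "coprime a q" for a
    proof -
      have "a mod q \<in> R" using that q by (simp add: R_def coprime_mod_left_iff)
      then obtain c where "\<And>n. \<psi> (a mod q * n) = c * \<psi> n" using empty unfolding E_def by auto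
      moreover have "\<psi> (a * n) = \<psi> (a mod q * n)" for n
        by (rule cong[OF empty(2)]) (simp add: mod_mult_left_eq)
      ultimately show ?thesis unfolding E_def by auto
    qed
    show ?case
    proof (cases "\<psi> 1 = 0")
      case True
      have "\<psi> a = 0" for a
      proof (cases "coprime a q")
        case True
        then obtain c where "\<And>n. \<psi> (a * n) = c * \<psi> n" using E unfolding E_def by blast
        from this[of 1] show ?thesis using \<open>\<psi> 1 = 0\<close> by simp
      qed (use empty in \<open>auto simp: V_def\<close>)
      then show ?thesis by simp
    next
      case False
      define \<kappa> where "\<kappa> n = \<psi> n / \<psi> 1" for n
      have mult: "\<kappa> (a * n) = \<kappa> a * \<kappa> n" for a n
      proof (cases "coprime a q")
        case True
        then obtain c where c: "\<And>n. \<psi> (a * n) = c * \<psi> n" using E unfolding E_def by blast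
        from c[of 1] c[of n] show ?thesis using False by (simp add: \<kappa>_def)
      next
        case False
        then have "\<psi> a = 0" "\<psi> (a * n) = 0" using empty by (auto simp: V_def)
        then show ?thesis by (simp add: \<kappa>_def)
      qed
      have one: "\<kappa> 1 = 1" using False by (simp add: \<kappa>_def)
      have pow: "\<kappa> (a ^ k) = \<kappa> a ^ k" for a k by (induction k) (use one mult in auto)
      have "null_mean (\<lambda>n. of_int (moebius_mu n) * \<kappa> n)"
      proof (rule moebius_character_null_mean[OF mult one _ q])
        fix n
        show "\<kappa> (n + q) = \<kappa> n" using empty by (simp add: \<kappa>_def V_def)
        show "\<kappa> n = 0 \<or> norm (\<kappa> n) = 1"
        proof (cases "coprime n q")
          case True
          then obtain k where k: "k > 0" "n ^ k mod q = 1 mod q" using coprime_power_mod[OF q] by blast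
          then have "\<psi> (n ^ k) = \<psi> 1" by (intro cong[OF empty(2)])
          then have "\<kappa> (n ^ k) = 1" using False by (simp add: \<kappa>_def)
          then have "\<kappa> n ^ k = 1" by (simp only: pow)
          then have "norm (\<kappa> n) ^ k = 1" by (metis norm_one norm_power)
          then show ?thesis using k(1) power_eq_imp_eq_base[of "norm (\<kappa> n)" k 1] by simp
        qed (use empty in \<open>auto simp: V_def \<kappa>_def\<close>)
      qed
      from null_mean_cmult[OF this, of "\<psi> 1"] show ?thesis using False by (simp add: \<kappa>_def)
    qed
  next
    case (insert a B)
    have a: "coprime a q" using insert by (simp add: R_def)
    obtain k where k: "k > 0" "a ^ k mod q = 1 mod q" using coprime_power_mod[OF q a] by blast
    have ak: "\<psi> (a ^ k * n) = \<psi> n" for n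
    proof -
      have "a ^ k * n mod q = 1 * n mod q" using k(2) mod_mult_left_eq by metis
      then show ?thesis using cong insert.prems by simp
    qed
    \<comment> \<open>The k-th roots of unity: each \<open>\<phi> l\<close> below is, up to the
      factor k, the projection of \<open>\<psi>\<close> onto the eigenvalue 1 /
      \<open>\<omega> l\<close> of the shift by a. The sum over l returns k times
      \<open>\<psi>\<close>.\<close>
    define \<omega> where "\<omega> l = expi (- real l / real k)" for l
    have \<omega>k: "\<omega> l ^ k = 1" for l using k by (simp add: \<omega>_def expi_power expi_eq_1_iff)
    define \<phi> where "\<phi> l n = (\<Sum>j<k. \<omega> l ^ j * \<psi> (a ^ j * n))" for l n
    have \<phi>V: "\<phi> l \<in> V" for l
      unfolding V_def
    proof (intro CollectI conjI allI impI)
      fix n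
      have "\<psi> (a ^ j * (n + q)) = \<psi> (a ^ j * n)" for j
        using insert.prems by (intro cong) (auto simp: distrib_left)
      then show "\<phi> l (n + q) = \<phi> l n" by (simp add: \<phi>_def)
      assume "\<not> coprime n q"
      then have "\<psi> (a ^ j * n) = 0" for j using insert.prems by (simp add: V_def)
      then show "\<phi> l n = 0" by (simp add: \<phi>_def)
    qed
    have \<phi>E: "E a (\<phi> l)" for l
    proof -
      have "\<phi> l n = \<omega> l * \<phi> l (a * n)" for n
      proof -
        have "\<omega> l * \<phi> l (a * n) = (\<Sum>j<k. \<omega> l ^ Suc j * \<psi> (a ^ Suc j * n))"
          by (simp add: \<phi>_def sum_distrib_left mult_ac)
        also have "\<dots> = (\<Sum>j<Suc k. \<omega> l ^ j * \<psi> (a ^ j * n)) - \<psi> n"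
          by (subst sum.lessThan_Suc_shift) simp
        also have "\<dots> = \<phi> l n" by (simp add: \<phi>_def \<omega>k ak)
        finally show ?thesis by simp
      qed
      moreover have "\<omega> l \<noteq> 0" by (metis norm_expi norm_zero zero_neq_one \<omega>_def)
      ultimately have "(1 / \<omega> l) * \<phi> l n = \<phi> l (a * n)" for n
        by (metis mult.assoc mult_1 nonzero_divide_eq_eq)
      then show ?thesis unfolding E_def by metis
    qed
    \<comment> \<open>Shifts by different residues commute, so the projection keeps the eigenvalue
      relations already achieved.\<close>
    have \<phi>E': "E b (\<phi> l)" if Eb: "E b \<psi>" for b l
    proof -
      obtain c where "\<And>n. \<psi> (b * n) = c * \<psi> n" using Eb unfolding E_def by blast
      then have "\<psi> (a ^ j * (b * n)) = c * \<psi> (a ^ j * n)" for j n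
        by (metis mult.left_commute)
      then have "\<phi> l (b * n) = c * \<phi> l n" for n
        unfolding \<phi>_def sum_distrib_left by (intro sum.cong refl) (simp only: mult.left_commute)
      then show ?thesis unfolding E_def by blast
    qed
    have IH: "null_mean (\<lambda>n. of_int (moebius_mu n) * \<phi> l n)" for l
    proof (rule insert.IH[OF _ \<phi>V])
      show "\<forall>b\<in>R - B. E b (\<phi> l)"
      proof
        fix b assume "b \<in> R - B"
        then show "E b (\<phi> l)" using \<phi>E \<phi>E' insert.prems by (cases "b = a") auto
      qed
    qed (use insert.prems in auto)
    have orth: "(\<Sum>l<k. \<omega> l ^ j) = (if j = 0 then of_nat k else 0)" if "j < k" for j
    proof (cases "j = 0")
      case False
      define \<rho> where "\<rho> = expi (- real j / real k)"
      have \<omega>\<rho>: "\<omega> l ^ j = \<rho> ^ l" for l by (simp add: \<omega>_def \<rho>_def expi_power mult_ac)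
      have "- real j / real k \<notin> \<int>"
      proof
        assume "- real j / real k \<in> \<int>"
        then have "real j / real k \<in> \<int>" using Ints_minus[of "- real j / real k"] by simp
        then obtain i where i: "real j / real k = of_int i" by (auto elim: Ints_cases)
        then have "real_of_int (int j) = of_int (i * int k)" using k by (simp add: field_simps)
        then have "int j = i * int k" by linarith
        then have "int k dvd int j" by simp
        then have "k dvd j" by simp
        then show False using that False by (auto dest: dvd_imp_le)
      qed
      then have "\<rho> \<noteq> 1" by (simp add: \<rho>_def expi_eq_1_iff)
      moreover have "\<rho> ^ k = 1" using k by (simp add: \<rho>_def expi_power expi_eq_1_iff)
      ultimately have "(\<Sum>l<k. \<rho> ^ l) = 0" by (simp add: sum_gp_strict)
      then show ?thesis using False by (simp add: \<omega>\<rho>)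
    qed simp
    have "(\<Sum>l<k. \<phi> l n) = of_nat k * \<psi> n" for n
    proof -
      have "(\<Sum>l<k. \<phi> l n) = (\<Sum>j<k. (\<Sum>l<k. \<omega> l ^ j) * \<psi> (a ^ j * n))"
        unfolding \<phi>_def by (subst sum.swap) (simp add: sum_distrib_right)
      also have "\<dots> = (\<Sum>j<k. (if j = 0 then of_nat k else 0) * \<psi> (a ^ j * n))"
        by (intro sum.cong refl) (simp add: orth)
      also have "\<dots> = of_nat k * \<psi> n" using k
        by (subst sum.remove[of _ 0]) auto
      finally show ?thesis .
    qed
    then have eq: "of_int (moebius_mu n) * \<psi> n = (1 / of_nat k) * (\<Sum>l<k. of_int (moebius_mu n) * \<phi> l n)" for n
      using k by (simp add: sum_distrib_left[symmetric])
    show ?case unfolding eq by (intro null_mean_cmult null_mean_sum IH)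
  qed
  have "finite R" unfolding R_def by (rule finite_subset[of _ "{..<q}"]) auto
  then show ?thesis using main[of R \<psi>] per supp by (auto simp: V_def)
qed

text \<open>It suffices to treat one class a modulo q. With d = gcd a q every n in it is d m, and
  \<open>moebius_mu\<close> splits at d m if d and m are coprime and vanishes otherwise. A prime
  dividing both m and q would divide a, hence d, against coprimality; so the remaining condition on
  m is supported on residues prime to q.\<close>

theorem moebius_periodic_null_mean:
  fixes \<psi> :: "nat \<Rightarrow> complex"
  assumes q: "q > 0" and per: "\<And>n. \<psi> (n + q) = \<psi> n"
  shows "null_mean (\<lambda>n. of_int (moebius_mu n) * \<psi> n)"
proof -
  have ind: "null_mean (\<lambda>n. of_int (moebius_mu n) * (if n mod q = a then 1 else 0))" if a: "a < q" for a
  proof -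
    define d where "d = gcd a q"
    have d: "d > 0" "d dvd a" "d dvd q" using q by (auto simp: d_def)
    define \<psi>' :: "nat \<Rightarrow> complex" where "\<psi>' m = (if coprime d m \<and> d * m mod q = a then 1 else 0)" for m
    have "null_mean (\<lambda>n. of_int (moebius_mu n) * \<psi>' n)"
    proof (rule moebius_coprime_null_mean[OF q])
      fix n
      have "coprime d (n + q) \<longleftrightarrow> coprime d n"
        using d(3) by (metis coprime_iff_gcd_eq_1 dvdE gcd_add_mult mult.commute add.commute)
      moreover have "d * (n + q) mod q = d * n mod q" by (simp add: distrib_left)
      ultimately show "\<psi>' (n + q) = \<psi>' n" by (simp add: \<psi>'_def)
      assume "\<not> coprime n q"
      then obtain p where p: "prime p" "p dvd n" "p dvd q"
        by (metis coprime_iff_gcd_eq_1 gcd_greatest_iff prime_factor_nat dvd_refl)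
      have "\<not> (coprime d n \<and> d * n mod q = a)"
      proof
        assume *: "coprime d n \<and> d * n mod q = a"
        have "p dvd d * n mod q" using p by (simp add: dvd_mod)
        then have "p dvd d" using * p by (simp add: d_def)
        then show False using * p by (metis coprime_common_divisor_nat not_prime_1)
      qed
      then show "\<psi>' n = 0" by (simp add: \<psi>'_def)
    qed
    show ?thesis
    proof (rule null_meanI)
      fix \<epsilon> :: real assume \<epsilon>: "\<epsilon> > 0"
      have "\<forall>\<^sub>F N in sequentially. norm (\<Sum>n=1..N. of_int (moebius_mu n) * \<psi>' n) \<le> \<epsilon> * real N"
        using \<open>null_mean (\<lambda>n. of_int (moebius_mu n) * \<psi>' n)\<close> \<epsilon> unfolding null_mean_iff by blast
      then have "\<forall>\<^sub>F N in sequentially. norm (\<Sum>n=1..N div d. of_int (moebius_mu n) * \<psi>' n) \<le> \<epsilon> * real (N div d)"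
        by (rule eventually_compose_filterlim) (use d in \<open>intro filterlim_at_top_div_const_nat\<close>)
      then show "\<forall>\<^sub>F N in sequentially. norm (\<Sum>n=1..N. of_int (moebius_mu n) * (if n mod q = a then 1 else 0 :: complex)) \<le> \<epsilon> * real N"
      proof eventually_elim
        case (elim N)
        have "(\<Sum>n=1..N. of_int (moebius_mu n) * (if n mod q = a then 1 else 0 :: complex))
            = (\<Sum>n\<in>{n\<in>{1..N}. d dvd n}. of_int (moebius_mu n) * (if n mod q = a then 1 else 0))"
        proof (rule sum.mono_neutral_right)
          show "\<forall>n\<in>{1..N} - {n\<in>{1..N}. d dvd n}. of_int (moebius_mu n) * (if n mod q = a then 1 else 0 :: complex) = 0"
          proof
            fix n assume "n \<in> {1..N} - {n\<in>{1..N}. d dvd n}"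
            then have "\<not> d dvd n" by auto
            then have "n mod q \<noteq> a" using d by (metis dvd_mod_iff)
            then show "of_int (moebius_mu n) * (if n mod q = a then 1 else 0 :: complex) = 0" by simp
          qed
        qed auto
        also have "\<dots> = (\<Sum>m=1..N div d. of_int (moebius_mu (d * m)) * (if d * m mod q = a then 1 else 0))"
          by (rule sum_multiples[OF d(1)])
        also have "\<dots> = (\<Sum>m=1..N div d. of_int (moebius_mu d) * (of_int (moebius_mu m) * \<psi>' m))"
        proof (intro sum.cong refl)
          fix m
          show "of_int (moebius_mu (d * m)) * (if d * m mod q = a then 1 else 0) = of_int (moebius_mu d) * (of_int (moebius_mu m) * \<psi>' m)"
          proof (cases "coprime d m")
            case True
            then have "(of_int (moebius_mu (d * m)) :: complex) = of_int (moebius_mu d) * of_int (moebius_mu m)"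
              using mult_fun_moebius unfolding mult_fun_def by blast
            then show ?thesis using True by (simp add: \<psi>'_def)
          next
            case False
            then obtain p where "prime p" "p dvd d" "p dvd m"
              by (metis coprime_iff_gcd_eq_1 gcd_greatest_iff prime_factor_nat dvd_refl)
            then have "p ^ 2 dvd d * m" "\<not> p dvd 1" by (auto simp: power2_eq_square mult_dvd_mono)
            then have "\<not> squarefree (d * m)" by (rule not_squarefreeI)
            then show ?thesis using False by (simp add: \<psi>'_def moebius_mu_def)
          qed
        qed
        also have "\<dots> = of_int (moebius_mu d) * (\<Sum>m=1..N div d. of_int (moebius_mu m) * \<psi>' m)"
          by (rule sum_distrib_left[symmetric])
        finally have "norm (\<Sum>n=1..N. of_int (moebius_mu n) * (if n mod q = a then 1 else 0 :: complex))
            = norm (of_int (moebius_mu d) :: complex) * norm (\<Sum>m=1..N div d. of_int (moebius_mu m) * \<psi>' m)"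
          by (simp add: norm_mult)
        also have "\<dots> \<le> 1 * (\<epsilon> * real (N div d))"
          using elim by (intro mult_mono norm_moebius_le) auto
        also have "\<dots> \<le> \<epsilon> * real N" using \<epsilon> by simp
        finally show ?case .
      qed
    qed
  qed
  have mod: "\<psi> n = \<psi> (n mod q)" for n
  proof -
    have "\<psi> (r + q * j) = \<psi> r" for r j
    proof (induction j)
      case (Suc j)
      have "r + q * Suc j = (r + q * j) + q" by simp
      then show ?case using per Suc by metis
    qed simp
    then show ?thesis by (metis mod_mult_div_eq)
  qed
  have "\<psi> n = (\<Sum>a<q. \<psi> a * (if n mod q = a then 1 else 0))" for n
    using q mod[of n] by (simp add: if_distrib cong: if_cong)
  then have eq: "of_int (moebius_mu n) * \<psi> n = (\<Sum>a<q. \<psi> a * (of_int (moebius_mu n) * (if n mod q = a then 1 else 0)))" for n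
    by (metis (no_types, lifting) mult.left_commute sum.cong sum_distrib_left)
  show ?thesis unfolding eq by (intro null_mean_sum null_mean_cmult ind) auto
qed

text \<open>Davenport's theorem. In the Katai correlations the i-th coefficient becomes a i (p^i -
  q^i), so for p different from q the highest irrational position j stays where it was. If all
  coefficients of positive degree are rational, the phase is periodic modulo their common
  denominator.\<close>

theorem moebius_polynomial_null_mean:
  fixes a :: "nat \<Rightarrow> real"
  shows "null_mean (\<lambda>n. of_int (moebius_mu n) * expi (\<Sum>i\<le>d. a i * real n ^ i))"
proof (cases "\<exists>j\<in>{1..d}. a j \<notin> \<rat>")
  case True
  define j where "j = Max {j\<in>{1..d}. a j \<notin> \<rat>}"
  have "j \<in> {j\<in>{1..d}. a j \<notin> \<rat>}" unfolding j_def using True by (intro Max_in) auto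
  then have j: "1 \<le> j" "j \<le> d" "a j \<notin> \<rat>" by auto
  have top: "a i \<in> \<rat>" if "j < i" "i \<le> d" for i
  proof (rule ccontr)
    assume "a i \<notin> \<rat>"
    then have "i \<le> j" unfolding j_def using that j by (intro Max_ge) auto
    then show False using that by simp
  qed
  show ?thesis
  proof (rule katai_criterion)
    show "(of_int (moebius_mu (m * n)) :: complex) = of_int (moebius_mu m) * of_int (moebius_mu n)" if "coprime m n" for m n
      using mult_fun_moebius that unfolding mult_fun_def by blast
    show "norm (of_int (moebius_mu n) :: complex) \<le> 1" for n by (rule norm_moebius_le)
    fix p q :: nat assume pq: "prime p" "prime q" "p \<noteq> q"
    have "null_mean (\<lambda>n. expi (\<Sum>i\<le>d. (a i * (real p ^ i - real q ^ i)) * real n ^ i))"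
    proof (rule weyl_null_mean[OF j(1,2)])
      show "a j * (real p ^ j - real q ^ j) \<notin> \<rat>"
      proof
        assume *: "a j * (real p ^ j - real q ^ j) \<in> \<rat>"
        have "p ^ j \<noteq> q ^ j" using pq j by (simp add: power_eq_iff_eq_base)
        then have nz: "real p ^ j - real q ^ j \<noteq> 0" by (metis of_nat_eq_iff of_nat_power right_minus_eq)
        have "(a j * (real p ^ j - real q ^ j)) / (real p ^ j - real q ^ j) \<in> \<rat>"
          using * by (intro Rats_divide) auto
        then show False using nz j by simp
      qed
      show "a i * (real p ^ i - real q ^ i) \<in> \<rat>" if "j < i" "i \<le> d" for i
        using top[OF that] by (intro Rats_mult) auto
    qed
    moreover have "(\<Sum>i\<le>d. (a i * (real p ^ i - real q ^ i)) * real n ^ i)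
        = (\<Sum>i\<le>d. a i * real (p * n) ^ i) - (\<Sum>i\<le>d. a i * real (q * n) ^ i)" for n
      by (simp add: sum_subtractf[symmetric] power_mult_distrib algebra_simps)
    ultimately show "null_mean (\<lambda>n. expi (\<Sum>i\<le>d. a i * real (p * n) ^ i) * cnj (expi (\<Sum>i\<le>d. a i * real (q * n) ^ i)))"
      by (simp only: expi_diff)
  qed simp
next
  case False
  then obtain q :: nat where q: "q > 0" "\<And>i. i \<in> {1..d} \<Longrightarrow> real q * a i \<in> \<int>"
    using common_denominator[of "{1..d}" a] by auto
  show ?thesis
  proof (rule moebius_periodic_null_mean[OF q(1)])
    fix n
    have "(\<Sum>i\<le>d. a i * real (n + q) ^ i) - (\<Sum>i\<le>d. a i * real n ^ i)
        = (\<Sum>i\<le>d. a i * (real (n + q) ^ i - real n ^ i))"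
      by (simp add: sum_subtractf right_diff_distrib)
    also have "\<dots> \<in> \<int>"
    proof (rule Ints_sum)
      fix i assume i: "i \<in> {..d}"
      show "a i * (real (n + q) ^ i - real n ^ i) \<in> \<int>"
      proof (cases "i = 0")
        case False
        then show ?thesis using i by (intro power_diff_Ints q) auto
      qed simp
    qed
    finally have "expi ((\<Sum>i\<le>d. a i * real (n + q) ^ i) - (\<Sum>i\<le>d. a i * real n ^ i)) = 1"
      by (simp only: expi_eq_1_iff)
    then show "expi (\<Sum>i\<le>d. a i * real (n + q) ^ i) = expi (\<Sum>i\<le>d. a i * real n ^ i)"
      using expi_add[of "(\<Sum>i\<le>d. a i * real (n + q) ^ i) - (\<Sum>i\<le>d. a i * real n ^ i)" "\<Sum>i\<le>d. a i * real n ^ i"]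
      by simp
  qed
qed

section \<open>Signed polynomials and roots of unity\<close>

abbreviation cpoly :: "int poly \<Rightarrow> complex poly" where
  "cpoly \<equiv> map_poly complex_of_int"

lemma coeff_cpoly [simp]: "coeff (cpoly p) n = of_int (coeff p n)"
  by (simp add: coeff_map_poly)

lemma cpoly_0 [simp]: "cpoly 0 = 0" and cpoly_1 [simp]: "cpoly 1 = 1"
  by simp_all

lemma cpoly_add: "cpoly (p + q) = cpoly p + cpoly q"
  by (simp add: poly_eq_iff)

lemma cpoly_diff: "cpoly (p - q) = cpoly p - cpoly q"
  by (simp add: poly_eq_iff)

lemma cpoly_mult: "cpoly (p * q) = cpoly p * cpoly q"
  by (simp add: poly_eq_iff coeff_mult)

lemma cpoly_power: "cpoly (p ^ n) = cpoly p ^ n"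
  by (induction n) (simp_all add: cpoly_mult)

lemma cpoly_smult: "cpoly (smult c p) = smult (of_int c) (cpoly p)"
  by (simp add: poly_eq_iff)

lemma cpoly_monom: "cpoly (monom c n) = monom (of_int c) n"
  by (simp add: poly_eq_iff)

lemma degree_cpoly [simp]: "degree (cpoly p) = degree p"
  by (rule degree_map_poly) simp

lemma cpoly_eq_0_iff [simp]: "cpoly p = 0 \<longleftrightarrow> p = 0"
  by (simp add: poly_eq_iff)

lemma geometric_dominates:
  fixes x :: real
  assumes "x \<ge> 2"
  shows "(\<Sum>i<n. x ^ i) < x ^ n"
proof (induction n)
  case (Suc n)
  have "(\<Sum>i<Suc n. x ^ i) < 2 * x ^ n" using Suc by simp
  also have "\<dots> \<le> x * x ^ n" using assms by (intro mult_right_mono) auto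
  finally show ?case by simp
qed simp

definition signed_poly :: "int poly \<Rightarrow> bool" where
  "signed_poly Q \<longleftrightarrow> Q \<noteq> 0 \<and> (\<forall>i. coeff Q i \<in> {-1, 0, 1})"

text \<open>For |w| at least 2 the leading term exceeds the sum of all lower ones, each coefficient
  having modulus at most 1.\<close>

lemma signed_poly_no_large_root:
  assumes "signed_poly Q" "norm w \<ge> 2"
  shows "poly (cpoly Q) w \<noteq> 0"
proof
  assume 0: "poly (cpoly Q) w = 0"
  define n where "n = degree Q"
  have co: "norm (complex_of_int (coeff Q i)) \<le> 1" for i
  proof -
    have "coeff Q i \<in> {-1, 0, 1}" using assms by (simp add: signed_poly_def)
    then show ?thesis by auto
  qed
  have lc: "norm (complex_of_int (coeff Q n)) = 1"
  proof -
    have "coeff Q n \<in> {-1, 0, 1}" "coeff Q n \<noteq> 0" using assms by (auto simp: signed_poly_def n_def)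
    then show ?thesis by auto
  qed
  have "0 = (\<Sum>i<n. of_int (coeff Q i) * w ^ i) + of_int (coeff Q n) * w ^ n"
    using 0 by (simp add: poly_altdef n_def lessThan_Suc_atMost[symmetric])
  then have "norm (of_int (coeff Q n) * w ^ n) = norm (\<Sum>i<n. of_int (coeff Q i) * w ^ i)"
    by (metis add_eq_0_iff norm_minus_cancel)
  also have "\<dots> \<le> (\<Sum>i<n. norm w ^ i)"
  proof (rule sum_norm_le)
    fix i
    have "norm (complex_of_int (coeff Q i)) * norm w ^ i \<le> 1 * norm w ^ i"
      by (intro mult_right_mono co) auto
    then show "norm (of_int (coeff Q i) * w ^ i) \<le> norm w ^ i" by (simp add: norm_mult norm_power)
  qed
  also have "\<dots> < norm w ^ n" by (rule geometric_dominates[OF assms(2)])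
  finally show False using lc by (simp add: norm_mult norm_power)
qed

lemma signed_poly_no_small_root:
  assumes "signed_poly Q" "w \<noteq> 0" "norm w \<le> 1/2"
  shows "poly (cpoly Q) w \<noteq> 0"
proof
  assume 0: "poly (cpoly Q) w = 0"
  have "signed_poly (reflect_poly Q)"
    using assms(1) by (auto simp: signed_poly_def coeff_reflect_poly)
  moreover have "norm (inverse w) \<ge> 2"
    using assms(2,3) le_imp_inverse_le[of "norm w" "1/2"] by (simp add: norm_inverse)
  ultimately have "poly (cpoly (reflect_poly Q)) (inverse w) \<noteq> 0"
    by (rule signed_poly_no_large_root)
  moreover have "cpoly (reflect_poly Q) = reflect_poly (cpoly Q)"
    by (simp add: poly_eq_iff coeff_reflect_poly)
  ultimately show False using 0 assms(2) by (simp add: poly_reflect_poly_nz)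
qed

lemma complex_poly_roots:
  fixes p :: "complex poly"
  assumes "lead_coeff p = 1"
  obtains z where "p = (\<Prod>i<degree p. [:- z i, 1:])"
proof -
  obtain A where A: "size A = degree p" "p = smult (lead_coeff p) (\<Prod>x\<in>#A. [:-x, 1:])"
    using alg_closed_imp_factorization[of p] assms by (metis leading_coeff_0_iff zero_neq_one)
  obtain xs where xs: "mset xs = A" using ex_mset by blast
  have "p = prod_list (map (\<lambda>x. [:-x, 1:]) xs)"
    using A(2) assms xs by (metis mset_map prod_mset_prod_list smult_1_left)
  also have "\<dots> = (\<Prod>i<length xs. [:- (xs ! i), 1:])"
    by (simp add: prod.list_conv_set_nth lessThan_atLeast0)
  finally show ?thesis using that[of "\<lambda>i. xs ! i"] A(1) xs by (metis size_mset)
qed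

text \<open>With \<open>R = \<Prod>(1 - z\<^sub>i X)\<close> the power sums satisfy
  \<open>R \<Sum> s\<^sub>k X\<^sup>k = d R - X R'\<close>, so they are integers as soon as \<open>R\<close> has integer coefficients.\<close>

lemma newton_identity:
  fixes z :: "nat \<Rightarrow> complex"
  defines "R \<equiv> \<lambda>d. \<Prod>i<d. 1 - fps_const (z i) * fps_X"
  shows "R d * Abs_fps (\<lambda>k. \<Sum>i<d. z i ^ k) = of_nat d * R d - fps_X * fps_deriv (R d)"
proof (induction d)
  case 0
  then show ?case by (simp add: R_def fps_eq_iff)
next
  case (Suc d)
  define S where "S d = Abs_fps (\<lambda>k. \<Sum>i<d. z i ^ k)" for d
  define g where "g = Abs_fps (\<lambda>k. z d ^ k)"
  have S: "S (Suc d) = S d + g" by (simp add: S_def g_def fps_eq_iff)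
  have g: "(1 - fps_const (z d) * fps_X) * g = 1"
  proof (rule fps_ext)
    fix n
    show "((1 - fps_const (z d) * fps_X) * g) $ n = 1 $ n"
      by (cases n) (simp_all add: g_def left_diff_distrib mult.assoc)
  qed
  have R: "R (Suc d) = (1 - fps_const (z d) * fps_X) * R d" by (simp add: R_def mult.commute)
  have "R (Suc d) * S (Suc d) = (1 - fps_const (z d) * fps_X) * (R d * S d) + R d * ((1 - fps_const (z d) * fps_X) * g)"
    unfolding R S by (simp add: algebra_simps)
  also have "\<dots> = (1 - fps_const (z d) * fps_X) * (of_nat d * R d - fps_X * fps_deriv (R d)) + R d"
    using Suc unfolding g S_def by simp
  also have "\<dots> = of_nat (Suc d) * R (Suc d) - fps_X * fps_deriv (R (Suc d))"
    unfolding R by (simp add: algebra_simps)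
  finally show ?case by (simp add: S_def)
qed

text \<open>Since \<open>R\<close> has integer coefficients and constant term 1, Newton's identity
  can be solved for each power sum in terms of the previous ones without division.\<close>

lemma power_sums_Ints:
  fixes z :: "nat \<Rightarrow> complex"
  assumes p: "cpoly p = (\<Prod>i<d. [:- z i, 1:])"
  shows "(\<Sum>i<d. z i ^ n) \<in> \<int>"
proof -
  define R where "R = (\<Prod>i<d. 1 - fps_const (z i) * fps_X)"
  have "fps_of_poly (reflect_poly (cpoly p)) = R"
  proof -
    have r: "reflect_poly [:- z i, 1:] = [:1, - z i:]" for i
      by (auto simp: poly_eq_iff coeff_reflect_poly coeff_pCons split: nat.splits)
    have f: "fps_of_poly [:1, - z i:] = 1 - fps_const (z i) * fps_X" for i
      by (simp add: fps_of_poly_pCons)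
    show ?thesis unfolding p R_def reflect_poly_prod fps_of_poly_prod r f ..
  qed
  then have Rint: "R $ k \<in> \<int>" for k
    by (metis Ints_0 Ints_of_int coeff_cpoly coeff_reflect_poly fps_of_poly_nth)
  have R0: "R $ 0 = 1" unfolding R_def by (induction d) simp_all
  define s where "s k = (\<Sum>i<d. z i ^ k)" for k
  have id: "R * Abs_fps s = of_nat d * R - fps_X * fps_deriv R"
    using newton_identity[of z d] unfolding R_def s_def by simp
  have "s n \<in> \<int>"
  proof (induction n rule: less_induct)
    case (less n)
    have "(of_nat d * R) $ n = of_nat d * R $ n"
      by (metis fps_mult_left_const_nth fps_of_nat)
    then have "(R * Abs_fps s) $ n \<in> \<int>"
      unfolding id using Rint by (cases n) (auto intro!: Ints_diff Ints_mult)
    moreover have "(R * Abs_fps s) $ n = s n + (\<Sum>i\<in>{0<..n}. R $ i * s (n - i))"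
    proof -
      have "{0..n} = insert 0 {0<..n}" by auto
      then show ?thesis by (simp add: fps_mult_nth R0)
    qed
    moreover have "(\<Sum>i\<in>{0<..n}. R $ i * s (n - i)) \<in> \<int>"
      using less Rint by (intro Ints_sum Ints_mult) auto
    ultimately show ?case by (metis Ints_diff add_diff_cancel_right')
  qed
  then show ?thesis by (simp add: s_def)
qed

text \<open>Kronecker: the power sums are bounded integers, so two windows of \<open>d\<close> consecutive power sums
  coincide; testing the difference against a polynomial vanishing at all other roots gives
  \<open>x\<^sup>a = x\<^sup>b\<close> for each root \<open>x\<close>, with multiplicities doing no harm.\<close>

lemma kronecker_roots_of_unity:
  fixes z :: "nat \<Rightarrow> complex"
  assumes p: "cpoly p = (\<Prod>i<d. [:- z i, 1:])" and norm: "\<And>i. i < d \<Longrightarrow> norm (z i) = 1"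
  shows "\<exists>N\<ge>1. \<forall>i<d. z i ^ N = 1"
proof -
  have "\<forall>k. \<exists>m. (\<Sum>i<d. z i ^ k) = of_int m"
    using power_sums_Ints[OF p] Ints_cases by metis
  then obtain s where s: "\<And>k. (\<Sum>i<d. z i ^ k) = complex_of_int (s k)" by metis
  have bd: "\<bar>s k\<bar> \<le> int d" for k
  proof -
    have "real_of_int \<bar>s k\<bar> = norm (\<Sum>i<d. z i ^ k)" by (simp add: s)
    also have "\<dots> \<le> (\<Sum>i<d. 1)" using norm by (intro sum_norm_le) (simp add: norm_power)
    finally show ?thesis by simp
  qed
  define v where "v k = map (\<lambda>j. s (k + j)) [0..<d]" for k
  have "v ` UNIV \<subseteq> {xs. set xs \<subseteq> {- int d..int d} \<and> length xs = d}"
  proof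
    fix xs assume "xs \<in> v ` UNIV"
    then obtain k where "xs = v k" by auto
    then show "xs \<in> {xs. set xs \<subseteq> {- int d..int d} \<and> length xs = d}"
      using bd by (auto simp: v_def abs_le_iff minus_le_iff)
  qed
  then have "finite (v ` UNIV)" by (rule finite_subset) (simp add: finite_lists_length_eq)
  then have "\<not> inj v" using finite_imageD infinite_UNIV_nat by blast
  then obtain a b where ab: "a < b" "v a = v b"
    unfolding inj_def by (metis linorder_neqE_nat)
  have win: "(\<Sum>i<d. (z i ^ a - z i ^ b) * z i ^ j) = 0" if "j < d" for j
  proof -
    have "s (a + j) = s (b + j)" using ab(2) that by (auto simp: v_def)
    then have "(\<Sum>i<d. z i ^ (a + j)) = (\<Sum>i<d. z i ^ (b + j))" by (simp add: s)
    then show ?thesis by (simp add: left_diff_distrib power_add sum_subtractf)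
  qed
  have "z l ^ (b - a) = 1" if l: "l < d" for l
  proof -
    define Y where "Y = z ` {..<d} - {z l}"
    define q where "q = (\<Prod>y\<in>Y. [:- y, 1:])"
    have "card Y < d"
    proof -
      have "card Y < card (z ` {..<d})" unfolding Y_def using l by (intro card_Diff1_less) auto
      also have "\<dots> \<le> d" using card_image_le[of "{..<d}" z] by simp
      finally show ?thesis .
    qed
    moreover have "degree q = card Y"
      unfolding q_def by (subst degree_prod_eq_sum_degree) auto
    ultimately have dq: "degree q < d" by simp
    have "(\<Sum>i<d. (z i ^ a - z i ^ b) * poly q (z i)) = (\<Sum>i<d. \<Sum>j\<le>degree q. coeff q j * ((z i ^ a - z i ^ b) * z i ^ j))"
      by (simp add: poly_altdef sum_distrib_left mult_ac)
    also have "\<dots> = (\<Sum>j\<le>degree q. coeff q j * (\<Sum>i<d. (z i ^ a - z i ^ b) * z i ^ j))"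
      by (subst sum.swap) (simp add: sum_distrib_left)
    also have "\<dots> = 0" using win dq by (intro sum.neutral) auto
    finally have "(\<Sum>i<d. (z i ^ a - z i ^ b) * poly q (z i)) = 0" .
    moreover have "(z i ^ a - z i ^ b) * poly q (z i) = (if z i = z l then (z l ^ a - z l ^ b) * poly q (z l) else 0)"
      if "i < d" for i
    proof (cases "z i = z l")
      case False
      then have "z i \<in> Y" using that by (simp add: Y_def)
      moreover have "finite Y" by (simp add: Y_def)
      ultimately have "poly q (z i) = 0" by (auto simp: q_def poly_prod prod_zero_iff)
      then show ?thesis using False by simp
    qed simp
    ultimately have "of_nat (card {i. i < d \<and> z i = z l}) * ((z l ^ a - z l ^ b) * poly q (z l)) = 0"
      by (simp add: sum.If_cases Int_def lessThan_def)
    moreover have "l \<in> {i. i < d \<and> z i = z l}" using l by simp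
    then have "card {i. i < d \<and> z i = z l} \<noteq> 0" by (auto simp: card_eq_0_iff)
    moreover have "poly q (z l) \<noteq> 0" by (auto simp: q_def poly_prod Y_def prod_zero_iff)
    ultimately have "z l ^ a = z l ^ b" by simp
    also have "\<dots> = z l ^ a * z l ^ (b - a)" using ab(1) by (simp flip: power_add)
    finally have "z l ^ a * z l ^ (b - a) = z l ^ a * 1" by simp
    moreover have "z l ^ a \<noteq> 0" using norm[OF l] by auto
    ultimately show ?thesis using mult_left_cancel by blast
  qed
  then show ?thesis using ab(1) by (intro exI[of _ "b - a"]) auto
qed

text \<open>Kronecker's theorem gives one N for all roots. Each linear factor of H then divides X^N
  - 1, and the d-th power, d being the degree, takes care of multiplicities.\<close>

lemma monic_unit_roots_divides:
  fixes H :: "int poly"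
  assumes lc: "\<bar>lead_coeff H\<bar> = 1" and roots: "\<And>\<zeta>. poly (cpoly H) \<zeta> = 0 \<Longrightarrow> norm \<zeta> = 1"
  shows "\<exists>N\<ge>1. \<exists>d. H dvd (monom 1 N - 1) ^ d"
proof -
  define G where "G = smult (lead_coeff H) H"
  have l2: "lead_coeff H * lead_coeff H = 1" using lc by (metis abs_mult_self_eq mult_1)
  have H0: "H \<noteq> 0" using lc by auto
  have "lead_coeff G = 1" using H0 l2 by (simp add: G_def)
  then have G1: "lead_coeff (cpoly G) = 1" unfolding degree_cpoly coeff_cpoly by simp
  obtain z where z0: "cpoly G = (\<Prod>i<degree (cpoly G). [:- z i, 1:])"
    using complex_poly_roots[OF G1] by blast
  define d where "d = degree (cpoly G)"
  have z: "cpoly G = (\<Prod>i<d. [:- z i, 1:])" using z0 unfolding d_def .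
  have root: "norm (z i) = 1" if "i < d" for i
  proof (rule roots)
    have "poly (cpoly G) (z i) = 0" unfolding z using that by (auto simp: poly_prod prod_zero_iff)
    then show "poly (cpoly H) (z i) = 0" using lc by (auto simp: G_def cpoly_smult)
  qed
  obtain N where N: "N \<ge> 1" "\<And>i. i < d \<Longrightarrow> z i ^ N = 1"
    using kronecker_roots_of_unity[OF z root] by blast
  define P where "P = (monom 1 N - 1 :: int poly) ^ d"
  have "cpoly G dvd (\<Prod>i<d. monom 1 N - 1)"
    unfolding z
  proof (rule prod_dvd_prod)
    fix i assume "i \<in> {..<d}"
    then have "poly (monom 1 N - 1) (z i) = 0" using N by (simp add: poly_monom)
    then show "[:- z i, 1:] dvd monom 1 N - 1" by (simp only: poly_eq_0_iff_dvd)
  qed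
  then have Gdvd: "cpoly G dvd cpoly P" by (simp add: P_def cpoly_power cpoly_diff cpoly_monom)
  \<comment> \<open>Divisibility is known only over the complex numbers. Division over the integers
    by H, whose leading coefficient is a unit, leaves a remainder that H divides over the complex
    numbers and that is therefore zero.\<close>
  obtain q r where qr: "pseudo_divmod P H = (q, r)" by fastforce
  define k where "k = Suc (degree P) - degree H"
  have eq: "smult (lead_coeff H ^ k) P = H * q + r" and dr: "r = 0 \<or> degree r < degree H"
    using pseudo_divmod[OF H0 qr] by (auto simp: k_def)
  have "cpoly G = smult (of_int (lead_coeff H)) (cpoly H)" by (simp add: G_def cpoly_smult)
  then have "cpoly H dvd cpoly P" using Gdvd by (metis smult_dvd_iff dvd_smult_cancel smult_dvd_cancel)
  then have "cpoly H dvd cpoly (smult (lead_coeff H ^ k) P) - cpoly H * cpoly q"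
    by (simp add: cpoly_smult dvd_smult)
  then have "cpoly H dvd cpoly r" unfolding eq by (simp add: cpoly_add cpoly_mult)
  then have "r = 0" using dr dvd_imp_degree_le[of "cpoly H" "cpoly r"] by fastforce
  then have "smult (lead_coeff H ^ k) (smult (lead_coeff H ^ k) P) = H * smult (lead_coeff H ^ k) q"
    using eq by simp
  moreover have "lead_coeff H ^ k * lead_coeff H ^ k = 1" using l2 by (simp flip: power_mult_distrib)
  ultimately have "P = H * smult (lead_coeff H ^ k) q" by simp
  then show ?thesis unfolding P_def using N(1) by (metis dvd_triv_left)
qed

lemma dvd_monom_minus_1:
  fixes N M :: nat
  shows "monom (1::int) N - 1 dvd monom 1 (N * M) - 1"
proof -
  have "monom (1::int) (N * M) = monom 1 N ^ M" by (simp add: monom_power)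
  then show ?thesis using power_diff_1_eq[of "monom (1::int) N" M] by (metis dvd_triv_left)
qed

text \<open>An element \<open>h\<close> of least degree divides every element of \<open>I\<close> over the rationals. The roots of a
  signed polynomial lie in \<open>1/2 < |z| < 2\<close>, so if \<open>z\<close> is a root of \<open>h\<close>, then \<open>1/2 < |z|\<^sup>L < 2\<close> for
  all \<open>L\<close> and hence \<open>|z| = 1\<close>. The primitive part of \<open>h\<close> is monic up to sign, so its roots are roots of unity.
  The content \<open>m\<close> is removed by pigeonhole: modulo \<open>m\<close> and a signed polynomial in \<open>I\<close> there are only
  finitely many residues of powers of the indeterminate.\<close>

theorem unipotent_of_signed_relations:
  fixes I :: "int poly set"
  assumes add: "\<And>P Q. P \<in> I \<Longrightarrow> Q \<in> I \<Longrightarrow> P + Q \<in> I"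
    and mult: "\<And>P R. P \<in> I \<Longrightarrow> R * P \<in> I"
    and cancel: "\<And>P. pCons 0 P \<in> I \<Longrightarrow> P \<in> I"
    and rel: "\<And>L. L \<ge> 1 \<Longrightarrow> \<exists>Q. signed_poly Q \<and> pcompose Q (monom 1 L) \<in> I"
  shows "\<exists>N\<ge>1. \<exists>k. (monom 1 N - 1) ^ k \<in> I"
proof -
  have minus: "P - Q \<in> I" if "P \<in> I" "Q \<in> I" for P Q
    using add[OF that(1) mult[OF that(2), of "-1"]] by simp
  have sm: "smult c P \<in> I" if "P \<in> I" for c P
    using mult[OF that, of "[:c:]"] by simp
  have mult': "P * R \<in> I" if "P \<in> I" for P R using mult[OF that, of R] by (simp add: mult.commute)
  obtain P1 where P1: "signed_poly P1" "P1 \<in> I"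
  proof -
    obtain Q where "signed_poly Q" "pcompose Q (monom 1 1) \<in> I" using rel[of 1] by auto
    moreover have "monom (1::int) 1 = [:0, 1:]" by (simp add: monom_altdef)
    ultimately show ?thesis using that[of Q] by (simp add: pcompose_idR)
  qed
  have lcP1: "\<bar>lead_coeff P1\<bar> = 1"
  proof -
    have "lead_coeff P1 \<in> {-1, 0, 1}" "lead_coeff P1 \<noteq> 0" using P1(1) by (auto simp: signed_poly_def)
    then show ?thesis by auto
  qed
  have P10: "P1 \<noteq> 0" using P1 by (simp add: signed_poly_def)
  obtain h where h: "h \<in> I" "h \<noteq> 0" and hmin: "\<And>g. g \<in> I \<Longrightarrow> g \<noteq> 0 \<Longrightarrow> degree h \<le> degree g"
    using ex_has_least_nat[of "\<lambda>g. g \<in> I \<and> g \<noteq> 0" P1 degree] P1 P10 by auto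
  \<comment> \<open>Pseudo-division stays within integer polynomials; the remainder lies in I and
    has smaller degree than \<open>h\<close>, so it vanishes by minimality.\<close>
  have pdiv: "\<exists>c q. c \<noteq> 0 \<and> smult c P = h * q" if P: "P \<in> I" for P
  proof -
    obtain q r where qr: "pseudo_divmod P h = (q, r)" by fastforce
    define c where "c = lead_coeff h ^ (Suc (degree P) - degree h)"
    have eq: "smult c P = h * q + r" and dr: "r = 0 \<or> degree r < degree h"
      using pseudo_divmod[OF h(2) qr] by (auto simp: c_def)
    have "r = smult c P - h * q" using eq by simp
    then have "r \<in> I" using P h by (auto intro: minus sm mult')
    then have "degree h \<le> degree r" if "r \<noteq> 0" using that hmin by blast
    then have "r = 0" using dr by linarith
    then show ?thesis using eq h(2) by (intro exI[of _ c] exI[of _ q]) (auto simp: c_def)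
  qed
  define H where "H = primitive_part h"
  define m where "m = content h"
  have hH: "h = smult m H" by (simp add: H_def m_def)
  have m0: "m \<noteq> 0" using h by (simp add: m_def)
  \<comment> \<open>Gauss's lemma: P1 has content 1, so in c P1 = h q the contents satisfy |c| = m
    content q. Cancelling them exhibits H, up to sign, as a divisor of P1, whose leading coefficient
    is a unit.\<close>
  have lcH: "\<bar>lead_coeff H\<bar> = 1"
  proof -
    obtain c q where cq: "c \<noteq> 0" "smult c P1 = h * q" using pdiv[OF P1(2)] by blast
    have "content P1 dvd lead_coeff P1" by simp
    then have "content P1 dvd 1" using lcP1 by (metis dvd_abs_iff)
    then have "content P1 = 1" by (simp only: is_unit_content_iff)
    then have "\<bar>c\<bar> = content (smult c P1)" by simp
    also have "\<dots> = m * content q" unfolding cq(2) content_mult m_def ..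
    finally have mc: "m * content q = \<bar>c\<bar>" ..
    have "h * q = smult m H * smult (content q) (primitive_part q)" by (simp flip: hH)
    then have "smult c P1 = smult (m * content q) (H * primitive_part q)"
      unfolding cq(2)
      by (simp only: mult_smult_left mult_smult_right smult_smult mult.commute[of "content q" m])
    then have "lead_coeff (smult c P1) = lead_coeff (smult \<bar>c\<bar> (H * primitive_part q))" by (simp add: mc)
    then have "c * lead_coeff P1 = \<bar>c\<bar> * (lead_coeff H * lead_coeff (primitive_part q))"
      using cq(1) by (simp add: lead_coeff_mult)
    then have "\<bar>c\<bar> * \<bar>lead_coeff P1\<bar> = \<bar>c\<bar> * (\<bar>lead_coeff H\<bar> * \<bar>lead_coeff (primitive_part q)\<bar>)"
      by (metis abs_mult abs_abs)
    then have "\<bar>lead_coeff H\<bar> * \<bar>lead_coeff (primitive_part q)\<bar> = 1" using cq(1) lcP1 by simp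
    then show ?thesis by (metis abs_ge_zero dvd_triv_left zdvd1_eq abs_abs)
  qed
  have rootI: "poly (cpoly P) \<zeta> = 0" if P: "P \<in> I" and root: "poly (cpoly H) \<zeta> = 0" for P \<zeta>
  proof -
    obtain c q where "c \<noteq> 0" "smult c P = h * q" using pdiv[OF P] by blast
    then have "smult (of_int c) (cpoly P) = smult (of_int m) (cpoly H) * cpoly q"
      by (metis cpoly_mult cpoly_smult hH)
    then have "of_int c * poly (cpoly P) \<zeta> = of_int m * poly (cpoly H) \<zeta> * poly (cpoly q) \<zeta>"
      by (metis poly_mult poly_smult)
    then show ?thesis using root \<open>c \<noteq> 0\<close> by simp
  qed
  have rootL: "\<exists>Q. signed_poly Q \<and> poly (cpoly Q) (\<zeta> ^ L) = 0" if \<zeta>: "poly (cpoly H) \<zeta> = 0" and L: "L \<ge> 1" for L \<zeta>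
  proof -
    obtain Q where Q: "signed_poly Q" "pcompose Q (monom 1 L) \<in> I" using rel[OF L] by blast
    have "cpoly (pcompose Q (monom 1 L)) = pcompose (cpoly Q) (monom 1 L)"
      by (induction Q) (simp_all add: pcompose_pCons cpoly_add cpoly_mult cpoly_monom map_poly_pCons)
    then have "poly (cpoly Q) (\<zeta> ^ L) = 0"
      using rootI[OF Q(2) \<zeta>] by (simp add: poly_pcompose poly_monom)
    then show ?thesis using Q by blast
  qed
  have root: "norm \<zeta> = 1" if \<zeta>: "poly (cpoly H) \<zeta> = 0" for \<zeta>
  proof -
    \<comment> \<open>If 0 were a root, h would be X times a polynomial that \<open>cancel\<close>
      places in I, contrary to minimality of the degree.\<close>
    have nz: "\<zeta> \<noteq> 0"
    proof
      assume "\<zeta> = 0"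
      then have "coeff H 0 = 0" using \<zeta> by (simp add: poly_0_coeff_0)
      then obtain H' where H': "H = pCons 0 H'" by (cases H) auto
      then have "pCons 0 (smult m H') \<in> I" using h(1) hH by simp
      then have "smult m H' \<in> I" by (rule cancel)
      moreover have "H' \<noteq> 0" using H' lcH by auto
      ultimately have "degree h \<le> degree H'" using hmin[of "smult m H'"] m0 by simp
      moreover have "degree h = Suc (degree H')" using hH H' \<open>H' \<noteq> 0\<close> m0 by simp
      ultimately show False by simp
    qed
    have "\<not> norm \<zeta> > 1"
    proof
      assume "norm \<zeta> > 1"
      then obtain L where L: "2 < norm \<zeta> ^ L" using real_arch_pow by blast
      then have "L \<ge> 1" by (cases L) auto
      then show False
        using rootL[OF \<zeta>] signed_poly_no_large_root[of _ "\<zeta> ^ L"] L by (auto simp: norm_power)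
    qed
    moreover have "\<not> norm \<zeta> < 1"
    proof
      assume "norm \<zeta> < 1"
      then obtain L where L: "norm \<zeta> ^ L < 1/2" using real_arch_pow_inv[of "1/2" "norm \<zeta>"] by auto
      then have "L \<ge> 1" by (cases L) auto
      then show False
        using rootL[OF \<zeta>] signed_poly_no_small_root[of _ "\<zeta> ^ L"] L nz by (fastforce simp: norm_power)
    qed
    ultimately show ?thesis by simp
  qed
  obtain N d where N: "N \<ge> 1" "H dvd (monom 1 N - 1) ^ d"
    using monic_unit_roots_divides[OF lcH root] by blast
  define Q where "Q = (monom 1 N - 1 :: int poly) ^ d"
  have mQ: "smult m Q \<in> I"
  proof -
    obtain q where "Q = H * q" using N(2) by (auto simp: Q_def)
    then have "smult m Q = h * q" by (simp add: hH)
    then show ?thesis using h mult' by simp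
  qed
  have "m > 0" using m0 normalize_content[of h] unfolding m_def by (metis abs_ge_zero less_le normalize_int_def)
  define D where "D = degree P1"
  \<comment> \<open>The finite set of remainders. Against the factor Q, degrees at or above D are
    reduced by P1, which lies in I with unit leading coefficient, and coefficients are reduced
    modulo m because m Q lies in I.\<close>
  define F where "F = {r :: int poly. (\<forall>i\<ge>D. coeff r i = 0) \<and> (\<forall>i. coeff r i \<in> {0..<m})}"
  have "F \<subseteq> Poly ` {xs. set xs \<subseteq> {0..<m} \<and> length xs = D}"
  proof
    fix r assume r: "r \<in> F"
    have "r = Poly (map (coeff r) [0..<D])"
      using r by (auto simp: poly_eq_iff F_def nth_default_def)
    moreover have "map (coeff r) [0..<D] \<in> {xs. set xs \<subseteq> {0..<m} \<and> length xs = D}"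
      using r by (auto simp: F_def)
    ultimately show "r \<in> Poly ` {xs. set xs \<subseteq> {0..<m} \<and> length xs = D}" by blast
  qed
  then have finF: "finite F" by (rule finite_subset) (simp add: finite_lists_length_eq)
  have reduce: "\<exists>r\<in>F. (P - r) * Q \<in> I" if "\<forall>i>D. coeff P i = 0" for P
  proof -
    define s where "s = P - smult (coeff P D * lead_coeff P1) P1"
    have l2: "lead_coeff P1 * lead_coeff P1 = 1" using lcP1 by (metis abs_mult_self_eq mult_1)
    have s0: "coeff s i = 0" if "i \<ge> D" for i
    proof (cases "i = D")
      case True
      have "coeff s D = coeff P D - coeff P D * (lead_coeff P1 * lead_coeff P1)"
        by (simp add: s_def D_def mult.assoc)
      then show ?thesis using l2 True by simp
    next
      case False
      then show ?thesis using that \<open>\<forall>i>D. coeff P i = 0\<close> by (simp add: s_def D_def coeff_eq_0)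
    qed
    define r where "r = map_poly (\<lambda>c. c mod m) s"
    define t where "t = map_poly (\<lambda>c. c div m) s"
    have rt: "s = r + smult m t" by (simp add: poly_eq_iff r_def t_def coeff_map_poly)
    have rF: "r \<in> F" using s0 \<open>m > 0\<close> by (auto simp: F_def r_def coeff_map_poly)
    have "P - r = smult (coeff P D * lead_coeff P1) P1 + smult m t" using rt by (simp add: s_def algebra_simps)
    then have "(P - r) * Q = smult (coeff P D * lead_coeff P1) P1 * Q + t * smult m Q"
      by (simp add: distrib_right)
    moreover have "smult (coeff P D * lead_coeff P1) P1 * Q + t * smult m Q \<in> I"
      by (intro add mult'[OF sm[OF P1(2)]] mult[OF mQ])
    ultimately have "(P - r) * Q \<in> I" by (simp only:)
    with rF show ?thesis by blast
  qed
  have ex: "\<exists>r\<in>F. (monom 1 k - r) * Q \<in> I" for k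
  proof (induction k)
    case 0
    show ?case
    \<comment> \<open>For D = 0 the set \<open>F\<close> contains only 0 and cannot hold the
      constant 1; but then P1 is a unit and I is everything.\<close>
    proof (cases "D = 0")
      case True
      then obtain c where c: "P1 = [:c:]" using degree_eq_zeroE[of P1] by (auto simp: D_def)
      have "c * c = 1" using lcP1 abs_mult_self_eq[of c] by (simp add: c)
      then have "1 = P1 * P1" by (simp add: c one_pCons)
      then have "1 \<in> I" using mult[OF P1(2), of P1] by simp
      then have "(monom 1 0 - 0) * Q \<in> I" using mult[of 1 "(monom 1 0 - 0) * Q"] by simp
      moreover have "0 \<in> F" using \<open>m > 0\<close> by (simp add: F_def)
      ultimately show ?thesis by blast
    next
      case False
      then show ?thesis by (intro reduce) auto
    qed
  next
    case (Suc k)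
    then obtain r where r: "r \<in> F" "(monom 1 k - r) * Q \<in> I" by blast
    have "\<forall>i>D. coeff (pCons 0 r) i = 0" using r(1) by (auto simp: F_def coeff_pCons split: nat.split)
    from reduce[OF this] obtain r' where r': "r' \<in> F" "(pCons 0 r - r') * Q \<in> I" by blast
    have "(monom 1 (Suc k) - r') * Q = pCons 0 1 * ((monom 1 k - r) * Q) + (pCons 0 r - r') * Q"
      by (simp add: monom_Suc algebra_simps)
    moreover have "pCons 0 1 * ((monom 1 k - r) * Q) + (pCons 0 r - r') * Q \<in> I"
      by (rule add[OF mult[OF r(2)] r'(2)])
    ultimately have "(monom 1 (Suc k) - r') * Q \<in> I" by (simp only:)
    then show ?case using r' by blast
  qed
  then obtain \<rho> where \<rho>: "\<And>k. \<rho> k \<in> F" "\<And>k. (monom 1 k - \<rho> k) * Q \<in> I" by metis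
  have "finite (range \<rho>)" using \<rho>(1) finF by (meson finite_subset image_subsetI)
  then have "\<not> inj \<rho>" using finite_imageD infinite_UNIV_nat by blast
  then obtain a b where ab: "a < b" "\<rho> a = \<rho> b" unfolding inj_def by (metis linorder_neqE_nat)
  have "(monom 1 b - \<rho> b) * Q - (monom 1 a - \<rho> a) * Q \<in> I" by (intro minus \<rho>)
  moreover have "(monom 1 b - \<rho> b) * Q - (monom 1 a - \<rho> a) * Q = monom 1 a * ((monom 1 (b - a) - 1) * Q)"
    using ab by (simp add: left_diff_distrib right_diff_distrib mult_monom flip: mult.assoc)
  ultimately have mon: "monom 1 a * ((monom 1 (b - a) - 1) * Q) \<in> I" by simp
  have strip: "monom 1 n * P \<in> I \<Longrightarrow> P \<in> I" for n P
  proof (induction n)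
    case (Suc n)
    then have "pCons 0 (monom 1 n * P) \<in> I" by (simp add: monom_Suc)
    then show ?case using cancel Suc.IH by blast
  qed simp
  have fin: "(monom 1 (b - a) - 1) * Q \<in> I" by (rule strip[OF mon])
  define M where "M = b - a"
  have M: "M \<ge> 1" using ab by (simp add: M_def)
  \<comment> \<open>Both X^M - 1 and X^N - 1 divide X^(NM) - 1, so the two different binomials are
    merged into a power of a single one.\<close>
  have "(monom 1 M - 1) * Q dvd (monom 1 (N * M) - 1) * (monom 1 (N * M) - 1) ^ d"
    unfolding Q_def by (intro mult_dvd_mono dvd_power_same dvd_monom_minus_1)
      (metis dvd_monom_minus_1 mult.commute)
  then obtain T where "(monom 1 (N * M) - 1) ^ Suc d = (monom 1 M - 1) * Q * T" by auto
  then have "(monom 1 (N * M) - 1) ^ Suc d \<in> I" using mult'[OF fin, of T] by (simp add: M_def)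
  moreover have "N * M \<ge> 1" using N M by simp
  ultimately show ?thesis by blast
qed

section \<open>The invariant mean of a compact abelian group\<close>

locale compact_group =
  fixes ty :: "'a::{topological_ab_group_add, t2_space} itself"
  assumes compact_UNIV: "compact (UNIV :: 'a set)"
begin

text \<open>The tube lemma replaces a uniform structure: the triples (u, y, z) for which adding u
  moves F by less than \<open>\<epsilon>\<close> form an open set containing the slice u = 0. The
  spectator variable z is carried along for \<open>continuous_mean\<close> and
  \<open>mean_fubini\<close>.\<close>

lemma uniform_continuity:
  fixes F :: "'a \<times> 'c::topological_space \<Rightarrow> 'b::metric_space"
  assumes F: "continuous_on UNIV F" and C: "compact (UNIV :: 'c set)" and \<epsilon>: "\<epsilon> > 0"
  shows "\<exists>U. open U \<and> 0 \<in> U \<and> (\<forall>x y z. x - y \<in> U \<longrightarrow> dist (F (x, z)) (F (y, z)) < \<epsilon>)"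
proof -
  define W where "W = {(u, y, z) | u y z. dist (F (y + u, z)) (F (y, z)) < \<epsilon>}"
  have W: "W = (\<lambda>p. dist (F (fst (snd p) + fst p, snd (snd p))) (F (fst (snd p), snd (snd p)))) -` {..<\<epsilon>}"
    by (auto simp: W_def)
  have "continuous_on UNIV (\<lambda>p. dist (F (fst (snd p) + fst p, snd (snd p))) (F (fst (snd p), snd (snd p))))"
    by (intro continuous_on_dist continuous_on_compose2[OF F] continuous_intros) auto
  then have W_open: "open W" unfolding W by (intro open_vimage) auto
  have W_zero: "{0} \<times> UNIV \<subseteq> W" using \<epsilon> by (auto simp: W_def)
  have "compact (UNIV :: ('a \<times> 'c) set)"
    using compact_Times[OF compact_UNIV C] by simp
  from Elementary_Topology.tube_lemma[OF this W_open W_zero]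
  obtain U where U: "0 \<in> U" "open U" "U \<times> UNIV \<subseteq> W" by blast
  have "dist (F (x, z)) (F (y, z)) < \<epsilon>" if "x - y \<in> U" for x y z
  proof -
    have "(x - y, y, z) \<in> W" using U that by auto
    then show ?thesis by (simp add: W_def)
  qed
  then show ?thesis using U by blast
qed

lemma uniform_continuity1:
  fixes f :: "'a \<Rightarrow> 'b::metric_space"
  assumes f: "continuous_on UNIV f" and \<epsilon>: "\<epsilon> > 0"
  shows "\<exists>U. open U \<and> 0 \<in> U \<and> (\<forall>x y. x - y \<in> U \<longrightarrow> dist (f x) (f y) < \<epsilon>)"
proof -
  have "continuous_on UNIV (\<lambda>p::'a \<times> 'a. f (fst p))"
    by (intro continuous_on_compose2[OF f] continuous_intros) auto
  from uniform_continuity[OF this compact_UNIV \<epsilon>] show ?thesis by auto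
qed

lemma continuous_of_modulus:
  fixes f :: "'a \<Rightarrow> 'b::metric_space"
  assumes "\<And>\<epsilon>. \<epsilon> > 0 \<Longrightarrow> \<exists>U. open U \<and> 0 \<in> U \<and> (\<forall>x y. x - y \<in> U \<longrightarrow> dist (f x) (f y) \<le> \<epsilon>)"
  shows "continuous_on UNIV f"
  unfolding continuous_on_def tendsto_iff
proof (intro ballI allI impI)
  fix x :: 'a and \<epsilon> :: real assume "\<epsilon> > 0"
  then obtain U where U: "open U" "0 \<in> U" "\<And>x y. x - y \<in> U \<Longrightarrow> dist (f x) (f y) \<le> \<epsilon> / 2"
    using assms[of "\<epsilon> / 2"] by auto
  have "open ((\<lambda>y. y - x) -` U)" using U(1) by (intro open_vimage continuous_intros)
  then have "\<forall>\<^sub>F y in nhds x. y \<in> (\<lambda>y. y - x) -` U"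
    by (rule eventually_nhds_in_open) (use U in simp)
  then have "\<forall>\<^sub>F y in at x. y - x \<in> U" unfolding eventually_at_filter by (auto elim: eventually_mono)
  then show "\<forall>\<^sub>F y in at x. dist (f y) (f x) < \<epsilon>"
    by (rule eventually_mono) (use U(3) \<open>\<epsilon> > 0\<close> in force)
qed

lemma translates_cover:
  assumes "open (W :: 'a set)" "W \<noteq> {}"
  shows "\<exists>ws. ws \<noteq> [] \<and> (\<forall>x. \<exists>w\<in>set ws. x + w \<in> W)"
proof -
  let ?T = "\<lambda>y. (\<lambda>x. x + y) -` W"
  obtain w0 where w0: "w0 \<in> W" using assms by blast
  have op: "open (?T y)" for y using assms by (intro open_vimage continuous_intros)
  have "UNIV \<subseteq> (\<Union>y\<in>UNIV. ?T y)"
  proof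
    fix x :: 'a
    have "x \<in> ?T (w0 - x)" using w0 by simp
    then show "x \<in> (\<Union>y\<in>UNIV. ?T y)" by blast
  qed
  then obtain D where D: "D \<subseteq> UNIV" "finite D" "UNIV \<subseteq> (\<Union>y\<in>D. ?T y)"
    using compactE_image[OF compact_UNIV, of UNIV ?T] op by metis
  obtain ws where ws: "set ws = D" using finite_list[OF D(2)] by blast
  have "D \<noteq> {}" using D(3) by auto
  then show ?thesis using D(3) ws by (intro exI[of _ ws]) auto
qed

text \<open>Lists count repeated translates, so that an average of averages is again an average,
  over \<open>pairsums\<close>.\<close>

definition avg :: "'a list \<Rightarrow> ('a \<Rightarrow> complex) \<Rightarrow> 'a \<Rightarrow> complex" where
  "avg ys f x = (\<Sum>y\<leftarrow>ys. f (x + y)) / of_nat (length ys)"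

definition pairsums :: "'a list \<Rightarrow> 'a list \<Rightarrow> 'a list" where
  "pairsums ys zs = concat (map (\<lambda>y. map (\<lambda>z. y + z) zs) ys)"

lemma pairsums_Nil: "ys \<noteq> [] \<Longrightarrow> zs \<noteq> [] \<Longrightarrow> pairsums ys zs \<noteq> []"
  by (cases ys; cases zs) (auto simp: pairsums_def)

lemma length_pairsums: "length (pairsums ys zs) = length ys * length zs"
  by (simp add: pairsums_def length_concat o_def sum_list_triv)

lemma avg_avg: "avg ys (avg zs f) x = avg (pairsums ys zs) f x"
proof -
  have "(\<Sum>y\<leftarrow>ys. avg zs f (x + y)) = (\<Sum>w\<leftarrow>pairsums ys zs. f (x + w)) / of_nat (length zs)"
    by (induction ys) (simp_all add: pairsums_def avg_def add_divide_distrib o_def add.assoc)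
  then show ?thesis by (simp add: avg_def length_pairsums)
qed

lemma avg_commute: "avg ys (avg zs f) x = avg zs (avg ys f) x"
proof -
  have "(\<Sum>y\<leftarrow>ys. \<Sum>z\<leftarrow>zs. f (x + y + z)) = (\<Sum>z\<leftarrow>zs. \<Sum>y\<leftarrow>ys. f (x + z + y))"
  proof (induction ys)
    case (Cons a ys)
    then show ?case by (simp add: sum_list_addf add_ac)
  qed simp
  then show ?thesis
    by (simp add: avg_def divide_inverse sum_list_mult_const mult.assoc)
qed

lemma avg_add: "avg ys (\<lambda>x. f x + g x) x = avg ys f x + avg ys g x"
  by (simp add: avg_def sum_list_addf add_divide_distrib)

lemma avg_cmult: "avg ys (\<lambda>x. c * f x) x = c * avg ys f x"
  by (simp add: avg_def sum_list_const_mult)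

lemma avg_const: "ys \<noteq> [] \<Longrightarrow> avg ys (\<lambda>_. c) x = c"
  by (simp add: avg_def sum_list_triv)

lemma avg_diff_le:
  assumes "ys \<noteq> []" "\<And>y. y \<in> set ys \<Longrightarrow> norm (f (x + y) - g (x' + y)) \<le> B"
  shows "norm (avg ys f x - avg ys g x') \<le> B"
proof -
  have "norm ((\<Sum>y\<leftarrow>ys. f (x + y)) - (\<Sum>y\<leftarrow>ys. g (x' + y))) \<le> real (length ys) * B"
    using assms(2)
  proof (induction ys)
    case (Cons a ys)
    have "norm ((\<Sum>y\<leftarrow>a # ys. f (x + y)) - (\<Sum>y\<leftarrow>a # ys. g (x' + y)))
        = norm ((f (x + a) - g (x' + a)) + ((\<Sum>y\<leftarrow>ys. f (x + y)) - (\<Sum>y\<leftarrow>ys. g (x' + y))))"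
      by (simp add: algebra_simps)
    also have "\<dots> \<le> B + real (length ys) * B"
      using Cons by (intro norm_triangle_mono) auto
    finally show ?case by (simp add: algebra_simps)
  qed simp
  then show ?thesis using assms(1)
    by (simp add: avg_def norm_divide divide_le_eq mult.commute flip: diff_divide_distrib)
qed

lemma avg_near_const:
  assumes "ys \<noteq> []" "\<And>x. norm (f x - c) \<le> B"
  shows "norm (avg ys f x - c) \<le> B"
  using avg_diff_le[of ys f x "\<lambda>_. c" x B] assms by (simp add: avg_const)

lemma avg_sum: "avg ys f = (\<lambda>x. (\<Sum>i<length ys. f (x + ys ! i)) * inverse (of_nat (length ys)))"
  by (auto simp: fun_eq_iff avg_def divide_inverse sum_list_sum_nth lessThan_atLeast0)

lemma continuous_shift:
  fixes f :: "'a \<Rightarrow> 'b::topological_space"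
  assumes "continuous_on UNIV f"
  shows "continuous_on UNIV (\<lambda>x. f (x + y))"
  by (rule continuous_on_compose2[OF assms]) (auto intro!: continuous_intros)

lemma continuous_avg: "continuous_on UNIV f \<Longrightarrow> continuous_on UNIV (avg ys f)"
  unfolding avg_sum by (intro continuous_on_mult_right continuous_on_sum continuous_shift)

text \<open>If \<open>k\<close> translates of the minimum's neighbourhood cover the group, averaging over them
  shrinks the oscillation by the factor \<open>1 - 1/k\<close>, up to \<open>\<epsilon>/k\<close>.\<close>

lemma small_oscillation:
  fixes f :: "'a \<Rightarrow> complex"
  assumes f: "continuous_on UNIV f" and real: "\<And>x. f x \<in> \<real>" and \<epsilon>: "\<epsilon> > 0"
  shows "\<exists>ys. ys \<noteq> [] \<and> (\<forall>x x'. norm (avg ys f x - avg ys f x') \<le> \<epsilon>)"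
proof -
  define \<Omega> where "\<Omega> = {d. \<exists>ys. ys \<noteq> [] \<and> (\<forall>x x'. norm (avg ys f x - avg ys f x') \<le> d)}"
  obtain U where U: "open U" "0 \<in> U" "\<And>x y. x - y \<in> U \<Longrightarrow> dist (f x) (f y) < \<epsilon> / 2"
    using uniform_continuity1[OF f, of "\<epsilon> / 2"] \<epsilon> by auto
  obtain ws where ws: "ws \<noteq> []" "\<And>x. \<exists>w\<in>set ws. x + w \<in> U"
    using translates_cover[OF U(1)] U(2) by blast
  define k where "k = real (length ws)"
  have k: "k \<ge> 1" using ws(1) by (cases ws) (auto simp: k_def)
  have "bounded (range f)" using f compact_UNIV compact_continuous_image compact_imp_bounded by blast
  then obtain B where B: "\<And>x. norm (f x) \<le> B" by (auto simp: bounded_iff)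
  have "2 * B \<in> \<Omega>"
  proof -
    have "norm (f x - f x') \<le> 2 * B" for x x' using norm_triangle_ineq4[of "f x" "f x'"] B[of x] B[of x'] by linarith
    then show ?thesis unfolding \<Omega>_def by (auto intro!: exI[of _ "[0]"] simp: avg_def)
  qed
  then have ne: "\<Omega> \<noteq> {}" by blast
  have pos: "d \<ge> 0" if "d \<in> \<Omega>" for d
    using that unfolding \<Omega>_def by (blast intro: order_trans[OF norm_ge_zero])
  then have bdd: "bdd_below \<Omega>" by (intro bdd_belowI[of _ 0])
  have real_avg: "avg ys f x = of_real (Re (avg ys f x))" for ys x
  proof -
    have "(\<Sum>y\<leftarrow>ys. f (x + y)) \<in> \<real>" using real by (induction ys) (auto intro!: Reals_add)
    then have "avg ys f x \<in> \<real>" unfolding avg_def by (auto intro!: Reals_divide)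
    then show ?thesis by (simp add: of_real_Re)
  qed
  have step: "(1 - 1 / k) * d + \<epsilon> / 2 / k \<in> \<Omega>" if d: "d \<in> \<Omega>" for d
  proof -
    obtain ys where ys: "ys \<noteq> []" "\<And>x x'. norm (avg ys f x - avg ys f x') \<le> d" using d by (auto simp: \<Omega>_def)
    define g where "g x = Re (avg ys f x)" for x
    have gc: "continuous_on UNIV g" unfolding g_def by (intro continuous_intros continuous_avg f)
    obtain x0 where x0: "\<And>x. g x0 \<le> g x"
      using continuous_attains_inf[OF compact_UNIV _ gc] by auto
    define m where "m = g x0"
    have gd: "g x \<le> m + d" for x
    proof -
      have "norm (of_real (g x - g x0) :: complex) \<le> d"
        using ys(2)[of x x0] real_avg[of ys x] real_avg[of ys x0] by (simp add: g_def)
      then show ?thesis unfolding norm_of_real m_def by linarith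
    qed
    have near: "g x \<le> m + \<epsilon> / 2" if "x - x0 \<in> U" for x
    proof -
      have "norm (avg ys f x - avg ys f x0) \<le> \<epsilon> / 2"
        using U(3) that by (intro avg_diff_le ys) (auto simp: dist_norm less_imp_le)
      then have "norm (of_real (g x - g x0) :: complex) \<le> \<epsilon> / 2"
        using real_avg[of ys x] real_avg[of ys x0] by (simp add: g_def)
      then show ?thesis unfolding norm_of_real m_def by linarith
    qed
    define S where "S x = (\<Sum>w\<leftarrow>ws. g (x + w))" for x
    have Slow: "S x \<ge> k * m" for x
      unfolding S_def k_def using x0 by (induction ws) (auto simp: m_def algebra_simps add_mono)
    have Sup: "S x \<le> k * m + (k - 1) * d + \<epsilon> / 2" for x
    proof -
      obtain w where w: "w \<in> set ws" "(x - x0) + w \<in> U" using ws(2) by blast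
      then obtain us vs where uv: "ws = us @ w # vs" by (meson split_list)
      have gen: "(\<Sum>w\<leftarrow>us. g (x + w)) \<le> real (length us) * (m + d)" for us
      proof (induction us)
        case (Cons a us)
        then show ?case using gd[of "x + a"] by (simp add: distrib_right)
      qed simp
      have "g (x + w) \<le> m + \<epsilon> / 2" by (rule near) (use w in \<open>simp add: algebra_simps\<close>)
      then have "S x \<le> real (length us) * (m + d) + (m + \<epsilon> / 2) + real (length vs) * (m + d)"
        unfolding S_def uv using gen[of us] gen[of vs] by simp
      also have "\<dots> = k * m + (k - 1) * d + \<epsilon> / 2" by (simp add: k_def uv algebra_simps)
      finally show ?thesis .
    qed
    have avS: "avg (pairsums ws ys) f x = of_real (S x / k)" for x
    proof -
      have "(\<Sum>w\<leftarrow>ws. avg ys f (x + w)) = of_real (S x)"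
        unfolding S_def g_def by (induction ws) (simp_all flip: real_avg)
      then show ?thesis unfolding avg_avg[symmetric] avg_def[of ws] by (simp add: k_def)
    qed
    have "norm (avg (pairsums ws ys) f x - avg (pairsums ws ys) f x') \<le> (1 - 1 / k) * d + \<epsilon> / 2 / k" for x x'
    proof -
      have "\<bar>S x - S x'\<bar> \<le> (k - 1) * d + \<epsilon> / 2" using Slow[of x] Slow[of x'] Sup[of x] Sup[of x'] by linarith
      then have "\<bar>S x - S x'\<bar> / k \<le> ((k - 1) * d + \<epsilon> / 2) / k" using k by (intro divide_right_mono) auto
      also have "\<dots> = (1 - 1 / k) * d + \<epsilon> / 2 / k" using k by (simp add: field_simps)
      finally have "norm (complex_of_real (S x / k - S x' / k)) \<le> (1 - 1 / k) * d + \<epsilon> / 2 / k"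
        using k unfolding norm_of_real by (simp add: abs_divide flip: diff_divide_distrib)
      then show ?thesis unfolding avS of_real_diff .
    qed
    then show ?thesis unfolding \<Omega>_def using pairsums_Nil[OF ws(1) ys(1)] by blast
  qed
  \<comment> \<open>If the infimum were at least \<open>\<epsilon>\<close>, one more step from d
    would lower the oscillation by at least \<open>\<epsilon>\<close>/(2k), and a d within
    \<open>\<epsilon>\<close>/(2k) of the infimum would fall below it.\<close>
  have "Inf \<Omega> < \<epsilon>"
  proof (rule ccontr)
    assume "\<not> Inf \<Omega> < \<epsilon>"
    then have big: "Inf \<Omega> \<ge> \<epsilon>" by simp
    have "Inf \<Omega> < Inf \<Omega> + \<epsilon> / 2 / k" using \<epsilon> k by simp
    then obtain d where d: "d \<in> \<Omega>" "d < Inf \<Omega> + \<epsilon> / 2 / k" using cInf_lessD[OF ne] by blast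
    have "Inf \<Omega> \<le> (1 - 1 / k) * d + \<epsilon> / 2 / k" using cInf_lower[OF step[OF d(1)] bdd] .
    moreover have "(1 / k) * \<epsilon> \<le> (1 / k) * d"
      using cInf_lower[OF d(1) bdd] big k by (intro mult_left_mono) auto
    ultimately have "Inf \<Omega> \<le> d - \<epsilon> / k + \<epsilon> / 2 / k" by (simp add: algebra_simps)
    then show False using d(2) by simp
  qed
  then obtain d where "d \<in> \<Omega>" "d < \<epsilon>" using cInf_lessD[OF ne] by blast
  then obtain ys where "ys \<noteq> []" "\<And>x x'. norm (avg ys f x - avg ys f x') \<le> d" by (auto simp: \<Omega>_def)
  then show ?thesis using \<open>d < \<epsilon>\<close> by (meson less_imp_le order_trans)
qed

text \<open>The constant is the Haar integral of f: averaging over translates preserves the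
  integral, so it is the only constant that averages can approach uniformly.\<close>

definition is_mean :: "('a \<Rightarrow> complex) \<Rightarrow> complex \<Rightarrow> bool" where
  "is_mean f c \<longleftrightarrow> (\<forall>\<epsilon>>0. \<exists>ys. ys \<noteq> [] \<and> (\<forall>x. norm (avg ys f x - c) \<le> \<epsilon>))"

definition mean :: "('a \<Rightarrow> complex) \<Rightarrow> complex" where
  "mean f = (THE c. is_mean f c)"

lemma small_oscillation_complex:
  fixes f :: "'a \<Rightarrow> complex"
  assumes f: "continuous_on UNIV f" and \<epsilon>: "\<epsilon> > 0"
  shows "\<exists>ys. ys \<noteq> [] \<and> (\<forall>x x'. norm (avg ys f x - avg ys f x') \<le> \<epsilon>)"
proof -
  let ?R = "\<lambda>x. complex_of_real (Re (f x))" and ?I = "\<lambda>x. complex_of_real (Im (f x))"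
  have cR: "continuous_on UNIV ?R" and cI: "continuous_on UNIV ?I" by (intro continuous_intros f)+
  obtain ys where ys: "ys \<noteq> []" "\<And>x x'. norm (avg ys ?R x - avg ys ?R x') \<le> \<epsilon> / 2"
    using small_oscillation[OF cR, of "\<epsilon> / 2"] \<epsilon> by auto
  obtain zs where zs: "zs \<noteq> []" "\<And>x x'. norm (avg zs ?I x - avg zs ?I x') \<le> \<epsilon> / 2"
    using small_oscillation[OF cI, of "\<epsilon> / 2"] \<epsilon> by auto
  have "f x = ?R x + \<i> * ?I x" for x by (simp add: complex_eq)
  then have "f = (\<lambda>x. ?R x + \<i> * ?I x)" by blast
  then have split: "avg ws f x = avg ws ?R x + \<i> * avg ws ?I x" for ws x
    by (metis (no_types) avg_add avg_cmult)
  have "norm (avg (pairsums ys zs) f x - avg (pairsums ys zs) f x') \<le> \<epsilon>" for x x'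
  proof -
    have r: "norm (avg (pairsums ys zs) ?R x - avg (pairsums ys zs) ?R x') \<le> \<epsilon> / 2"
      unfolding avg_avg[symmetric] avg_commute[of ys zs] by (rule avg_diff_le[OF zs(1) ys(2)])
    have i: "norm (\<i> * (avg (pairsums ys zs) ?I x - avg (pairsums ys zs) ?I x')) \<le> \<epsilon> / 2"
      unfolding avg_avg[symmetric] norm_mult norm_ii mult_1 by (rule avg_diff_le[OF ys(1) zs(2)])
    have "avg (pairsums ys zs) f x - avg (pairsums ys zs) f x'
        = (avg (pairsums ys zs) ?R x - avg (pairsums ys zs) ?R x') + \<i> * (avg (pairsums ys zs) ?I x - avg (pairsums ys zs) ?I x')"
      unfolding split by (simp add: algebra_simps)
    then show ?thesis using norm_triangle_mono[OF r i] by simp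
  qed
  then show ?thesis using pairsums_Nil[OF ys(1) zs(1)] by blast
qed

text \<open>Averages over different lists commute, and averaging a nearly constant function keeps it
  near that constant. Hence two averages of small oscillation are both close to their common
  composite, which makes the sequence Cauchy.\<close>

lemma is_mean_exists:
  assumes f: "continuous_on UNIV f"
  shows "\<exists>c. is_mean f c"
proof -
  have "\<forall>n. \<exists>ys. ys \<noteq> [] \<and> (\<forall>x x'. norm (avg ys f x - avg ys f x') \<le> 1 / real (Suc n))"
    using small_oscillation_complex[OF f] by simp
  then obtain Y where Y: "\<And>n. Y n \<noteq> []" "\<And>n x x'. norm (avg (Y n) f x - avg (Y n) f x') \<le> 1 / real (Suc n)"
    by metis
  have cmp: "norm (avg (Y n) f x - avg (Y m) f x') \<le> 1 / real (Suc n) + 1 / real (Suc m)" for n m x x'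
  proof -
    have 1: "norm (avg (Y m) (avg (Y n) f) 0 - avg (Y n) f x) \<le> 1 / real (Suc n)"
      by (rule avg_near_const[OF Y(1) Y(2)])
    have 2: "norm (avg (Y n) (avg (Y m) f) 0 - avg (Y m) f x') \<le> 1 / real (Suc m)"
      by (rule avg_near_const[OF Y(1) Y(2)])
    have "norm (avg (Y n) f x - avg (Y m) f x') \<le> norm (avg (Y n) f x - avg (Y m) (avg (Y n) f) 0)
        + norm (avg (Y m) (avg (Y n) f) 0 - avg (Y m) f x')"
      using norm_triangle_ineq[of "avg (Y n) f x - avg (Y m) (avg (Y n) f) 0" "avg (Y m) (avg (Y n) f) 0 - avg (Y m) f x'"]
      by simp
    then show ?thesis using 1 2 avg_commute[of "Y m" "Y n" f 0] by (simp add: norm_minus_commute)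
  qed
  define a where "a n = avg (Y n) f 0" for n
  have "Cauchy a"
    unfolding Cauchy_iff
  proof (intro allI impI)
    fix e :: real assume "e > 0"
    then obtain M where M: "1 / real (Suc M) < e / 2" using nat_approx_posE half_gt_zero by blast
    show "\<exists>M. \<forall>m\<ge>M. \<forall>n\<ge>M. norm (a m - a n) < e"
    proof (intro exI[of _ M] allI impI)
      fix m n assume "m \<ge> M" "n \<ge> M"
      then have "1 / real (Suc m) \<le> 1 / real (Suc M)" "1 / real (Suc n) \<le> 1 / real (Suc M)"
        by (simp_all add: frac_le)
      then show "norm (a m - a n) < e" using cmp[of m 0 n 0] M unfolding a_def by linarith
    qed
  qed
  then obtain c where c: "a \<longlonglongrightarrow> c" using Cauchy_convergent convergent_def by blast
  have "norm (avg (Y n) f x - c) \<le> 1 / real (Suc n)" for n x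
  proof (rule tendsto_upperbound[OF _ _ sequentially_bot])
    show "(\<lambda>m. norm (avg (Y n) f x - a m) - 1 / real (Suc m)) \<longlonglongrightarrow> norm (avg (Y n) f x - c)"
      using tendsto_diff[OF tendsto_norm[OF tendsto_diff[OF tendsto_const c]] LIMSEQ_Suc[OF lim_1_over_n]] by simp
    show "\<forall>\<^sub>F m in sequentially. norm (avg (Y n) f x - a m) - 1 / real (Suc m) \<le> 1 / real (Suc n)"
      using cmp[of n x _ 0] by (intro always_eventually allI) (simp add: a_def algebra_simps)
  qed
  then have "is_mean f c"
    unfolding is_mean_def
    by (metis Y(1) less_eq_real_def nat_approx_posE order_trans)
  then show ?thesis ..
qed

lemma is_mean_unique:
  assumes "is_mean f c" "is_mean f d"
  shows "c = d"
proof -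
  have "norm (c - d) \<le> \<epsilon>" if \<epsilon>: "\<epsilon> > 0" for \<epsilon>
  proof -
    obtain ys where ys: "ys \<noteq> []" "\<And>x. norm (avg ys f x - c) \<le> \<epsilon> / 2"
      using assms(1) \<epsilon> unfolding is_mean_def by (meson half_gt_zero)
    obtain zs where zs: "zs \<noteq> []" "\<And>x. norm (avg zs f x - d) \<le> \<epsilon> / 2"
      using assms(2) \<epsilon> unfolding is_mean_def by (meson half_gt_zero)
    have 1: "norm (avg zs (avg ys f) 0 - c) \<le> \<epsilon> / 2" by (rule avg_near_const[OF zs(1) ys(2)])
    have 2: "norm (avg ys (avg zs f) 0 - d) \<le> \<epsilon> / 2" by (rule avg_near_const[OF ys(1) zs(2)])
    have "norm (c - d) \<le> norm (c - avg ys (avg zs f) 0) + norm (avg ys (avg zs f) 0 - d)"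
      using norm_triangle_ineq[of "c - avg ys (avg zs f) 0" "avg ys (avg zs f) 0 - d"] by simp
    then show ?thesis using 1 2 avg_commute[of ys zs f 0] by (simp add: norm_minus_commute)
  qed
  then have "norm (c - d) \<le> 0" by (rule field_le_epsilon[of _ 0, simplified])
  then show ?thesis by simp
qed

lemma mean_eqI: "is_mean f c \<Longrightarrow> mean f = c"
  unfolding mean_def using is_mean_unique by blast

lemma is_mean_mean: "continuous_on UNIV f \<Longrightarrow> is_mean f (mean f)"
  using is_mean_exists mean_eqI by metis

lemma is_mean_const: "is_mean (\<lambda>_. c) c"
  unfolding is_mean_def by (auto intro!: exI[of _ "[0]"] simp: avg_def)

lemma mean_const [simp]: "mean (\<lambda>_. c) = c"
  by (rule mean_eqI[OF is_mean_const])

text \<open>A list that is good for f stays good after further averaging, so the composed list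
  serves both functions.\<close>

lemma is_mean_add:
  assumes "is_mean f c" "is_mean g d"
  shows "is_mean (\<lambda>x. f x + g x) (c + d)"
  unfolding is_mean_def
proof (intro allI impI)
  fix \<epsilon> :: real assume "\<epsilon> > 0"
  then obtain ys zs where ys: "ys \<noteq> []" "\<And>x. norm (avg ys f x - c) \<le> \<epsilon> / 2"
    and zs: "zs \<noteq> []" "\<And>x. norm (avg zs g x - d) \<le> \<epsilon> / 2"
    using assms unfolding is_mean_def by (meson half_gt_zero)
  have "norm (avg (pairsums ys zs) (\<lambda>x. f x + g x) x - (c + d)) \<le> \<epsilon>" for x
  proof -
    have "norm (avg zs (avg ys f) x - c) \<le> \<epsilon> / 2" by (rule avg_near_const[OF zs(1) ys(2)])
    moreover have "norm (avg ys (avg zs g) x - d) \<le> \<epsilon> / 2" by (rule avg_near_const[OF ys(1) zs(2)])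
    ultimately have "norm ((avg ys (avg zs f) x - c) + (avg ys (avg zs g) x - d)) \<le> \<epsilon> / 2 + \<epsilon> / 2"
      unfolding avg_commute[of ys zs f] by (rule norm_triangle_mono)
    then show ?thesis by (simp add: avg_add avg_avg algebra_simps)
  qed
  then show "\<exists>ys. ys \<noteq> [] \<and> (\<forall>x. norm (avg ys (\<lambda>x. f x + g x) x - (c + d)) \<le> \<epsilon>)"
    using pairsums_Nil[OF ys(1) zs(1)] by blast
qed

lemma is_mean_cmult:
  assumes "is_mean f c"
  shows "is_mean (\<lambda>x. a * f x) (a * c)"
proof (cases "a = 0")
  case False
  show ?thesis unfolding is_mean_def
  proof (intro allI impI)
    fix \<epsilon> :: real assume "\<epsilon> > 0"
    then have "\<epsilon> / norm a > 0" using False by simp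
    then obtain ys where ys: "ys \<noteq> []" "\<And>x. norm (avg ys f x - c) \<le> \<epsilon> / norm a"
      using assms unfolding is_mean_def by blast
    have "norm (avg ys (\<lambda>x. a * f x) x - a * c) \<le> \<epsilon>" for x
      using ys(2)[of x] False
      by (simp add: avg_cmult norm_mult le_divide_eq mult.commute flip: right_diff_distrib)
    then show "\<exists>ys. ys \<noteq> [] \<and> (\<forall>x. norm (avg ys (\<lambda>x. a * f x) x - a * c) \<le> \<epsilon>)" using ys(1) by blast
  qed
qed (use is_mean_const[of 0] in simp)

lemma is_mean_translate:
  assumes "is_mean f c"
  shows "is_mean (\<lambda>x. f (x + a)) c"
proof -
  have "avg ys (\<lambda>x. f (x + a)) x = avg ys f (x + a)" for ys x
    by (simp add: avg_def add_ac)
  then show ?thesis using assms unfolding is_mean_def by metis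
qed

lemma is_mean_cnj:
  assumes "is_mean f c"
  shows "is_mean (\<lambda>x. cnj (f x)) (cnj c)"
proof -
  have "avg ys (\<lambda>x. cnj (f x)) x - cnj c = cnj (avg ys f x - c)" for ys x
  proof -
    have "(\<Sum>y\<leftarrow>ys. cnj (f (x + y))) = cnj (\<Sum>y\<leftarrow>ys. f (x + y))" by (induction ys) auto
    then show ?thesis by (simp add: avg_def)
  qed
  then show ?thesis using assms unfolding is_mean_def by (simp del: complex_cnj_diff)
qed

lemma is_mean_near:
  assumes "is_mean f c" "\<And>x. norm (f x - d) \<le> B"
  shows "norm (c - d) \<le> B"
proof (rule field_le_epsilon)
  fix \<epsilon> :: real assume "\<epsilon> > 0"
  then obtain ys where ys: "ys \<noteq> []" "\<And>x. norm (avg ys f x - c) \<le> \<epsilon>"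
    using assms(1) unfolding is_mean_def by blast
  have "norm (avg ys f 0 - d) \<le> B" by (rule avg_near_const[OF ys(1) assms(2)])
  then show "norm (c - d) \<le> B + \<epsilon>"
    using ys(2)[of 0] norm_triangle_ineq4[of "avg ys f 0 - d" "avg ys f 0 - c"] by simp
qed

context
  fixes f :: "'a \<Rightarrow> complex"
  assumes f: "continuous_on UNIV f"
begin

lemma mean_cmult: "mean (\<lambda>x. c * f x) = c * mean f"
  by (rule mean_eqI[OF is_mean_cmult[OF is_mean_mean[OF f]]])

lemma mean_translate: "mean (\<lambda>x. f (x + a)) = mean f"
  by (rule mean_eqI[OF is_mean_translate[OF is_mean_mean[OF f]]])

lemma mean_cnj: "mean (\<lambda>x. cnj (f x)) = cnj (mean f)"
  by (rule mean_eqI[OF is_mean_cnj[OF is_mean_mean[OF f]]])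

lemma mean_near: "(\<And>x. norm (f x - d) \<le> B) \<Longrightarrow> norm (mean f - d) \<le> B"
  by (rule is_mean_near[OF is_mean_mean[OF f]])

lemma norm_mean_le: "(\<And>x. norm (f x) \<le> B) \<Longrightarrow> norm (mean f) \<le> B"
  using mean_near[of 0 B] by simp

lemma mean_add:
  assumes g: "continuous_on UNIV g"
  shows "mean (\<lambda>x. f x + g x) = mean f + mean g"
  by (rule mean_eqI[OF is_mean_add[OF is_mean_mean[OF f] is_mean_mean[OF g]]])

end

lemma mean_diff:
  assumes "continuous_on UNIV f" "continuous_on UNIV g"
  shows "mean (\<lambda>x. f x - g x) = mean f - mean g"
  using mean_add[OF assms(1), of "\<lambda>x. - 1 * g x"] mean_cmult[OF assms(2), of "-1"] assms(2)
  by (simp add: continuous_on_minus)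

lemma mean_sum:
  assumes "\<And>i. i \<in> I \<Longrightarrow> continuous_on UNIV (F i)"
  shows "mean (\<lambda>x. \<Sum>i\<in>I. F i x) = (\<Sum>i\<in>I. mean (F i))"
  using assms
proof (induction I rule: infinite_finite_induct)
  case (insert i I)
  then show ?case by (simp add: mean_add continuous_on_sum)
qed simp_all

text \<open>With 0 <= h <= B all values lie in the disc of radius B about B, and so does the mean;
  conjugation invariance makes it real.\<close>

lemma mean_nonneg:
  fixes h :: "'a \<Rightarrow> real"
  assumes h: "continuous_on UNIV h" and nn: "\<And>x. h x \<ge> 0"
  shows "mean (\<lambda>x. of_real (h x)) \<in> \<real>\<^sub>\<ge>\<^sub>0"
proof -
  let ?f = "\<lambda>x. complex_of_real (h x)"
  have f: "continuous_on UNIV ?f" by (intro continuous_intros h)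
  have "bounded (range h)" using h compact_UNIV compact_continuous_image compact_imp_bounded by blast
  then obtain B where B: "\<And>x. \<bar>h x\<bar> \<le> B" by (auto simp: bounded_iff)
  have "cnj (mean ?f) = mean ?f" using mean_cnj[OF f] by simp
  then have "Im (mean ?f) = 0" by (simp add: complex_eq_iff)
  moreover have "norm (mean ?f - of_real B) \<le> B"
  proof (rule mean_near[OF f])
    fix x
    have "norm (complex_of_real (h x - B)) \<le> B" unfolding norm_of_real using B[of x] nn[of x] by linarith
    then show "norm (?f x - of_real B) \<le> B" by simp
  qed
  then have "\<bar>Re (mean ?f) - B\<bar> \<le> B" using abs_Re_le_cmod[of "mean ?f - of_real B"] by simp
  then have "Re (mean ?f) \<ge> 0" by linarith
  ultimately show ?thesis by (simp add: complex_nonneg_Reals_iff)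
qed

lemma mean_mono:
  fixes h h' :: "'a \<Rightarrow> real"
  assumes "continuous_on UNIV h" "continuous_on UNIV h'" "\<And>x. h x \<le> h' x"
  shows "Re (mean (\<lambda>x. of_real (h x))) \<le> Re (mean (\<lambda>x. of_real (h' x)))"
proof -
  have "mean (\<lambda>x. of_real (h' x - h x)) \<in> \<real>\<^sub>\<ge>\<^sub>0"
    using assms by (intro mean_nonneg continuous_intros) auto
  moreover have "mean (\<lambda>x. of_real (h' x - h x)) = mean (\<lambda>x. of_real (h' x)) - mean (\<lambda>x. of_real (h x))"
    unfolding of_real_diff by (intro mean_diff continuous_intros assms)
  ultimately show ?thesis by (simp add: complex_nonneg_Reals_iff)
qed

text \<open>Finitely many translates of the set where h exceeds h x0 / 2 cover the group, so a
  finite sum of translates of h is bounded below, while each translate has the same mean. This gives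
  definiteness of the inner product.\<close>

lemma mean_pos:
  fixes h :: "'a \<Rightarrow> real"
  assumes h: "continuous_on UNIV h" and nn: "\<And>x. h x \<ge> 0" and pos: "h x0 > 0"
  shows "Re (mean (\<lambda>x. of_real (h x))) > 0"
proof -
  let ?f = "\<lambda>x. complex_of_real (h x)"
  have f: "continuous_on UNIV ?f" by (intro continuous_intros h)
  define W where "W = h -` {h x0 / 2<..}"
  have "open W" unfolding W_def using h by (intro open_vimage) auto
  moreover have "x0 \<in> W" using pos by (simp add: W_def)
  then have "W \<noteq> {}" by blast
  ultimately obtain ws where ws: "ws \<noteq> []" "\<And>x. \<exists>w\<in>set ws. x + w \<in> W" using translates_cover by blast
  have ge: "(\<Sum>i<length ws. h (x + ws ! i)) \<ge> h x0 / 2" for x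
  proof -
    obtain w where w: "w \<in> set ws" "x + w \<in> W" using ws(2) by blast
    then obtain i where i: "i < length ws" "ws ! i = w" by (metis in_set_conv_nth)
    have "h x0 / 2 \<le> h (x + ws ! i)" using w i by (simp add: W_def)
    also have "\<dots> \<le> (\<Sum>i<length ws. h (x + ws ! i))"
      by (rule member_le_sum) (use i nn in auto)
    finally show ?thesis .
  qed
  have c: "continuous_on UNIV (\<lambda>x. ?f (x + y))" "continuous_on UNIV (\<lambda>x. h (x + y))" for y
    by (intro continuous_on_compose2[OF f] continuous_on_compose2[OF h] continuous_intros; simp)+
  have "Re (mean (\<lambda>x. of_real (h x0 / 2))) \<le> Re (mean (\<lambda>x. of_real (\<Sum>i<length ws. h (x + ws ! i))))"
    using ge by (intro mean_mono continuous_intros c) auto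
  also have "mean (\<lambda>x. of_real (\<Sum>i<length ws. h (x + ws ! i))) = (\<Sum>i<length ws. mean (\<lambda>x. ?f (x + ws ! i)))"
    unfolding of_real_sum by (rule mean_sum[OF c(1)])
  also have "\<dots> = of_nat (length ws) * mean ?f" by (simp add: mean_translate[OF f])
  finally have "h x0 / 2 \<le> real (length ws) * Re (mean ?f)" by simp
  then have "real (length ws) * Re (mean ?f) > 0" using pos by linarith
  then show ?thesis by (simp add: zero_less_mult_iff)
qed

lemma common_averages:
  assumes "finite I" "\<And>i. i \<in> I \<Longrightarrow> is_mean (F i) (c i)" "\<epsilon> > 0"
  shows "\<exists>ys. ys \<noteq> [] \<and> (\<forall>i\<in>I. \<forall>x. norm (avg ys (F i) x - c i) \<le> \<epsilon>)"
  using assms(1,2)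
proof (induction I rule: finite_induct)
  case empty
  then show ?case by (intro exI[of _ "[0]"]) auto
next
  case (insert i I)
  then obtain ys where ys: "ys \<noteq> []" "\<And>j x. j \<in> I \<Longrightarrow> norm (avg ys (F j) x - c j) \<le> \<epsilon>" by auto
  have "is_mean (F i) (c i)" using insert by auto
  then obtain zs where zs: "zs \<noteq> []" "\<And>x. norm (avg zs (F i) x - c i) \<le> \<epsilon>"
    unfolding is_mean_def using assms(3) by blast
  have "norm (avg (pairsums ys zs) (F j) x - c j) \<le> \<epsilon>" if "j \<in> insert i I" for j x
  proof (cases "j = i")
    case True
    then show ?thesis unfolding avg_avg[symmetric] using avg_near_const[OF ys(1) zs(2)] by simp
  next
    case False
    then have "j \<in> I" using that by simp
    then show ?thesis unfolding avg_avg[symmetric] avg_commute[of ys zs] using avg_near_const[OF zs(1) ys(2)] by simp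
  qed
  then show ?case using pairsums_Nil[OF ys(1) zs(1)] by blast
qed

lemma continuous_section:
  fixes F :: "'a \<times> 'a \<Rightarrow> complex"
  assumes F: "continuous_on UNIV F"
  shows "continuous_on UNIV (\<lambda>y. F (x, y))" "continuous_on UNIV (\<lambda>y. F (y, x))"
  by (intro continuous_on_compose2[OF F] continuous_intros; simp)+

lemma continuous_mean:
  fixes F :: "'a \<times> 'a \<Rightarrow> complex"
  assumes F: "continuous_on UNIV F"
  shows "continuous_on UNIV (\<lambda>x. mean (\<lambda>y. F (x, y)))"
proof (rule continuous_of_modulus)
  fix \<epsilon> :: real assume "\<epsilon> > 0"
  then obtain U where U: "open U" "0 \<in> U" "\<And>x y z. x - y \<in> U \<Longrightarrow> dist (F (x, z)) (F (y, z)) < \<epsilon>"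
    using uniform_continuity[OF F compact_UNIV] by metis
  have "dist (mean (\<lambda>z. F (x, z))) (mean (\<lambda>z. F (y, z))) \<le> \<epsilon>" if "x - y \<in> U" for x y
  proof -
    have "norm (mean (\<lambda>z. F (x, z) - F (y, z))) \<le> \<epsilon>"
      using U(3)[OF that] by (intro norm_mean_le continuous_intros continuous_section[OF F]) (auto simp: dist_norm less_imp_le)
    then show ?thesis by (simp add: dist_norm mean_diff continuous_section[OF F])
  qed
  then show "\<exists>U. open U \<and> 0 \<in> U \<and> (\<forall>x y. x - y \<in> U \<longrightarrow> dist (mean (\<lambda>z. F (x, z))) (mean (\<lambda>z. F (y, z))) \<le> \<epsilon>)"
    using U by blast
qed

text \<open>By compactness one list \<open>ys\<close> averages all sections F (x, .) to within
  \<open>\<epsilon>\<close> of their means. Averaging over \<open>ys\<close> commutes with the mean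
  in x, being a finite sum, so \<open>mean c\<close> is approximated by averages of the other
  iterated mean.\<close>

lemma mean_fubini:
  fixes F :: "'a \<times> 'a \<Rightarrow> complex"
  assumes F: "continuous_on UNIV F"
  shows "mean (\<lambda>x. mean (\<lambda>y. F (x, y))) = mean (\<lambda>y. mean (\<lambda>x. F (x, y)))"
proof -
  define c where "c x = mean (\<lambda>y. F (x, y))" for x
  have cc: "continuous_on UNIV c" unfolding c_def by (rule continuous_mean[OF F])
  have "is_mean (\<lambda>y. mean (\<lambda>x. F (x, y))) (mean c)"
    unfolding is_mean_def
  proof (intro allI impI)
    fix \<epsilon> :: real assume \<epsilon>: "\<epsilon> > 0"
    then obtain U where U: "open U" "0 \<in> U" "\<And>x y z. x - y \<in> U \<Longrightarrow> dist (F (x, z)) (F (y, z)) < \<epsilon> / 3"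
      using uniform_continuity[OF F compact_UNIV, of "\<epsilon> / 3"] by (metis zero_less_divide_iff zero_less_numeral)
    \<comment> \<open>The points -w form a finite net: x + w in U says that x and -w are
      U-close.\<close>
    obtain ws where ws: "ws \<noteq> []" "\<And>x. \<exists>w\<in>set ws. x + w \<in> U" using translates_cover[OF U(1)] U(2) by blast
    obtain ys where ys: "ys \<noteq> []" "\<And>w x. w \<in> set ws \<Longrightarrow> norm (avg ys (\<lambda>y. F (- w, y)) x - c (- w)) \<le> \<epsilon> / 3"
      using common_averages[of "set ws" "\<lambda>w y. F (- w, y)" "\<lambda>w. c (- w)" "\<epsilon> / 3"] \<epsilon>
        is_mean_mean[OF continuous_section(1)[OF F]] unfolding c_def by auto
    have all: "norm (avg ys (\<lambda>y. F (x, y)) y' - c x) \<le> \<epsilon>" for x y'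
    proof -
      obtain w where w: "w \<in> set ws" "x + w \<in> U" using ws(2) by blast
      have d: "norm (F (x, z) - F (- w, z)) \<le> \<epsilon> / 3" for z
        using U(3)[of x "- w" z] w by (simp add: dist_norm less_imp_le)
      have 1: "norm (avg ys (\<lambda>y. F (x, y)) y' - avg ys (\<lambda>y. F (- w, y)) y') \<le> \<epsilon> / 3"
        by (rule avg_diff_le[OF ys(1) d])
      have "norm (mean (\<lambda>z. F (x, z) - F (- w, z))) \<le> \<epsilon> / 3"
        using d by (intro norm_mean_le continuous_intros continuous_section[OF F])
      then have 2: "norm (c x - c (- w)) \<le> \<epsilon> / 3"
        by (simp add: c_def mean_diff continuous_section[OF F])
      have "avg ys (\<lambda>y. F (x, y)) y' - c x = (avg ys (\<lambda>y. F (x, y)) y' - avg ys (\<lambda>y. F (- w, y)) y')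
          + ((avg ys (\<lambda>y. F (- w, y)) y' - c (- w)) + - (c x - c (- w)))" by simp
      then have "norm (avg ys (\<lambda>y. F (x, y)) y' - c x) \<le> \<epsilon> / 3 + (\<epsilon> / 3 + \<epsilon> / 3)"
        using 1 2 ys(2)[OF w(1), of y'] by (metis norm_triangle_mono norm_minus_cancel)
      then show ?thesis by simp
    qed
    have "norm (avg ys (\<lambda>y. mean (\<lambda>x. F (x, y))) y' - mean c) \<le> \<epsilon>" for y'
    proof -
      have "avg ys (\<lambda>y. mean (\<lambda>x. F (x, y))) y' = (1 / of_nat (length ys)) * (\<Sum>i<length ys. mean (\<lambda>x. F (x, y' + ys ! i)))"
        by (simp add: avg_def sum_list_sum_nth lessThan_atLeast0)
      also have "(\<Sum>i<length ys. mean (\<lambda>x. F (x, y' + ys ! i))) = mean (\<lambda>x. \<Sum>i<length ys. F (x, y' + ys ! i))"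
        by (rule mean_sum[symmetric]) (rule continuous_section[OF F])
      also have "(1 / of_nat (length ys)) * mean (\<lambda>x. \<Sum>i<length ys. F (x, y' + ys ! i))
          = mean (\<lambda>x. (1 / of_nat (length ys)) * (\<Sum>i<length ys. F (x, y' + ys ! i)))"
        by (rule mean_cmult[symmetric]) (intro continuous_intros continuous_section[OF F])
      also have "\<dots> = mean (\<lambda>x. avg ys (\<lambda>y. F (x, y)) y')"
        by (simp add: avg_def sum_list_sum_nth lessThan_atLeast0)
      finally have eq: "avg ys (\<lambda>y. mean (\<lambda>x. F (x, y))) y' = mean (\<lambda>x. avg ys (\<lambda>y. F (x, y)) y')" .
      have ca: "continuous_on UNIV (\<lambda>x. avg ys (\<lambda>y. F (x, y)) y')"
        unfolding avg_sum by (intro continuous_on_mult_right continuous_on_sum continuous_section[OF F])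
      have "norm (mean (\<lambda>x. avg ys (\<lambda>y. F (x, y)) y' - c x)) \<le> \<epsilon>"
        by (rule norm_mean_le[OF _ all]) (intro continuous_intros ca cc)
      then show ?thesis unfolding eq by (simp add: mean_diff ca cc)
    qed
    then show "\<exists>ys. ys \<noteq> [] \<and> (\<forall>x. norm (avg ys (\<lambda>y. mean (\<lambda>x. F (x, y))) x - mean c) \<le> \<epsilon>)"
      using ys(1) by blast
  qed
  then show ?thesis using mean_eqI unfolding c_def by metis
qed

end

section \<open>Convolution operators\<close>

lemma bcontfun_Cauchy_convergent:
  fixes f :: "nat \<Rightarrow> 'b::topological_space \<Rightarrow>\<^sub>C 'c::complete_space"
  assumes "Cauchy f"
  shows "convergent f"
proof -
  have "uniformly_Cauchy_on UNIV (\<lambda>n. apply_bcontfun (f n))"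
    unfolding uniformly_Cauchy_on_def
  proof (intro allI impI)
    fix e :: real assume "e > 0"
    then obtain M where "\<And>m n. m \<ge> M \<Longrightarrow> n \<ge> M \<Longrightarrow> dist (f m) (f n) < e"
      using metric_CauchyD[OF assms] by meson
    then show "\<exists>M. \<forall>x\<in>UNIV. \<forall>m\<ge>M. \<forall>n\<ge>M. dist (f m x) (f n x) < e"
      using dist_fun_lt_imp_dist_val_lt by blast
  qed
  then have "uniformly_convergent_on UNIV (\<lambda>n. apply_bcontfun (f n))"
    by (rule Cauchy_uniformly_convergent)
  then obtain l where "uniform_limit UNIV (\<lambda>n. apply_bcontfun (f n)) l sequentially"
    unfolding uniformly_convergent_on_def by blast
  then obtain l' where "f \<longlonglongrightarrow> l'" by (rule uniform_limit_bcontfunE) simp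
  then show ?thesis by (rule convergentI)
qed

text \<open>Definiteness is not assumed, because the form is later applied to differences such as
  lam times the inner product minus another form, where the degenerate directions are the
  interesting ones. The test vectors f - t B(f,g) g give a real quadratic in t.\<close>

lemma positive_form_Cauchy_Schwarz:
  fixes B :: "('b \<Rightarrow> complex) \<Rightarrow> ('b \<Rightarrow> complex) \<Rightarrow> complex"
  assumes V: "\<And>f g c. f \<in> V \<Longrightarrow> g \<in> V \<Longrightarrow> (\<lambda>x. f x + c * g x) \<in> V"
    and lin: "\<And>f g h c. f \<in> V \<Longrightarrow> g \<in> V \<Longrightarrow> h \<in> V \<Longrightarrow> B (\<lambda>x. f x + c * g x) h = B f h + c * B g h"
    and herm: "\<And>f g. f \<in> V \<Longrightarrow> g \<in> V \<Longrightarrow> B g f = cnj (B f g)"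
    and pos: "\<And>f. f \<in> V \<Longrightarrow> Re (B f f) \<ge> 0"
    and fg: "f \<in> V" "g \<in> V"
  shows "(norm (B f g))\<^sup>2 \<le> Re (B f f) * Re (B g g)"
proof -
  define p where "p = Re (B f f)"
  define r where "r = Re (B g g)"
  define b where "b = B f g"
  have real: "B h h = of_real (Re (B h h))" if "h \<in> V" for h
    using herm[OF that that] by (simp add: complex_eq_iff)
  have quad: "p - 2 * t * (norm b)\<^sup>2 + t\<^sup>2 * (norm b)\<^sup>2 * r \<ge> 0" for t :: real
  proof -
    define c where "c = - of_real t * b"
    define u where "u = (\<lambda>x. f x + c * g x)"
    have u: "u \<in> V" unfolding u_def by (rule V[OF fg])
    have Bu: "B u h = B f h + c * B g h" if "h \<in> V" for h
      unfolding u_def by (rule lin[OF fg that])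
    have "B f u = cnj (B f f + c * B g f)" using herm[OF u fg(1)] Bu[OF fg(1)] by simp
    moreover have "B g u = cnj (B f g + c * B g g)" using herm[OF u fg(2)] Bu[OF fg(2)] by simp
    ultimately have "B u u = cnj (B f f) + cnj c * cnj (B g f) + c * (cnj (B f g) + cnj c * cnj (B g g))"
      using Bu[OF u] by simp
    also have "cnj (B g f) = b" using herm[OF fg] by (simp add: b_def)
    also have "cnj (B f f) = of_real p" using real[OF fg(1)] unfolding p_def by (metis complex_cnj_complex_of_real)
    also have "cnj (B g g) = of_real r" using real[OF fg(2)] unfolding r_def by (metis complex_cnj_complex_of_real)
    also have "cnj (B f g) = cnj b" by (simp add: b_def)
    finally have "B u u = of_real p + cnj c * b + c * cnj b + c * cnj c * of_real r" by (simp add: algebra_simps)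
    also have "cnj c * b = of_real (- t * (norm b)\<^sup>2)"
      unfolding of_real_mult complex_norm_square by (simp add: c_def mult_ac)
    also have "c * cnj b = of_real (- t * (norm b)\<^sup>2)"
      unfolding of_real_mult complex_norm_square by (simp add: c_def mult_ac)
    also have "c * cnj c = of_real (t\<^sup>2 * (norm b)\<^sup>2)"
      unfolding of_real_mult complex_norm_square by (simp add: c_def power2_eq_square mult_ac)
    finally have "Re (B u u) = p - 2 * t * (norm b)\<^sup>2 + t\<^sup>2 * (norm b)\<^sup>2 * r"
      by (simp flip: of_real_add of_real_mult)
    then show ?thesis using pos[OF u] by simp
  qed
  have r: "r \<ge> 0" "p \<ge> 0" using pos fg by (auto simp: r_def p_def)
  have "(norm b)\<^sup>2 \<le> p * r"
  proof (cases "r = 0")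
    case True
    have "(norm b)\<^sup>2 \<le> 0"
    proof (rule ccontr)
      assume "\<not> (norm b)\<^sup>2 \<le> 0"
      then have nb: "(norm b)\<^sup>2 > 0" by simp
      have "p - 2 * ((p + 1) / (2 * (norm b)\<^sup>2)) * (norm b)\<^sup>2 = -1" using nb by (simp add: field_simps)
      then show False using quad[of "(p + 1) / (2 * (norm b)\<^sup>2)"] True by simp
    qed
    then show ?thesis using True by simp
  next
    case False
    then have "r > 0" using r by simp
    then have "p - (norm b)\<^sup>2 / r \<ge> 0" using quad[of "1 / r"] by (simp add: field_simps power2_eq_square)
    then show ?thesis using \<open>r > 0\<close> by (simp add: field_simps)
  qed
  then show ?thesis by (simp add: p_def r_def b_def)
qed

context compact_group
begin

definition inn :: "('a \<Rightarrow> complex) \<Rightarrow> ('a \<Rightarrow> complex) \<Rightarrow> complex" where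
  "inn f g = mean (\<lambda>x. f x * cnj (g x))"

definition nrm :: "('a \<Rightarrow> complex) \<Rightarrow> real" where
  "nrm f = sqrt (Re (inn f f))"

definition conv :: "('a \<Rightarrow> complex) \<Rightarrow> ('a \<Rightarrow> complex) \<Rightarrow> 'a \<Rightarrow> complex" where
  "conv k f x = mean (\<lambda>y. k (x - y) * f y)"

abbreviation cont :: "('a \<Rightarrow> complex) \<Rightarrow> bool" where
  "cont f \<equiv> continuous_on UNIV f"

lemma cont_pre:
  assumes "cont f"
  shows "cont (\<lambda>y. f (x - y))" "cont (\<lambda>y. f (y - x))" "cont (\<lambda>y. f (- y))" "cont (\<lambda>y. f (y + x))"
  by (rule continuous_on_compose2[OF assms]; auto intro!: continuous_intros)+

lemma cont_diff_pair:
  assumes "cont f"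
  shows "continuous_on UNIV (\<lambda>p::'a \<times> 'a. f (fst p - snd p))"
  by (rule continuous_on_compose2[OF assms]) (auto intro!: continuous_intros)

lemma cont_fst_snd:
  assumes "cont f"
  shows "continuous_on UNIV (\<lambda>p::'a \<times> 'a. f (fst p))" "continuous_on UNIV (\<lambda>p::'a \<times> 'a. f (snd p))"
  by (rule continuous_on_compose2[OF assms]; auto intro!: continuous_intros)+

lemma cont_lin: "cont f \<Longrightarrow> cont g \<Longrightarrow> cont (\<lambda>x. f x + c * g x)"
  by (intro continuous_intros)

lemma cont_bounded:
  assumes "cont f"
  obtains B where "B \<ge> 0" "\<And>x. norm (f x) \<le> B"
proof -
  have "bounded (range f)" using assms compact_UNIV compact_continuous_image compact_imp_bounded by blast
  then obtain B where B: "\<And>x. norm (f x) \<le> B" by (auto simp: bounded_iff)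
  moreover from this have "B \<ge> 0" using norm_ge_zero order_trans by blast
  ultimately show ?thesis using that by blast
qed

lemma inn_lin:
  assumes "cont f" "cont g" "cont h"
  shows "inn (\<lambda>x. f x + c * g x) h = inn f h + c * inn g h"
proof -
  have c: "cont (\<lambda>x. f x * cnj (h x))" "cont (\<lambda>x. g x * cnj (h x))" "cont (\<lambda>x. c * (g x * cnj (h x)))"
    by (intro continuous_intros assms)+
  have "inn (\<lambda>x. f x + c * g x) h = mean (\<lambda>x. f x * cnj (h x) + c * (g x * cnj (h x)))"
    by (simp add: inn_def algebra_simps)
  then show ?thesis by (simp add: mean_add[OF c(1) c(3)] mean_cmult[OF c(2)] inn_def)
qed

lemma inn_herm:
  assumes "cont f" "cont g"
  shows "inn g f = cnj (inn f g)"
proof -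
  have c: "cont (\<lambda>x. f x * cnj (g x))" by (intro continuous_intros assms)
  then show ?thesis using mean_cnj[OF c] by (simp add: inn_def mult.commute)
qed

lemma inn_self:
  "inn f f = mean (\<lambda>x. of_real ((norm (f x))\<^sup>2))"
  unfolding inn_def complex_norm_square ..

lemma inn_pos:
  assumes "cont f"
  shows "inn f f = of_real (Re (inn f f))" "Re (inn f f) \<ge> 0"
proof -
  have "inn f f \<in> \<real>\<^sub>\<ge>\<^sub>0"
    unfolding inn_self by (intro mean_nonneg continuous_intros assms) auto
  then show "inn f f = of_real (Re (inn f f))" "Re (inn f f) \<ge> 0"
    by (auto simp: complex_nonneg_Reals_iff complex_eq_iff)
qed

lemma inn_eq_0:
  assumes "cont f" "Re (inn f f) \<le> 0"
  shows "f x = 0"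
proof (rule ccontr)
  assume "f x \<noteq> 0"
  then have "Re (mean (\<lambda>x. of_real ((norm (f x))\<^sup>2))) > 0"
    by (intro mean_pos[where ?x0.0 = x] continuous_intros assms) auto
  then show False using assms(2) by (simp add: inn_self)
qed

lemma nrm_nonneg [simp]: "nrm f \<ge> 0" if "cont f"
  using inn_pos[OF that] by (simp add: nrm_def)

lemma nrm_sq: "cont f \<Longrightarrow> (nrm f)\<^sup>2 = Re (inn f f)"
  using inn_pos[of f] by (simp add: nrm_def)

lemma inn_Cauchy_Schwarz:
  assumes "cont f" "cont g"
  shows "norm (inn f g) \<le> nrm f * nrm g"
proof -
  have "(norm (inn f g))\<^sup>2 \<le> Re (inn f f) * Re (inn g g)"
    by (rule positive_form_Cauchy_Schwarz[where V = "{f. cont f}"])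
       (use assms in \<open>auto intro: cont_lin inn_lin inn_herm inn_pos(2)\<close>)
  also have "\<dots> = (nrm f * nrm g)\<^sup>2" using assms by (simp add: power_mult_distrib nrm_sq)
  finally show ?thesis by (rule power2_le_imp_le) (use assms in simp)
qed

lemma nrm_le:
  assumes "cont f" "\<And>x. norm (f x) \<le> B"
  shows "nrm f \<le> B"
proof -
  have B: "B \<ge> 0" using assms(2)[of 0] norm_ge_zero order_trans by blast
  have "Re (inn f f) \<le> Re (mean (\<lambda>x. of_real (B\<^sup>2)))"
    unfolding inn_self using assms by (intro mean_mono continuous_intros power_mono) auto
  then have "(nrm f)\<^sup>2 \<le> B\<^sup>2" using assms by (simp add: nrm_sq)
  then show ?thesis using B by (rule power2_le_imp_le)
qed

lemma mean_mult_le: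
  assumes "cont u" "cont f" "\<And>x. norm (u x) \<le> B"
  shows "norm (mean (\<lambda>y. u y * f y)) \<le> B * nrm f"
proof -
  have cf: "cont (\<lambda>x. cnj (f x))" by (intro continuous_intros assms)
  have "mean (\<lambda>y. u y * f y) = inn u (\<lambda>x. cnj (f x))" by (simp add: inn_def)
  moreover have "nrm (\<lambda>x. cnj (f x)) = nrm f" by (simp add: nrm_def inn_self)
  moreover have "nrm u * nrm f \<le> B * nrm f"
    using assms by (intro mult_right_mono nrm_le) auto
  ultimately show ?thesis using inn_Cauchy_Schwarz[OF assms(1) cf] by simp
qed

lemma cont_conv:
  assumes "cont k" "cont f"
  shows "cont (conv k f)"
  unfolding conv_def
  using continuous_mean[of "\<lambda>p. k (fst p - snd p) * f (snd p)"] cont_diff_pair[OF assms(1)] cont_fst_snd(2)[OF assms(2)]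
  by (simp add: continuous_on_mult)

lemma conv_lin:
  assumes "cont k" "cont f" "cont g"
  shows "conv k (\<lambda>x. f x + c * g x) x = conv k f x + c * conv k g x"
proof -
  have c: "cont (\<lambda>y. k (x - y) * f y)" "cont (\<lambda>y. k (x - y) * g y)" "cont (\<lambda>y. c * (k (x - y) * g y))"
    by (intro continuous_intros assms cont_pre)+
  have "conv k (\<lambda>x. f x + c * g x) x = mean (\<lambda>y. k (x - y) * f y + c * (k (x - y) * g y))"
    by (simp add: conv_def algebra_simps)
  then show ?thesis by (simp add: mean_add[OF c(1) c(3)] mean_cmult[OF c(2)] conv_def)
qed

lemma conv_translate:
  assumes "cont k" "cont f"
  shows "conv k (\<lambda>x. f (x + a)) x = conv k f (x + a)"
proof -
  have c: "cont (\<lambda>y. k (x + a - y) * f y)" by (intro continuous_intros assms cont_pre)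
  show ?thesis using mean_translate[OF c, of a] by (simp add: conv_def)
qed

lemma conv_le:
  assumes "cont k" "cont f" "\<And>x. norm (k x) \<le> B"
  shows "norm (conv k f x) \<le> B * nrm f"
  unfolding conv_def by (rule mean_mult_le) (use assms cont_pre in auto)

lemma conv_diff_le:
  assumes "cont k" "cont f" "\<And>y. norm (k (x - y) - k (x' - y)) \<le> b"
  shows "norm (conv k f x - conv k f x') \<le> b * nrm f"
proof -
  have c: "cont (\<lambda>y. k (x - y) * f y)" "cont (\<lambda>y. k (x' - y) * f y)" by (intro continuous_intros assms cont_pre)+
  have "conv k f x - conv k f x' = mean (\<lambda>y. (k (x - y) - k (x' - y)) * f y)"
    using mean_diff[OF c] by (simp add: conv_def left_diff_distrib)
  also have "norm \<dots> \<le> b * nrm f"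
    by (intro mean_mult_le continuous_intros assms cont_pre)
  finally show ?thesis .
qed

text \<open>Kernel of the adjoint of convolution by g; see \<open>inn_conv\<close>, which is
  Fubini.\<close>

definition adj :: "('a \<Rightarrow> complex) \<Rightarrow> 'a \<Rightarrow> complex" where
  "adj g z = cnj (g (- z))"

lemma cont_adj: "cont g \<Longrightarrow> cont (adj g)"
  unfolding adj_def by (intro continuous_intros cont_pre)

lemma inn_conv:
  assumes k: "cont k" and f: "cont f" and h: "cont h"
  shows "inn (conv k f) h = inn f (conv (adj k) h)"
proof -
  let ?F = "\<lambda>p. k (fst p - snd p) * f (snd p) * cnj (h (fst p))"
  have F: "continuous_on UNIV ?F"
    by (intro continuous_intros cont_diff_pair[OF k] cont_fst_snd(2)[OF f] cont_fst_snd(1)[OF h])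
  have c1: "cont (\<lambda>y. k (x - y) * f y)" for x by (intro continuous_intros cont_pre k f)
  have c2: "cont (\<lambda>x. adj k (y - x) * h x)" for y by (intro continuous_intros cont_pre cont_adj k h)
  have "inn (conv k f) h = mean (\<lambda>x. mean (\<lambda>y. ?F (x, y)))"
    unfolding inn_def conv_def using mean_cmult[OF c1, of "cnj (h _)"] by (simp add: mult.commute)
  also have "\<dots> = mean (\<lambda>y. mean (\<lambda>x. ?F (x, y)))" by (rule mean_fubini[OF F])
  also have "\<dots> = mean (\<lambda>y. f y * cnj (conv (adj k) h y))"
  proof -
    have "mean (\<lambda>x. ?F (x, y)) = f y * cnj (conv (adj k) h y)" for y
    proof -
      have "cnj (conv (adj k) h y) = mean (\<lambda>x. cnj (adj k (y - x) * h x))"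
        unfolding conv_def by (rule mean_cnj[OF c2, symmetric])
      also have "f y * \<dots> = mean (\<lambda>x. f y * cnj (adj k (y - x) * h x))"
        by (rule mean_cmult[symmetric]) (intro continuous_intros cont_pre cont_adj k h)
      finally show ?thesis by (simp add: adj_def mult_ac)
    qed
    then show ?thesis by simp
  qed
  finally show ?thesis by (simp add: inn_def)
qed

section \<open>Compactness and limits in the supremum norm\<close>

text \<open>Arzela-Ascoli with equicontinuity expressed by neighbourhoods of 0. A function in the
  set is known up to a small error from its values on a finite net of points, rounded to a finite
  net of the disc; choosing one representative per rounding pattern gives total boundedness.\<close>

lemma compact_equicontinuous:
  fixes U :: "real \<Rightarrow> 'a set"
  assumes U: "\<And>\<epsilon>. \<epsilon> > 0 \<Longrightarrow> open (U \<epsilon>) \<and> 0 \<in> U \<epsilon>"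
  shows "compact {u :: 'a \<Rightarrow>\<^sub>C complex. (\<forall>x. norm (u x) \<le> B) \<and> (\<forall>\<epsilon>>0. \<forall>x y. x - y \<in> U \<epsilon> \<longrightarrow> norm (u x - u y) \<le> \<epsilon>)}"
    (is "compact ?S")
proof -
  have ev: "continuous_on UNIV (\<lambda>u :: 'a \<Rightarrow>\<^sub>C complex. u x)" for x
    unfolding continuous_on_iff using dist_fun_lt_imp_dist_val_lt by blast
  have "?S = (\<Inter>x. {u :: 'a \<Rightarrow>\<^sub>C complex. norm (u x) \<le> B}) \<inter> (\<Inter>\<epsilon>\<in>{0<..}. \<Inter>x. \<Inter>y\<in>{y. x - y \<in> U \<epsilon>}. {u :: 'a \<Rightarrow>\<^sub>C complex. norm (u x - u y) \<le> \<epsilon>})"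
    by auto
  moreover have "closed \<dots>"
    by (intro closed_Int closed_INT ballI closed_Collect_le continuous_intros ev)
  ultimately have "closed ?S" by simp
  then have "complete ?S"
    unfolding complete_def
  proof (intro allI impI)
    fix f assume cl: "closed ?S" and f: "(\<forall>n. f n \<in> ?S) \<and> Cauchy f"
    then obtain l where l: "f \<longlonglongrightarrow> l" using bcontfun_Cauchy_convergent unfolding convergent_def by blast
    have "l \<in> ?S" by (rule closed_sequentially[OF cl _ l]) (use f in blast)
    then show "\<exists>l\<in>?S. f \<longlonglongrightarrow> l" using l by blast
  qed
  moreover have "\<exists>K. finite K \<and> ?S \<subseteq> (\<Union>u\<in>K. ball u \<epsilon>)" if \<epsilon>: "\<epsilon> > 0" for \<epsilon>
  proof -
    \<comment> \<open>Two functions with the same pattern are compared in four moves of size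
      \<open>\<eta>\<close>; the fifth share gives strict inequality.\<close>
    define \<eta> where "\<eta> = \<epsilon> / 5"
    have \<eta>: "\<eta> > 0" using \<epsilon> by (simp add: \<eta>_def)
    obtain ws where ws: "\<And>x. \<exists>w\<in>set ws. x + w \<in> U \<eta>" using translates_cover[of "U \<eta>"] U[OF \<eta>] by blast
    define P where "P = uminus ` set ws"
    have P: "finite P" "\<And>x. \<exists>p\<in>P. x - p \<in> U \<eta>" using ws by (auto simp: P_def)
    obtain D :: "complex set" where D: "finite D" "cball 0 B \<subseteq> (\<Union>d\<in>D. ball d \<eta>)"
      using compact_cball[of "0::complex" B] \<eta> unfolding compact_eq_totally_bounded by blast
    define near where "near \<phi> u \<longleftrightarrow> u \<in> ?S \<and> (\<forall>p\<in>P. dist (u p) (\<phi> p) < \<eta>)" for \<phi> and u :: "'a \<Rightarrow>\<^sub>C complex"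
    define rep where "rep \<phi> = (SOME u. near \<phi> u)" for \<phi>
    have "?S \<subseteq> (\<Union>u\<in>rep ` (PiE P (\<lambda>_. D)). ball u \<epsilon>)"
    proof
      fix u :: "'a \<Rightarrow>\<^sub>C complex" assume u: "u \<in> ?S"
      have "\<exists>d\<in>D. dist (u p) d < \<eta>" for p
      proof -
        have "u p \<in> cball 0 B" using u by simp
        then show ?thesis using D(2) unfolding subset_iff UN_iff mem_ball by (metis dist_commute)
      qed
      then obtain \<phi>0 where \<phi>0: "\<And>p. \<phi>0 p \<in> D" "\<And>p. dist (u p) (\<phi>0 p) < \<eta>" by metis
      define \<phi> where "\<phi> = restrict \<phi>0 P"
      have \<phi>: "\<phi> \<in> PiE P (\<lambda>_. D)" using \<phi>0 by (auto simp: \<phi>_def)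
      have nu: "near \<phi> u" using u \<phi>0 by (auto simp: near_def \<phi>_def)
      then have nr: "near \<phi> (rep \<phi>)" unfolding rep_def by (rule someI)
      have "dist (rep \<phi> x) (u x) \<le> 4 * \<eta>" for x
      proof -
        obtain p where p: "p \<in> P" "x - p \<in> U \<eta>" using P(2) by blast
        have "dist (rep \<phi> x) (rep \<phi> p) \<le> \<eta>" "dist (u x) (u p) \<le> \<eta>"
          using nr nu p \<eta> by (auto simp: near_def dist_norm)
        moreover have "dist (rep \<phi> p) (\<phi> p) < \<eta>" "dist (u p) (\<phi> p) < \<eta>"
          using nr nu p by (auto simp: near_def)
        moreover have "dist (rep \<phi> x) (u x) \<le> dist (rep \<phi> x) (rep \<phi> p) + dist (rep \<phi> p) (\<phi> p) + dist (u p) (\<phi> p) + dist (u x) (u p)"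
          using dist_triangle[of "rep \<phi> x" "u x" "rep \<phi> p"] dist_triangle[of "rep \<phi> p" "u x" "u p"]
            dist_triangle2[of "rep \<phi> p" "u p" "\<phi> p"] dist_commute[of "u x" "u p"] by linarith
        ultimately show ?thesis by linarith
      qed
      then have "dist (rep \<phi>) u \<le> 4 * \<eta>" by (rule dist_bound)
      then have "u \<in> ball (rep \<phi>) \<epsilon>" using \<epsilon> by (simp add: \<eta>_def)
      then show "u \<in> (\<Union>u\<in>rep ` (PiE P (\<lambda>_. D)). ball u \<epsilon>)" using \<phi> by blast
    qed
    moreover have "finite (rep ` (PiE P (\<lambda>_. D)))" using P D by (intro finite_imageI finite_PiE) auto
    ultimately show ?thesis by blast
  qed
  ultimately show ?thesis unfolding compact_eq_totally_bounded by blast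
qed

lemma cont_bcontfun: "cont f \<Longrightarrow> \<exists>u. f = apply_bcontfun u"
  using cont_bounded bcontfun_normI bcontfunE by metis

lemma mean_tendsto:
  assumes "uniform_limit UNIV f l F" "\<And>n. cont (f n)" "cont l"
  shows "((\<lambda>n. mean (f n)) \<longlongrightarrow> mean l) F"
proof (rule tendstoI)
  fix e :: real assume e: "e > 0"
  have "\<forall>\<^sub>F n in F. \<forall>x\<in>UNIV. dist (f n x) (l x) < e / 2"
    using uniform_limitD[OF assms(1), of "e / 2"] e by simp
  then show "\<forall>\<^sub>F n in F. dist (mean (f n)) (mean l) < e"
  proof (rule eventually_mono)
    fix n assume *: "\<forall>x\<in>UNIV. dist (f n x) (l x) < e / 2"
    have c: "cont (\<lambda>x. f n x - l x)" by (intro continuous_intros assms)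
    have "norm (mean (\<lambda>x. f n x - l x)) \<le> e / 2"
      by (rule norm_mean_le[OF c]) (use * in \<open>auto simp: dist_norm intro: less_imp_le\<close>)
    then show "dist (mean (f n)) (mean l) < e"
      using e by (simp add: dist_norm mean_diff[OF assms(2,3)])
  qed
qed

lemma bounded_range_cont: "cont f \<Longrightarrow> bounded (range f)"
  using compact_UNIV compact_continuous_image compact_imp_bounded by blast

lemma inn_tendsto:
  assumes u: "uniform_limit UNIV f l F" "uniform_limit UNIV g m F"
    and c: "\<And>n. cont (f n)" "\<And>n. cont (g n)" "cont l" "cont m"
  shows "((\<lambda>n. inn (f n) (g n)) \<longlongrightarrow> inn l m) F"
  unfolding inn_def
proof (rule mean_tendsto)
  have cm: "cont (\<lambda>x. cnj (m x))" by (intro continuous_intros c)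
  have "uniform_limit UNIV (\<lambda>n x. cnj (g n x)) (\<lambda>x. cnj (m x)) F"
    by (rule bounded_linear.uniform_limit[OF bounded_linear_cnj u(2)])
  then show "uniform_limit UNIV (\<lambda>n x. f n x * cnj (g n x)) (\<lambda>x. l x * cnj (m x)) F"
    by (rule uniform_lim_mult[OF u(1) _ bounded_range_cont[OF c(3)] bounded_range_cont[OF cm]])
qed (intro continuous_intros c)+

lemma conv_tendsto:
  assumes u: "uniform_limit UNIV f l F" and c: "\<And>n. cont (f n)" "cont l" and k: "cont k"
  shows "((\<lambda>n. conv k (f n) x) \<longlongrightarrow> conv k l x) F"
  unfolding conv_def
proof (rule mean_tendsto)
  have ck: "cont (\<lambda>y. k (x - y))" by (rule cont_pre[OF k])
  show "uniform_limit UNIV (\<lambda>n y. k (x - y) * f n y) (\<lambda>y. k (x - y) * l y) F"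
    by (rule uniform_lim_mult[OF uniform_limit_const u bounded_range_cont[OF ck] bounded_range_cont[OF c(2)]])
qed (intro continuous_intros c cont_pre k)+

lemma uniform_limit_id_bcontfun:
  "uniform_limit UNIV (\<lambda>u::'a \<Rightarrow>\<^sub>C complex. apply_bcontfun u) (apply_bcontfun v) (at v within S)"
  by (rule tendsto_bcontfun_uniform_limit) (rule tendsto_ident_at)

lemma uniform_limit_shift:
  fixes f :: "'i \<Rightarrow> 'a \<Rightarrow> complex"
  assumes "uniform_limit UNIV f l F"
  shows "uniform_limit UNIV (\<lambda>n x. f n (x + a)) (\<lambda>x. l (x + a)) F"
  using assms unfolding uniform_limit_iff by (fast elim: eventually_mono)

lemma continuous_inn_shift:
  "continuous_on S (\<lambda>u::'a \<Rightarrow>\<^sub>C complex. inn (\<lambda>x. u (x + a)) u)"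
  unfolding continuous_on_def
  by (intro ballI inn_tendsto uniform_limit_shift uniform_limit_id_bcontfun continuous_shift) auto

lemma continuous_eval_bcontfun: "continuous_on S (\<lambda>u::'a \<Rightarrow>\<^sub>C complex. u x)"
  unfolding continuous_on_iff using dist_fun_lt_imp_dist_val_lt by blast

lemma inn_scale:
  assumes "cont f" "cont h"
  shows "inn (\<lambda>x. c * f x) h = c * inn f h" "inn f (\<lambda>x. c * h x) = cnj c * inn f h"
    "inn (\<lambda>x. c * f x) (\<lambda>x. c * f x) = of_real ((norm c)\<^sup>2) * inn f f"
proof -
  have 1: "inn (\<lambda>x. c * f x) h = c * inn f h" if "cont f" "cont h" for f h
    using mean_cmult[of "\<lambda>x. f x * cnj (h x)" c] that
    by (simp add: inn_def mult.assoc continuous_on_mult continuous_on_cnj)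
  have c: "cont (\<lambda>x. c * f x)" if "cont f" for f by (intro continuous_intros that)
  have 2: "inn f (\<lambda>x. c * h x) = cnj c * inn f h" if "cont f" "cont h" for f h
    using inn_herm[OF c[OF that(2)] that(1)] inn_herm[OF that(2,1)] 1[OF that(2,1)] by simp
  show "inn (\<lambda>x. c * f x) h = c * inn f h" "inn f (\<lambda>x. c * h x) = cnj c * inn f h"
    using assms 1 2 by auto
  show "inn (\<lambda>x. c * f x) (\<lambda>x. c * f x) = of_real ((norm c)\<^sup>2) * inn f f"
    unfolding complex_norm_square using assms by (simp add: 1 2 c)
qed

lemma conv_scale:
  assumes "cont k" "cont f"
  shows "conv k (\<lambda>x. c * f x) x = c * conv k f x"
  using mean_cmult[of "\<lambda>y. k (x - y) * f y" c] assms cont_pre(1)[OF assms(1)]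
  by (simp add: conv_def mult_ac continuous_on_mult)

lemma normalize:
  assumes "cont f" "f x \<noteq> 0"
  shows "\<exists>c. c \<noteq> 0 \<and> inn (\<lambda>x. c * f x) (\<lambda>x. c * f x) = 1"
proof -
  have p: "Re (inn f f) > 0" using inn_eq_0[OF assms(1)] assms(2) by force
  define r where "r = sqrt (Re (inn f f))"
  have r: "r > 0" "r\<^sup>2 = Re (inn f f)" using p by (auto simp: r_def)
  have "inn (\<lambda>x. of_real (1 / r) * f x) (\<lambda>x. of_real (1 / r) * f x) = of_real ((1 / r)\<^sup>2) * of_real (r\<^sup>2)"
    unfolding inn_scale(3)[OF assms(1,1)] r(2) using inn_pos(1)[OF assms(1)] r(1) by (simp add: norm_divide power_divide)
  also have "\<dots> = of_real (((1 / r) * r)\<^sup>2)" by (simp only: of_real_mult power_mult_distrib)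
  also have "\<dots> = 1" using r by simp
  finally show ?thesis using r by (intro exI[of _ "of_real (1 / r)"]) simp
qed

lemma inn_translate:
  assumes "cont f" "cont h"
  shows "inn (\<lambda>x. f (x + a)) (\<lambda>x. h (x + a)) = inn f h"
  unfolding inn_def by (rule mean_translate[where f = "\<lambda>x. f x * cnj (h x)"]) (intro continuous_intros assms)

lemma adj_adj [simp]: "adj (adj g) = g"
  by (simp add: adj_def fun_eq_iff)

definition character :: "('a \<Rightarrow> complex) \<Rightarrow> bool" where
  "character \<kappa> \<longleftrightarrow> cont \<kappa> \<and> (\<forall>x y. \<kappa> (x + y) = \<kappa> x * \<kappa> y) \<and> (\<forall>x. norm (\<kappa> x) = 1)"

end

section \<open>The largest eigenvalue of a convolution operator\<close>

text \<open>The witness \<open>x1\<close> that g is nonzero is what forces \<open>lam\<close> to be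
  positive.\<close>

locale convolution_operator = compact_group ty
  for ty :: "'a::{topological_ab_group_add, t2_space} itself" +
  fixes g :: "'a \<Rightarrow> complex" and x1 :: 'a
  assumes cont_g: "cont g" and g_x1: "g x1 \<noteq> 0"
begin

abbreviation "G \<equiv> conv g"
text \<open>The composite of \<open>G\<close> with its adjoint: self-adjoint, positive and commuting
  with translations, so that its eigenspaces are invariant under the group.\<close>

definition "K f = conv (adj g) (G f)"
definition "lam = Sup {Re (inn (G f) (G f)) / Re (inn f f) | f. cont f}"

lemma cont_G [simp]: "cont f \<Longrightarrow> cont (G f)"
  by (rule cont_conv[OF cont_g])

lemma cont_K [simp]: "cont f \<Longrightarrow> cont (K f)"
  unfolding K_def by (rule cont_conv[OF cont_adj[OF cont_g] cont_G])

lemma inn_K: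
  assumes "cont f" "cont h"
  shows "inn (K f) h = inn (G f) (G h)"
  unfolding K_def using inn_conv[OF cont_adj[OF cont_g] cont_G[OF assms(1)] assms(2)] by simp

lemma G_lin: "cont f \<Longrightarrow> cont h \<Longrightarrow> G (\<lambda>x. f x + c * h x) = (\<lambda>x. G f x + c * G h x)"
  using conv_lin[OF cont_g] by (simp add: fun_eq_iff)

lemma K_lin:
  assumes "cont f" "cont h"
  shows "K (\<lambda>x. f x + c * h x) = (\<lambda>x. K f x + c * K h x)"
  unfolding K_def G_lin[OF assms] using conv_lin[OF cont_adj[OF cont_g] cont_G[OF assms(1)] cont_G[OF assms(2)]]
  by (simp add: fun_eq_iff)

lemma K_scale:
  assumes "cont f"
  shows "K (\<lambda>x. c * f x) = (\<lambda>x. c * K f x)"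
proof -
  have *: "G (\<lambda>x. c * f x) = (\<lambda>x. c * G f x)" using conv_scale[OF cont_g assms] by (simp add: fun_eq_iff)
  show ?thesis unfolding K_def * using conv_scale[OF cont_adj[OF cont_g] cont_G[OF assms]] by (simp add: fun_eq_iff)
qed

lemma K_translate: "cont f \<Longrightarrow> K (\<lambda>x. f (x + a)) = (\<lambda>x. K f (x + a))"
proof -
  assume f: "cont f"
  have *: "G (\<lambda>x. f (x + a)) = (\<lambda>x. G f (x + a))" using conv_translate[OF cont_g f] by (simp add: fun_eq_iff)
  show ?thesis unfolding K_def * using conv_translate[OF cont_adj[OF cont_g] cont_G[OF f]] by (simp add: fun_eq_iff)
qed

definition "C = (SOME C. C > 0 \<and> (\<forall>x. norm (g x) \<le> C))"

lemma C: "C > 0" "norm (g x) \<le> C"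
proof -
  obtain B where "B \<ge> 0" "\<And>x. norm (g x) \<le> B" using cont_bounded[OF cont_g] by blast
  then have "B + 1 > 0 \<and> (\<forall>x. norm (g x) \<le> B + 1)" by (smt (verit))
  then have "C > 0 \<and> (\<forall>x. norm (g x) \<le> C)" unfolding C_def by (rule someI)
  then show "C > 0" "norm (g x) \<le> C" by auto
qed

lemma nrm_G: "cont f \<Longrightarrow> nrm (G f) \<le> C * nrm f"
  by (intro nrm_le cont_G conv_le cont_g C)

lemma norm_K: "cont f \<Longrightarrow> norm (K f x) \<le> C * (C * nrm f)"
proof -
  assume f: "cont f"
  have "norm (K f x) \<le> C * nrm (G f)"
    unfolding K_def by (intro conv_le cont_adj cont_g cont_G f) (simp add: adj_def C)
  also have "\<dots> \<le> C * (C * nrm f)" using nrm_G[OF f] C by (intro mult_left_mono) auto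
  finally show ?thesis .
qed

lemma K_tendsto:
  assumes u: "uniform_limit UNIV f l F" and c: "\<And>n. cont (f n)" "cont l"
  shows "((\<lambda>n. K (f n) x) \<longlongrightarrow> K l x) F"
  unfolding K_def
proof (intro conv_tendsto cont_adj cont_g cont_G c)
  show "uniform_limit UNIV (\<lambda>n. G (f n)) (G l) F"
    unfolding uniform_limit_iff
  proof (intro allI impI)
    fix e :: real assume e: "e > 0"
    have "\<forall>\<^sub>F n in F. \<forall>x\<in>UNIV. dist (f n x) (l x) < e / (2 * C)"
      using uniform_limitD[OF u] e C by simp
    then show "\<forall>\<^sub>F n in F. \<forall>x\<in>UNIV. dist (G (f n) x) (G l x) < e"
    proof (rule eventually_mono, intro ballI)
      fix n x assume *: "\<forall>x\<in>UNIV. dist (f n x) (l x) < e / (2 * C)"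
      let ?d = "\<lambda>x. f n x + (- 1) * l x"
      have d: "cont ?d" by (intro cont_lin c)
      have "nrm ?d \<le> e / (2 * C)" by (rule nrm_le[OF d]) (use * in \<open>auto simp: dist_norm intro: less_imp_le\<close>)
      then have "C * nrm ?d \<le> C * (e / (2 * C))" using C by (intro mult_left_mono) auto
      then have "norm (G ?d x) \<le> e / 2" using conv_le[OF cont_g d C(2), of x] C by (simp add: field_simps)
      then show "dist (G (f n) x) (G l x) < e" using e G_lin[OF c, of n "- 1"] by (simp add: dist_norm)
    qed
  qed
qed

definition "nbhd \<epsilon> = (SOME U. open U \<and> 0 \<in> U \<and> (\<forall>x y. x - y \<in> U \<longrightarrow> dist (adj g x) (adj g y) < \<epsilon> / C))"

lemma nbhd:
  assumes "\<epsilon> > 0"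
  shows "open (nbhd \<epsilon>)" "0 \<in> nbhd \<epsilon>" "x - y \<in> nbhd \<epsilon> \<Longrightarrow> dist (adj g x) (adj g y) < \<epsilon> / C"
proof -
  have "\<exists>U. open U \<and> 0 \<in> U \<and> (\<forall>x y. x - y \<in> U \<longrightarrow> dist (adj g x) (adj g y) < \<epsilon> / C)"
    by (rule uniform_continuity1[OF cont_adj[OF cont_g]]) (use assms C in simp)
  then have "open (nbhd \<epsilon>) \<and> 0 \<in> nbhd \<epsilon> \<and> (\<forall>x y. x - y \<in> nbhd \<epsilon> \<longrightarrow> dist (adj g x) (adj g y) < \<epsilon> / C)"
    unfolding nbhd_def by (rule someI_ex)
  then show "open (nbhd \<epsilon>)" "0 \<in> nbhd \<epsilon>" "x - y \<in> nbhd \<epsilon> \<Longrightarrow> dist (adj g x) (adj g y) < \<epsilon> / C" by auto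
qed

lemma K_modulus:
  assumes "cont f" "nrm f \<le> B" "\<epsilon> > 0" "x - y \<in> nbhd \<epsilon>"
  shows "norm (K f x - K f y) \<le> \<epsilon> * B"
proof -
  have "norm (K f x - K f y) \<le> (\<epsilon> / C) * nrm (G f)"
    unfolding K_def
  proof (intro conv_diff_le cont_adj cont_g cont_G assms)
    fix z
    have "(x - z) - (y - z) \<in> nbhd \<epsilon>" using assms by simp
    then show "norm (adj g (x - z) - adj g (y - z)) \<le> \<epsilon> / C"
      using nbhd(3)[OF assms(3)] by (auto simp: dist_norm intro: less_imp_le)
  qed
  also have "\<dots> \<le> (\<epsilon> / C) * (C * B)"
    using nrm_G[OF assms(1)] C assms(2,3) by (intro mult_left_mono order_trans[OF nrm_G[OF assms(1)]]) auto
  finally show ?thesis using C by simp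
qed

text \<open>A compact set containing the image under \<open>K\<close> of all functions with
  \<open>nrm\<close> at most B: smoothing turns a mean-square bound into a uniform bound and a
  common modulus of continuity.\<close>

definition "Kset B = {u :: 'a \<Rightarrow>\<^sub>C complex. (\<forall>x. norm (u x) \<le> C * (C * B)) \<and>
  (\<forall>\<epsilon>>0. \<forall>x y. x - y \<in> nbhd (\<epsilon> / B) \<longrightarrow> norm (u x - u y) \<le> \<epsilon>)}"

lemma compact_Kset: "B > 0 \<Longrightarrow> compact (Kset B)"
  unfolding Kset_def by (rule compact_equicontinuous[where U = "\<lambda>\<epsilon>. nbhd (\<epsilon> / B)"]) (simp add: nbhd)

lemma K_in_Kset:
  assumes "cont f" "nrm f \<le> B" "B > 0" "K f = apply_bcontfun u"
  shows "u \<in> Kset B"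
proof -
  have "norm (u x) \<le> C * (C * B)" for x
    using norm_K[OF assms(1), of x] mult_left_mono[OF mult_left_mono[OF assms(2)], of C C] C
    unfolding assms(4) by linarith
  moreover have "norm (u x - u y) \<le> \<epsilon>" if "\<epsilon> > 0" "x - y \<in> nbhd (\<epsilon> / B)" for \<epsilon> x y
    using K_modulus[OF assms(1,2) _ that(2)] that(1) assms(3) unfolding assms(4) by simp
  ultimately show ?thesis unfolding Kset_def by blast
qed

lemma Rayleigh_le: "cont f \<Longrightarrow> Re (inn (G f) (G f)) / Re (inn f f) \<le> C\<^sup>2"
proof -
  assume f: "cont f"
  have "(nrm (G f))\<^sup>2 \<le> (C * nrm f)\<^sup>2" using nrm_G[OF f] f by (intro power_mono) auto
  then have "Re (inn (G f) (G f)) \<le> C\<^sup>2 * Re (inn f f)" using f by (simp add: power_mult_distrib nrm_sq)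
  then show ?thesis using inn_pos(2)[OF f] by (cases "Re (inn f f) = 0") (auto simp: divide_le_eq)
qed

lemma bdd_Rayleigh: "bdd_above {Re (inn (G f) (G f)) / Re (inn f f) | f. cont f}"
  using Rayleigh_le by (intro bdd_aboveI[of _ "C\<^sup>2"]) blast

lemma G_le_lam:
  assumes f: "cont f"
  shows "Re (inn (G f) (G f)) \<le> lam * Re (inn f f)"
proof (cases "Re (inn f f) = 0")
  case True
  then have "f = (\<lambda>_. 0)" using inn_eq_0[OF f] by (auto simp: fun_eq_iff)
  then show ?thesis by (simp add: conv_def inn_def)
next
  case False
  then have "Re (inn f f) > 0" using inn_pos(2)[OF f] by simp
  moreover have "Re (inn (G f) (G f)) / Re (inn f f) \<le> lam"
    unfolding lam_def by (rule cSup_upper[OF _ bdd_Rayleigh]) (use f in blast)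
  ultimately show ?thesis by (simp add: divide_le_eq)
qed

lemma lam_pos: "lam > 0"
proof -
  let ?f = "adj g"
  have f: "cont ?f" by (rule cont_adj[OF cont_g])
  have "G ?f 0 = mean (\<lambda>y. of_real ((norm (g (- y)))\<^sup>2))"
    unfolding conv_def complex_norm_square by (simp add: adj_def)
  moreover have "Re \<dots> > 0"
    by (rule mean_pos[where ?x0.0 = "- x1"]) (use g_x1 in \<open>auto intro!: continuous_intros cont_pre cont_g\<close>)
  ultimately have "G ?f 0 \<noteq> 0" by force
  then have "Re (inn (G ?f) (G ?f)) > 0" using inn_eq_0[OF cont_G[OF f]] by force
  then have "lam * Re (inn ?f ?f) > 0" using G_le_lam[OF f] by linarith
  then show ?thesis using inn_pos(2)[OF f] by (simp add: zero_less_mult_iff)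
qed

lemma near_maximizer:
  assumes "\<epsilon> > 0"
  shows "\<exists>f. cont f \<and> inn f f = 1 \<and> Re (inn (G f) (G f)) > lam - \<epsilon>"
proof -
  have "max 0 (lam - \<epsilon>) < lam" using lam_pos assms by simp
  then obtain r where "r \<in> {Re (inn (G f) (G f)) / Re (inn f f) | f. cont f}" "max 0 (lam - \<epsilon>) < r"
    unfolding lam_def using less_cSupE[of _ "{Re (inn (G f) (G f)) / Re (inn f f) | f. cont f}"] by blast
  then obtain f where f: "cont f" "max 0 (lam - \<epsilon>) < Re (inn (G f) (G f)) / Re (inn f f)" by blast
  then have ne: "Re (inn f f) \<noteq> 0" by auto
  have "\<exists>x. f x \<noteq> 0"
  proof (rule ccontr)
    assume "\<nexists>x. f x \<noteq> 0"
    then show False using ne by (simp add: inn_def)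
  qed
  then obtain c where c: "c \<noteq> 0" "inn (\<lambda>x. c * f x) (\<lambda>x. c * f x) = 1" using normalize[OF f(1)] by blast
  let ?h = "\<lambda>x. c * f x"
  have h: "cont ?h" by (intro continuous_intros f)
  have "G ?h = (\<lambda>x. c * G f x)" using conv_scale[OF cont_g f(1)] by (simp add: fun_eq_iff)
  then have "Re (inn (G ?h) (G ?h)) = (norm c)\<^sup>2 * Re (inn (G f) (G f))"
    using inn_scale(3)[OF cont_G[OF f(1)] cont_G[OF f(1)]] by (simp del: of_real_power)
  moreover have "1 = (norm c)\<^sup>2 * Re (inn f f)"
    using arg_cong[OF inn_scale(3)[OF f(1,1), of c], of Re] c(2) by (simp del: of_real_power)
  ultimately have "Re (inn (G ?h) (G ?h)) = Re (inn (G f) (G f)) / Re (inn f f)"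
    using ne by (simp add: field_simps)
  then show ?thesis using f h c(2) by (intro exI[of _ ?h]) simp
qed

text \<open>Cauchy-Schwarz for the semidefinite form lam (f, h) - (G f, G h), evaluated at f and w =
  lam f - K f. Its value there is the square of \<open>nrm\<close> w, so a small deficit in the
  Rayleigh quotient bounds w itself.\<close>

lemma nearly_eigenfunction:
  fixes f :: "'a \<Rightarrow> complex"
  assumes f: "cont f"
  shows "(nrm (\<lambda>x. lam * f x - K f x))\<^sup>2 \<le> lam * (lam * Re (inn f f) - Re (inn (G f) (G f)))"
proof -
  define B where "B f h = lam * inn f h - inn (G f) (G h)" for f h
  let ?w = "\<lambda>x. lam * f x - K f x"
  have w: "cont ?w" by (intro continuous_intros f cont_K)
  have CS: "(norm (B f ?w))\<^sup>2 \<le> Re (B f f) * Re (B ?w ?w)"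
  proof (rule positive_form_Cauchy_Schwarz[where V = "{f. cont f}"])
    show "B (\<lambda>x. f x + c * g x) h = B f h + c * B g h" if "f \<in> {f. cont f}" "g \<in> {f. cont f}" "h \<in> {f. cont f}" for f g h c
      using that unfolding B_def by (simp add: G_lin inn_lin algebra_simps)
    show "B g f = cnj (B f g)" if "f \<in> {f. cont f}" "g \<in> {f. cont f}" for f g
      using that inn_herm[of f g] inn_herm[of "G f" "G g"] unfolding B_def by simp
    show "0 \<le> Re (B f f)" if "f \<in> {f. cont f}" for f
      using that G_le_lam[of f] unfolding B_def by simp
  qed (use f w in \<open>auto intro: cont_lin\<close>)
  have "B f ?w = inn ?w ?w"
  proof -
    have "inn ?w ?w = inn (\<lambda>x. lam * f x + (- 1) * K f x) ?w" by simp
    also have "\<dots> = inn (\<lambda>x. lam * f x) ?w + (- 1) * inn (K f) ?w"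
      by (intro inn_lin w cont_K f continuous_intros)
    finally show ?thesis unfolding B_def using inn_scale(1)[OF f w] inn_K[OF f w] by simp
  qed
  then have "norm (B f ?w) = (nrm ?w)\<^sup>2"
    using inn_pos[OF w] nrm_sq[OF w] by (metis abs_of_nonneg norm_of_real)
  moreover have "Re (B ?w ?w) \<le> lam * (nrm ?w)\<^sup>2"
    using inn_pos(2)[OF cont_G[OF w]] nrm_sq[OF w] by (simp add: B_def)
  moreover have p: "Re (B f f) \<ge> 0" using G_le_lam[OF f] by (simp add: B_def)
  moreover define q where "q = (nrm ?w)\<^sup>2"
  ultimately have le: "q\<^sup>2 \<le> Re (B f f) * (lam * q)"
    using order_trans[OF CS mult_left_mono[OF _ p]] by simp
  have "q \<ge> 0" by (simp add: q_def)
  have "q \<le> lam * Re (B f f)"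
  proof (cases "q = 0")
    case False
    then have "q > 0" using \<open>q \<ge> 0\<close> by simp
    moreover have "q * q \<le> (lam * Re (B f f)) * q" using le by (simp add: power2_eq_square mult_ac)
    ultimately show ?thesis by simp
  qed (use p lam_pos in simp)
  then have "(nrm ?w)\<^sup>2 \<le> lam * Re (B f f)" by (simp add: q_def)
  then show ?thesis by (simp add: B_def)
qed

text \<open>A maximizing sequence f n need not converge uniformly, but K (f n) has a uniform limit m
  along a subsequence. Applying K once more to the defects lam f - K f, which tend to 0 in
  \<open>nrm\<close>, gives lam m - K m = 0 pointwise.\<close>

lemma eigenfunction_exists: "\<exists>u. cont u \<and> u \<noteq> (\<lambda>_. 0) \<and> K u = (\<lambda>x. of_real lam * u x)"
proof -
  have "\<forall>n. \<exists>f. cont f \<and> inn f f = 1 \<and> Re (inn (G f) (G f)) > lam - 1 / real (Suc n)"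
    using near_maximizer by simp
  then obtain f where f: "\<And>n. cont (f n)" "\<And>n. inn (f n) (f n) = 1"
      "\<And>n. Re (inn (G (f n)) (G (f n))) > lam - 1 / real (Suc n)" by metis
  have "\<forall>n. \<exists>u. K (f n) = apply_bcontfun u" using cont_bcontfun cont_K f(1) by blast
  then obtain v where v: "\<And>n. K (f n) = apply_bcontfun (v n)" by metis
  have nf: "nrm (f n) = 1" for n by (simp add: nrm_def f)
  have "v n \<in> Kset 1" for n by (rule K_in_Kset[OF f(1) _ _ v]) (simp_all add: nf)
  then obtain l r where l: "l \<in> Kset 1" "strict_mono r" "(v \<circ> r) \<longlonglongrightarrow> l"
    using compact_Kset[of 1] unfolding compact_def by (metis zero_less_one)
  define m :: "'a \<Rightarrow> complex" where "m = apply_bcontfun l"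
  have m: "cont m" by (simp add: m_def)
  have ul: "uniform_limit UNIV (\<lambda>n. K (f (r n))) m sequentially"
    using tendsto_bcontfun_uniform_limit[OF l(3)] by (simp add: v o_def m_def)
  define w where "w n = (\<lambda>x. lam * f (r n) x - K (f (r n)) x)" for n
  have w: "cont (w n)" for n unfolding w_def by (intro continuous_intros f cont_K)
  have nw: "(nrm (w n))\<^sup>2 \<le> lam * (1 / real (Suc n))" for n
  proof -
    have "(nrm (w n))\<^sup>2 \<le> lam * (lam - Re (inn (G (f (r n))) (G (f (r n)))))"
      using nearly_eigenfunction[OF f(1)[of "r n"]] f(2)[of "r n"] by (simp add: w_def)
    also have "\<dots> \<le> lam * (1 / real (Suc (r n)))"
      using f(3)[of "r n"] lam_pos by (intro mult_left_mono) auto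
    also have "\<dots> \<le> lam * (1 / real (Suc n))"
      using seq_suble[OF l(2), of n] lam_pos by (intro mult_left_mono divide_left_mono) auto
    finally show ?thesis .
  qed
  have "(\<lambda>n. nrm (w n)) \<longlonglongrightarrow> 0"
  proof (rule real_tendsto_sandwich)
    show "\<forall>\<^sub>F n in sequentially. 0 \<le> nrm (w n)" using w by simp
    show "\<forall>\<^sub>F n in sequentially. nrm (w n) \<le> sqrt (lam * (1 / real (Suc n)))"
      using nw real_le_rsqrt by auto
    have "(\<lambda>n. sqrt (lam * (1 / real (Suc n)))) \<longlonglongrightarrow> sqrt (lam * 0)"
      by (intro tendsto_real_sqrt tendsto_mult_left LIMSEQ_Suc[OF lim_const_over_n])
    then show "(\<lambda>n. sqrt (lam * (1 / real (Suc n)))) \<longlonglongrightarrow> 0" by simp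
  qed simp
  then have nw0: "(\<lambda>n. C * (C * nrm (w n))) \<longlonglongrightarrow> 0" by (intro tendsto_mult_right_zero)
  have KK: "K m x = of_real lam * m x" for x
  proof -
    have "(\<lambda>n. K (w n) x) \<longlonglongrightarrow> 0"
      by (rule Lim_null_comparison[OF _ nw0]) (use norm_K[OF w] in auto)
    moreover have "K (w n) x = lam * K (f (r n)) x - K (K (f (r n))) x" for n
    proof -
      have "K (\<lambda>x. lam * f (r n) x + (- 1) * K (f (r n)) x)
          = (\<lambda>x. K (\<lambda>x. lam * f (r n) x) x + (- 1) * K (K (f (r n))) x)"
        by (intro K_lin cont_K f continuous_intros)
      then show ?thesis by (simp add: w_def K_scale f)
    qed
    moreover have "(\<lambda>n. K (f (r n)) x) \<longlonglongrightarrow> m x"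
      by (rule tendsto_uniform_limitI[OF ul]) simp
    moreover have "(\<lambda>n. K (K (f (r n))) x) \<longlonglongrightarrow> K m x"
      by (intro K_tendsto ul cont_K f m)
    ultimately have "(\<lambda>n. lam * K (f (r n)) x - K (K (f (r n))) x) \<longlonglongrightarrow> of_real lam * m x - K m x"
      "(\<lambda>n. lam * K (f (r n)) x - K (K (f (r n))) x) \<longlonglongrightarrow> 0"
      by (auto intro!: tendsto_intros)
    then have "of_real lam * m x - K m x = 0" using LIMSEQ_unique by blast
    then show ?thesis by simp
  qed
  \<comment> \<open>If m were 0, the Rayleigh quotient of f (r n), which equals (K f, f), would drop
    to lam/4, while it exceeds lam/2 for large n.\<close>
  have "m \<noteq> (\<lambda>_. 0)"
  proof
    assume "m = (\<lambda>_. 0)"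
    then have "\<forall>\<^sub>F n in sequentially. \<forall>x\<in>UNIV. dist (K (f (r n)) x) 0 < lam / 4"
      using uniform_limitD[OF ul, of "lam / 4"] lam_pos by simp
    moreover have "\<forall>\<^sub>F n in sequentially. 1 / real (Suc n) < lam / 2"
      by (rule order_tendstoD(2)[OF LIMSEQ_Suc[OF lim_const_over_n]]) (use lam_pos in simp)
    ultimately have "\<forall>\<^sub>F n in sequentially. False"
    proof eventually_elim
      case (elim n)
      have "nrm (K (f (r n))) \<le> lam / 4"
        by (rule nrm_le) (use elim(1) f in \<open>auto intro: less_imp_le\<close>)
      then have "norm (inn (K (f (r n))) (f (r n))) \<le> lam / 4"
        using inn_Cauchy_Schwarz[OF cont_K[OF f(1)] f(1), of "r n" "r n"] nf by simp
      then have "Re (inn (G (f (r n))) (G (f (r n)))) \<le> lam / 4"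
        using inn_K[OF f(1) f(1), of "r n" "r n"] complex_Re_le_cmod order_trans by metis
      moreover have "1 / real (Suc (r n)) \<le> 1 / real (Suc n)"
        using seq_suble[OF l(2), of n] by (intro divide_left_mono) auto
      ultimately show False using f(3)[of "r n"] elim(2) lam_pos by linarith
    qed
    then show False by simp
  qed
  then show ?thesis using KK by (intro exI[of _ m]) (auto simp: m)
qed

section \<open>Characters separate points\<close>

definition eigenspace :: "('a \<times> complex) set \<Rightarrow> ('a \<Rightarrow> complex) set" where
  "eigenspace Y = {u. cont u \<and> K u = (\<lambda>x. of_real lam * u x) \<and> (\<forall>p\<in>Y. \<forall>x. u (x + fst p) = snd p * u x)}"

text \<open>Unit length refers to the mean-square norm, whereas the topology is that of the supremum
  norm.\<close>

definition sphere :: "('a \<times> complex) set \<Rightarrow> ('a \<Rightarrow>\<^sub>C complex) set" where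
  "sphere Y = {u. apply_bcontfun u \<in> eigenspace Y \<and> inn u u = 1}"

lemma eigenspace_lin: "f \<in> eigenspace Y \<Longrightarrow> h \<in> eigenspace Y \<Longrightarrow> (\<lambda>x. f x + c * h x) \<in> eigenspace Y"
  unfolding eigenspace_def by (auto simp: K_lin cont_lin algebra_simps)

lemma eigenspace_scale: "f \<in> eigenspace Y \<Longrightarrow> (\<lambda>x. c * f x) \<in> eigenspace Y"
  unfolding eigenspace_def by (auto simp: K_scale continuous_on_mult_left algebra_simps)

lemma eigenspace_translate: "f \<in> eigenspace Y \<Longrightarrow> (\<lambda>x. f (x + a)) \<in> eigenspace Y"
proof -
  assume f: "f \<in> eigenspace Y"
  have "f (x + fst p + a) = snd p * f (x + a)" if "p \<in> Y" for p x
  proof -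
    have *: "x + fst p + a = (x + a) + fst p" by (simp add: ac_simps)
    have "\<forall>x. f (x + fst p) = snd p * f x" using f that by (simp add: eigenspace_def)
    then have "f ((x + a) + fst p) = snd p * f (x + a)" by (rule spec)
    then show ?thesis by (simp only: *)
  qed
  then show ?thesis using f by (simp add: eigenspace_def K_translate continuous_shift)
qed

lemma eigenspace_cont: "f \<in> eigenspace Y \<Longrightarrow> cont f"
  by (simp add: eigenspace_def)

lemma sphere_nonempty:
  assumes "f \<in> eigenspace Y" "f x \<noteq> 0"
  shows "\<exists>u c. c \<noteq> 0 \<and> u \<in> sphere Y \<and> apply_bcontfun u = (\<lambda>x. c * f x)"
proof -
  obtain c where c: "c \<noteq> 0" "inn (\<lambda>x. c * f x) (\<lambda>x. c * f x) = 1"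
    using normalize[OF eigenspace_cont[OF assms(1)] assms(2)] by blast
  have e: "(\<lambda>x. c * f x) \<in> eigenspace Y" by (rule eigenspace_scale[OF assms(1)])
  obtain u where u: "(\<lambda>x. c * f x) = apply_bcontfun u" using cont_bcontfun[OF eigenspace_cont[OF e]] by blast
  then show ?thesis using c e by (intro exI[of _ u] exI[of _ c]) (simp add: sphere_def)
qed

text \<open>An eigenfunction reproduces itself, u = K (u / lam), so it inherits the bounds for
  values of \<open>K\<close>.\<close>

lemma sphere_in_Kset: "u \<in> sphere Y \<Longrightarrow> u \<in> Kset (1 / lam)"
proof -
  assume u: "u \<in> sphere Y"
  have c: "cont (apply_bcontfun u)" by simp
  have "K (\<lambda>x. of_real (1 / lam) * u x) = (\<lambda>x. of_real (1 / lam) * K u x)" by (rule K_scale[OF c])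
  also have "\<dots> = apply_bcontfun u"
    using u lam_pos by (simp add: sphere_def eigenspace_def)
  finally have *: "K (\<lambda>x. of_real (1 / lam) * u x) = apply_bcontfun u" .
  have cc: "cont (\<lambda>x. of_real (1 / lam) * u x)" by (intro continuous_intros c)
  have "Re (inn (\<lambda>x. of_real (1 / lam) * u x) (\<lambda>x. of_real (1 / lam) * u x)) = (1 / lam)\<^sup>2"
    unfolding inn_scale(3)[OF c c] using u lam_pos by (simp add: sphere_def norm_divide power_divide)
  then have "nrm (\<lambda>x. of_real (1 / lam) * u x) = 1 / lam"
    unfolding nrm_def using lam_pos by (simp add: real_sqrt_divide)
  then show ?thesis using K_in_Kset[OF cc _ _ *] lam_pos by simp
qed

lemma closed_sphere: "closed (sphere Y)"
proof -
  have K': "continuous_on UNIV (\<lambda>u::'a \<Rightarrow>\<^sub>C complex. K u x)" for x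
    unfolding continuous_on_def by (intro ballI K_tendsto uniform_limit_id_bcontfun) auto
  have inn': "continuous_on UNIV (\<lambda>u::'a \<Rightarrow>\<^sub>C complex. inn u u)"
    using continuous_inn_shift[of UNIV 0] by simp
  have "sphere Y = (\<Inter>x. {u::'a \<Rightarrow>\<^sub>C complex. K u x = of_real lam * u x})
      \<inter> (\<Inter>p\<in>Y. \<Inter>x. {u::'a \<Rightarrow>\<^sub>C complex. u (x + fst p) = snd p * u x}) \<inter> {u::'a \<Rightarrow>\<^sub>C complex. inn u u = 1}"
    by (auto simp: sphere_def eigenspace_def fun_eq_iff)
  also have "closed \<dots>"
    by (intro closed_Int closed_INT ballI closed_Collect_eq continuous_intros continuous_eval_bcontfun K' inn')
  finally show ?thesis .
qed

lemma compact_sphere: "compact (sphere Y)"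
proof -
  have "compact (Kset (1 / lam))" by (rule compact_Kset) (use lam_pos in simp)
  then have "compact (Kset (1 / lam) \<inter> sphere Y)" by (rule compact_Int_closed[OF _ closed_sphere])
  also have "Kset (1 / lam) \<inter> sphere Y = sphere Y" using sphere_in_Kset by blast
  finally show ?thesis .
qed

text \<open>Instead of diagonalizing all translations at once on a finite-dimensional eigenspace, joint
  eigenvalue conditions are imposed one by one; compactness of the spheres makes Zorn's lemma applicable.\<close>

lemma maximal_eigenspace: "\<exists>Y. sphere Y \<noteq> {} \<and> (\<forall>p. sphere (insert p Y) \<noteq> {} \<longrightarrow> p \<in> Y)"
proof -
  define \<A> where "\<A> = {Y. sphere Y \<noteq> {}}"
  obtain u0 where "cont u0" "u0 \<noteq> (\<lambda>_. 0)" "K u0 = (\<lambda>x. of_real lam * u0 x)"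
    using eigenfunction_exists by blast
  then have "u0 \<in> eigenspace {}" "\<exists>x. u0 x \<noteq> 0" by (auto simp: eigenspace_def fun_eq_iff)
  then have ne: "{} \<in> \<A>" using sphere_nonempty unfolding \<A>_def by blast
  have "\<exists>M\<in>\<A>. \<forall>Y\<in>\<A>. M \<subseteq> Y \<longrightarrow> Y = M"
  proof (rule subset_Zorn_nonempty)
    show "\<A> \<noteq> {}" using ne by blast
    fix \<C> assume \<C>: "\<C> \<noteq> {}" "subset.chain \<A> \<C>"
    have top: "\<exists>Z\<in>I. \<forall>Y\<in>I. Y \<subseteq> Z" if "finite I" "I \<noteq> {}" "I \<subseteq> \<C>" for I
      using that
    proof (induction rule: finite_ne_induct)
      case (insert Y I)
      then obtain Z where Z: "Z \<in> I" "\<forall>Y\<in>I. Y \<subseteq> Z" by auto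
      moreover have "Y \<subseteq> Z \<or> Z \<subseteq> Y" using \<C>(2) insert.prems Z(1) unfolding subset_chain_def by blast
      ultimately show ?case by blast
    qed simp
    have anti: "sphere Z \<subseteq> sphere Y" if "Y \<subseteq> Z" for Y Z
      using that by (auto simp: sphere_def eigenspace_def)
    have "sphere {} \<inter> (\<Inter>Y\<in>\<C>. sphere Y) \<noteq> {}"
    proof (rule compact_imp_fip_image[OF compact_sphere closed_sphere])
      fix I assume I: "finite I" "I \<subseteq> \<C>"
      show "sphere {} \<inter> (\<Inter>Y\<in>I. sphere Y) \<noteq> {}"
      proof (cases "I = {}")
        case True
        then show ?thesis using ne by (simp add: \<A>_def)
      next
        case False
        obtain Z where Z: "Z \<in> I" "\<forall>Y\<in>I. Y \<subseteq> Z" by (rule bexE[OF top[OF I(1) False I(2)]])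
        have "Z \<in> \<A>" using \<C>(2) subsetD[OF I(2) Z(1)] unfolding subset_chain_def by (meson subsetD)
        then have "sphere Z \<noteq> {}" by (simp add: \<A>_def)
        then show ?thesis using anti Z by blast
      qed
    qed
    then obtain u where "\<forall>Y\<in>\<C>. u \<in> sphere Y" by blast
    then have "u \<in> sphere (\<Union>\<C>)" using \<C>(1) by (auto simp: sphere_def eigenspace_def)
    then show "\<Union>\<C> \<in> \<A>" unfolding \<A>_def by blast
  qed
  then obtain M where M: "sphere M \<noteq> {}" "\<And>Y. sphere Y \<noteq> {} \<Longrightarrow> M \<subseteq> Y \<Longrightarrow> Y = M"
    by (auto simp: \<A>_def)
  have "p \<in> M" if "sphere (insert p M) \<noteq> {}" for p using M(2)[OF that] by blast
  then show ?thesis using M(1) by blast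
qed

text \<open>If \<open>f\<close> maximizes \<open>a = Re \<langle>\<tau> f, f\<rangle>\<close> for the translation \<open>\<tau>\<close> by \<open>y\<close>, then \<open>(\<tau> + \<tau>\<inverse>) f = 2 a f\<close>, so with
  \<open>c + cnj c = 2 a\<close> and \<open>c (cnj c) = 1\<close> either \<open>\<tau> f = cnj c f\<close> or \<open>\<tau> f - cnj c f\<close> is an eigenfunction for \<open>c\<close>.\<close>

lemma translation_eigenvalue:
  assumes ne: "sphere Y \<noteq> {}"
  shows "\<exists>c. sphere (insert (y, c) Y) \<noteq> {}"
proof -
  obtain u where u: "u \<in> sphere Y"
    and max: "\<And>v. v \<in> sphere Y \<Longrightarrow> Re (inn (\<lambda>x. v (x + y)) v) \<le> Re (inn (\<lambda>x. u (x + y)) u)"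
    using continuous_attains_sup[OF compact_sphere ne continuous_on_Re[OF continuous_inn_shift[of _ y]]] by blast
  define f where "f = apply_bcontfun u"
  have f: "f \<in> eigenspace Y" "inn f f = 1" using u by (auto simp: f_def sphere_def)
  have cf: "cont f" by (rule eigenspace_cont[OF f(1)])
  define a where "a = Re (inn (\<lambda>x. f (x + y)) f)"
  have le: "Re (inn (\<lambda>x. h (x + y)) h) \<le> a * Re (inn h h)" if h: "h \<in> eigenspace Y" for h
  proof (cases "\<exists>x. h x \<noteq> 0")
    case False
    then show ?thesis by (simp add: inn_def)
  next
    case True
    have ch: "cont h" by (rule eigenspace_cont[OF h])
    obtain v c where v: "c \<noteq> 0" "v \<in> sphere Y" "apply_bcontfun v = (\<lambda>x. c * h x)"
      using sphere_nonempty[OF h] True by blast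
    have 1: "inn (\<lambda>x. c * h (x + y)) (\<lambda>x. c * h x) = of_real ((norm c)\<^sup>2) * inn (\<lambda>x. h (x + y)) h"
      unfolding complex_norm_square using ch continuous_shift[OF ch]
      by (simp add: inn_scale(1,2) continuous_on_mult_left)
    have 2: "inn (\<lambda>x. c * h x) (\<lambda>x. c * h x) = 1" using v by (simp add: sphere_def)
    have "Re (inn (\<lambda>x. c * h (x + y)) (\<lambda>x. c * h x)) \<le> a * 1"
      using max[OF v(2)] v(3) by (simp add: a_def f_def)
    also have "1 = (norm c)\<^sup>2 * Re (inn h h)"
      using arg_cong[OF inn_scale(3)[OF ch ch, of c], of Re] 2 by (simp del: of_real_power)
    finally have "(norm c)\<^sup>2 * Re (inn (\<lambda>x. h (x + y)) h) \<le> (norm c)\<^sup>2 * (a * Re (inn h h))"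
      unfolding 1 by (simp del: of_real_power add: mult_ac)
    then show ?thesis using v(1) by simp
  qed
  define S where "S h = (\<lambda>x. h (x + y) + h (x + - y))" for h :: "'a \<Rightarrow> complex"
  define B where "B h k = 2 * of_real a * inn h k - inn (\<lambda>x. h (x + y)) k - inn (\<lambda>x. h (x + - y)) k" for h k
  have adj: "inn (\<lambda>x. h (x + - y)) k = cnj (inn (\<lambda>x. k (x + y)) h)" if "cont h" "cont k" for h k
    using inn_translate[OF continuous_shift[OF that(1), of "- y"] that(2), of y]
      inn_herm[OF continuous_shift[OF that(2), of y] that(1)] by simp
  define w where "w = (\<lambda>x. (2 * of_real a * f x + (- 1) * f (x + y)) + (- 1) * f (x + - y))"
  have w: "w \<in> eigenspace Y"
    unfolding w_def by (intro eigenspace_lin eigenspace_scale eigenspace_translate f)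
  have cw: "cont w" by (rule eigenspace_cont[OF w])
  \<comment> \<open>Variational equation at the maximizer: \<open>le\<close> makes B semidefinite,
    the choice of a makes B f f = 0, so B f w = 0. Since B f w is also the squared length of w, the
    function w vanishes.\<close>
  have "(norm (B f w))\<^sup>2 \<le> Re (B f f) * Re (B w w)"
  proof (rule positive_form_Cauchy_Schwarz[where V = "eigenspace Y"])
    show "B (\<lambda>x. f x + c * g x) h = B f h + c * B g h"
      if "f \<in> eigenspace Y" "g \<in> eigenspace Y" "h \<in> eigenspace Y" for f g h c
      using inn_lin[OF that[THEN eigenspace_cont], of c]
        inn_lin[OF continuous_shift[OF that(1)[THEN eigenspace_cont], of y] continuous_shift[OF that(2)[THEN eigenspace_cont], of y] that(3)[THEN eigenspace_cont], of c]
        inn_lin[OF continuous_shift[OF that(1)[THEN eigenspace_cont], of "- y"] continuous_shift[OF that(2)[THEN eigenspace_cont], of "- y"] that(3)[THEN eigenspace_cont], of c]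
      unfolding B_def by (simp add: right_diff_distrib distrib_left mult.left_commute del: add_uminus_conv_diff)
    show "B g f = cnj (B f g)" if "f \<in> eigenspace Y" "g \<in> eigenspace Y" for f g
      using that[THEN eigenspace_cont] inn_herm[of f g] unfolding B_def by (simp add: adj del: add_uminus_conv_diff)
    show "0 \<le> Re (B f f)" if "f \<in> eigenspace Y" for f
      using eigenspace_cont[OF that] le[OF that] unfolding B_def by (simp add: adj del: add_uminus_conv_diff)
  qed (auto intro: eigenspace_lin f w)
  moreover have "Re (B f f) = 0"
    unfolding B_def adj[OF cf cf] using f(2) by (simp add: a_def)
  ultimately have "B f w = 0" by simp
  moreover have "B f w = inn w w"
  proof -
    have c: "cont (\<lambda>x. 2 * of_real a * f x)" "cont (\<lambda>x. f (x + y))" "cont (\<lambda>x. f (x + - y))"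
      "cont (\<lambda>x. 2 * of_real a * f x + (- 1) * f (x + y))"
      using cf continuous_shift[OF cf, of "- y"] by (auto intro!: continuous_intros continuous_shift)
    have "inn w w = inn (\<lambda>x. 2 * of_real a * f x + (- 1) * f (x + y)) w + (- 1) * inn (\<lambda>x. f (x + - y)) w"
      using inn_lin[OF c(4,3) cw, of "- 1"] unfolding w_def by simp
    also have "inn (\<lambda>x. 2 * of_real a * f x + (- 1) * f (x + y)) w
        = 2 * of_real a * inn f w + (- 1) * inn (\<lambda>x. f (x + y)) w"
      using inn_lin[OF c(1,2) cw, of "- 1"] inn_scale(1)[OF cf cw] by simp
    finally show ?thesis by (simp add: B_def)
  qed
  ultimately have w0: "w x = 0" for x using inn_eq_0[OF cw] by simp
  have rel: "f (x + y) = 2 * of_real a * f x - f (x + - y)" for x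
    using w0[of x] unfolding w_def by (simp add: algebra_simps)
  have "a\<^sup>2 \<le> 1"
  proof -
    have ct: "cont (\<lambda>x. f (x + y))" by (rule continuous_shift[OF cf])
    have "nrm f = 1" using f(2) by (simp add: nrm_def)
    moreover have "nrm (\<lambda>x. f (x + y)) = nrm f" by (simp add: nrm_def inn_translate[OF cf cf])
    ultimately have "\<bar>a\<bar> \<le> 1"
      using inn_Cauchy_Schwarz[OF ct cf] abs_Re_le_cmod[of "inn (\<lambda>x. f (x + y)) f"] by (simp add: a_def)
    then show ?thesis by (simp add: abs_square_le_1)
  qed
  \<comment> \<open>A root of z^2 - 2 a z + 1, the quadratic equation that translation by y
    satisfies on f; |a| at most 1 places it on the unit circle.\<close>
  define c where "c = Complex a (sqrt (1 - a\<^sup>2))"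
  have c: "c + cnj c = 2 * of_real a" "c * cnj c = 1"
    using \<open>a\<^sup>2 \<le> 1\<close> by (auto simp: c_def complex_eq_iff power2_eq_square[symmetric])
  define v where "v = (\<lambda>x. f (x + y) + (- cnj c) * f x)"
  have v: "v \<in> eigenspace Y" unfolding v_def by (intro eigenspace_lin eigenspace_translate f)
  have v_shift: "v (x + y) = c * v x" for x
  proof -
    have "f (x + y + y) = (c + cnj c) * f (x + y) - f x" using rel[of "x + y"] by (simp add: c(1))
    moreover have "c * (cnj c * f x) = f x" using c(2) by (simp flip: mult.assoc)
    ultimately show ?thesis unfolding v_def by (simp add: distrib_right right_diff_distrib)
  qed
  show ?thesis
  proof (cases "\<exists>x. v x \<noteq> 0")
    case True
    have "v \<in> eigenspace (insert (y, c) Y)" using v v_shift by (simp add: eigenspace_def)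
    then show ?thesis using sphere_nonempty True by blast
  next
    case False
    then have "f \<in> eigenspace (insert (y, cnj c) Y)" using f(1) by (simp add: eigenspace_def v_def)
    then have "u \<in> sphere (insert (y, cnj c) Y)" using f(2) by (simp add: sphere_def f_def)
    then show ?thesis by blast
  qed
qed

text \<open>For maximal Y every y already has an eigenvalue in Y, so a function in the eigenspace
  satisfies f (x + y) = c f x for each y. Dividing by f 0 makes it multiplicative, and translation
  invariance of the inner product forces modulus 1.\<close>

lemma character_eigenfunction: "\<exists>\<kappa>. character \<kappa> \<and> K \<kappa> = (\<lambda>x. of_real lam * \<kappa> x)"
proof -
  obtain Y where Y: "sphere Y \<noteq> {}" "\<And>p. sphere (insert p Y) \<noteq> {} \<Longrightarrow> p \<in> Y" using maximal_eigenspace by blast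
  obtain u where u: "u \<in> sphere Y" using Y by blast
  define f where "f = apply_bcontfun u"
  have f: "f \<in> eigenspace Y" "inn f f = 1" using u by (auto simp: f_def sphere_def)
  have ex: "\<exists>c. \<forall>x. f (x + y) = c * f x" for y
  proof -
    obtain c where "(y, c) \<in> Y" using translation_eigenvalue[OF Y(1)] Y(2) by blast
    then have "\<forall>x. f (x + y) = c * f x" using f(1) by (auto simp: eigenspace_def)
    then show ?thesis by blast
  qed
  have f0: "f 0 \<noteq> 0"
  proof
    assume z: "f 0 = 0"
    have "f y = 0" for y
    proof -
      obtain c where "\<forall>x. f (x + y) = c * f x" using ex by blast
      from this[rule_format, of 0] show ?thesis using z by simp
    qed
    then show False using f(2) by (simp add: inn_def)
  qed
  define \<kappa> where "\<kappa> = (\<lambda>x. 1 / f 0 * f x)"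
  have e: "\<kappa> \<in> eigenspace Y" unfolding \<kappa>_def by (rule eigenspace_scale[OF f(1)])
  have ck: "cont \<kappa>" by (rule eigenspace_cont[OF e])
  have mult: "\<kappa> (x + y) = \<kappa> x * \<kappa> y" for x y
  proof -
    obtain c where c: "\<forall>x. f (x + y) = c * f x" using ex by blast
    from c[rule_format, of 0] have "f y = c * f 0" by simp
    then show ?thesis using c[rule_format, of x] f0 by (simp add: \<kappa>_def field_simps)
  qed
  have "norm (\<kappa> y) = 1" for y
  proof -
    have "inn \<kappa> \<kappa> = inn (\<lambda>x. \<kappa> (x + y)) (\<lambda>x. \<kappa> (x + y))" by (rule inn_translate[OF ck ck, symmetric])
    also have "\<dots> = of_real ((norm (\<kappa> y))\<^sup>2) * inn \<kappa> \<kappa>"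
      unfolding mult using inn_scale(3)[OF ck ck, of "\<kappa> y"] by (simp add: mult.commute)
    finally have "of_real ((norm (\<kappa> y))\<^sup>2) * inn \<kappa> \<kappa> = 1 * inn \<kappa> \<kappa>" by simp
    moreover have "inn \<kappa> \<kappa> \<noteq> 0"
    proof
      assume "inn \<kappa> \<kappa> = 0"
      then have "\<kappa> 0 = 0" using inn_eq_0[OF ck] by simp
      then show False using f0 by (simp add: \<kappa>_def)
    qed
    ultimately have "complex_of_real ((norm (\<kappa> y))\<^sup>2) = of_real 1" by (metis mult_right_cancel of_real_1)
    then have "(norm (\<kappa> y))\<^sup>2 = 1" unfolding of_real_eq_iff .
    then show ?thesis using norm_ge_zero[of "\<kappa> y"] unfolding power2_eq_1_iff by linarith
  qed
  then have "character \<kappa>" using ck mult by (simp add: character_def)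
  then show ?thesis using e by (auto simp: eigenspace_def)
qed

end

context compact_group
begin

lemma separating_function:
  assumes "x0 \<noteq> (0::'a)"
  shows "\<exists>k. cont k \<and> k x0 \<noteq> k 0"
proof -
  have "compact_space (euclidean :: 'a topology)" using compact_UNIV by (simp add: compact_space_def)
  then have "normal_space (euclidean :: 'a topology)"
    by (rule compact_Hausdorff_or_regular_imp_normal_space)
       (metis Hausdorff_space_def disjnt_def hausdorff open_openin)
  then obtain k :: "'a \<Rightarrow> real" where "continuous_map euclidean euclideanreal k" "k ` {x0} \<subseteq> {0}" "k ` {0} \<subseteq> {1}"
    using Urysohn_lemma_alt[of euclidean "{x0}" "{0}" 0 1] assms by (auto simp: disjnt_def)
  then have "cont (\<lambda>x. of_real (k x))" "complex_of_real (k x0) \<noteq> of_real (k 0)"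
    by (auto intro!: continuous_intros)
  then show ?thesis by blast
qed

text \<open>A character trivial at \<open>x0\<close> is annihilated by convolution with \<open>k(\<cdot> + x0) - k\<close>.\<close>

theorem characters_separate:
  assumes "x0 \<noteq> (0::'a)"
  shows "\<exists>\<kappa>. character \<kappa> \<and> \<kappa> x0 \<noteq> 1"
proof (rule ccontr)
  assume none: "\<nexists>\<kappa>. character \<kappa> \<and> \<kappa> x0 \<noteq> 1"
  obtain k where k: "cont k" "k x0 \<noteq> k 0" using separating_function[OF assms] by blast
  define g where "g x = k (x + x0) - k x" for x
  have cg: "cont g" unfolding g_def by (intro continuous_intros continuous_shift k)
  interpret convolution_operator ty g 0
    by unfold_locales (use k cg in \<open>auto simp: g_def\<close>)
  obtain \<kappa> where \<kappa>: "character \<kappa>" "K \<kappa> = (\<lambda>x. of_real lam * \<kappa> x)" using character_eigenfunction by blast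
  have ck: "cont \<kappa>" and k1: "\<kappa> x0 = 1" and mult: "\<And>x y. \<kappa> (x + y) = \<kappa> x * \<kappa> y"
    using \<kappa>(1) none by (auto simp: character_def)
  have "G \<kappa> x = 0" for x
  proof -
    have c: "cont (\<lambda>y. k (x - y + x0) * \<kappa> y)" "cont (\<lambda>y. k (x - y) * \<kappa> y)"
      using cont_pre(1)[OF continuous_shift[OF k(1), of x0]] cont_pre(1)[OF k(1)] ck
      by (auto intro!: continuous_on_mult)
    have "G \<kappa> x = mean (\<lambda>y. k (x - y + x0) * \<kappa> y) - mean (\<lambda>y. k (x - y) * \<kappa> y)"
      unfolding conv_def g_def using mean_diff[OF c] by (simp add: left_diff_distrib)
    also have "mean (\<lambda>y. k (x - y + x0) * \<kappa> y) = mean (\<lambda>y. k (x - (y + x0) + x0) * \<kappa> (y + x0))"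
      by (rule mean_translate[OF c(1), symmetric])
    also have "\<dots> = mean (\<lambda>y. k (x - y) * \<kappa> y)" by (simp add: mult k1 diff_diff_add[symmetric])
    finally show ?thesis by simp
  qed
  then have "K \<kappa> 0 = 0" unfolding K_def conv_def[of "adj g"] by simp
  then have "\<kappa> 0 = 0" using \<kappa>(2) lam_pos by (simp add: fun_eq_iff)
  moreover have "norm (\<kappa> 0) = 1" using \<kappa>(1) by (simp add: character_def)
  ultimately show False by simp
qed

lemma character_mult: "character \<kappa> \<Longrightarrow> character \<psi> \<Longrightarrow> character (\<lambda>x. \<kappa> x * \<psi> x)"
  unfolding character_def by (auto simp: norm_mult mult_ac intro: continuous_on_mult)

lemma character_cnj: "character \<kappa> \<Longrightarrow> character (\<lambda>x. cnj (\<kappa> x))"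
  unfolding character_def by (auto intro: continuous_on_cnj)

lemma character_one: "character (\<lambda>_. 1)"
  unfolding character_def by simp

lemma mean_character:
  assumes "character \<kappa>" "\<kappa> x \<noteq> 1"
  shows "mean \<kappa> = 0"
proof -
  have c: "cont \<kappa>" using assms by (simp add: character_def)
  have "mean \<kappa> = mean (\<lambda>y. \<kappa> (y + x))" by (rule mean_translate[OF c, symmetric])
  also have "\<dots> = mean (\<lambda>y. \<kappa> x * \<kappa> y)" using assms(1) by (simp add: character_def mult.commute)
  also have "\<dots> = \<kappa> x * mean \<kappa>" by (rule mean_cmult[OF c])
  finally show ?thesis using assms(2) by simp
qed

section \<open>Density of trigonometric polynomials\<close>

inductive_set trig :: "('a \<Rightarrow> complex) set" where
  char: "character \<kappa> \<Longrightarrow> \<kappa> \<in> trig"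
| add: "f \<in> trig \<Longrightarrow> g \<in> trig \<Longrightarrow> (\<lambda>x. f x + g x) \<in> trig"
| cmult: "f \<in> trig \<Longrightarrow> (\<lambda>x. c * f x) \<in> trig"

lemma trig_const: "(\<lambda>_. c) \<in> trig"
  using trig.cmult[OF trig.char[OF character_one], of c] by simp

lemma trig_cont: "f \<in> trig \<Longrightarrow> cont f"
  by (induction rule: trig.induct) (auto simp: character_def intro!: continuous_intros)

lemma trig_cnj: "f \<in> trig \<Longrightarrow> (\<lambda>x. cnj (f x)) \<in> trig"
proof (induction rule: trig.induct)
  case (char \<kappa>)
  then show ?case by (intro trig.char character_cnj)
next
  case (add f g)
  then show ?case using trig.add by simp
next
  case (cmult f c)
  then show ?case using trig.cmult[of _ "cnj c"] by simp
qed

lemma trig_mult_char: "f \<in> trig \<Longrightarrow> character \<kappa> \<Longrightarrow> (\<lambda>x. f x * \<kappa> x) \<in> trig"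
proof (induction rule: trig.induct)
  case (char \<psi>)
  then show ?case by (intro trig.char character_mult)
next
  case (add f g)
  then have "(\<lambda>x. f x * \<kappa> x + g x * \<kappa> x) \<in> trig" by (intro trig.add) auto
  then show ?case by (simp add: distrib_right)
next
  case (cmult f c)
  then show ?case using trig.cmult[of "\<lambda>x. f x * \<kappa> x" c] by (simp add: mult.assoc)
qed

lemma trig_mult: "g \<in> trig \<Longrightarrow> f \<in> trig \<Longrightarrow> (\<lambda>x. f x * g x) \<in> trig"
proof (induction rule: trig.induct)
  case (char \<psi>)
  then show ?case by (intro trig_mult_char)
next
  case (add g h)
  then have "(\<lambda>x. f x * g x + f x * h x) \<in> trig" by (intro trig.add) auto
  then show ?case by (simp add: distrib_left)
next
  case (cmult g c)
  then show ?case using trig.cmult[of "\<lambda>x. f x * g x" c] by (simp add: mult_ac)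
qed

lemma trig_Re:
  assumes "f \<in> trig"
  shows "(\<lambda>x. of_real (Re (f x))) \<in> trig"
proof -
  have "(\<lambda>x. 1 / 2 * (f x + cnj (f x))) \<in> trig" by (intro trig.cmult trig.add trig_cnj assms)
  moreover have "1 / 2 * (z + cnj z) = of_real (Re z)" for z by (simp add: complex_eq_iff)
  ultimately show ?thesis by simp
qed

text \<open>Stone-Weierstrass is applied to the real functions that are trigonometric polynomials. A
  character separating two points does so by its real or its imaginary part, and both belong to this
  ring.\<close>

lemma trig_approx_real:
  fixes f :: "'a \<Rightarrow> real"
  assumes f: "continuous_on UNIV f" and e: "e > 0"
  shows "\<exists>g. (\<lambda>x. of_real (g x)) \<in> trig \<and> (\<forall>x. \<bar>f x - g x\<bar> < e)"
proof -
  define R where "R = {g :: 'a \<Rightarrow> real. (\<lambda>x. of_real (g x)) \<in> trig}"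
  have cr: "continuous_on UNIV g" if "g \<in> R" for g
    using continuous_on_Re[OF trig_cont, of "\<lambda>x. of_real (g x)"] that by (simp add: R_def)
  have "function_ring_on R UNIV"
  proof (rule function_ring_on.intro)
    show "compact (UNIV :: 'a set)" by (rule compact_UNIV)
    show "continuous_on UNIV g" if "g \<in> R" for g by (rule cr[OF that])
    show "(\<lambda>x. g x + h x) \<in> R" if "g \<in> R" "h \<in> R" for g h
      using that trig.add unfolding R_def by simp
    show "(\<lambda>x. g x * h x) \<in> R" if "g \<in> R" "h \<in> R" for g h
      using that trig_mult unfolding R_def by simp
    show "(\<lambda>_. c) \<in> R" for c using trig_const by (simp add: R_def)
    fix x y :: 'a assume "x \<noteq> y"
    then have "x - y \<noteq> 0" by simp
    then obtain \<kappa> where k: "character \<kappa>" "\<kappa> (x - y) \<noteq> 1" using characters_separate by blast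
    have "\<kappa> (x - y + y) = \<kappa> (x - y) * \<kappa> y" "norm (\<kappa> y) = 1" using k(1) unfolding character_def by blast+
    then have ne: "\<kappa> x \<noteq> \<kappa> y" using k(2) by auto
    have "(\<lambda>x. - \<i> * \<kappa> x) \<in> trig" by (intro trig.cmult trig.char k)
    from trig_Re[OF this] have "(\<lambda>x. Im (\<kappa> x)) \<in> R" by (simp add: R_def)
    moreover have "(\<lambda>x. Re (\<kappa> x)) \<in> R" using trig_Re[OF trig.char[OF k(1)]] by (simp add: R_def)
    moreover have "Re (\<kappa> x) \<noteq> Re (\<kappa> y) \<or> Im (\<kappa> x) \<noteq> Im (\<kappa> y)" using ne by (auto simp: complex_eq_iff)
    ultimately show "\<exists>f\<in>R. f x \<noteq> f y" by (metis (no_types, lifting))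
  qed
  from function_ring_on.Stone_Weierstrass_basic[OF this f e] show ?thesis unfolding R_def by auto
qed

theorem trig_approx:
  assumes f: "cont f" and e: "e > 0"
  shows "\<exists>g\<in>trig. \<forall>x. norm (f x - g x) < e"
proof -
  obtain g where g: "(\<lambda>x. of_real (g x)) \<in> trig" "\<And>x. \<bar>Re (f x) - g x\<bar> < e / 2"
    using trig_approx_real[OF continuous_on_Re[OF f], of "e / 2"] e by auto
  obtain h where h: "(\<lambda>x. of_real (h x)) \<in> trig" "\<And>x. \<bar>Im (f x) - h x\<bar> < e / 2"
    using trig_approx_real[OF continuous_on_Im[OF f], of "e / 2"] e by auto
  have "(\<lambda>x. of_real (g x) + \<i> * of_real (h x)) \<in> trig" by (intro trig.add trig.cmult g h)
  moreover have "norm (f x - (of_real (g x) + \<i> * of_real (h x))) < e" for x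
    using cmod_le[of "f x - (of_real (g x) + \<i> * of_real (h x))"] g(2)[of x] h(2)[of x] by simp
  ultimately show ?thesis by (intro bexI[of _ "\<lambda>x. of_real (g x) + \<i> * of_real (h x)"]) auto
qed

section \<open>Zero entropy and relations between characters\<close>

lemma character_powi:
  assumes "character \<kappa>"
  shows "character (\<lambda>x. \<kappa> x powi e)"
proof -
  have "\<kappa> x \<noteq> 0" for x using assms unfolding character_def by (metis norm_zero zero_neq_one)
  then show ?thesis using assms
    by (auto simp: character_def power_int_mult_distrib norm_power_int intro!: continuous_on_power_int)
qed

lemma character_prod:
  "(\<And>i. i \<in> I \<Longrightarrow> character (\<psi> i)) \<Longrightarrow> character (\<lambda>x. \<Prod>i\<in>I. \<psi> i x)"
  by (induction I rule: infinite_finite_induct) (simp_all add: character_one character_mult)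

text \<open>Expanding the Riesz product yields the characters \<open>\<Prod> \<psi>\<^sub>j\<^bsup>e j\<^esup>\<close> with \<open>e j \<in> {-1, 0, 1}\<close>,
  all nontrivial except the one for \<open>e = 0\<close>.\<close>

lemma mean_Riesz_product:
  fixes \<psi> :: "nat \<Rightarrow> 'a \<Rightarrow> complex" and m :: nat
  assumes \<psi>: "\<And>j. j < m \<Longrightarrow> character (\<psi> j)"
    and indep: "\<And>e. (\<And>j. j < m \<Longrightarrow> e j \<in> {-1, 0, 1}) \<Longrightarrow> (\<And>x. (\<Prod>j<m. \<psi> j x powi e j) = 1) \<Longrightarrow> (\<forall>j<m. e j = 0)"
  shows "mean (\<lambda>x. of_real (\<Prod>j<m. 1 + Re (\<psi> j x * cnj (c j)))) = 1"
proof -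
  define P where "P k x = (\<Prod>j<k. 1 + Re (\<psi> j x * cnj (c j)))" for k x
  define \<Theta> where "\<Theta> k e x = (\<Prod>j\<in>{k..<m}. \<psi> j x powi e j)" for k e x
  have cP: "cont (\<lambda>x. of_real (P k x))" if "k \<le> m" for k
    unfolding P_def using \<psi>[unfolded character_def] that
    by (intro continuous_intros) (simp add: less_le_trans)
  have c\<Theta>: "character (\<Theta> k e)" for k e
    unfolding \<Theta>_def by (intro character_prod character_powi \<psi>) simp
  \<comment> \<open>The claim is generalized by a tail of characters with arbitrary exponents from k
    on. Peeling off the k-th factor of the product then amounts to inserting the exponents 0, 1 and
    -1 at position k.\<close>
  have main: "mean (\<lambda>x. of_real (P k x) * \<Theta> k e x) = (if \<forall>j\<in>{k..<m}. e j = 0 then 1 else 0)"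
    if "k \<le> m" "\<forall>j\<in>{k..<m}. e j \<in> {-1, 0, 1}" for k and e :: "nat \<Rightarrow> int"
    using that
  proof (induction k arbitrary: e)
    case 0
    have P0: "P 0 x = 1" for x by (simp add: P_def)
    show ?case
    proof (cases "\<forall>j\<in>{0..<m}. e j = 0")
      case True
      then have "\<Theta> 0 e x = 1" for x by (simp add: \<Theta>_def)
      then show ?thesis using True by (simp add: P0)
    next
      case False
      have "\<exists>x. \<Theta> 0 e x \<noteq> 1"
      proof (rule ccontr)
        assume "\<nexists>x. \<Theta> 0 e x \<noteq> 1"
        then have "\<forall>j<m. e j = 0" using 0 by (intro indep) (auto simp: \<Theta>_def lessThan_atLeast0)
        then show False using False by simp
      qed
      then show ?thesis using mean_character[OF c\<Theta>] False by (auto simp: P0)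
    qed
  next
    case (Suc k)
    have k: "k < m" "k \<le> m" using Suc.prems by auto
    have split: "\<Theta> k e' x = \<psi> k x powi e' k * \<Theta> (Suc k) e' x" for e' x
      unfolding \<Theta>_def using k by (simp add: prod.atLeast_Suc_lessThan)
    have upd: "\<Theta> (Suc k) (e(k := a)) x = \<Theta> (Suc k) e x" for a x
      unfolding \<Theta>_def by (intro prod.cong) auto
    have inv: "inverse (\<psi> k x) = cnj (\<psi> k x)" for x
    proof -
      have "norm (\<psi> k x) = 1" using \<psi>[OF k(1)] by (simp add: character_def)
      then have "\<psi> k x * cnj (\<psi> k x) = 1" by (metis complex_norm_square of_real_1 one_power2)
      then show ?thesis by (rule inverse_unique)
    qed
    have half: "complex_of_real (1 + Re (z * cnj d)) = 1 + (cnj d / 2 * z + d / 2 * cnj z)" for z d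
      by (simp add: complex_eq_iff field_simps)
    have eq: "of_real (P (Suc k) x) * \<Theta> (Suc k) e x = of_real (P k x) * \<Theta> k (e(k := 0)) x
        + (cnj (c k) / 2 * (of_real (P k x) * \<Theta> k (e(k := 1)) x) + c k / 2 * (of_real (P k x) * \<Theta> k (e(k := -1)) x))" for x
    proof -
      have PS: "complex_of_real (P (Suc k) x) = of_real (P k x) * (1 + (cnj (c k) / 2 * \<psi> k x + c k / 2 * cnj (\<psi> k x)))"
        unfolding P_def by (simp only: prod.lessThan_Suc of_real_mult half)
      show ?thesis unfolding PS split upd by (simp add: inv power_int_minus1_right algebra_simps)
    qed
    have ct: "cont (\<lambda>x. of_real (P k x) * \<Theta> k e' x)" for e'
      using cP[OF k(2)] c\<Theta>[of k e'] by (auto simp: character_def intro: continuous_on_mult)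
    have IH: "mean (\<lambda>x. of_real (P k x) * \<Theta> k (e(k := a)) x) = (if \<forall>j\<in>{k..<m}. (e(k := a)) j = 0 then 1 else 0)"
      if "a \<in> {-1, 0, 1}" for a
      by (rule Suc.IH[OF k(2)]) (use Suc.prems(2) that in auto)
    have "mean (\<lambda>x. of_real (P (Suc k) x) * \<Theta> (Suc k) e x) = mean (\<lambda>x. of_real (P k x) * \<Theta> k (e(k := 0)) x)
        + (cnj (c k) / 2 * mean (\<lambda>x. of_real (P k x) * \<Theta> k (e(k := 1)) x) + c k / 2 * mean (\<lambda>x. of_real (P k x) * \<Theta> k (e(k := -1)) x))"
      unfolding eq by (subst mean_add; (subst mean_add)?; (intro continuous_on_add continuous_on_mult_left ct)?)
        (simp_all only: mean_cmult[OF ct])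
    also have "\<dots> = (if \<forall>j\<in>{Suc k..<m}. e j = 0 then 1 else 0)"
    proof -
      have "k \<in> {k..<m}" "{k..<m} = insert k {Suc k..<m}" using k by auto
      then show ?thesis by (simp add: IH)
    qed
    finally show ?case .
  qed
  have "mean (\<lambda>x. of_real (P m x) * \<Theta> m (\<lambda>_. 0) x) = 1" by (subst main) auto
  then show ?thesis by (simp add: \<Theta>_def P_def)
qed

end

locale affine_flow = compact_group ty
  for ty :: "'a::{topological_ab_group_add, t2_space} itself" +
  fixes A T :: "'a \<Rightarrow> 'a" and b :: 'a
  assumes A: "continuous_automorphism A" and T: "T x = A x + b"
begin

lemma A_add: "A (x + y) = A x + A y" and A_surj: "surj A" and A_cont: "continuous_on UNIV A"
  using A by (auto simp: continuous_automorphism_def Modules.additive_def bij_def)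

lemma iter_add: "(A ^^ i) (x + y) = (A ^^ i) x + (A ^^ i) y"
  by (induction i) (simp_all add: A_add)

lemma iter_cont: "continuous_on UNIV (A ^^ i)"
  by (induction i) (auto intro: continuous_on_compose2[OF A_cont] simp: id_def o_def)

text \<open>The affine part only adds the orbit of 0, which a character sees as a unimodular
  constant depending on i.\<close>

lemma T_iter: "(T ^^ i) x = (A ^^ i) x + (T ^^ i) 0"
  by (induction i) (simp_all add: T A_add add.assoc)

lemma T_iter_cont: "continuous_on UNIV (T ^^ i)"
proof -
  have "T ^^ i = (\<lambda>x. (A ^^ i) x + (T ^^ i) 0)" by (rule ext) (rule T_iter)
  moreover have "continuous_on UNIV (\<lambda>x. (A ^^ i) x + (T ^^ i) 0)" by (intro continuous_intros iter_cont)
  ultimately show ?thesis by (simp only:)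
qed

lemma character_iter: "character \<kappa> \<Longrightarrow> character (\<lambda>x. \<kappa> ((A ^^ i) x))"
  unfolding character_def by (auto simp: iter_add intro: continuous_on_compose2[OF _ iter_cont])

text \<open>Radius 1 means an arc of angle pi/3 to either side of c, exactly the condition that the
  real part of \<open>\<kappa> x * cnj c\<close> exceeds 1/2.\<close>

definition arc_cover :: "('a \<Rightarrow> complex) \<Rightarrow> 'a set set" where
  "arc_cover \<kappa> = {{x. norm (\<kappa> x - c) < 1} | c. norm c = 1}"

lemma open_arc_cover:
  assumes "character \<kappa>"
  shows "open_cover (arc_cover \<kappa>)"
proof -
  have "open {x. norm (\<kappa> x - c) < 1}" for c
    using assms by (intro open_Collect_less continuous_intros) (auto simp: character_def)
  moreover have "x \<in> {y. norm (\<kappa> y - \<kappa> x) < 1} \<and> norm (\<kappa> x) = 1" for x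
    using assms by (simp add: character_def)
  ultimately show ?thesis unfolding open_cover_def arc_cover_def by blast
qed

lemma open_iterated_join:
  assumes "open_cover \<U>"
  shows "open_cover (iterated_join T \<U> n)"
proof -
  have "open (\<Inter>i<n. (T ^^ i) -` s i)" if "\<forall>i<n. s i \<in> \<U>" for s
    using that assms by (intro open_INT ballI open_vimage T_iter_cont) (auto simp: open_cover_def)
  moreover have "\<exists>W\<in>iterated_join T \<U> n. x \<in> W" for x
  proof -
    have "(T ^^ i) x \<in> \<Union>\<U>" for i using assms by (simp add: open_cover_def)
    then have "\<forall>i. \<exists>U. U \<in> \<U> \<and> (T ^^ i) x \<in> U" by (simp add: Union_iff Bex_def)
    then obtain s where "\<And>i. s i \<in> \<U>" "\<And>i. (T ^^ i) x \<in> s i" by metis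
    then show ?thesis unfolding iterated_join_def by (intro bexI[of _ "\<Inter>i<n. (T ^^ i) -` s i"]) auto
  qed
  then have "\<Union>(iterated_join T \<U> n) = UNIV" by (auto simp: Union_iff)
  ultimately show ?thesis by (auto simp: open_cover_def iterated_join_def)
qed

lemma cover_number_attained:
  assumes "open_cover (\<W> :: 'a set set)"
  shows "\<exists>\<V>. \<V> \<subseteq> \<W> \<and> finite \<V> \<and> \<Union>\<V> = UNIV \<and> card \<V> = cover_number \<W>"
proof -
  have W: "UNIV \<subseteq> \<Union>\<W>" "\<And>U. U \<in> \<W> \<Longrightarrow> open U" using assms by (simp_all add: open_cover_def)
  obtain \<V> where "\<V> \<subseteq> \<W>" "finite \<V>" "UNIV \<subseteq> \<Union>\<V>" by (rule compactE[OF compact_UNIV W])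
  then have "card \<V> \<in> {card \<V> |\<V>. \<V> \<subseteq> \<W> \<and> finite \<V> \<and> \<Union>\<V> = UNIV}" by auto
  then have "{card \<V> |\<V>. \<V> \<subseteq> \<W> \<and> finite \<V> \<and> \<Union>\<V> = UNIV} \<noteq> {}" by (rule ex_in_conv[THEN iffD1, OF exI])
  from Inf_nat_def1[OF this] show ?thesis unfolding cover_number_def by (auto simp: eq_commute)
qed

text \<open>On a member of the joined cover each factor of a suitable Riesz product is at least \<open>3/2\<close>, while its
  mean is \<open>1\<close>; so a member has measure at most \<open>(2/3)\<^sup>m\<close>.\<close>

lemma cover_number_arc_cover:
  assumes \<kappa>: "character \<kappa>" and m: "\<And>j. j < m \<Longrightarrow> L * j < n"
    and indep: "\<And>e. (\<And>j. j < m \<Longrightarrow> e j \<in> {-1, 0, 1}) \<Longrightarrow> (\<And>x. (\<Prod>j<m. \<kappa> ((A ^^ (L * j)) x) powi e j) = 1)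
      \<Longrightarrow> (\<forall>j<m. e j = 0)"
  shows "(3 / 2) ^ m \<le> real (cover_number (iterated_join T (arc_cover \<kappa>) n))"
proof -
  define F where "F c x = (\<Prod>j<m. 1 + Re (\<kappa> ((A ^^ (L * j)) x) * cnj (c j)))" for c x
  have ch: "character (\<lambda>x. \<kappa> ((A ^^ (L * j)) x))" for j by (rule character_iter[OF \<kappa>])
  have mF: "mean (\<lambda>x. of_real (F c x)) = 1" for c
    unfolding F_def by (rule mean_Riesz_product[OF ch indep])
  have cF: "continuous_on UNIV (F c)" for c
    unfolding F_def using ch by (intro continuous_intros) (auto simp: character_def)
  have nn: "F c x \<ge> 0" if "\<And>j. norm (c j) = 1" for c x
    unfolding F_def
  proof (intro prod_nonneg ballI)
    fix j
    have "norm (\<kappa> ((A ^^ (L * j)) x) * cnj (c j)) = 1"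
      using that ch[of j] by (simp add: norm_mult character_def)
    then show "0 \<le> 1 + Re (\<kappa> ((A ^^ (L * j)) x) * cnj (c j))"
      using abs_Re_le_cmod[of "\<kappa> ((A ^^ (L * j)) x) * cnj (c j)"] by linarith
  qed
  have major: "\<exists>c. (\<forall>j. norm (c j) = 1) \<and> (\<forall>x\<in>W. (3 / 2) ^ m \<le> F c x)"
    if W: "W \<in> iterated_join T (arc_cover \<kappa>) n" for W
  proof -
    obtain s where s: "W = (\<Inter>i<n. (T ^^ i) -` s i)" "\<forall>i<n. s i \<in> arc_cover \<kappa>"
      using W unfolding iterated_join_def by blast
    have "\<forall>i. \<exists>d. norm d = 1 \<and> (i < n \<longrightarrow> s i = {x. norm (\<kappa> x - d) < 1})"
    proof
      fix i
      show "\<exists>d. norm d = 1 \<and> (i < n \<longrightarrow> s i = {x. norm (\<kappa> x - d) < 1})"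
      proof (cases "i < n")
        case True
        then show ?thesis using s(2) by (auto simp: arc_cover_def)
      qed (auto intro: exI[of _ 1])
    qed
    then obtain d where d: "\<And>i. norm (d i) = 1" "\<And>i. i < n \<Longrightarrow> s i = {x. norm (\<kappa> x - d i) < 1}" by metis
    \<comment> \<open>The arc centre is rotated back by the orbit of 0, so that a condition on
      T^(Lj) x becomes one on A^(Lj) x.\<close>
    define c where "c j = d (L * j) * cnj (\<kappa> ((T ^^ (L * j)) 0))" for j
    have nk: "norm (\<kappa> x) = 1" for x using \<kappa> by (simp add: character_def)
    have nc: "norm (c j) = 1" for j using d(1) nk by (simp add: c_def norm_mult)
    have "(3 / 2) ^ m \<le> F c x" if x: "x \<in> W" for x
    proof -
      have "3 / 2 \<le> 1 + Re (\<kappa> ((A ^^ (L * j)) x) * cnj (c j))" if j: "j < m" for j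
      proof -
        let ?z = "\<kappa> ((T ^^ (L * j)) x)"
        have "norm (?z - d (L * j)) < 1" using x m[OF j] d(2)[OF m[OF j]] unfolding s(1) by auto
        then have "(norm (?z - d (L * j)))\<^sup>2 < 1" by (simp add: abs_square_less_1)
        moreover have "(norm (z - w))\<^sup>2 = 2 - 2 * Re (z * cnj w)" if "norm z = 1" "norm w = 1" for z w :: complex
        proof -
          have "(norm (z - w))\<^sup>2 = (norm z)\<^sup>2 + (norm w)\<^sup>2 - 2 * Re (z * cnj w)"
            by (simp only: cmod_power2) (simp add: power2_eq_square algebra_simps)
          then show ?thesis using that by simp
        qed
        ultimately have "Re (?z * cnj (d (L * j))) > 1 / 2" using nk d(1) by simp
        moreover have "?z = \<kappa> ((A ^^ (L * j)) x) * \<kappa> ((T ^^ (L * j)) 0)"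
          using T_iter[of "L * j" x] \<kappa> by (simp add: character_def)
        ultimately show ?thesis by (simp add: c_def mult_ac)
      qed
      then have "(\<Prod>j<m. 3 / 2) \<le> F c x" unfolding F_def by (intro prod_mono) auto
      then show ?thesis by simp
    qed
    then show ?thesis using nc by blast
  qed
  obtain \<V> where \<V>: "\<V> \<subseteq> iterated_join T (arc_cover \<kappa>) n" "finite \<V>" "\<Union>\<V> = UNIV"
      "card \<V> = cover_number (iterated_join T (arc_cover \<kappa>) n)"
    using cover_number_attained[OF open_iterated_join[OF open_arc_cover[OF \<kappa>], of n]] by (elim exE conjE)
  have "\<forall>W\<in>\<V>. \<exists>c. (\<forall>j. norm (c j) = 1) \<and> (\<forall>x\<in>W. (3 / 2) ^ m \<le> F c x)" using major \<V>(1) by blast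
  then obtain c where c: "\<And>W j. W \<in> \<V> \<Longrightarrow> norm (c W j) = 1" "\<And>W x. W \<in> \<V> \<Longrightarrow> x \<in> W \<Longrightarrow> (3 / 2) ^ m \<le> F (c W) x"
    by metis
  have sum_ge: "(3 / 2) ^ m \<le> (\<Sum>W\<in>\<V>. F (c W) x)" for x
  proof -
    have "x \<in> \<Union>\<V>" by (simp add: \<V>(3))
    then obtain W where W: "W \<in> \<V>" "x \<in> W" by (rule UnionE)
    have "F (c W) x \<le> (\<Sum>W\<in>\<V>. F (c W) x)"
      by (rule member_le_sum[OF W(1) _ \<V>(2)]) (use nn c(1) in auto)
    then show ?thesis using c(2)[OF W] by linarith
  qed
  have "Re (mean (\<lambda>x. of_real ((3 / 2) ^ m))) \<le> Re (mean (\<lambda>x. of_real (\<Sum>W\<in>\<V>. F (c W) x)))"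
    by (rule mean_mono) (use sum_ge cF in \<open>auto intro!: continuous_intros\<close>)
  also have "mean (\<lambda>x. of_real (\<Sum>W\<in>\<V>. F (c W) x)) = (\<Sum>W\<in>\<V>. mean (\<lambda>x. of_real (F (c W) x)))"
    unfolding of_real_sum by (rule mean_sum) (intro continuous_intros cF)
  finally show ?thesis using \<V>(4) by (simp add: mF)
qed

theorem signed_relation:
  assumes h: "topological_entropy T = 0" and \<kappa>: "character \<kappa>" and L: "L \<ge> 1"
  shows "\<exists>m e. (\<forall>j<m. e j \<in> {-1, 0, 1}) \<and> (\<exists>j<m. e j \<noteq> 0) \<and> (\<forall>x. (\<Prod>j<m. \<kappa> ((A ^^ (L * j)) x) powi e j) = (1::complex))"
proof (rule ccontr)
  assume none: "\<not> ?thesis"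
  have lower: "ln (3 / 2) / real L \<le> ln (real (cover_number (iterated_join T (arc_cover \<kappa>) n))) / real n" if n: "n \<ge> 1" for n
  proof -
    \<comment> \<open>Rounded up, n / L: the number of multiples of L among the times below n. Then
      L m is at least n, which gives the entropy bound ln (3/2) / L without loss.\<close>
    define m where "m = (n + L - 1) div L"
    have jm: "L * j < n" if "j < m" for j
    proof -
      have "L * Suc j \<le> L * m" using that by (intro mult_le_mono2) simp
      also have "\<dots> \<le> n + L - 1" by (simp add: m_def)
      finally show ?thesis using n L by simp
    qed
    have "n + L - 1 < L * m + L" using L dividend_less_times_div[of L "n + L - 1"] by (simp add: m_def add.commute)
    then have nm: "n \<le> L * m" by simp
    have ge: "(3 / 2) ^ m \<le> real (cover_number (iterated_join T (arc_cover \<kappa>) n))"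
      by (rule cover_number_arc_cover[OF \<kappa> jm]) (use none in blast)+
    have "real n * ln (3 / 2) \<le> real (L * m) * ln (3 / 2)" using nm by (intro mult_right_mono of_nat_mono) auto
    also have "\<dots> = real L * ln ((3 / 2) ^ m)" by (simp add: ln_realpow)
    also have "\<dots> \<le> real L * ln (real (cover_number (iterated_join T (arc_cover \<kappa>) n)))"
    proof -
      have "(0::real) < (3 / 2) ^ m" by simp
      then have "ln ((3 / 2) ^ m) \<le> ln (real (cover_number (iterated_join T (arc_cover \<kappa>) n)))"
        using ge by (subst ln_le_cancel_iff) linarith+
      then show ?thesis by (intro mult_left_mono) auto
    qed
    finally show ?thesis using n L by (simp add: field_simps)
  qed
  have "ereal (ln (3 / 2) / real L) \<le> cover_entropy T (arc_cover \<kappa>)"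
    unfolding cover_entropy_def
    by (rule le_Limsup) (use lower in \<open>auto intro!: eventually_sequentiallyI[of 1]\<close>)
  also have "\<dots> \<le> topological_entropy T"
    unfolding topological_entropy_def by (rule SUP_upper) (simp add: open_arc_cover \<kappa>)
  finally have "ln (3 / 2) / real L \<le> (0::real)" unfolding h by (simp add: zero_ereal_def)
  moreover have "ln (3 / 2) > (0::real)" by simp
  ultimately show False using L by (simp add: divide_le_0_iff)
qed

end

section \<open>Characters along an orbit\<close>

text \<open>Telescoping (i+1)^(d+1) - i^(d+1) expresses m^(d+1) through the power sums of degree at
  most d, with the factor d+1 at the top one.\<close>

lemma ex_poly_sum_powers: "\<exists>q :: real poly. \<forall>m. (\<Sum>i<m. real i ^ d) = poly q (real m)"
proof (induction d rule: less_induct)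
  case (less d)
  have "\<forall>k. \<exists>q :: real poly. k < d \<longrightarrow> (\<forall>m. (\<Sum>i<m. real i ^ k) = poly q (real m))"
    using less by blast
  then obtain Q :: "nat \<Rightarrow> real poly" where Q: "\<And>k m. k < d \<Longrightarrow> (\<Sum>i<m. real i ^ k) = poly (Q k) (real m)"
    by metis
  define q where "q = smult (1 / real (Suc d)) (monom 1 (Suc d) - (\<Sum>k<d. smult (real (Suc d choose k)) (Q k)))"
  have "(\<Sum>i<m. real i ^ d) = poly q (real m)" for m
  proof -
    have "real m ^ Suc d = (\<Sum>i<m. real (Suc i) ^ Suc d - real i ^ Suc d)"
      by (subst sum_lessThan_telescope) simp
    also have "\<dots> = (\<Sum>i<m. \<Sum>k\<le>d. real (Suc d choose k) * real i ^ k)"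
    proof (intro sum.cong refl)
      fix i
      have "real (Suc i) ^ Suc d = (\<Sum>k\<le>Suc d. real (Suc d choose k) * real i ^ k)"
        using binomial_ring[of "real i" 1 "Suc d"] by (simp add: add.commute)
      then show "real (Suc i) ^ Suc d - real i ^ Suc d = (\<Sum>k\<le>d. real (Suc d choose k) * real i ^ k)"
        by (simp only: sum.atMost_Suc) simp
    qed
    also have "\<dots> = (\<Sum>k\<le>d. real (Suc d choose k) * (\<Sum>i<m. real i ^ k))"
      unfolding sum_distrib_left by (rule sum.swap)
    also have "\<dots> = (\<Sum>k<d. real (Suc d choose k) * (\<Sum>i<m. real i ^ k)) + real (Suc d) * (\<Sum>i<m. real i ^ d)"
      by (simp add: lessThan_Suc_atMost[symmetric])
    also have "(\<Sum>k<d. real (Suc d choose k) * (\<Sum>i<m. real i ^ k)) = (\<Sum>k<d. real (Suc d choose k) * poly (Q k) (real m))"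
      by (intro sum.cong refl) (simp add: Q)
    finally show ?thesis unfolding q_def by (simp add: poly_monom poly_sum field_simps)
  qed
  then show ?case by blast
qed

lemma ex_poly_sum: "\<exists>q :: real poly. \<forall>m. (\<Sum>i<m. poly p (real i)) = poly q (real m)"
proof -
  obtain Q :: "nat \<Rightarrow> real poly" where Q: "\<And>d m. (\<Sum>i<m. real i ^ d) = poly (Q d) (real m)"
    using ex_poly_sum_powers by metis
  have "(\<Sum>i<m. poly p (real i)) = poly (\<Sum>d\<le>degree p. smult (coeff p d) (Q d)) (real m)" for m
    unfolding poly_altdef[of p] by (subst sum.swap) (simp add: poly_sum Q flip: sum_distrib_left)
  then show ?thesis by blast
qed

text \<open>Only a power of \<open>A\<close> acts unipotently on the character, so polynomial
  behaviour is available on each residue class separately.\<close>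

definition poly_phase :: "nat \<Rightarrow> (nat \<Rightarrow> complex) \<Rightarrow> bool" where
  "poly_phase N v \<longleftrightarrow> (\<forall>r. \<exists>p. \<forall>m. v (N * m + r) = expi (poly p (real m)))"

text \<open>Discrete integration: along a residue class v is a product of values of v', so its
  exponent is a partial sum of a polynomial, again polynomial.\<close>

lemma poly_phase_of_quotient:
  assumes v': "poly_phase N v'" and quot: "\<And>n. v (n + N) = v' n * v n" and norm: "\<And>n. norm (v n) = 1"
  shows "poly_phase N v"
  unfolding poly_phase_def
proof
  fix r
  obtain p where p: "\<And>m. v' (N * m + r) = expi (poly p (real m))" using v' unfolding poly_phase_def by blast
  obtain q where q: "\<And>m. (\<Sum>i<m. poly p (real i)) = poly q (real m)" using ex_poly_sum by blast
  obtain \<theta> where \<theta>: "v r = expi \<theta>" using ex_expi[OF norm] by blast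
  have "v (N * m + r) = expi (\<theta> + (\<Sum>i<m. poly p (real i)))" for m
  proof (induction m)
    case (Suc m)
    have "v (N * Suc m + r) = v' (N * m + r) * v (N * m + r)" using quot[of "N * m + r"] by (simp add: add_ac)
    then show ?case unfolding Suc p by (simp add: add_ac flip: expi_add)
  qed (simp add: \<theta>)
  then have "v (N * m + r) = expi (poly ([:\<theta>:] + q) (real m))" for m by (simp add: q)
  then show "\<exists>p. \<forall>m. v (N * m + r) = expi (poly p (real m))" by blast
qed

lemma indicator_residue_class:
  assumes "N \<ge> 1"
  shows "(\<Sum>k<N. expi (real k * (real n - real r) / real N)) = (if n mod N = r mod N then of_nat N else 0)"
proof -
  define x where "x = (real n - real r) / real N"
  have e: "expi (real k * (real n - real r) / real N) = expi x ^ k" for k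
    by (simp add: expi_power x_def)
  have x1: "expi x = 1 \<longleftrightarrow> n mod N = r mod N"
  proof
    assume "expi x = 1"
    then obtain z :: int where "x = of_int z" unfolding expi_eq_1_iff by (auto elim: Ints_cases)
    then have "real_of_int (int n - int r) = real_of_int (z * int N)" using assms by (simp add: x_def field_simps)
    then have "int n - int r = z * int N" by (simp only: of_int_eq_iff)
    then have "int N dvd int n - int r" by simp
    then have "int n mod int N = int r mod int N" by (simp add: mod_eq_dvd_iff)
    then show "n mod N = r mod N" by (metis of_nat_eq_iff of_nat_mod)
  next
    assume "n mod N = r mod N"
    then have "int n mod int N = int r mod int N" by (metis of_nat_mod)
    then have "int N dvd int n - int r" by (simp add: mod_eq_dvd_iff)
    then obtain z where "int n - int r = int N * z" by (elim dvdE)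
    then have "real_of_int (int n - int r) = real_of_int (int N * z)" by simp
    then have "x = of_int z" using assms by (simp add: x_def field_simps)
    then show "expi x = 1" unfolding expi_eq_1_iff by simp
  qed
  show ?thesis
  proof (cases "expi x = 1")
    case True
    then show ?thesis using x1 by (simp add: e)
  next
    case False
    have "expi x ^ N = expi (real n - real r)" using assms by (simp add: expi_power x_def)
    also have "\<dots> = 1" by (simp add: expi_eq_1_iff)
    finally show ?thesis using False x1 by (simp add: e sum_gp_strict)
  qed
qed

text \<open>The indicator of a residue class is a finite sum of linear phases in n. Multiplied by
  the polynomial phase on that class, rewritten in (n - r) / N, each becomes one polynomial phase on
  all integers, as Davenport's theorem requires.\<close>

lemma moebius_poly_phase_null_mean:
  assumes N: "N \<ge> 1" and v: "poly_phase N v"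
  shows "null_mean (\<lambda>n. of_int (moebius_mu n) * v n)"
proof -
  obtain P where P: "\<And>r m. v (N * m + r) = expi (poly (P r) (real m))"
    using v unfolding poly_phase_def by metis
  define q where "q r k = pcompose (P r) [:- real r / real N, 1 / real N:] + [:- real k * real r / real N, real k / real N:]" for r k
  have q: "expi (poly (q r k) (real n)) = expi (poly (P r) ((real n - real r) / real N)) * expi (real k * (real n - real r) / real N)" for r k n
    by (simp add: q_def poly_pcompose diff_divide_distrib right_diff_distrib mult.commute flip: expi_add)
  have eq: "v n = (\<Sum>r<N. \<Sum>k<N. 1 / of_nat N * expi (poly (q r k) (real n)))" for n
  proof -
    have "(\<Sum>r<N. \<Sum>k<N. 1 / of_nat N * expi (poly (q r k) (real n)))
        = (\<Sum>r<N. if n mod N = r then expi (poly (P r) ((real n - real r) / real N)) else 0)"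
    proof (intro sum.cong refl)
      fix r assume r: "r \<in> {..<N}"
      have "(\<Sum>k<N. 1 / of_nat N * expi (poly (q r k) (real n))) = 1 / of_nat N * expi (poly (P r) ((real n - real r) / real N))
          * (\<Sum>k<N. expi (real k * (real n - real r) / real N))"
        by (simp add: q sum_distrib_left mult.assoc)
      then show "(\<Sum>k<N. 1 / of_nat N * expi (poly (q r k) (real n))) = (if n mod N = r then expi (poly (P r) ((real n - real r) / real N)) else 0)"
        using r N by (simp add: indicator_residue_class)
    qed
    also have "\<dots> = expi (poly (P (n mod N)) ((real n - real (n mod N)) / real N))"
      using N by (simp add: sum.delta)
    also have "(real n - real (n mod N)) / real N = real (n div N)"
    proof -
      have "real n = real (N * (n div N) + n mod N)" by simp
      then show ?thesis using N unfolding of_nat_add of_nat_mult by simp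
    qed
    also have "expi (poly (P (n mod N)) (real (n div N))) = v n" using P[of "n div N" "n mod N"] by simp
    finally show ?thesis by simp
  qed
  have "null_mean (\<lambda>n. \<Sum>r<N. \<Sum>k<N. 1 / of_nat N * (of_int (moebius_mu n) * expi (poly (q r k) (real n))))"
    unfolding poly_altdef by (intro null_mean_sum null_mean_cmult moebius_polynomial_null_mean)
  then show ?thesis unfolding eq sum_distrib_left by (simp only: mult.left_commute)
qed

context affine_flow
begin

text \<open>The action of \<open>\<int>[X]\<close> on characters, with \<open>X\<close> acting as composition with \<open>A\<close>, written pointwise.\<close>

definition act :: "('a \<Rightarrow> complex) \<Rightarrow> int poly \<Rightarrow> 'a \<Rightarrow> complex" where
  "act \<kappa> P = fold_coeffs (\<lambda>a f x. \<kappa> x powi a * f (A x)) P (\<lambda>_. 1)"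

lemma act_0 [simp]: "act \<kappa> 0 x = 1"
  by (simp add: act_def)

lemma act_pCons [simp]: "act \<kappa> (pCons a P) x = \<kappa> x powi a * act \<kappa> P (A x)"
  by (cases "P = 0"; cases "a = 0") (simp_all add: act_def)

lemma norm_act: "character \<kappa> \<Longrightarrow> norm (act \<kappa> P x) = 1"
  by (induction P arbitrary: x) (simp_all add: norm_mult norm_power_int character_def)

lemma act_add:
  assumes "character \<kappa>"
  shows "act \<kappa> (P + Q) x = act \<kappa> P x * act \<kappa> Q x"
proof (induction P Q arbitrary: x rule: poly_induct2)
  case (pCons a P b Q)
  have "\<kappa> x \<noteq> 0" using assms unfolding character_def by (metis norm_zero zero_neq_one)
  then show ?case by (simp add: pCons power_int_add mult_ac)
qed simp

lemma act_smult: "act \<kappa> (smult a P) x = act \<kappa> P x powi a"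
proof (induction P arbitrary: x)
  case (pCons c P)
  then show ?case by (simp add: power_int_mult_distrib power_int_mult mult.commute[of a c])
qed simp

lemma act_uminus:
  assumes "character \<kappa>"
  shows "act \<kappa> (- P) x = inverse (act \<kappa> P x)"
  using act_smult[of \<kappa> "-1" P x] by (simp add: power_int_minus1_right)

lemma act_monom_mult: "act \<kappa> (monom 1 N * P) x = act \<kappa> P ((A ^^ N) x)"
proof (induction N arbitrary: x)
  case (Suc N)
  have "monom 1 (Suc N) * P = pCons 0 (monom 1 N * P)" by (simp add: monom_Suc)
  then show ?case by (simp add: Suc funpow_swap1)
qed (simp add: monom_0)

lemma act_monom: "act \<kappa> (monom a i) x = \<kappa> ((A ^^ i) x) powi a"
  by (induction i arbitrary: x) (simp_all add: monom_0 monom_Suc funpow_swap1)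

lemma act_sum:
  assumes "character \<kappa>"
  shows "act \<kappa> (\<Sum>i\<in>S. P i) x = (\<Prod>i\<in>S. act \<kappa> (P i) x)"
  by (induction S rule: infinite_finite_induct) (simp_all add: act_add[OF assms])

text \<open>The exponents of a multiplicative relation along multiples of L are the coefficients of
  a signed polynomial Q, and the relation says that Q(X^L) annihilates
  \<open>\<kappa>\<close>.\<close>

lemma unipotent_annihilator:
  assumes h: "topological_entropy T = 0" and \<kappa>: "character \<kappa>"
  shows "\<exists>N\<ge>1. \<exists>k. \<forall>x. act \<kappa> ((monom 1 N - 1) ^ k) x = 1"
proof -
  define I where "I = {P. \<forall>x. act \<kappa> P x = 1}"
  have add: "P + Q \<in> I" if "P \<in> I" "Q \<in> I" for P Q
    using that by (simp add: I_def act_add[OF \<kappa>])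
  have mult: "R * P \<in> I" if "P \<in> I" for P R
    using that
  proof (induction R)
    case 0
    then show ?case by (simp add: I_def)
  next
    case (pCons a R)
    have "smult a P \<in> I" "pCons 0 (R * P) \<in> I" using pCons by (simp_all add: I_def act_smult)
    then have "smult a P + pCons 0 (R * P) \<in> I" by (rule add)
    then show ?case by simp
  qed
  \<comment> \<open>Multiplication by X is composition with A, and surjectivity of A lets it be
    undone.\<close>
  have cancel: "P \<in> I" if P: "pCons 0 P \<in> I" for P
    unfolding I_def
  proof (intro CollectI allI)
    fix x
    obtain y where "x = A y" using A_surj by (metis surjD)
    then show "act \<kappa> P x = 1" using P by (simp add: I_def)
  qed
  have rel: "\<exists>Q. signed_poly Q \<and> pcompose Q (monom 1 L) \<in> I" if L: "L \<ge> 1" for L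
  proof -
    obtain m e where "(\<forall>j<m. e j \<in> {-1, 0, 1}) \<and> (\<exists>j<m. e j \<noteq> 0)
        \<and> (\<forall>x. (\<Prod>j<m. \<kappa> ((A ^^ (L * j)) x) powi e j) = 1)"
      by (rule exE[OF signed_relation[OF h \<kappa> L]]) (elim exE)
    then have me: "\<forall>j<m. e j \<in> {-1, 0, 1}" "\<exists>j<m. e j \<noteq> 0"
        "\<forall>x. (\<Prod>j<m. \<kappa> ((A ^^ (L * j)) x) powi e j) = 1" by simp_all
    define Q where "Q = (\<Sum>j<m. monom (e j) j)"
    have coeff: "coeff Q j = (if j < m then e j else 0)" for j
      by (simp add: Q_def coeff_sum sum.delta)
    have "Q \<noteq> 0"
    proof
      assume "Q = 0"
      then show False using me(2) coeff by (metis coeff_0)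
    qed
    then have "signed_poly Q" using me(1) by (simp add: signed_poly_def coeff)
    moreover have "pcompose Q (monom 1 L) = (\<Sum>j<m. monom (e j) (L * j))"
    proof -
      have "monom c j = smult c (monom 1 1 ^ j)" for c :: int and j by (simp add: monom_power smult_monom)
      moreover have "pcompose (monom 1 1 ^ j) (monom 1 L) = (monom 1 L :: int poly) ^ j" for j
        by (induction j) (simp_all add: pcompose_mult pcompose_1 monom_Suc monom_0 pcompose_pCons)
      ultimately have "pcompose (monom c j) (monom 1 L) = monom c (L * j)" for c :: int and j
        by (metis monom_power power_one pcompose_smult smult_monom mult.right_neutral)
      then show ?thesis by (simp add: Q_def pcompose_sum)
    qed
    moreover have "(\<Sum>j<m. monom (e j) (L * j)) \<in> I"
      using me(3) by (simp add: I_def act_sum[OF \<kappa>] act_monom)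
    ultimately show ?thesis by auto
  qed
  show ?thesis using unipotent_of_signed_relations[of I, OF add mult cancel rel] by (auto simp: I_def)
qed

text \<open>The quotient of the values at n + N and n is \<open>\<kappa>\<close> at A^n w, in which
  the translation part has disappeared. Further quotients apply X^N - 1 repeatedly, and the k-th one
  is 1, so the phase is recovered by k + 1 integrations.\<close>

lemma poly_phase_character:
  assumes h: "topological_entropy T = 0" and \<kappa>: "character \<kappa>"
  shows "\<exists>N\<ge>1. poly_phase N (\<lambda>n. \<kappa> ((T ^^ n) x))"
proof -
  obtain N k where N: "N \<ge> 1" and k: "\<And>x. act \<kappa> ((monom 1 N - 1) ^ k) x = 1"
    using unipotent_annihilator[OF h \<kappa>] by blast
  define w where "w = (T ^^ N) x - x"
  define v where "v j n = act \<kappa> ((monom 1 N - 1) ^ j) ((A ^^ n) w)" for j n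
  have v_norm: "norm (v j n) = 1" for j n by (simp add: v_def norm_act[OF \<kappa>])
  have v_step: "v j (n + N) = v (Suc j) n * v j n" for j n
  proof -
    have "(monom 1 N - 1) ^ Suc j = monom 1 N * (monom 1 N - 1) ^ j + - ((monom 1 N - 1) ^ j :: int poly)"
      by (simp add: algebra_simps)
    then have "v (Suc j) n = act \<kappa> ((monom 1 N - 1) ^ j) ((A ^^ N) ((A ^^ n) w)) * inverse (v j n)"
      by (simp only: v_def act_add[OF \<kappa>] act_monom_mult act_uminus[OF \<kappa>])
    also have "(A ^^ N) ((A ^^ n) w) = (A ^^ (n + N)) w" by (simp add: funpow_add add.commute[of n])
    finally have "v (Suc j) n = v j (n + N) * inverse (v j n)" by (simp add: v_def)
    moreover have "v j n \<noteq> 0" using v_norm[of j n] by (metis norm_zero zero_neq_one)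
    ultimately show ?thesis by (simp add: field_simps)
  qed
  \<comment> \<open>Induction downwards from the trivial level k; truncated subtraction makes the
    statement stationary once level 0 is reached.\<close>
  have v_phase: "poly_phase N (v (k - i))" for i
  proof (induction i)
    case 0
    have "v k (N * m + r) = expi (poly 0 (real m))" for m r by (simp add: v_def k)
    then show ?case unfolding poly_phase_def diff_zero by blast
  next
    case (Suc i)
    show ?case
    proof (cases "i < k")
      case True
      then have "Suc (k - Suc i) = k - i" by simp
      then show ?thesis using poly_phase_of_quotient[OF Suc, of "v (k - Suc i)"] v_step[of "k - Suc i"] v_norm by simp
    next
      case False
      then show ?thesis using Suc by simp
    qed
  qed
  have "poly_phase N (v 0)" using v_phase[of k] by simp
  moreover have "\<kappa> ((T ^^ (n + N)) x) = v 0 n * \<kappa> ((T ^^ n) x)" for n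
  proof -
    have "(T ^^ (n + N)) x = (T ^^ n) ((T ^^ N) x)" by (simp add: funpow_add)
    also have "\<dots> = (A ^^ n) (w + x) + (T ^^ n) 0" using T_iter[of n "(T ^^ N) x"] by (simp add: w_def)
    also have "\<dots> = (A ^^ n) w + (T ^^ n) x" using T_iter[of n x] by (simp add: iter_add add.assoc)
    finally have "\<kappa> ((T ^^ (n + N)) x) = \<kappa> ((A ^^ n) w) * \<kappa> ((T ^^ n) x)" using \<kappa> by (simp add: character_def)
    moreover have "v 0 n = \<kappa> ((A ^^ n) w)" by (simp add: v_def one_pCons)
    ultimately show ?thesis by simp
  qed
  moreover have "norm (\<kappa> ((T ^^ n) x)) = 1" for n using \<kappa> by (simp add: character_def)
  ultimately have "poly_phase N (\<lambda>n. \<kappa> ((T ^^ n) x))" by (rule poly_phase_of_quotient)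
  then show ?thesis using N by blast
qed

lemma trig_null_mean:
  assumes h: "topological_entropy T = 0" and f: "f \<in> trig"
  shows "null_mean (\<lambda>n. of_int (moebius_mu n) * f ((T ^^ n) x))"
  using f
proof (induction rule: trig.induct)
  case (char \<kappa>)
  then show ?case using poly_phase_character[OF h] moebius_poly_phase_null_mean by blast
next
  case (add f g)
  then show ?case using null_mean_add by (simp add: distrib_left)
next
  case (cmult f c)
  then show ?case using null_mean_cmult[of _ c] by (simp add: mult.left_commute)
qed

theorem moebius_disjoint:
  assumes h: "topological_entropy T = 0" and f: "cont f"
  shows "null_mean (\<lambda>n. of_int (moebius_mu n) * f ((T ^^ n) x))"
proof (rule null_meanI)
  fix \<epsilon> :: real assume \<epsilon>: "\<epsilon> > 0"
  obtain g where g: "g \<in> trig" "\<And>y. norm (f y - g y) < \<epsilon> / 2" using trig_approx[OF f, of "\<epsilon> / 2"] \<epsilon> by auto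
  let ?a = "\<lambda>n. complex_of_int (moebius_mu n)"
  have a: "norm (?a n) \<le> 1" for n by (simp add: moebius_mu_def norm_power)
  have "\<forall>\<^sub>F N in sequentially. norm (\<Sum>n=1..N. ?a n * g ((T ^^ n) x)) \<le> \<epsilon> / 2 * real N"
    using trig_null_mean[OF h g(1), of x] \<epsilon> unfolding null_mean_iff by (metis half_gt_zero)
  then show "\<forall>\<^sub>F N in sequentially. norm (\<Sum>n=1..N. ?a n * f ((T ^^ n) x)) \<le> \<epsilon> * real N"
  proof (rule eventually_mono)
    fix N assume N: "norm (\<Sum>n=1..N. ?a n * g ((T ^^ n) x)) \<le> \<epsilon> / 2 * real N"
    have "norm ((\<Sum>n=1..N. ?a n * f ((T ^^ n) x)) - (\<Sum>n=1..N. ?a n * g ((T ^^ n) x)))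
        \<le> (\<Sum>n=1..N. \<epsilon> / 2)"
      unfolding sum_subtractf[symmetric]
    proof (rule sum_norm_le)
      fix n
      have "norm (?a n * f ((T ^^ n) x) - ?a n * g ((T ^^ n) x)) = norm (?a n) * norm (f ((T ^^ n) x) - g ((T ^^ n) x))"
        by (simp only: right_diff_distrib[symmetric] norm_mult)
      also have "\<dots> \<le> 1 * (\<epsilon> / 2)" using a g(2) by (intro mult_mono) (auto intro: less_imp_le)
      finally show "norm (?a n * f ((T ^^ n) x) - ?a n * g ((T ^^ n) x)) \<le> \<epsilon> / 2" by simp
    qed
    also have "\<dots> = \<epsilon> / 2 * real N" by simp
    finally show "norm (\<Sum>n=1..N. ?a n * f ((T ^^ n) x)) \<le> \<epsilon> * real N"
      using N norm_triangle_sub[of "\<Sum>n=1..N. ?a n * f ((T ^^ n) x)" "\<Sum>n=1..N. ?a n * g ((T ^^ n) x)"] by simp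
  qed
qed

end

theorem theorem1p1:
  fixes A T :: "'a::{topological_ab_group_add, t2_space} \<Rightarrow> 'a" and b :: 'a
  assumes "compact (UNIV :: 'a set)"
    and "continuous_automorphism A"
    and "\<And>x. T x = A x + b"
    and "topological_entropy T = 0"
  shows "linearly_disjoint (\<lambda>n. of_int (moebius_mu n)) T"
proof -
  interpret affine_flow "TYPE('a)" A T b
    using assms by unfold_locales
  show ?thesis
    unfolding linearly_disjoint_def observable_def
  proof (intro allI impI, elim exE conjE)
    fix \<xi> :: "nat \<Rightarrow> complex" and f :: "'a \<Rightarrow> complex" and x assume f: "continuous_on UNIV f" and \<xi>: "\<xi> = (\<lambda>n. f ((T ^^ n) x))"
    from moebius_disjoint[OF assms(4) f, of x]
    show "(\<lambda>N. 1 / of_nat N * (\<Sum>n=1..N. of_int (moebius_mu n) * \<xi> n)) \<longlonglongrightarrow> 0"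
      unfolding null_mean_def \<xi> by simp
  qed
qed

end
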